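(* Let $\Omega\subset\mathbb R^n$ be a bounded Lipschitz domain, and suppose that $\Omega$ is convex. Let $s\in(0,1)$, and let $u\in\widetilde H^s(\Omega)$, $u\ge 0$, $u\not\equiv 0$. Then $$(-\Delta_\Omega)^s_{\rm DR}u > (-\Delta_\Omega)^s_{\rm NSp}u\qquad\text{in }\Omega$$ in the sense of distributions.
   Context: $\widetilde H^s(\Omega)$ denotes the space of $u\in H^s(\mathbb R^n)$ (the usual Sobolev--Slobodetskii space) with support in $\overline\Omega$; its elements are identified with functions on $\Omega$ extended by zero to $\mathbb R^n$. $(\cdot,\cdot)$ denotes the $L_2(\Omega)$ inner product. The Fourier transform is $\mathcal F u(\xi)=(2\pi)^{-n/2}\int_{\mathbb R^n}e^{-i\langle \xi,x\rangle}u(x)\,dx$. The restricted Dirichlet fractional Laplacian $(-\Delta_\Omega)^s_{\rm DR}$ is the operator defined by the quadratic form $$Q_s^{\rm DR}[u]=((-\Delta_\Omega)^s_{\rm DR}u,u)=\int_{\mathbb R^n}|\xi|^{2s}\,|\mathcal F u(\xi)|^2\,d\xi$$ with domain $\widetilde H^s(\Omega)$. That is, for $u\in\widetilde H^s(\Omega)$ the distribution $(-\Delta_\Omega)^s_{\rm DR}u$ on $\Omega$ acts on real-valued $\varphi\in C_0^\infty(\Omega)$ by $\langle(-\Delta_\Omega)^s_{\rm DR}u,\varphi\rangle=\int_{\mathbb R^n}|\xi|^{2s}\mathcal F u(\xi)\overline{\mathcal F\varphi(\xi)}\,d\xi$. Let $0=\mu_0<\mu_1\le\mu_2\le\dots$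 be the eigenvalues (with multiplicity) of the Neumann Laplacian $-\Delta$ in $\Omega$, and let $\psi_0\equiv\mathrm{const},\psi_1,\psi_2,\dots$ be corresponding real eigenfunctions, forming an orthonormal basis of $L_2(\Omega)$. The spectral Neumann fractional Laplacian $(-\Delta_\Omega)^s_{\rm NSp}$ is the operator defined by the quadratic form $$Q_s^{\rm NSp}[u]=((-\Delta_\Omega)^s_{\rm NSp}u,u)=\sum_{j=0}^\infty\mu_j^s\,|(u,\psi_j)|^2$$ with domain $H^s(\Omega)\supset\widetilde H^s(\Omega)$. That is, $\langle(-\Delta_\Omega)^s_{\rm NSp}u,\varphi\rangle=\sum_{j=0}^\infty\mu_j^s(u,\psi_j)(\psi_j,\varphi)$ for real-valued $\varphi\in C_0^\infty(\Omega)$. For distributions $f,g$ on $\Omega$, "$f>g$ in $\Omega$ in the sense of distributions" means $\langle f-g,\varphi\rangle>0$ for every $\varphi\in C_0^\infty(\Omega)$ with $\varphi\ge0$, $\varphi\not\equiv0$. *)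

theory Defs
  imports "HOL-Analysis.Analysis"
begin

text \<open>
  The ambient space is an arbitrary Euclidean space 'a, with n = DIM('a) at least 1.
  An element of L2 or of a Sobolev space is a class of functions modulo Lebesgue null sets;
  it is represented here by any Borel measurable member of the class. A function on an open
  set \<Omega> is represented by a function on the whole space whose values off \<Omega> are irrelevant.
\<close>

text \<open>Near each boundary point, \<Omega> is the strict epigraph, in some direction \<open>e\<close>, of a
  Lipschitz function \<open>g\<close> on the hyperplane orthogonal to \<open>e\<close>.\<close>

definition lipschitz_domain :: "'a::euclidean_space set \<Rightarrow> bool" where
  "lipschitz_domain \<Omega> \<longleftrightarrow>
     open \<Omega> \<and> connected \<Omega> \<and> \<Omega> \<noteq> {} \<and>
     (\<forall>p\<in>frontier \<Omega>. \<exists>e r L. \<exists>g::'a \<Rightarrow> real.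
        norm e = 1 \<and> r > 0 \<and> L-lipschitz_on {y. y \<bullet> e = 0} g \<and>
        (\<forall>x\<in>ball p r. x \<in> \<Omega> \<longleftrightarrow> g (x - (x \<bullet> e) *\<^sub>R e) < x \<bullet> e))"

definition partial_deriv :: "'a::euclidean_space \<Rightarrow> ('a \<Rightarrow> real) \<Rightarrow> 'a \<Rightarrow> real" where
  "partial_deriv b f x = frechet_derivative f (at x) b"

primrec Ck :: "nat \<Rightarrow> ('a::euclidean_space \<Rightarrow> real) \<Rightarrow> bool" where
  "Ck 0 f \<longleftrightarrow> continuous_on UNIV f"
| "Ck (Suc k) f \<longleftrightarrow> (\<forall>x. f differentiable at x) \<and> (\<forall>b\<in>Basis. Ck k (partial_deriv b f))"

definition smooth :: "('a::euclidean_space \<Rightarrow> real) \<Rightarrow> bool" where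
  "smooth f \<longleftrightarrow> (\<forall>k. Ck k f)"

definition test_function :: "'a::euclidean_space set \<Rightarrow> ('a \<Rightarrow> real) \<Rightarrow> bool" where
  "test_function \<Omega> \<phi> \<longleftrightarrow>
     smooth \<phi> \<and> compact (closure {x. \<phi> x \<noteq> 0}) \<and> closure {x. \<phi> x \<noteq> 0} \<subseteq> \<Omega>"

text \<open>A distribution is represented by its action on real-valued test functions.\<close>

definition distr_greater ::
  "'a::euclidean_space set \<Rightarrow> (('a \<Rightarrow> real) \<Rightarrow> real) \<Rightarrow> (('a \<Rightarrow> real) \<Rightarrow> real) \<Rightarrow> bool" where
  "distr_greater \<Omega> f g \<longleftrightarrow>
     (\<forall>\<phi>. test_function \<Omega> \<phi> \<longrightarrow> (\<forall>x. \<phi> x \<ge> 0) \<longrightarrow> (\<exists>x. \<phi> x \<noteq> 0) \<longrightarrow> f \<phi> - g \<phi> > 0)"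

definition L2_on :: "'a::euclidean_space set \<Rightarrow> ('a \<Rightarrow> 'b::euclidean_space) set" where
  "L2_on \<Omega> = {f. set_borel_measurable lborel \<Omega> f \<and>
                 set_integrable lborel \<Omega> (\<lambda>x. (norm (f x))\<^sup>2)}"

definition L2_inner :: "'a::euclidean_space set \<Rightarrow> ('a \<Rightarrow> real) \<Rightarrow> ('a \<Rightarrow> real) \<Rightarrow> real" where
  "L2_inner \<Omega> f g = (LINT x:\<Omega>|lborel. f x * g x)"

text \<open>The Sobolev--Slobodetskii space of order \<open>0 < s < 1\<close> on the whole space. On the diagonal
  the integrand is \<open>0 / 0 = 0\<close>; the diagonal is a null set.\<close>

definition sobolev_slobodetskii :: "real \<Rightarrow> ('a::euclidean_space \<Rightarrow> real) set" where
  "sobolev_slobodetskii s = {u \<in> L2_on UNIV.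
     (\<integral>\<^sup>+ x. \<integral>\<^sup>+ y. ennreal ((u x - u y)\<^sup>2 / norm (x - y) powr (real DIM('a) + 2 * s))
        \<partial>lborel \<partial>lborel) < \<infinity>}"

text \<open>Vanishing a.e. off \<open>closure \<Omega>\<close> says that the support of u, as a distribution, lies in \<open>closure \<Omega>\<close>.\<close>

definition sobolev_tilde :: "real \<Rightarrow> 'a::euclidean_space set \<Rightarrow> ('a \<Rightarrow> real) set" where
  "sobolev_tilde s \<Omega> =
     {u \<in> sobolev_slobodetskii s. AE x in lborel. x \<notin> closure \<Omega> \<longrightarrow> u x = 0}"

definition weak_gradient :: "'a::euclidean_space set \<Rightarrow> ('a \<Rightarrow> real) \<Rightarrow> ('a \<Rightarrow> 'a) \<Rightarrow> bool" where
  "weak_gradient \<Omega> u G \<longleftrightarrow>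
     (\<forall>\<phi>. test_function \<Omega> \<phi> \<longrightarrow> (\<forall>b\<in>Basis.
        (LINT x:\<Omega>|lborel. u x * partial_deriv b \<phi> x) = - (LINT x:\<Omega>|lborel. (G x \<bullet> b) * \<phi> x)))"

definition H1_pair :: "'a::euclidean_space set \<Rightarrow> ('a \<Rightarrow> real) \<Rightarrow> ('a \<Rightarrow> 'a) \<Rightarrow> bool" where
  "H1_pair \<Omega> u G \<longleftrightarrow> u \<in> L2_on \<Omega> \<and> G \<in> L2_on \<Omega> \<and> weak_gradient \<Omega> u G"

text \<open>Below, the Fourier integral is applied only to L2 functions vanishing off a bounded set;
  these are absolutely integrable.\<close>

definition fourier :: "('a::euclidean_space \<Rightarrow> complex) \<Rightarrow> 'a \<Rightarrow> complex" where
  "fourier u \<xi> = of_real ((2 * pi) powr (- real DIM('a) / 2)) *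
                  (LINT x|lborel. exp (- \<i> * of_real (\<xi> \<bullet> x)) * u x)"

text \<open>For real-valued \<open>u\<close> and \<open>\<phi>\<close> the integral is real (substitute \<open>- \<xi>\<close> for \<open>\<xi>\<close>), so \<open>Re\<close>
  only adjusts the type.\<close>

definition frac_laplacian_DR :: "real \<Rightarrow> ('a::euclidean_space \<Rightarrow> real) \<Rightarrow> ('a \<Rightarrow> real) \<Rightarrow> real" where
  "frac_laplacian_DR s u \<phi> =
     Re (LINT \<xi>|lborel. of_real (norm \<xi> powr (2 * s)) *
           fourier (\<lambda>x. of_real (u x)) \<xi> * cnj (fourier (\<lambda>x. of_real (\<phi> x)) \<xi>))"

text \<open>The Neumann Laplacian is the operator associated with the Dirichlet form on \<open>H\<^sup>1(\<Omega>)\<close>,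
  so its eigenfunctions are defined by the weak eigenvalue equation tested against all of
  \<open>H\<^sup>1(\<Omega>)\<close>.\<close>

definition neumann_eigenfunction :: "'a::euclidean_space set \<Rightarrow> real \<Rightarrow> ('a \<Rightarrow> real) \<Rightarrow> bool" where
  "neumann_eigenfunction \<Omega> m \<psi> \<longleftrightarrow>
     \<not> (AE x in lborel. x \<in> \<Omega> \<longrightarrow> \<psi> x = 0) \<and>
     (\<exists>G. H1_pair \<Omega> \<psi> G \<and>
        (\<forall>v H. H1_pair \<Omega> v H \<longrightarrow> (LINT x:\<Omega>|lborel. G x \<bullet> H x) = m * L2_inner \<Omega> \<psi> v))"

definition L2_orthonormal_basis :: "'a::euclidean_space set \<Rightarrow> (nat \<Rightarrow> 'a \<Rightarrow> real) \<Rightarrow> bool" where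
  "L2_orthonormal_basis \<Omega> \<psi> \<longleftrightarrow>
     (\<forall>j. \<psi> j \<in> L2_on \<Omega>) \<and>
     (\<forall>i j. L2_inner \<Omega> (\<psi> i) (\<psi> j) = (if i = j then 1 else 0)) \<and>
     (\<forall>f\<in>L2_on \<Omega>.
        (\<lambda>N. LINT x:\<Omega>|lborel. (f x - (\<Sum>j<N. L2_inner \<Omega> f (\<psi> j) * \<psi> j x))\<^sup>2) \<longlonglongrightarrow> 0)"

text \<open>All eigenvalues occur in \<open>\<mu>\<close>, with the right multiplicity, because the eigenfunctions form
  an orthonormal basis.\<close>

definition neumann_eigensystem ::
  "'a::euclidean_space set \<Rightarrow> (nat \<Rightarrow> real) \<Rightarrow> (nat \<Rightarrow> 'a \<Rightarrow> real) \<Rightarrow> bool" where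
  "neumann_eigensystem \<Omega> \<mu> \<psi> \<longleftrightarrow>
     \<mu> 0 = 0 \<and> 0 < \<mu> 1 \<and> mono \<mu> \<and>
     (\<exists>c. AE x in lborel. x \<in> \<Omega> \<longrightarrow> \<psi> 0 x = c) \<and>
     (\<forall>j. neumann_eigenfunction \<Omega> (\<mu> j) (\<psi> j)) \<and>
     L2_orthonormal_basis \<Omega> \<psi>"

text \<open>The series converges absolutely for every u in \<open>L\<^sup>2(\<Omega>)\<close> and every test function
  (\<open>\<mu>\<^sub>j powr s \<le> 1 + \<mu>\<^sub>j\<close>, and a test function lies in the domain of the Neumann Laplacian).
  Note \<open>0 powr s = 0\<close>, so the term \<open>j = 0\<close> vanishes.\<close>

definition frac_laplacian_NSp ::
  "real \<Rightarrow> 'a::euclidean_space set \<Rightarrow> (nat \<Rightarrow> real) \<Rightarrow> (nat \<Rightarrow> 'a \<Rightarrow> real) \<Rightarrow>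
   ('a \<Rightarrow> real) \<Rightarrow> ('a \<Rightarrow> real) \<Rightarrow> real" where
  "frac_laplacian_NSp s \<Omega> \<mu> \<psi> u \<phi> =
     (\<Sum>j. \<mu> j powr s * L2_inner \<Omega> u (\<psi> j) * L2_inner \<Omega> (\<psi> j) \<phi>)"

end

theory Submission
  imports Defs "HOL-Probability.Probability"
begin

text \<open>
  Write \<open>A\<close> for the free Laplacian \<open>-\<Delta>\<close> on the whole space and \<open>N\<close> for the Neumann Laplacian of \<open>\<Omega>\<close>.
  A fractional power is an average of resolvents,
  \<open>a powr s = K\<^sup>-\<^sup>1 * (integral over r > 0 of r powr (s - 1) * (1 - r / (r + a)))\<close>
  (\<open>power_subordination\<close>). Applied to the spectral representations of \<open>A\<close> and \<open>N\<close> this shows that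
  the difference of the two forms at \<open>(u, \<phi>)\<close> is \<open>K\<^sup>-\<^sup>1\<close> times the integral over \<open>r > 0\<close> of
  \<open>r powr (s - 1) * r * (((r + N)\<^sup>-\<^sup>1 \<phi>, u) - ((r + A)\<^sup>-\<^sup>1 \<phi>, u))\<close>: both representations give
  the same inner product \<open>(u, \<phi>)\<close>, which cancels. So everything follows from the comparison
  \<open>(r + A)\<^sup>-\<^sup>1 \<phi> \<le> (r + N)\<^sup>-\<^sup>1 \<phi>\<close> on \<open>\<Omega>\<close> (\<open>resolvent_comparison\<close>).

  The comparison is where convexity enters. The heat kernel with pole \<open>y\<close> decreases radially away
  from \<open>y\<close>, and if \<open>y\<close> lies in the convex set \<open>\<Omega>\<close>, the outward normal at a boundary point \<open>x\<close> makes
  an acute angle with \<open>x - y\<close>. Hence the outward normal derivative of the kernel is nonpositive on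
  the boundary, the kernel is a subsolution of the Neumann problem (\<open>heat_kernel_subsolution\<close>), and
  so is the free resolvent, which is a superposition of heat kernels. The weak maximum principle
  (\<open>weak_maximum_principle\<close>) then bounds the free resolvent by the Neumann resolvent. No boundary
  integral is needed: the sign of the normal derivative is expressed by multiplying with smooth
  cutoffs that are radially decreasing about \<open>y\<close> (\<open>radial_cutoff\<close>), and convexity is what makes such
  cutoffs available.

  Test functions for the weak formulations come from mollification. The weak maximum principle needs
  the chain rule for weak gradients (\<open>H1_pair_chain_rule\<close>), which is proved by mollifying in the
  interior. The Neumann resolvent is represented by the partial sums of its eigenfunction expansion,
  and the free resolvent by the heat integral over a compact time interval; both errors tend
  to 0 in the weak maximum principle, which is stated with a right-hand side for that purpose. On
  the Fourier side, the only form of Parseval's identity used is the one with a Gaussian weight,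
  which is Fubini's theorem (\<open>gaussian_parseval\<close>).

  The inequality is strict because \<open>r (r + N)\<^sup>-\<^sup>1\<close> tends to the projection onto constants as \<open>r\<close> tends
  to 0, whereas \<open>r (r + A)\<^sup>-\<^sup>1\<close> tends to 0: the Neumann problem conserves mass and the free one
  loses it to infinity.
\<close>

section \<open>Calculus of smooth functions\<close>

lemma partial_deriv_eqI: "(f has_derivative f') (at x) \<Longrightarrow> partial_deriv b f x = f' b"
  unfolding partial_deriv_def using frechet_derivative_at by metis

lemma Ck_Suc_imp_Ck: "Ck (Suc k) f \<Longrightarrow> Ck k f"
proof (induction k arbitrary: f)
  case 0
  then show ?case
    by (auto intro!: continuous_at_imp_continuous_on differentiable_imp_continuous_within)
qed auto

lemma Ck_imp_continuous: "Ck k f \<Longrightarrow> continuous_on UNIV f"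
proof (induction k arbitrary: f)
  case (Suc k)
  then show ?case using Ck_Suc_imp_Ck by blast
qed simp

lemma Ck_const [simp]: "Ck k (\<lambda>x. c)"
proof (induction k arbitrary: c)
  case (Suc k)
  have "partial_deriv b (\<lambda>x::'a. c) = (\<lambda>x. 0)" for b
    by (rule ext, rule partial_deriv_eqI) simp
  then show ?case by (simp add: Suc)
qed simp

lemma Ck_add:
  assumes "Ck k f" "Ck k g" shows "Ck k (\<lambda>x. f x + g x)"
  using assms
proof (induction k arbitrary: f g)
  case (Suc k)
  have "partial_deriv b (\<lambda>x. f x + g x) = (\<lambda>x. partial_deriv b f x + partial_deriv b g x)" for b
    using Suc.prems by (intro ext partial_deriv_eqI[THEN trans])
      (auto intro!: has_derivative_add simp: frechet_derivative_works partial_deriv_def)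
  then show ?case using Suc by simp
qed (simp add: continuous_on_add)

lemma partial_deriv_mult:
  assumes "f differentiable at x" "g differentiable at x"
  shows "partial_deriv b (\<lambda>x. f x * g x) x = f x * partial_deriv b g x + partial_deriv b f x * g x"
proof -
  have "((\<lambda>x. f x * g x) has_derivative
      (\<lambda>h. f x * frechet_derivative g (at x) h + frechet_derivative f (at x) h * g x)) (at x)"
    using assms by (intro has_derivative_mult) (simp_all add: frechet_derivative_works)
  from partial_deriv_eqI[OF this] show ?thesis by (simp add: partial_deriv_def)
qed

lemma Ck_mult:
  assumes "Ck k f" "Ck k g" shows "Ck k (\<lambda>x. f x * g x)"
  using assms
proof (induction k arbitrary: f g)
  case (Suc k)
  have "partial_deriv b (\<lambda>x. f x * g x) = (\<lambda>x. f x * partial_deriv b g x + partial_deriv b f x * g x)" for b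
    using Suc.prems by (auto simp: partial_deriv_mult)
  moreover have "Ck k f" "Ck k g" using Suc.prems Ck_Suc_imp_Ck by blast+
  ultimately show ?case using Suc by (auto intro!: Ck_add)
qed (simp add: continuous_on_mult)

lemma Ck_sum: "(\<And>i. i \<in> I \<Longrightarrow> Ck k (f i)) \<Longrightarrow> Ck k (\<lambda>x. \<Sum>i\<in>I. f i x)"
  by (induction I rule: infinite_finite_induct) (auto intro: Ck_add)

lemma Ck_inner: "Ck k (\<lambda>x. x \<bullet> c)"
proof (cases k)
  case (Suc j)
  have "partial_deriv b (\<lambda>x. x \<bullet> c) = (\<lambda>x. b \<bullet> c)" for b
    by (intro ext partial_deriv_eqI) (auto intro!: derivative_eq_intros)
  then show ?thesis using Suc by (auto intro!: differentiableI derivative_eq_intros)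
qed (auto intro!: continuous_intros)

lemma Ck_exp:
  assumes "Ck k f" shows "Ck k (\<lambda>x. exp (f x))"
  using assms
proof (induction k)
  case (Suc k)
  have D: "((\<lambda>x. exp (f x)) has_derivative (\<lambda>h. exp (f x) * frechet_derivative f (at x) h)) (at x)" for x
    using Suc.prems by (auto intro!: derivative_eq_intros simp: frechet_derivative_works)
  have "partial_deriv b (\<lambda>x. exp (f x)) = (\<lambda>x. exp (f x) * partial_deriv b f x)" for b
    using partial_deriv_eqI[OF D] by (auto simp: partial_deriv_def)
  moreover have "Ck k (\<lambda>x. exp (f x))" using Suc Ck_Suc_imp_Ck by blast
  ultimately show ?case using Suc.prems D by (auto intro!: Ck_mult differentiableI)
qed (auto intro!: continuous_intros)

lemma partial_deriv_affine:
  assumes "f differentiable at (c *\<^sub>R x + a)"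
  shows "((\<lambda>x. f (c *\<^sub>R x + a)) has_derivative (\<lambda>h. c * frechet_derivative f (at (c *\<^sub>R x + a)) h)) (at x)"
    and "partial_deriv b (\<lambda>x. f (c *\<^sub>R x + a)) x = c * partial_deriv b f (c *\<^sub>R x + a)"
proof -
  let ?D = "frechet_derivative f (at (c *\<^sub>R x + a))"
  have D: "(f has_derivative ?D) (at (c *\<^sub>R x + a))"
    using assms by (simp add: frechet_derivative_works)
  have "((\<lambda>x. f (c *\<^sub>R x + a)) has_derivative (\<lambda>h. ?D (c *\<^sub>R h))) (at x)"
    by (rule has_derivative_compose[where g = f and f = "\<lambda>x. c *\<^sub>R x + a", OF _ D])
      (auto intro!: derivative_eq_intros)
  moreover have "?D (c *\<^sub>R h) = c * ?D h" for h
    using linear_cmul[OF has_derivative_linear[OF D]] by simp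
  ultimately show *: "((\<lambda>x. f (c *\<^sub>R x + a)) has_derivative (\<lambda>h. c * ?D h)) (at x)" by simp
  from partial_deriv_eqI[OF *] show "partial_deriv b (\<lambda>x. f (c *\<^sub>R x + a)) x = c * partial_deriv b f (c *\<^sub>R x + a)"
    by (simp add: partial_deriv_def)
qed

lemma Ck_affine:
  assumes "Ck k f" shows "Ck k (\<lambda>x. f (c *\<^sub>R x + a))"
  using assms
proof (induction k arbitrary: f)
  case 0
  then have "continuous_on UNIV f" by simp
  then have "continuous_on UNIV (\<lambda>x. f (c *\<^sub>R x + a))"
    by (rule continuous_on_compose2) (auto intro!: continuous_intros)
  then show ?case by simp
next
  case (Suc k)
  then have d: "f differentiable at x" for x by simp
  have "partial_deriv b (\<lambda>x. f (c *\<^sub>R x + a)) = (\<lambda>x. c * partial_deriv b f (c *\<^sub>R x + a))" for b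
    using partial_deriv_affine(2)[OF d] by auto
  moreover have "\<forall>x. (\<lambda>x. f (c *\<^sub>R x + a)) differentiable at x"
    using partial_deriv_affine(1)[OF d] differentiableI by blast
  ultimately show ?case using Suc by (auto intro!: Ck_mult)
qed

lemma frechet_derivative_basis_expansion:
  fixes f :: "'a::euclidean_space \<Rightarrow> real"
  assumes "f differentiable at x"
  shows "frechet_derivative f (at x) h = (\<Sum>b\<in>Basis. (h \<bullet> b) * partial_deriv b f x)"
proof -
  have L: "linear (frechet_derivative f (at x))" using assms linear_frechet_derivative by blast
  have "frechet_derivative f (at x) h = frechet_derivative f (at x) (\<Sum>b\<in>Basis. (h \<bullet> b) *\<^sub>R b)"
    by (simp add: euclidean_representation)
  then show ?thesis using L by (simp add: linear_sum linear_cmul partial_deriv_def)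
qed

lemma partial_deriv_zero_outside_support:
  assumes "x \<notin> closure {x. f x \<noteq> 0}"
  shows "partial_deriv b f x = 0"
proof -
  have "(f has_derivative (\<lambda>h. 0)) (at x)"
  proof (rule has_derivative_transform_within_open)
    show "((\<lambda>_. 0) has_derivative (\<lambda>h. 0)) (at x)" by simp
    show "open (- closure {x. f x \<noteq> 0})" by (simp add: open_Compl)
    show "0 = f y" if "y \<in> - closure {x. f x \<noteq> 0}" for y
      using that closure_subset[of "{x. f x \<noteq> 0}"] by auto
  qed (use assms in simp)
  then show ?thesis by (rule partial_deriv_eqI)
qed

text \<open>The derivative vanishes on the complement of the support because that set is open.\<close>

lemma partial_deriv_support:
  "closure {x. partial_deriv b f x \<noteq> 0} \<subseteq> closure {x. f x \<noteq> 0}"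
  using partial_deriv_zero_outside_support[of _ f b]
  by (metis (mono_tags, lifting) closure_minimal closed_closure mem_Collect_eq subsetI)

lemma bounded_support_partial_deriv:
  assumes "bounded {x. f x \<noteq> 0}" shows "bounded {x. partial_deriv b f x \<noteq> 0}"
  using partial_deriv_support[of b f] closure_subset assms bounded_closure bounded_subset by metis

lemma test_function_partial_deriv:
  assumes "test_function \<Omega> f" "b \<in> Basis" shows "test_function \<Omega> (partial_deriv b f)"
proof -
  have "Ck (Suc k) f" for k using assms unfolding test_function_def smooth_def by blast
  then have "smooth (partial_deriv b f)" using assms(2) by (auto simp: smooth_def)
  moreover have "closure {x. partial_deriv b f x \<noteq> 0} \<subseteq> closure {x. f x \<noteq> 0}"
    by (rule partial_deriv_support)
  ultimately show ?thesis using assms unfolding test_function_def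
    by (meson closed_closure closed_subset compact_closure bounded_subset compact_imp_bounded subset_trans closure_subset)
qed

lemma uniformly_continuous_compact_support:
  fixes f :: "'a::euclidean_space \<Rightarrow> real"
  assumes c: "continuous_on UNIV f" and b: "bounded {x. f x \<noteq> 0}" and e: "e > 0"
  obtains d where "d > 0" "\<And>x y. dist x y < d \<Longrightarrow> \<bar>f x - f y\<bar> < e"
proof -
  obtain R where R: "\<And>x. f x \<noteq> 0 \<Longrightarrow> norm x \<le> R" using b by (auto simp: bounded_iff)
  have "uniformly_continuous_on (cball 0 (R+1)) f"
    by (intro compact_uniformly_continuous continuous_on_subset[OF c]) auto
  then obtain d where d: "d > 0" "\<And>x y. x \<in> cball 0 (R+1) \<Longrightarrow> y \<in> cball 0 (R+1) \<Longrightarrow> dist x y < d \<Longrightarrow> dist (f x) (f y) < e"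
    unfolding uniformly_continuous_on_def using e by (metis dist_commute)
  have "\<bar>f x - f y\<bar> < e" if "dist x y < min d 1" for x y
  proof (cases "norm x \<le> R \<or> norm y \<le> R")
    case True
    moreover have "norm y \<le> norm x + dist x y" "norm x \<le> norm y + dist x y"
      by norm+
    ultimately have "x \<in> cball 0 (R+1)" "y \<in> cball 0 (R+1)" using that by auto
    then show ?thesis using d(2)[of x y] that by (simp add: dist_real_def)
  next
    case False
    then have "f x = 0" "f y = 0" using R by blast+
    then show ?thesis using e by simp
  qed
  then show ?thesis using that[of "min d 1"] d(1) by auto
qed

lemma continuous_compact_support_bounded:
  fixes f :: "'a::euclidean_space \<Rightarrow> real"
  assumes "continuous_on UNIV f" "bounded {x. f x \<noteq> 0}"
  obtains B where "\<And>x. \<bar>f x\<bar> \<le> B" "B \<ge> 0"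
proof -
  have "compact (f ` closure {x. f x \<noteq> 0})"
    using assms by (intro compact_continuous_image) (auto intro: continuous_on_subset)
  then obtain B where B: "\<And>x. x \<in> closure {x. f x \<noteq> 0} \<Longrightarrow> \<bar>f x\<bar> \<le> B"
    by (metis (no_types, lifting) bounded_iff compact_imp_bounded imageI real_norm_def)
  have "\<bar>f x\<bar> \<le> max B 0" for x
    using B[of x] closure_subset[of "{x. f x \<noteq> 0}"] by (cases "f x = 0") (auto intro: le_max_iff_disj[THEN iffD2])
  then show ?thesis using that by (metis max.cobounded2)
qed

lemma continuous_compact_support_integrable:
  fixes f :: "'a::euclidean_space \<Rightarrow> real"
  assumes "continuous_on UNIV f" "bounded {x. f x \<noteq> 0}"
  shows "integrable lborel f"
proof -
  have "integrable lborel (\<lambda>x. indicator (closure {x. f x \<noteq> 0}) x *\<^sub>R f x)"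
    using assms by (intro borel_integrable_compact) (auto intro: continuous_on_subset)
  moreover have "(\<lambda>x. indicator (closure {x. f x \<noteq> 0}) x *\<^sub>R f x) = f"
    using closure_subset[of "{x. f x \<noteq> 0}"] by (force simp: indicator_def)
  ultimately show ?thesis by simp
qed

section \<open>Changes of variables and integration by parts\<close>

lemma lborel_integral_affine:
  fixes f :: "'a::euclidean_space \<Rightarrow> 'b::{banach, second_countable_topology}" and c :: real
  assumes [measurable]: "f \<in> borel_measurable borel" and c: "c \<noteq> 0"
  shows "(LINT x|lborel. f (t + c *\<^sub>R x)) = (1 / \<bar>c\<bar> ^ DIM('a)) *\<^sub>R (LINT x|lborel. f x)"
    and "integrable lborel (\<lambda>x. f (t + c *\<^sub>R x)) \<longleftrightarrow> integrable lborel f"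
proof -
  have "(LINT x|lborel. f x) = (\<bar>c\<bar> ^ DIM('a)) *\<^sub>R (LINT x|lborel. f (t + c *\<^sub>R x))"
    by (subst lborel_affine[OF c, of t]) (simp add: integral_density integral_distr)
  then show "(LINT x|lborel. f (t + c *\<^sub>R x)) = (1 / \<bar>c\<bar> ^ DIM('a)) *\<^sub>R (LINT x|lborel. f x)"
    using c by simp
  have "integrable lborel f \<longleftrightarrow> integrable lborel (\<lambda>x. (\<bar>c\<bar> ^ DIM('a)) *\<^sub>R f (t + c *\<^sub>R x))"
    by (subst lborel_affine[OF c, of t]) (simp add: integrable_density integrable_distr_eq)
  then show "integrable lborel (\<lambda>x. f (t + c *\<^sub>R x)) \<longleftrightarrow> integrable lborel f"
    using c integrable_scaleR_right[of "1 / \<bar>c\<bar> ^ DIM('a)" lborel "\<lambda>x. (\<bar>c\<bar> ^ DIM('a)) *\<^sub>R f (t + c *\<^sub>R x)"]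
    by auto
qed

lemma lborel_integral_translate:
  fixes f :: "'a::euclidean_space \<Rightarrow> 'b::{banach, second_countable_topology}"
  assumes "f \<in> borel_measurable borel"
  shows "(LINT x|lborel. f (x + c)) = (LINT x|lborel. f x)"
    and "integrable lborel (\<lambda>x. f (x + c)) \<longleftrightarrow> integrable lborel f"
  using lborel_integral_affine[OF assms, of 1 c] by (simp_all add: add.commute)

lemma lborel_integral_reflect:
  fixes f :: "'a::euclidean_space \<Rightarrow> 'b::{banach, second_countable_topology}"
  assumes "f \<in> borel_measurable borel"
  shows "(LINT x|lborel. f (c - x)) = (LINT x|lborel. f x)"
    and "integrable lborel (\<lambda>x. f (c - x)) \<longleftrightarrow> integrable lborel f"
  using lborel_integral_affine[OF assms, of "-1" c] by simp_all

lemma has_real_derivative_along_line: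
  fixes f :: "'a::euclidean_space \<Rightarrow> real"
  assumes "f differentiable at (x + t *\<^sub>R b)"
  shows "((\<lambda>t. f (x + t *\<^sub>R b)) has_real_derivative frechet_derivative f (at (x + t *\<^sub>R b)) b) (at t)"
proof -
  let ?D = "frechet_derivative f (at (x + t *\<^sub>R b))"
  have D: "(f has_derivative ?D) (at (x + t *\<^sub>R b))"
    using assms by (simp add: frechet_derivative_works)
  have "((\<lambda>t. f (x + t *\<^sub>R b)) has_derivative (\<lambda>h. ?D (h *\<^sub>R b))) (at t)"
    by (rule has_derivative_compose[where g = f and f = "\<lambda>t. x + t *\<^sub>R b", OF _ D])
      (auto intro!: derivative_eq_intros)
  moreover have "?D (h *\<^sub>R b) = h * ?D b" for h
    using linear_cmul[OF has_derivative_linear[OF D]] by simp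
  ultimately show ?thesis by (simp add: has_field_derivative_def mult.commute[of _ "?D b"])
qed

lemma mean_value_along_segment:
  fixes f :: "'a::euclidean_space \<Rightarrow> real"
  assumes "\<And>x. f differentiable at x"
  obtains \<theta> where "0 < \<theta>" "\<theta> < 1" "f (x + h) - f x = frechet_derivative f (at (x + \<theta> *\<^sub>R h)) h"
proof -
  have "\<exists>z. z > 0 \<and> z < 1 \<and> f (x + 1 *\<^sub>R h) - f (x + 0 *\<^sub>R h) = (1 - 0) * frechet_derivative f (at (x + z *\<^sub>R h)) h"
    by (rule MVT2) (auto intro: has_real_derivative_along_line assms)
  then show ?thesis using that by auto
qed

text \<open>Translation invariance makes the integral of every difference quotient vanish; the mean value theorem bounds the quotients uniformly on a fixed ball, so the limit may be taken inside.\<close>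

lemma integral_partial_deriv_eq_0:
  fixes f :: "'a::euclidean_space \<Rightarrow> real"
  assumes d: "\<And>x. f differentiable at x" and c: "continuous_on UNIV (partial_deriv b f)"
    and s: "bounded {x. f x \<noteq> 0}"
  shows "(LINT x|lborel. partial_deriv b f x) = 0"
proof -
  have cf: "continuous_on UNIV f"
    using d by (intro continuous_at_imp_continuous_on ballI differentiable_imp_continuous_within) auto
  have fi: "integrable lborel f" by (rule continuous_compact_support_integrable[OF cf s])
  have [measurable]: "f \<in> borel_measurable borel" "partial_deriv b f \<in> borel_measurable borel"
    using cf c by (auto intro: borel_measurable_continuous_onI)
  obtain B where B: "\<And>x. \<bar>partial_deriv b f x\<bar> \<le> B" "B \<ge> 0"
    using continuous_compact_support_bounded[OF c bounded_support_partial_deriv[OF s]] by blast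
  obtain R where R: "\<And>x. f x \<noteq> 0 \<Longrightarrow> norm x \<le> R" using s by (auto simp: bounded_iff)
  define h where "h n = inverse (real (Suc n))" for n
  have h: "h n > 0" "h n \<le> 1" "h n \<noteq> 0" for n by (auto simp: h_def field_simps)
  have h0: "h \<longlonglongrightarrow> 0" unfolding h_def by (rule LIMSEQ_inverse_real_of_nat)
  define q where "q n x = (f (x + h n *\<^sub>R b) - f x) / h n" for n x
  have "(\<lambda>n. LINT x|lborel. q n x) \<longlonglongrightarrow> (LINT x|lborel. partial_deriv b f x)"
  proof (rule integral_dominated_convergence)
    show "integrable lborel (\<lambda>x. B * indicator (cball 0 (R + norm b)) x)"
      by (intro integrable_mult_right integrable_real_indicator emeasure_lborel_cball_finite) simp
    show "AE x in lborel. (\<lambda>n. q n x) \<longlonglongrightarrow> partial_deriv b f x"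
    proof (rule AE_I2)
      fix x
      have "((\<lambda>t. f (x + t *\<^sub>R b)) has_real_derivative partial_deriv b f x) (at 0)"
        using has_real_derivative_along_line[of f x 0 b] d by (simp add: partial_deriv_def)
      then have "((\<lambda>t. (f (x + t *\<^sub>R b) - f x) / t) \<longlongrightarrow> partial_deriv b f x) (at 0)"
        by (simp add: DERIV_def)
      moreover have "filterlim h (at 0) sequentially"
        unfolding filterlim_at using h(3) h0 by (intro conjI always_eventually) auto
      ultimately show "(\<lambda>n. q n x) \<longlonglongrightarrow> partial_deriv b f x"
        unfolding q_def by (rule filterlim_compose)
    qed
    show "AE x in lborel. norm (q n x) \<le> B * indicator (cball 0 (R + norm b)) x" for n
    proof (rule AE_I2)
      fix x
      show "norm (q n x) \<le> B * indicator (cball 0 (R + norm b)) x"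
      proof (cases "norm x \<le> R + norm b")
        case True
        obtain \<theta> where \<theta>: "f (x + h n *\<^sub>R b) - f x = frechet_derivative f (at (x + \<theta> *\<^sub>R h n *\<^sub>R b)) (h n *\<^sub>R b)"
          using mean_value_along_segment[OF d] by metis
        also have "\<dots> = h n * partial_deriv b f (x + \<theta> *\<^sub>R h n *\<^sub>R b)"
          using linear_cmul[OF linear_frechet_derivative[OF d]] by (simp add: partial_deriv_def)
        finally have "q n x = partial_deriv b f (x + \<theta> *\<^sub>R h n *\<^sub>R b)" using h[of n] by (simp add: q_def)
        then show ?thesis using B True by auto
      next
        case False
        have "norm (h n *\<^sub>R b) \<le> norm b" using h[of n] by (simp add: mult_left_le_one_le)
        moreover have "norm x \<le> norm (x + h n *\<^sub>R b) + norm (h n *\<^sub>R b)"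
          by (metis add_diff_cancel norm_triangle_ineq4)
        ultimately have "\<not> norm (x + h n *\<^sub>R b) \<le> R" "\<not> norm x \<le> R" using False norm_ge_zero[of b] by linarith+
        then have "f (x + h n *\<^sub>R b) = 0" "f x = 0" using R by blast+
        then show ?thesis using B by (simp add: q_def)
      qed
    qed
  qed (auto simp: q_def)
  moreover have "(LINT x|lborel. q n x) = 0" for n
  proof -
    have "integrable lborel (\<lambda>x. f (x + h n *\<^sub>R b))" using fi by (subst lborel_integral_translate(2)) auto
    then have "(LINT x|lborel. f (x + h n *\<^sub>R b) - f x) = 0"
      using fi lborel_integral_translate(1)[of f "h n *\<^sub>R b"] by (simp add: Bochner_Integration.integral_diff)
    then show ?thesis by (simp add: q_def)
  qed
  ultimately show ?thesis using LIMSEQ_unique[OF _ tendsto_const[of 0]] by simp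
qed

section \<open>Convolution with smooth functions\<close>

definition convolve :: "('a::euclidean_space \<Rightarrow> real) \<Rightarrow> ('a \<Rightarrow> real) \<Rightarrow> 'a \<Rightarrow> real" where
  "convolve f \<rho> x = (LINT y|lborel. f y * \<rho> (x - y))"

lemma integrable_convolve_integrand:
  fixes f \<rho> :: "'a::euclidean_space \<Rightarrow> real"
  assumes f: "integrable lborel f" and r: "continuous_on UNIV \<rho>" "bounded {x. \<rho> x \<noteq> 0}"
  shows "integrable lborel (\<lambda>y. f y * \<rho> (x - y))"
proof -
  obtain B where B: "\<And>x. \<bar>\<rho> x\<bar> \<le> B" using continuous_compact_support_bounded[OF r] by blast
  have [measurable]: "\<rho> \<in> borel_measurable borel" using r by (auto intro: borel_measurable_continuous_onI)
  show ?thesis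
    by (rule Bochner_Integration.integrable_bound[OF integrable_mult_right[OF integrable_norm[OF f], of B]])
      (use f in measurable, rule AE_I2, simp add: abs_mult mult.commute[of B],
        intro mult_left_mono order_trans[OF B], auto)
qed

lemma continuous_convolve:
  assumes f: "integrable lborel f" and r: "continuous_on UNIV \<rho>" "bounded {x. \<rho> x \<noteq> 0}"
  shows "continuous_on UNIV (convolve f \<rho>)"
proof -
  have "\<exists>d>0. \<forall>x'. dist x' x < d \<longrightarrow> dist (convolve f \<rho> x') (convolve f \<rho> x) < e" if e: "e > 0" for x e
  proof -
    define F where "F = (LINT y|lborel. \<bar>f y\<bar>)"
    have F: "F \<ge> 0" by (simp add: F_def)
    have "e / (F + 1) > 0" using e F by simp
    from uniformly_continuous_compact_support[OF r this]
    obtain d where d: "d > 0" "\<And>x y. dist x y < d \<Longrightarrow> \<bar>\<rho> x - \<rho> y\<bar> < e / (F + 1)"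
      by blast
    have "\<bar>convolve f \<rho> x' - convolve f \<rho> x\<bar> < e" if "dist x' x < d" for x'
    proof -
      have "\<bar>convolve f \<rho> x' - convolve f \<rho> x\<bar> = \<bar>LINT y|lborel. f y * (\<rho> (x' - y) - \<rho> (x - y))\<bar>"
        unfolding convolve_def right_diff_distrib
        by (subst Bochner_Integration.integral_diff) (simp_all add: integrable_convolve_integrand[OF f r])
      also have "\<dots> \<le> (LINT y|lborel. \<bar>f y\<bar> * (e / (F + 1)))"
      proof (rule order_trans[OF integral_abs_bound], rule integral_mono)
        show "integrable lborel (\<lambda>y. \<bar>f y * (\<rho> (x' - y) - \<rho> (x - y))\<bar>)"
          using integrable_convolve_integrand[OF f r] by (auto simp: right_diff_distrib)
        show "\<bar>f y * (\<rho> (x' - y) - \<rho> (x - y))\<bar> \<le> \<bar>f y\<bar> * (e / (F + 1))" for y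
          using d(2)[of "x' - y" "x - y"] that unfolding abs_mult by (intro mult_left_mono) (auto simp: dist_norm)
      qed (use f in auto)
      also have "\<dots> = F * (e / (F + 1))" by (simp add: F_def)
      also have "\<dots> < e" using e F by (simp add: field_simps)
      finally show ?thesis .
    qed
    then show ?thesis using d(1) by (auto simp: dist_real_def)
  qed
  then show ?thesis by (auto simp: continuous_on_iff)
qed

text \<open>The increment of \<open>\<rho>\<close> is its derivative at an intermediate point, so the error of the linear
  approximation is governed by the modulus of uniform continuity of the partial derivatives,
  uniformly in the integration variable. This gives total differentiability directly.\<close>

lemma has_derivative_convolve:
  assumes f: "integrable lborel f" and r: "Ck (Suc 0) \<rho>" "bounded {x. \<rho> x \<noteq> 0}"
  shows "(convolve f \<rho> has_derivative (\<lambda>h. \<Sum>b\<in>Basis. (h \<bullet> b) * convolve f (partial_deriv b \<rho>) x)) (at x)"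
proof -
  let ?n = "real DIM('a)"
  have c0: "continuous_on UNIV \<rho>" using Ck_imp_continuous r by blast
  have d: "\<rho> differentiable at x" for x using r by simp
  have c1: "continuous_on UNIV (partial_deriv b \<rho>)" "bounded {x. partial_deriv b \<rho> x \<noteq> 0}" if "b \<in> Basis" for b
    using r that by (auto intro: bounded_support_partial_deriv)
  define F where "F = (LINT y|lborel. \<bar>f y\<bar>)"
  have F: "F \<ge> 0" by (simp add: F_def)
  let ?L = "\<lambda>h. \<Sum>b\<in>Basis. (h \<bullet> b) * convolve f (partial_deriv b \<rho>) x"
  have L: "bounded_linear ?L"
    by (intro bounded_linear_sum bounded_linear_mult_const bounded_linear_inner_left)
  have "\<exists>\<delta>>0. \<forall>x'. norm (x' - x) < \<delta> \<longrightarrow> norm (convolve f \<rho> x' - convolve f \<rho> x - ?L (x' - x)) \<le> e * norm (x' - x)"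
    if e: "e > 0" for e
  proof -
    define e' where "e' = e / (?n * (F + 1))"
    have e': "e' > 0" using e F by (simp add: e'_def)
    have "\<exists>\<delta>>0. \<forall>x y. dist x y < \<delta> \<longrightarrow> \<bar>partial_deriv b \<rho> x - partial_deriv b \<rho> y\<bar> < e'" if "b \<in> Basis" for b
      using uniformly_continuous_compact_support[OF c1[OF that] e'] by metis
    then obtain D where D: "\<And>b. b \<in> Basis \<Longrightarrow> D b > 0"
      "\<And>b x y. b \<in> Basis \<Longrightarrow> dist x y < D b \<Longrightarrow> \<bar>partial_deriv b \<rho> x - partial_deriv b \<rho> y\<bar> < e'"
      by metis
    define \<delta> where "\<delta> = Min (D ` (Basis::'a set))"
    have \<delta>: "\<delta> > 0" using D by (simp add: \<delta>_def)
    have "norm (convolve f \<rho> x' - convolve f \<rho> x - ?L (x' - x)) \<le> e * norm (x' - x)" if x': "norm (x' - x) < \<delta>" for x'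
    proof -
      define h where "h = x' - x"
      have int: "integrable lborel (\<lambda>y. f y * \<rho> (z - y))" for z using integrable_convolve_integrand[OF f c0 r(2)] .
      have int1: "integrable lborel (\<lambda>y. f y * partial_deriv b \<rho> (z - y))" if "b \<in> Basis" for z b
        using integrable_convolve_integrand[OF f c1[OF that]] .
      have pt: "\<bar>\<rho> (a + h) - \<rho> a - (\<Sum>b\<in>Basis. (h \<bullet> b) * partial_deriv b \<rho> a)\<bar> \<le> ?n * (norm h * e')" for a
      proof -
        obtain \<theta> where \<theta>: "0 < \<theta>" "\<theta> < 1" "\<rho> (a + h) - \<rho> a = frechet_derivative \<rho> (at (a + \<theta> *\<^sub>R h)) h"
          using mean_value_along_segment[OF d] by metis
        have "\<rho> (a + h) - \<rho> a - (\<Sum>b\<in>Basis. (h \<bullet> b) * partial_deriv b \<rho> a)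
          = (\<Sum>b\<in>Basis. (h \<bullet> b) * (partial_deriv b \<rho> (a + \<theta> *\<^sub>R h) - partial_deriv b \<rho> a))"
          by (simp add: \<theta> frechet_derivative_basis_expansion[OF d] sum_subtractf right_diff_distrib)
        also have "\<bar>\<dots>\<bar> \<le> (\<Sum>b\<in>(Basis::'a set). norm h * e')"
        proof (rule order_trans[OF sum_abs], rule sum_mono)
          fix b :: 'a assume b: "b \<in> Basis"
          have "dist (a + \<theta> *\<^sub>R h) a \<le> norm h" using \<theta> by (simp add: dist_norm mult_left_le_one_le)
          also have "\<dots> < D b" using x' b unfolding h_def \<delta>_def by auto
          finally have "\<bar>partial_deriv b \<rho> (a + \<theta> *\<^sub>R h) - partial_deriv b \<rho> a\<bar> \<le> e'" using D(2)[OF b] by (simp add: less_imp_le)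
          then show "\<bar>(h \<bullet> b) * (partial_deriv b \<rho> (a + \<theta> *\<^sub>R h) - partial_deriv b \<rho> a)\<bar> \<le> norm h * e'"
            using Basis_le_norm[OF b, of h] by (auto simp: abs_mult intro!: mult_mono)
        qed
        finally show ?thesis by simp
      qed
      define E where "E y = f y * \<rho> (x' - y) - f y * \<rho> (x - y)
        - (\<Sum>b\<in>Basis. (h \<bullet> b) * (f y * partial_deriv b \<rho> (x - y)))" for y
      have S: "integrable lborel (\<lambda>y. \<Sum>b\<in>Basis. (h \<bullet> b) * (f y * partial_deriv b \<rho> (x - y)))"
        by (intro Bochner_Integration.integrable_sum integrable_mult_right int1)
      have Eint: "integrable lborel E"
        unfolding E_def by (intro Bochner_Integration.integrable_diff int S)
      have "(LINT y|lborel. (\<Sum>b\<in>Basis. (h \<bullet> b) * (f y * partial_deriv b \<rho> (x - y)))) = ?L h"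
        unfolding convolve_def
        by (subst Bochner_Integration.integral_sum) (auto intro!: integrable_mult_right int1)
      then have eq: "convolve f \<rho> x' - convolve f \<rho> x - ?L (x' - x) = (LINT y|lborel. E y)"
        unfolding E_def h_def[symmetric] convolve_def[of f \<rho>]
        by (subst Bochner_Integration.integral_diff[OF _ S], intro Bochner_Integration.integrable_diff int)
          (subst Bochner_Integration.integral_diff[OF int int], simp)
      have E': "E y = f y * (\<rho> ((x - y) + h) - \<rho> (x - y) - (\<Sum>b\<in>Basis. (h \<bullet> b) * partial_deriv b \<rho> (x - y)))" for y
      proof -
        have "(\<Sum>b\<in>Basis. (h \<bullet> b) * (f y * partial_deriv b \<rho> (x - y))) = f y * (\<Sum>b\<in>Basis. (h \<bullet> b) * partial_deriv b \<rho> (x - y))"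
          unfolding sum_distrib_left by (intro sum.cong refl mult.left_commute)
        moreover have "\<rho> (x' - y) = \<rho> (x - y + h)" by (simp add: h_def algebra_simps)
        ultimately show ?thesis unfolding E_def by (simp add: right_diff_distrib)
      qed
      have "\<bar>LINT y|lborel. E y\<bar> \<le> (LINT y|lborel. \<bar>f y\<bar> * (?n * (norm h * e')))"
      proof (rule order_trans[OF integral_abs_bound], rule integral_mono)
        show "\<bar>E y\<bar> \<le> \<bar>f y\<bar> * (?n * (norm h * e'))" for y
          unfolding E' abs_mult using pt[of "x - y"] by (intro mult_left_mono) auto
      qed (use f Eint in auto)
      also have "\<dots> = F * (?n * (norm h * e'))" by (simp add: F_def)
      also have "\<dots> = (F / (F + 1)) * (e * norm h)" by (simp add: e'_def)
      also have "\<dots> \<le> 1 * (e * norm h)" using F e by (intro mult_right_mono) auto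
      finally show ?thesis unfolding eq by (simp add: h_def)
    qed
    then show ?thesis using \<delta> by blast
  qed
  then show ?thesis using L by (auto simp: has_derivative_at_alt)
qed

lemma partial_deriv_convolve:
  assumes "integrable lborel f" "Ck (Suc 0) \<rho>" "bounded {x. \<rho> x \<noteq> 0}" "b \<in> Basis"
  shows "partial_deriv b (convolve f \<rho>) = convolve f (partial_deriv b \<rho>)"
proof
  fix x
  show "partial_deriv b (convolve f \<rho>) x = convolve f (partial_deriv b \<rho>) x"
    using partial_deriv_eqI[OF has_derivative_convolve[OF assms(1-3)], of b x] assms(4)
    by (simp add: inner_Basis if_distrib[of "\<lambda>c. c * _"] cong: if_cong)
qed

lemma Ck_convolve:
  assumes "integrable lborel f" "Ck k \<rho>" "bounded {x. \<rho> x \<noteq> 0}"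
  shows "Ck k (convolve f \<rho>)"
  using assms(2,3)
proof (induction k arbitrary: \<rho>)
  case 0
  then show ?case using continuous_convolve[OF assms(1)] by simp
next
  case (Suc k)
  have 1: "Ck (Suc 0) \<rho>" using Suc.prems by (auto intro: Ck_imp_continuous)
  show ?case
  proof (simp, intro conjI allI ballI)
    show "convolve f \<rho> differentiable at x" for x
      using has_derivative_convolve[OF assms(1) 1 Suc.prems(2)] by (rule differentiableI)
    show "Ck k (partial_deriv b (convolve f \<rho>))" if "b \<in> Basis" for b
      unfolding partial_deriv_convolve[OF assms(1) 1 Suc.prems(2) that]
      by (rule Suc.IH) (use Suc.prems that bounded_support_partial_deriv in auto)
  qed
qed

section \<open>Square-integrable functions on a domain\<close>

lemma L2_on_iff:
  "f \<in> L2_on \<Omega> \<longleftrightarrow> (\<lambda>x. indicator \<Omega> x *\<^sub>R f x) \<in> borel_measurable lborel \<and>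
     integrable lborel (\<lambda>x. indicator \<Omega> x * (norm (f x))\<^sup>2)"
  by (simp add: L2_on_def set_borel_measurable_def set_integrable_def)

lemma L2_on_inner_integrable:
  fixes f g :: "'a::euclidean_space \<Rightarrow> 'b::euclidean_space"
  assumes "f \<in> L2_on \<Omega>" "g \<in> L2_on \<Omega>"
  shows "set_integrable lborel \<Omega> (\<lambda>x. f x \<bullet> g x)"
proof -
  have [measurable]: "(\<lambda>x. indicator \<Omega> x *\<^sub>R f x) \<in> borel_measurable lborel"
    "(\<lambda>x. indicator \<Omega> x *\<^sub>R g x) \<in> borel_measurable lborel" using assms by (auto simp: L2_on_iff)
  have eq: "indicator \<Omega> x *\<^sub>R (f x \<bullet> g x) = (indicator \<Omega> x *\<^sub>R f x) \<bullet> (indicator \<Omega> x *\<^sub>R g x)" for x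
    by (auto simp: indicator_def)
  have "integrable lborel (\<lambda>x. indicator \<Omega> x * (norm (f x))\<^sup>2 + indicator \<Omega> x * (norm (g x))\<^sup>2)"
    using assms by (intro Bochner_Integration.integrable_add) (auto simp: L2_on_iff)
  then show ?thesis unfolding set_integrable_def eq
  proof (rule Bochner_Integration.integrable_bound)
    have "\<bar>f x \<bullet> g x\<bar> \<le> (norm (f x))\<^sup>2 + (norm (g x))\<^sup>2" for x
    proof -
      have "\<bar>f x \<bullet> g x\<bar> \<le> norm (f x) * norm (g x)" by (rule Cauchy_Schwarz_ineq2)
      also have "\<dots> \<le> 2 * norm (f x) * norm (g x)" by (simp add: mult.assoc)
      also have "\<dots> \<le> (norm (f x))\<^sup>2 + (norm (g x))\<^sup>2" by (rule sum_squares_bound)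
      finally show ?thesis .
    qed
    then show "AE x in lborel. norm ((indicator \<Omega> x *\<^sub>R f x) \<bullet> (indicator \<Omega> x *\<^sub>R g x))
      \<le> norm (indicator \<Omega> x * (norm (f x))\<^sup>2 + indicator \<Omega> x * (norm (g x))\<^sup>2)"
      by (auto simp: indicator_def)
  qed measurable
qed

lemma L2_on_mult_integrable:
  fixes f g :: "'a::euclidean_space \<Rightarrow> real"
  shows "f \<in> L2_on \<Omega> \<Longrightarrow> g \<in> L2_on \<Omega> \<Longrightarrow> set_integrable lborel \<Omega> (\<lambda>x. f x * g x)"
  using L2_on_inner_integrable[of f \<Omega> g] by simp

lemma L2_on_dominated:
  fixes f :: "'a::euclidean_space \<Rightarrow> 'b::euclidean_space" and g :: "'a \<Rightarrow> 'c::euclidean_space"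
  assumes "g \<in> L2_on \<Omega>" "set_borel_measurable lborel \<Omega> f"
    and "\<And>x. x \<in> \<Omega> \<Longrightarrow> norm (f x) \<le> C * norm (g x)"
  shows "f \<in> L2_on \<Omega>"
proof -
  have m[measurable]: "(\<lambda>x. indicator \<Omega> x *\<^sub>R f x) \<in> borel_measurable lborel"
    using assms(2) by (simp add: set_borel_measurable_def)
  have eq: "indicator \<Omega> x * (norm (f x))\<^sup>2 = (norm (indicator \<Omega> x *\<^sub>R f x))\<^sup>2" for x
    by (auto simp: indicator_def)
  have "integrable lborel (\<lambda>x. C\<^sup>2 * (indicator \<Omega> x * (norm (g x))\<^sup>2))"
    using assms by (intro integrable_mult_right) (auto simp: L2_on_iff)
  then have "integrable lborel (\<lambda>x. indicator \<Omega> x * (norm (f x))\<^sup>2)" unfolding eq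
  proof (rule Bochner_Integration.integrable_bound)
    show "AE x in lborel. norm ((norm (indicator \<Omega> x *\<^sub>R f x))\<^sup>2) \<le> norm (C\<^sup>2 * (indicator \<Omega> x * (norm (g x))\<^sup>2))"
      using assms(3) by (auto simp: indicator_def power_mult_distrib[symmetric] intro!: power_mono)
  qed measurable
  then show ?thesis using m by (simp add: L2_on_iff)
qed

lemma L2_on_add:
  fixes f g :: "'a::euclidean_space \<Rightarrow> 'b::euclidean_space"
  assumes f: "f \<in> L2_on \<Omega>" and g: "g \<in> L2_on \<Omega>"
  shows "(\<lambda>x. f x + g x) \<in> L2_on \<Omega>"
proof -
  have "integrable lborel (\<lambda>x. (indicator \<Omega> x * (norm (f x))\<^sup>2 + 2 * (indicator \<Omega> x *\<^sub>R (f x \<bullet> g x))) + indicator \<Omega> x * (norm (g x))\<^sup>2)"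
    using f g L2_on_inner_integrable[OF f g]
    by (intro Bochner_Integration.integrable_add integrable_mult_right) (auto simp: L2_on_iff set_integrable_def)
  moreover have "(indicator \<Omega> x * (norm (f x))\<^sup>2 + 2 * (indicator \<Omega> x *\<^sub>R (f x \<bullet> g x))) + indicator \<Omega> x * (norm (g x))\<^sup>2
    = indicator \<Omega> x * (norm (f x + g x))\<^sup>2" for x
    by (simp add: power2_norm_eq_inner inner_add inner_commute[of "g x" "f x"] algebra_simps)
  moreover have "(\<lambda>x. indicator \<Omega> x *\<^sub>R f x + indicator \<Omega> x *\<^sub>R g x) \<in> borel_measurable lborel"
    using f g by (auto simp: L2_on_iff)
  ultimately show ?thesis by (simp add: L2_on_iff scaleR_add_right)
qed

lemma L2_on_scaleR:
  fixes f :: "'a::euclidean_space \<Rightarrow> 'b::euclidean_space"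
  assumes f: "f \<in> L2_on \<Omega>" shows "(\<lambda>x. c *\<^sub>R f x) \<in> L2_on \<Omega>"
proof (rule L2_on_dominated[OF f, where C = "\<bar>c\<bar>"])
  have m: "(\<lambda>x. indicator \<Omega> x *\<^sub>R f x) \<in> borel_measurable lborel"
    using f by (simp add: L2_on_iff)
  have "(\<lambda>x. indicator \<Omega> x *\<^sub>R c *\<^sub>R f x) = (\<lambda>x. c *\<^sub>R (indicator \<Omega> x *\<^sub>R f x))"
    by (simp add: mult.commute)
  then show "set_borel_measurable lborel \<Omega> (\<lambda>x. c *\<^sub>R f x)"
    unfolding set_borel_measurable_def using borel_measurable_scaleR[OF borel_measurable_const m] by simp
qed simp

lemma L2_on_diff:
  fixes f g :: "'a::euclidean_space \<Rightarrow> 'b::euclidean_space"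
  shows "f \<in> L2_on \<Omega> \<Longrightarrow> g \<in> L2_on \<Omega> \<Longrightarrow> (\<lambda>x. f x - g x) \<in> L2_on \<Omega>"
  using L2_on_add[OF _ L2_on_scaleR, of f \<Omega> g "-1"] by simp

lemma L2_on_zero: "(\<lambda>x. 0) \<in> L2_on \<Omega>"
  by (simp add: L2_on_iff)

lemma L2_on_sum:
  fixes f :: "'i \<Rightarrow> 'a::euclidean_space \<Rightarrow> 'b::euclidean_space"
  shows "(\<And>i. i \<in> I \<Longrightarrow> f i \<in> L2_on \<Omega>) \<Longrightarrow> (\<lambda>x. \<Sum>i\<in>I. f i x) \<in> L2_on \<Omega>"
  by (induction I rule: infinite_finite_induct) (auto intro: L2_on_add L2_on_zero)

lemma L2_on_component:
  fixes G :: "'a::euclidean_space \<Rightarrow> 'b::euclidean_space"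
  assumes G: "G \<in> L2_on \<Omega>" shows "(\<lambda>x. G x \<bullet> b) \<in> L2_on \<Omega>"
proof (rule L2_on_dominated[OF G, where C = "norm b"])
  have "(\<lambda>x. (indicator \<Omega> x *\<^sub>R G x) \<bullet> b) \<in> borel_measurable lborel"
    using G by (intro borel_measurable_inner) (auto simp: L2_on_iff)
  then show "set_borel_measurable lborel \<Omega> (\<lambda>x. G x \<bullet> b)"
    by (simp add: set_borel_measurable_def)
  show "norm (G x \<bullet> b) \<le> norm b * norm (G x)" for x
    using Cauchy_Schwarz_ineq2[of "G x" b] by (simp add: mult.commute)
qed

lemma L2_on_bounded:
  fixes f :: "'a::euclidean_space \<Rightarrow> 'b::euclidean_space"
  assumes "open \<Omega>" "bounded \<Omega>" "set_borel_measurable lborel \<Omega> f" "\<And>x. x \<in> \<Omega> \<Longrightarrow> norm (f x) \<le> C"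
  shows "f \<in> L2_on \<Omega>"
proof (rule L2_on_dominated[where g = "\<lambda>x. 1::real"])
  show "(\<lambda>x. 1::real) \<in> L2_on \<Omega>"
    using assms emeasure_bounded_finite[OF assms(2)] by (auto simp: L2_on_iff)
qed (use assms in auto)

lemma L2_on_set_integrable:
  fixes f :: "'a::euclidean_space \<Rightarrow> 'b::euclidean_space"
  assumes f: "f \<in> L2_on \<Omega>" and \<Omega>: "open \<Omega>" "bounded \<Omega>"
  shows "set_integrable lborel \<Omega> f"
proof -
  have 1: "(\<lambda>x. 1::real) \<in> L2_on \<Omega>"
    by (rule L2_on_bounded[OF \<Omega>, where C = 1]) (use \<Omega> in \<open>auto simp: set_borel_measurable_def\<close>)
  have "(\<lambda>x. norm (f x)) \<in> L2_on \<Omega>"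
  proof (rule L2_on_dominated[OF f, where C = 1])
    have [measurable]: "(\<lambda>x. indicator \<Omega> x *\<^sub>R f x) \<in> borel_measurable lborel"
      using f by (simp add: L2_on_iff)
    have "(\<lambda>x. norm (indicator \<Omega> x *\<^sub>R f x)) \<in> borel_measurable lborel" by measurable
    then show "set_borel_measurable lborel \<Omega> (\<lambda>x. norm (f x))"
      by (simp add: set_borel_measurable_def)
  qed simp
  from L2_on_mult_integrable[OF this 1] have "set_integrable lborel \<Omega> (\<lambda>x. norm (f x))" by simp
  then show ?thesis unfolding set_integrable_def
    by (rule Bochner_Integration.integrable_bound) (use f in \<open>auto simp: L2_on_iff\<close>)
qed

text \<open>The usual discriminant argument, with the degenerate case treated separately because functions are not identified when they agree almost everywhere.\<close>

lemma L2_on_Cauchy_Schwarz: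
  fixes f g :: "'a::euclidean_space \<Rightarrow> real"
  assumes f: "f \<in> L2_on \<Omega>" and g: "g \<in> L2_on \<Omega>"
  shows "(L2_inner \<Omega> f g)\<^sup>2 \<le> L2_inner \<Omega> f f * L2_inner \<Omega> g g"
proof -
  note int = L2_on_mult_integrable[OF f f] L2_on_mult_integrable[OF f g] L2_on_mult_integrable[OF g g]
  have q: "0 \<le> L2_inner \<Omega> f f + 2 * t * L2_inner \<Omega> f g + t\<^sup>2 * L2_inner \<Omega> g g" for t
  proof -
    have "L2_inner \<Omega> f f + 2 * t * L2_inner \<Omega> f g + t\<^sup>2 * L2_inner \<Omega> g g
      = (LINT x:\<Omega>|lborel. f x * f x + (2 * t) * (f x * g x) + t\<^sup>2 * (g x * g x))"
      using int by (simp add: L2_inner_def)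
    also have "\<dots> = (LINT x:\<Omega>|lborel. (f x + t * g x)\<^sup>2)"
      by (simp add: power2_eq_square algebra_simps)
    also have "\<dots> \<ge> 0" unfolding set_lebesgue_integral_def by (intro integral_nonneg_AE) auto
    finally show ?thesis .
  qed
  have gg: "L2_inner \<Omega> g g \<ge> 0" unfolding L2_inner_def set_lebesgue_integral_def by (intro integral_nonneg_AE) auto
  show ?thesis
  proof (cases "L2_inner \<Omega> g g = 0")
    case True
    have "L2_inner \<Omega> f g = 0"
    proof (rule ccontr)
      assume n: "L2_inner \<Omega> f g \<noteq> 0"
      define a where "a = L2_inner \<Omega> f f"
      have "a \<ge> 0" unfolding a_def L2_inner_def set_lebesgue_integral_def by (intro integral_nonneg_AE) auto
      then show False using q[of "- (a + 1) / (2 * L2_inner \<Omega> f g)"] True n by (simp add: a_def[symmetric] field_simps)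
    qed
    then show ?thesis using True by simp
  next
    case False
    then have p: "L2_inner \<Omega> g g > 0" using gg by simp
    let ?a = "L2_inner \<Omega> f f" and ?b = "L2_inner \<Omega> f g" and ?c = "L2_inner \<Omega> g g"
    have "0 \<le> ?c * (?a + 2 * (- ?b / ?c) * ?b + (- ?b / ?c)\<^sup>2 * ?c)"
      using q[of "- ?b / ?c"] p by (intro mult_nonneg_nonneg) auto
    also have "\<dots> = ?a * ?c - ?b\<^sup>2" using p by (simp add: field_simps power2_eq_square)
    finally show ?thesis by simp
  qed
qed

lemma L2_inner_commute: "L2_inner \<Omega> f g = L2_inner \<Omega> g f"
  by (simp add: L2_inner_def mult.commute)

lemma L2_inner_add_left:
  "f \<in> L2_on \<Omega> \<Longrightarrow> g \<in> L2_on \<Omega> \<Longrightarrow> h \<in> L2_on \<Omega> \<Longrightarrow> L2_inner \<Omega> (\<lambda>x. f x + g x) h = L2_inner \<Omega> f h + L2_inner \<Omega> g h"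
  using L2_on_mult_integrable[of f \<Omega> h] L2_on_mult_integrable[of g \<Omega> h] by (simp add: L2_inner_def distrib_right)

lemma L2_inner_diff_left:
  "f \<in> L2_on \<Omega> \<Longrightarrow> g \<in> L2_on \<Omega> \<Longrightarrow> h \<in> L2_on \<Omega> \<Longrightarrow> L2_inner \<Omega> (\<lambda>x. f x - g x) h = L2_inner \<Omega> f h - L2_inner \<Omega> g h"
  using L2_on_mult_integrable[of f \<Omega> h] L2_on_mult_integrable[of g \<Omega> h] by (simp add: L2_inner_def left_diff_distrib)

lemma L2_inner_mult_left: "L2_inner \<Omega> (\<lambda>x. c * f x) h = c * L2_inner \<Omega> f h"
  by (simp add: L2_inner_def mult.assoc)

lemma L2_inner_sum_left:
  fixes f :: "'i \<Rightarrow> 'a::euclidean_space \<Rightarrow> real"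
  assumes h: "h \<in> L2_on \<Omega>"
  shows "(\<And>i. i \<in> I \<Longrightarrow> f i \<in> L2_on \<Omega>) \<Longrightarrow> L2_inner \<Omega> (\<lambda>x. \<Sum>i\<in>I. f i x) h = (\<Sum>i\<in>I. L2_inner \<Omega> (f i) h)"
proof (induction I rule: infinite_finite_induct)
  case (insert i I)
  then show ?case using L2_inner_add_left[of "f i" \<Omega> "\<lambda>x. \<Sum>i\<in>I. f i x" h] h by (simp add: L2_on_sum)
qed (simp_all add: L2_inner_def)

lemma integral_nonpos:
  fixes f :: "'b \<Rightarrow> real"
  assumes "\<And>x. f x \<le> 0" shows "integral\<^sup>L M f \<le> 0"
  using integral_nonneg_AE[where M = M and f = "\<lambda>x. - f x"] assms by simp

lemma L2_inner_self_nonneg: "0 \<le> L2_inner \<Omega> f f"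
  unfolding L2_inner_def set_lebesgue_integral_def by (intro integral_nonneg_AE) auto

section \<open>Mollification\<close>

lemma integral_tendsto_of_L1:
  fixes f :: "'a \<Rightarrow> real"
  assumes "\<And>n. integrable M (u n)" "integrable M f" "(\<lambda>n. LINT x|M. \<bar>u n x - f x\<bar>) \<longlonglongrightarrow> 0"
  shows "(\<lambda>n. LINT x|M. u n x) \<longlonglongrightarrow> (LINT x|M. f x)"
proof -
  have "(\<lambda>n. (LINT x|M. u n x) - (LINT x|M. f x)) \<longlonglongrightarrow> 0"
  proof (rule Lim_null_comparison[OF _ assms(3)], intro always_eventually allI)
    fix n
    show "norm ((LINT x|M. u n x) - (LINT x|M. f x)) \<le> (LINT x|M. \<bar>u n x - f x\<bar>)"
      using assms integral_abs_bound[of M "\<lambda>x. u n x - f x"] by simp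
  qed
  then show ?thesis by (simp add: LIM_zero_iff)
qed

text \<open>The indicator of an open set is lower semicontinuous, so the overlap of \<open>U\<close> with its translate
  tends to the whole measure of \<open>U\<close> by dominated convergence.\<close>

lemma L1_translation_tendsto_open:
  fixes U :: "'a::euclidean_space set"
  assumes U: "open U" "emeasure lborel U < \<infinity>" and y: "y \<longlonglongrightarrow> 0"
  shows "(\<lambda>n::nat. LINT x|lborel. \<bar>indicator U (x - y n) - indicator U x :: real\<bar>) \<longlonglongrightarrow> 0"
proof -
  have [measurable]: "U \<in> sets borel" using U by simp
  have i: "integrable lborel (indicator U :: 'a \<Rightarrow> real)" using U by (intro integrable_real_indicator) auto
  have it: "integrable lborel (\<lambda>x. indicator U (x - y n) :: real)" for n
    using lborel_integral_translate(2)[of "indicator U :: 'a \<Rightarrow> real" "- y n"] i by simp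
  have it1: "(LINT x|lborel. indicator U (x - y n) :: real) = measure lborel U" for n
    using lborel_integral_translate(1)[of "indicator U :: 'a \<Rightarrow> real" "- y n"] by simp
  have ip: "integrable lborel (\<lambda>x. indicator U (x - y n) * indicator U x :: real)" for n
    by (rule Bochner_Integration.integrable_bound[OF i]) (auto simp: indicator_def)
  have "(\<lambda>n. LINT x|lborel. indicator U (x - y n) * indicator U x :: real) \<longlonglongrightarrow> (LINT x|lborel. indicator U x)"
  proof (rule integral_dominated_convergence[OF _ _ i])
    show "AE x in lborel. (\<lambda>n. indicator U (x - y n) * indicator U x) \<longlonglongrightarrow> (indicator U x :: real)"
    proof (rule AE_I2)
      fix x
      show "(\<lambda>n. indicator U (x - y n) * indicator U x) \<longlonglongrightarrow> (indicator U x :: real)"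
      proof (cases "x \<in> U")
        case True
        have "(\<lambda>n. x - y n) \<longlonglongrightarrow> x" using tendsto_diff[OF tendsto_const y] by simp
        then have "\<forall>\<^sub>F n in sequentially. x - y n \<in> U" using U True topological_tendstoD by blast
        then have "\<forall>\<^sub>F n in sequentially. indicator U (x - y n) * indicator U x = (indicator U x :: real)"
          by eventually_elim (use True in auto)
        then show ?thesis by (rule tendsto_eventually)
      qed simp
    qed
  qed (auto simp: indicator_def)
  then have "(\<lambda>n. 2 * measure lborel U - 2 * (LINT x|lborel. indicator U (x - y n) * indicator U x :: real)) \<longlonglongrightarrow>
      2 * measure lborel U - 2 * measure lborel U"
    by (intro tendsto_intros) simp
  moreover have "(LINT x|lborel. \<bar>indicator U (x - y n) - indicator U x :: real\<bar>)
      = 2 * measure lborel U - 2 * (LINT x|lborel. indicator U (x - y n) * indicator U x :: real)" for n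
  proof -
    have "\<bar>indicator U (x - y n) - indicator U x :: real\<bar> = (indicator U (x - y n) + indicator U x)
       - 2 * (indicator U (x - y n) * indicator U x)" for x
      by (auto simp: indicator_def)
    then have "(LINT x|lborel. \<bar>indicator U (x - y n) - indicator U x :: real\<bar>) =
      (LINT x|lborel. (indicator U (x - y n) + indicator U x) - 2 * (indicator U (x - y n) * indicator U x))"
      by presburger
    also have "\<dots> = (LINT x|lborel. indicator U (x - y n) + indicator U x) - (LINT x|lborel. 2 * (indicator U (x - y n) * indicator U x))"
      by (intro Bochner_Integration.integral_diff Bochner_Integration.integrable_add it i integrable_mult_right ip)
    also have "(LINT x|lborel. indicator U (x - y n) + indicator U x) = 2 * measure lborel U"
      by (subst Bochner_Integration.integral_add[OF it i]) (simp add: it1)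
    finally show ?thesis by simp
  qed
  ultimately show ?thesis by simp
qed

text \<open>Translation is an isometry of \<open>L\<^sup>1\<close>, so continuity of translation passes to \<open>L\<^sup>1\<close> limits.\<close>

lemma L1_translation_approx:
  fixes f g :: "'a::euclidean_space \<Rightarrow> real"
  assumes f: "integrable lborel f" and g: "integrable lborel g"
  shows "(LINT x|lborel. \<bar>f (x - y) - f x\<bar>) \<le> (LINT x|lborel. \<bar>g (x - y) - g x\<bar>) + 2 * (LINT x|lborel. \<bar>f x - g x\<bar>)"
proof -
  have [measurable]: "f \<in> borel_measurable borel" "g \<in> borel_measurable borel" using f g by auto
  have it: "integrable lborel (\<lambda>x. h (x - y))" if "integrable lborel h" for h :: "'a \<Rightarrow> real"
    using lborel_integral_translate(2)[of h "- y"] that by auto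
  have i1: "integrable lborel (\<lambda>x. \<bar>f (x - y) - f x\<bar>)" using it[OF f] f by auto
  have i2: "integrable lborel (\<lambda>x. \<bar>g (x - y) - g x\<bar>)" using it[OF g] g by auto
  have i3: "integrable lborel (\<lambda>x. \<bar>f x - g x\<bar>)" using f g by auto
  have i4: "integrable lborel (\<lambda>x. \<bar>f (x - y) - g (x - y)\<bar>)" using it[OF i3] by simp
  have e4: "(LINT x|lborel. \<bar>f (x - y) - g (x - y)\<bar>) = (LINT x|lborel. \<bar>f x - g x\<bar>)"
    using lborel_integral_translate(1)[of "\<lambda>x. \<bar>f x - g x\<bar>" "- y"] by simp
  have "(LINT x|lborel. \<bar>f (x - y) - f x\<bar>) \<le> (LINT x|lborel. (\<bar>g (x - y) - g x\<bar> + \<bar>f (x - y) - g (x - y)\<bar>) + \<bar>f x - g x\<bar>)"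
    by (rule integral_mono[OF i1]) (use i2 i3 i4 in auto)
  also have "\<dots> = (LINT x|lborel. \<bar>g (x - y) - g x\<bar>) + 2 * (LINT x|lborel. \<bar>f x - g x\<bar>)"
    by (subst Bochner_Integration.integral_add[OF Bochner_Integration.integrable_add[OF i2 i4] i3],
        subst Bochner_Integration.integral_add[OF i2 i4]) (simp add: e4)
  finally show ?thesis .
qed

text \<open>By outer regularity, indicators of open sets generate all integrable functions under \<open>L\<^sup>1\<close> limits.\<close>

lemma L1_translation_tendsto:
  fixes f :: "'a::euclidean_space \<Rightarrow> real"
  assumes "integrable lborel f"
  shows "\<forall>y::nat \<Rightarrow> 'a. y \<longlonglongrightarrow> 0 \<longrightarrow> (\<lambda>n. LINT x|lborel. \<bar>f (x - y n) - f x\<bar>) \<longlonglongrightarrow> 0"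
proof -
  define P where "P f \<longleftrightarrow> (\<forall>y::nat \<Rightarrow> 'a. y \<longlonglongrightarrow> 0 \<longrightarrow> (\<lambda>n. LINT x|lborel. \<bar>f (x - y n) - f x\<bar>) \<longlonglongrightarrow> 0)"
    for f :: "'a \<Rightarrow> real"
  have approx: "P f" if f: "integrable lborel f"
    and g: "\<And>e. e > 0 \<Longrightarrow> \<exists>g. integrable lborel g \<and> P g \<and> (LINT x|lborel. \<bar>f x - g x\<bar>) < e" for f
    unfolding P_def
  proof (intro allI impI)
    fix y :: "nat \<Rightarrow> 'a" assume y: "y \<longlonglongrightarrow> 0"
    show "(\<lambda>n. LINT x|lborel. \<bar>f (x - y n) - f x\<bar>) \<longlonglongrightarrow> 0"
    proof (rule LIMSEQ_I)
      fix e :: real assume "e > 0"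
      then obtain g where g: "integrable lborel g" "P g" "(LINT x|lborel. \<bar>f x - g x\<bar>) < e / 4"
        using g[of "e/4"] by auto
      have "(\<lambda>n. LINT x|lborel. \<bar>g (x - y n) - g x\<bar>) \<longlonglongrightarrow> 0" using g(2) y by (simp add: P_def)
      from LIMSEQ_D[OF this, of "e/2"] \<open>e > 0\<close> obtain N where
        N: "\<And>n. n \<ge> N \<Longrightarrow> norm ((LINT x|lborel. \<bar>g (x - y n) - g x\<bar>) - 0) < e/2" by auto
      have "norm ((LINT x|lborel. \<bar>f (x - y n) - f x\<bar>) - 0) < e" if "n \<ge> N" for n
      proof -
        have "0 \<le> (LINT x|lborel. \<bar>f (x - y n) - f x\<bar>)" by (intro integral_nonneg_AE) auto
        moreover have "(LINT x|lborel. \<bar>g (x - y n) - g x\<bar>) < e/2" using N[OF that] by auto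
        ultimately show ?thesis using L1_translation_approx[OF f g(1), of "y n"] g(3) by simp
      qed
      then show "\<exists>N. \<forall>n\<ge>N. norm ((LINT x|lborel. \<bar>f (x - y n) - f x\<bar>) - 0) < e" by blast
    qed
  qed
  have "P f" using assms
  proof (induction rule: integrable_induct)
    case (base A c)
    then have [measurable]: "A \<in> sets borel" by simp
    have iA: "integrable lborel (indicator A :: 'a \<Rightarrow> real)" using base by (intro integrable_real_indicator) auto
    have "P (\<lambda>x. c * indicator A x)"
    proof (rule approx)
      show "integrable lborel (\<lambda>x. c * indicator A x)" using iA by simp
      fix e :: real assume e: "e > 0"
      obtain U where U: "open U" "A \<subseteq> U" "emeasure lborel (U - A) < e / (\<bar>c\<bar> + 1)"
        using outer_regular_lborel[of A "e / (\<bar>c\<bar> + 1)"] e by auto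
      have [measurable]: "U \<in> sets borel" using U by simp
      have "emeasure lborel U = emeasure lborel A + emeasure lborel (U - A)"
        using U by (subst plus_emeasure) (auto simp: Un_absorb1)
      also have "\<dots> < \<infinity>" using base U(3) by (auto simp: less_top[symmetric])
      finally have fU: "emeasure lborel U < \<infinity>" .
      have iU: "integrable lborel (indicator U :: 'a \<Rightarrow> real)" using fU by (intro integrable_real_indicator) auto
      have "P (\<lambda>x. c * indicator U x)" unfolding P_def
      proof (intro allI impI)
        fix y :: "nat \<Rightarrow> 'a" assume y: "y \<longlonglongrightarrow> 0"
        have "(\<lambda>n. \<bar>c\<bar> * (LINT x|lborel. \<bar>indicator U (x - y n) - indicator U x\<bar>)) \<longlonglongrightarrow> \<bar>c\<bar> * 0"
          by (intro tendsto_mult_left L1_translation_tendsto_open U fU y)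
        then show "(\<lambda>n. LINT x|lborel. \<bar>c * indicator U (x - y n) - c * indicator U x\<bar>) \<longlonglongrightarrow> 0"
          by (simp add: right_diff_distrib[symmetric] abs_mult)
      qed
      moreover have "(LINT x|lborel. \<bar>c * indicator A x - c * indicator U x\<bar>) < e"
      proof -
        have "\<bar>c * indicator A x - c * indicator U x\<bar> = \<bar>c\<bar> * indicator (U - A) x" for x
          using U(2) by (auto simp: indicator_def)
        then have "(LINT x|lborel. \<bar>c * indicator A x - c * indicator U x\<bar>) = \<bar>c\<bar> * measure lborel (U - A)"
          by simp
        also have "measure lborel (U - A) \<le> e / (\<bar>c\<bar> + 1)"
          unfolding measure_def using U(3) e by (intro enn2real_leI) (auto simp: less_imp_le)
        then have "\<bar>c\<bar> * measure lborel (U - A) \<le> \<bar>c\<bar> * (e / (\<bar>c\<bar> + 1))" by (intro mult_left_mono) auto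
        also have "\<dots> < e" using e by (simp add: field_simps)
        finally show ?thesis .
      qed
      ultimately show "\<exists>g. integrable lborel g \<and> P g \<and> (LINT x|lborel. \<bar>c * indicator A x - g x\<bar>) < e"
        using iU by (intro exI[of _ "\<lambda>x. c * indicator U x"]) simp
    qed
    then show ?case by (simp add: mult.commute)
  next
    case (add f g)
    show ?case unfolding P_def
    proof (intro allI impI)
      fix y :: "nat \<Rightarrow> 'a" assume y: "y \<longlonglongrightarrow> 0"
      have it: "integrable lborel (\<lambda>x. h (x - z))" if "integrable lborel h" for h :: "'a \<Rightarrow> real" and z
        using lborel_integral_translate(2)[of h "- z"] that by auto
      have "(\<lambda>n. (LINT x|lborel. \<bar>f (x - y n) - f x\<bar>) + (LINT x|lborel. \<bar>g (x - y n) - g x\<bar>)) \<longlonglongrightarrow> 0 + 0"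
        using add y by (intro tendsto_add) (auto simp: P_def)
      then show "(\<lambda>n. LINT x|lborel. \<bar>(f (x - y n) + g (x - y n)) - (f x + g x)\<bar>) \<longlonglongrightarrow> 0"
      proof (rule Lim_null_comparison[rotated, OF tendsto_eq_rhs], simp, intro always_eventually allI)
        fix n
        have "norm (LINT x|lborel. \<bar>(f (x - y n) + g (x - y n)) - (f x + g x)\<bar>) = (LINT x|lborel. \<bar>(f (x - y n) + g (x - y n)) - (f x + g x)\<bar>)"
          by (simp add: integral_nonneg_AE)
        also have "\<dots> \<le> (LINT x|lborel. \<bar>f (x - y n) - f x\<bar> + \<bar>g (x - y n) - g x\<bar>)"
          by (rule integral_mono) (use it add in auto)
        also have "\<dots> = (LINT x|lborel. \<bar>f (x - y n) - f x\<bar>) + (LINT x|lborel. \<bar>g (x - y n) - g x\<bar>)"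
          by (rule Bochner_Integration.integral_add) (use it add in auto)
        finally show "norm (LINT x|lborel. \<bar>(f (x - y n) + g (x - y n)) - (f x + g x)\<bar>) \<le> \<dots>" .
      qed
    qed
  next
    case (lim f s)
    have fi: "integrable lborel f" and si: "\<And>i. integrable lborel (s i)" and Ps: "\<And>i. P (s i)"
      and conv: "\<And>x. (\<lambda>i. s i x) \<longlonglongrightarrow> f x" and bd: "\<And>i x. norm (s i x) \<le> 2 * norm (f x)"
      using lim by auto
    show ?case
    proof (rule approx[OF fi])
      fix e :: real assume e: "e > 0"
      have [measurable]: "f \<in> borel_measurable lborel" "\<And>i. s i \<in> borel_measurable lborel" using fi si by auto
      have "(\<lambda>i. LINT x|lborel. \<bar>f x - s i x\<bar>) \<longlonglongrightarrow> integral\<^sup>L (lborel::'a measure) (\<lambda>_. 0::real)"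
      proof (rule integral_dominated_convergence[where f = "\<lambda>_. 0::real" and s = "\<lambda>i x. \<bar>f x - s i x\<bar>"
            and w = "\<lambda>x. 3 * \<bar>f x\<bar>"])
        show "integrable lborel (\<lambda>x. 3 * \<bar>f x\<bar>)" using fi by auto
        show "AE x in lborel. (\<lambda>i. \<bar>f x - s i x\<bar>) \<longlonglongrightarrow> 0"
        proof (rule AE_I2)
          fix x
          have "(\<lambda>i. \<bar>f x - s i x\<bar>) \<longlonglongrightarrow> \<bar>f x - f x\<bar>" by (intro tendsto_intros conv)
          then show "(\<lambda>i. \<bar>f x - s i x\<bar>) \<longlonglongrightarrow> 0" by simp
        qed
        show "AE x in lborel. norm \<bar>f x - s i x\<bar> \<le> 3 * \<bar>f x\<bar>" for i
        proof (rule AE_I2)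
          fix x
          show "norm \<bar>f x - s i x\<bar> \<le> 3 * \<bar>f x\<bar>" using bd[of i x] by simp
        qed
      qed auto
      from LIMSEQ_D[OF this e] obtain N where "norm ((LINT x|lborel. \<bar>f x - s N x\<bar>) - integral\<^sup>L (lborel::'a measure) (\<lambda>_. 0::real)) < e" by blast
      then have "(LINT x|lborel. \<bar>f x - s N x\<bar>) < e" by simp
      then show "\<exists>g. integrable lborel g \<and> P g \<and> (LINT x|lborel. \<bar>f x - g x\<bar>) < e"
        using si Ps by blast
    qed
  qed
  then show ?thesis by (simp add: P_def)
qed

locale mollifiers =
  fixes \<rho> :: "real \<Rightarrow> 'a::euclidean_space \<Rightarrow> real"
  assumes smooth_mollifier: "\<delta> > 0 \<Longrightarrow> smooth (\<rho> \<delta>)"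
    and mollifier_nonneg: "\<delta> > 0 \<Longrightarrow> 0 \<le> \<rho> \<delta> x"
    and mollifier_support: "\<delta> > 0 \<Longrightarrow> \<rho> \<delta> x \<noteq> 0 \<Longrightarrow> norm x \<le> \<delta>"
    and mollifier_integral: "\<delta> > 0 \<Longrightarrow> (LINT x|lborel. \<rho> \<delta> x) = 1"
begin

lemma Ck_mollifier: "\<delta> > 0 \<Longrightarrow> Ck k (\<rho> \<delta>)"
  using smooth_mollifier by (auto simp: smooth_def)

lemma continuous_mollifier: "\<delta> > 0 \<Longrightarrow> continuous_on UNIV (\<rho> \<delta>)"
  using Ck_mollifier Ck_imp_continuous by blast

lemma bounded_support_mollifier: "\<delta> > 0 \<Longrightarrow> bounded {x. \<rho> \<delta> x \<noteq> 0}"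
  using mollifier_support by (auto simp: bounded_iff)

lemma integrable_mollifier: "\<delta> > 0 \<Longrightarrow> integrable lborel (\<rho> \<delta>)"
  by (rule continuous_compact_support_integrable[OF continuous_mollifier bounded_support_mollifier])

lemma convolve_mollifier_eq:
  assumes "integrable lborel f" "\<delta> > 0"
  shows "convolve f (\<rho> \<delta>) x = (LINT z|lborel. f (x - z) * \<rho> \<delta> z)"
    and "integrable lborel (\<lambda>z. f (x - z) * \<rho> \<delta> z)"
proof -
  have [measurable]: "f \<in> borel_measurable borel" using assms by auto
  have [measurable]: "\<rho> \<delta> \<in> borel_measurable borel"
    using assms(2) by (intro borel_measurable_continuous_onI continuous_mollifier)
  show "convolve f (\<rho> \<delta>) x = (LINT z|lborel. f (x - z) * \<rho> \<delta> z)"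
    using lborel_integral_reflect(1)[of "\<lambda>y. f y * \<rho> \<delta> (x - y)" x] by (simp add: convolve_def)
  show "integrable lborel (\<lambda>z. f (x - z) * \<rho> \<delta> z)"
    using lborel_integral_reflect(2)[of "\<lambda>y. f y * \<rho> \<delta> (x - y)" x]
      integrable_convolve_integrand[OF assms(1) continuous_mollifier bounded_support_mollifier] assms(2) by simp
qed

text \<open>Since \<open>\<rho> \<delta>\<close> has mass one, the error is an average of \<open>f (x - z) - f x\<close> over \<open>norm z \<le> \<delta>\<close>; integrating in \<open>x\<close> first leaves an average of translation errors.\<close>

lemma nn_integral_mollify_error_le:
  assumes f: "integrable lborel f" and d: "\<delta> > 0" and c: "c \<ge> 0"
    and small: "\<And>z. norm z \<le> \<delta> \<Longrightarrow> (LINT x|lborel. \<bar>f (x - z) - f x\<bar>) \<le> c"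
  shows "(\<integral>\<^sup>+x. ennreal \<bar>convolve f (\<rho> \<delta>) x - f x\<bar> \<partial>lborel) \<le> ennreal c"
proof -
  have [measurable]: "f \<in> borel_measurable borel" using f by auto
  have [measurable]: "\<rho> \<delta> \<in> borel_measurable borel"
    using d by (intro borel_measurable_continuous_onI continuous_mollifier)
  have it: "integrable lborel (\<lambda>x. f (x - z))" for z
    using lborel_integral_translate(2)[of f "- z"] f by auto
  have "ennreal \<bar>convolve f (\<rho> \<delta>) x - f x\<bar> \<le> (\<integral>\<^sup>+z. ennreal (\<bar>f (x - z) - f x\<bar> * \<rho> \<delta> z) \<partial>lborel)" for x
  proof -
    have i2: "integrable lborel (\<lambda>z. f x * \<rho> \<delta> z)" using integrable_mollifier[OF d] by simp
    have "convolve f (\<rho> \<delta>) x - f x = (LINT z|lborel. f (x - z) * \<rho> \<delta> z) - (LINT z|lborel. f x * \<rho> \<delta> z)"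
      using convolve_mollifier_eq(1)[OF f d] mollifier_integral[OF d] by simp
    also have "\<dots> = (LINT z|lborel. f (x - z) * \<rho> \<delta> z - f x * \<rho> \<delta> z)"
      by (rule Bochner_Integration.integral_diff[symmetric, OF convolve_mollifier_eq(2)[OF f d] i2])
    also have "\<bar>\<dots>\<bar> \<le> (LINT z|lborel. \<bar>f (x - z) - f x\<bar> * \<rho> \<delta> z)"
      using integral_abs_bound[of lborel "\<lambda>z. f (x - z) * \<rho> \<delta> z - f x * \<rho> \<delta> z"] mollifier_nonneg[OF d]
      by (simp add: left_diff_distrib[symmetric] abs_mult)
    finally have "ennreal \<bar>convolve f (\<rho> \<delta>) x - f x\<bar> \<le> ennreal (LINT z|lborel. \<bar>f (x - z) - f x\<bar> * \<rho> \<delta> z)"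
      by (rule ennreal_leI)
    also have "\<dots> = (\<integral>\<^sup>+z. ennreal (\<bar>f (x - z) - f x\<bar> * \<rho> \<delta> z) \<partial>lborel)"
    proof (rule nn_integral_eq_integral[symmetric])
      have "integrable lborel (\<lambda>z. \<bar>f (x - z) * \<rho> \<delta> z - f x * \<rho> \<delta> z\<bar>)"
        by (intro integrable_abs Bochner_Integration.integrable_diff convolve_mollifier_eq(2)[OF f d] i2)
      then show "integrable lborel (\<lambda>z. \<bar>f (x - z) - f x\<bar> * \<rho> \<delta> z)"
        using mollifier_nonneg[OF d] by (simp add: left_diff_distrib[symmetric] abs_mult)
    qed (use mollifier_nonneg[OF d] in auto)
    finally show ?thesis .
  qed
  then have "(\<integral>\<^sup>+x. ennreal \<bar>convolve f (\<rho> \<delta>) x - f x\<bar> \<partial>lborel)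
     \<le> (\<integral>\<^sup>+x. \<integral>\<^sup>+z. ennreal (\<bar>f (x - z) - f x\<bar> * \<rho> \<delta> z) \<partial>lborel \<partial>lborel)"
    by (intro nn_integral_mono)
  also have "\<dots> = (\<integral>\<^sup>+z. \<integral>\<^sup>+x. ennreal (\<bar>f (x - z) - f x\<bar> * \<rho> \<delta> z) \<partial>lborel \<partial>lborel)"
    by (rule lborel_pair.Fubini') measurable
  also have "\<dots> \<le> (\<integral>\<^sup>+z. ennreal (c * \<rho> \<delta> z) \<partial>lborel)"
  proof (rule nn_integral_mono)
    fix z
    have "(\<integral>\<^sup>+x. ennreal (\<bar>f (x - z) - f x\<bar> * \<rho> \<delta> z) \<partial>lborel) = ennreal ((LINT x|lborel. \<bar>f (x - z) - f x\<bar>) * \<rho> \<delta> z)"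
      using it[of z] f mollifier_nonneg[OF d] by (subst nn_integral_eq_integral) auto
    also have "\<dots> \<le> ennreal (c * \<rho> \<delta> z)"
      using small[of z] mollifier_support[OF d, of z] mollifier_nonneg[OF d, of z]
      by (cases "\<rho> \<delta> z = 0") (auto intro!: ennreal_leI mult_right_mono)
    finally show "(\<integral>\<^sup>+x. ennreal (\<bar>f (x - z) - f x\<bar> * \<rho> \<delta> z) \<partial>lborel) \<le> ennreal (c * \<rho> \<delta> z)" .
  qed
  also have "\<dots> = ennreal (LINT z|lborel. c * \<rho> \<delta> z)"
    using integrable_mollifier[OF d] mollifier_nonneg[OF d] c by (intro nn_integral_eq_integral) auto
  also have "\<dots> = ennreal c" using mollifier_integral[OF d] by simp
  finally show ?thesis .
qed

lemma integrable_mollify: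
  assumes f: "integrable lborel f" and d: "\<delta> > 0"
  shows "integrable lborel (convolve f (\<rho> \<delta>))"
proof -
  have [measurable]: "f \<in> borel_measurable borel" using f by auto
  have it: "integrable lborel (\<lambda>x. f (x - z))" for z
    using lborel_integral_translate(2)[of f "- z"] f by auto
  have m: "convolve f (\<rho> \<delta>) \<in> borel_measurable lborel"
    using continuous_convolve[OF f continuous_mollifier bounded_support_mollifier] d
    by (simp add: borel_measurable_continuous_onI)
  have "(LINT x|lborel. \<bar>f (x - z) - f x\<bar>) \<le> 2 * (LINT x|lborel. \<bar>f x\<bar>)" for z
    using L1_translation_approx[OF f, of "\<lambda>_. 0" z] by simp
  then have "(\<integral>\<^sup>+x. ennreal \<bar>convolve f (\<rho> \<delta>) x - f x\<bar> \<partial>lborel) \<le> ennreal (2 * (LINT x|lborel. \<bar>f x\<bar>))"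
    by (intro nn_integral_mollify_error_le[OF f d]) (auto simp: integral_nonneg_AE)
  also have "\<dots> < \<infinity>" by simp
  finally have "integrable lborel (\<lambda>x. convolve f (\<rho> \<delta>) x - f x)"
    using m by (intro integrableI_bounded) auto
  from Bochner_Integration.integrable_add[OF this f] show ?thesis by simp
qed

lemma mollify_tendsto_L1:
  assumes f: "integrable lborel f" and d: "\<And>n. \<delta> n > 0" "\<delta> \<longlonglongrightarrow> 0"
  shows "(\<lambda>n. LINT x|lborel. \<bar>convolve f (\<rho> (\<delta> n)) x - f x\<bar>) \<longlonglongrightarrow> 0"
proof (rule LIMSEQ_I)
  fix e :: real assume e: "e > 0"
  have "((\<lambda>y. LINT x|lborel. \<bar>f (x - y) - f x\<bar>) \<longlongrightarrow> 0) (at 0)"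
    using L1_translation_tendsto[OF f] by (auto simp: tendsto_at_iff_sequentially comp_def)
  from LIM_D[OF this, of "e/2"] e obtain r where r: "r > 0"
    "\<And>y. y \<noteq> 0 \<Longrightarrow> norm y < r \<Longrightarrow> \<bar>LINT x|lborel. \<bar>f (x - y) - f x\<bar>\<bar> < e/2" by auto
  have small: "(LINT x|lborel. \<bar>f (x - y) - f x\<bar>) \<le> e/2" if "norm y < r" for y
    using r(2)[of y] that e by (cases "y = 0") auto
  obtain N where N: "\<And>n. n \<ge> N \<Longrightarrow> \<delta> n < r"
    using LIMSEQ_D[OF d(2) r(1)] by (metis abs_ge_self diff_zero le_less_trans real_norm_def)
  have "norm ((LINT x|lborel. \<bar>convolve f (\<rho> (\<delta> n)) x - f x\<bar>) - 0) < e" if n: "n \<ge> N" for n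
  proof -
    have i: "integrable lborel (\<lambda>x. \<bar>convolve f (\<rho> (\<delta> n)) x - f x\<bar>)"
      using integrable_mollify[OF f d(1)] f by auto
    have "ennreal (LINT x|lborel. \<bar>convolve f (\<rho> (\<delta> n)) x - f x\<bar>) = (\<integral>\<^sup>+x. ennreal \<bar>convolve f (\<rho> (\<delta> n)) x - f x\<bar> \<partial>lborel)"
      using i by (intro nn_integral_eq_integral[symmetric]) auto
    also have "\<dots> \<le> ennreal (e/2)"
      using small N[OF n] e by (intro nn_integral_mollify_error_le[OF f d(1)]) auto
    finally have "(LINT x|lborel. \<bar>convolve f (\<rho> (\<delta> n)) x - f x\<bar>) \<le> e/2"
      using e by (simp add: ennreal_le_iff)
    then show ?thesis using e by (simp add: integral_nonneg_AE)
  qed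
  then show "\<exists>N. \<forall>n\<ge>N. norm ((LINT x|lborel. \<bar>convolve f (\<rho> (\<delta> n)) x - f x\<bar>) - 0) < e" by blast
qed

end

section \<open>The Sobolev space and its chain rule\<close>

lemma test_function_Ck: "test_function \<Omega> \<phi> \<Longrightarrow> Ck k \<phi>"
  by (simp add: test_function_def smooth_def)

lemma test_function_continuous: "test_function \<Omega> \<phi> \<Longrightarrow> continuous_on UNIV \<phi>"
  using test_function_Ck Ck_imp_continuous by blast

lemma test_function_differentiable: "test_function \<Omega> \<phi> \<Longrightarrow> \<phi> differentiable at x"
  using test_function_Ck[of \<Omega> \<phi> "Suc 0"] by simp

lemma test_function_bounded_support: "test_function \<Omega> \<phi> \<Longrightarrow> bounded {x. \<phi> x \<noteq> 0}"
  unfolding test_function_def using closure_subset bounded_subset compact_imp_bounded by metis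

lemma test_function_outside: "test_function \<Omega> \<phi> \<Longrightarrow> x \<notin> \<Omega> \<Longrightarrow> \<phi> x = 0"
  unfolding test_function_def using closure_subset[of "{x. \<phi> x \<noteq> 0}"] by blast

lemma test_function_bounded:
  assumes "test_function \<Omega> \<phi>" obtains B where "\<And>x. \<bar>\<phi> x\<bar> \<le> B" "B \<ge> 0"
  using continuous_compact_support_bounded[OF test_function_continuous test_function_bounded_support] assms by blast

lemma test_function_integrable: "test_function \<Omega> \<phi> \<Longrightarrow> integrable lborel \<phi>"
  by (rule continuous_compact_support_integrable[OF test_function_continuous test_function_bounded_support])

lemma test_function_measurable: "test_function \<Omega> \<phi> \<Longrightarrow> \<phi> \<in> borel_measurable borel"
  using test_function_continuous borel_measurable_continuous_onI by blast

lemma test_function_L2: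
  assumes "open \<Omega>" "bounded \<Omega>" "test_function \<Omega> \<phi>"
  shows "\<phi> \<in> L2_on \<Omega>"
proof -
  obtain B where B: "\<And>x. \<bar>\<phi> x\<bar> \<le> B" using test_function_bounded[OF assms(3)] by blast
  have [measurable]: "\<phi> \<in> borel_measurable borel" by (rule test_function_measurable[OF assms(3)])
  show ?thesis
    by (rule L2_on_bounded[OF assms(1,2), where C = B]) (use B assms(1) in \<open>auto simp: set_borel_measurable_def\<close>)
qed

lemma H1_pair_add:
  assumes \<Omega>: "open \<Omega>" "bounded \<Omega>" and u: "H1_pair \<Omega> u G" and v: "H1_pair \<Omega> v H"
  shows "H1_pair \<Omega> (\<lambda>x. u x + v x) (\<lambda>x. G x + H x)"
proof -
  have L2: "u \<in> L2_on \<Omega>" "G \<in> L2_on \<Omega>" "v \<in> L2_on \<Omega>" "H \<in> L2_on \<Omega>" using u v by (auto simp: H1_pair_def)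
  have "weak_gradient \<Omega> (\<lambda>x. u x + v x) (\<lambda>x. G x + H x)"
    unfolding weak_gradient_def
  proof (intro allI impI ballI)
    fix \<phi> and b :: 'a assume t: "test_function \<Omega> \<phi>" and b: "b \<in> Basis"
    have t2: "\<phi> \<in> L2_on \<Omega>" "partial_deriv b \<phi> \<in> L2_on \<Omega>"
      using test_function_L2[OF \<Omega>] t test_function_partial_deriv[OF t b] by auto
    have "(LINT x:\<Omega>|lborel. u x * partial_deriv b \<phi> x) = - (LINT x:\<Omega>|lborel. (G x \<bullet> b) * \<phi> x)"
      "(LINT x:\<Omega>|lborel. v x * partial_deriv b \<phi> x) = - (LINT x:\<Omega>|lborel. (H x \<bullet> b) * \<phi> x)"
      using u v t b by (auto simp: H1_pair_def weak_gradient_def)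
    then show "(LINT x:\<Omega>|lborel. (u x + v x) * partial_deriv b \<phi> x) = - (LINT x:\<Omega>|lborel. ((G x + H x) \<bullet> b) * \<phi> x)"
      using L2_on_mult_integrable[OF L2(1) t2(2)] L2_on_mult_integrable[OF L2(3) t2(2)]
        L2_on_mult_integrable[OF L2_on_component[OF L2(2)] t2(1)] L2_on_mult_integrable[OF L2_on_component[OF L2(4)] t2(1)]
      by (simp add: distrib_right inner_add_left)
  qed
  then show ?thesis using L2_on_add[OF L2(1,3)] L2_on_add[OF L2(2,4)] by (simp add: H1_pair_def)
qed

lemma H1_pair_scaleR:
  assumes u: "H1_pair \<Omega> u G"
  shows "H1_pair \<Omega> (\<lambda>x. c * u x) (\<lambda>x. c *\<^sub>R G x)"
  using u L2_on_scaleR[of u \<Omega> c] L2_on_scaleR[of G \<Omega> c]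
  by (auto simp: H1_pair_def weak_gradient_def mult.assoc)

lemma H1_pair_zero: "H1_pair \<Omega> (\<lambda>x. 0) (\<lambda>x. 0)"
  by (simp add: H1_pair_def weak_gradient_def L2_on_zero)

lemma H1_pair_diff:
  assumes "open \<Omega>" "bounded \<Omega>" "H1_pair \<Omega> u G" "H1_pair \<Omega> v H"
  shows "H1_pair \<Omega> (\<lambda>x. u x - v x) (\<lambda>x. G x - H x)"
  using H1_pair_add[OF assms(1-3) H1_pair_scaleR[OF assms(4), of "-1"]] by simp

lemma H1_pair_sum:
  assumes "open \<Omega>" "bounded \<Omega>" "\<And>i. i \<in> I \<Longrightarrow> H1_pair \<Omega> (u i) (G i)"
  shows "H1_pair \<Omega> (\<lambda>x. \<Sum>i\<in>I. u i x) (\<lambda>x. \<Sum>i\<in>I. G i x)"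
  using assms(3) by (induction I rule: infinite_finite_induct) (auto intro: H1_pair_add[OF assms(1,2)] H1_pair_zero)

context mollifiers
begin

lemma
  assumes d: "\<delta> > 0" and sub: "cball x \<delta> \<subseteq> \<Omega>"
  shows test_function_mollifier: "test_function \<Omega> (\<lambda>y. \<rho> \<delta> (x - y))"
    and partial_deriv_mollifier: "partial_deriv b (\<lambda>y. \<rho> \<delta> (x - y)) y = - partial_deriv b (\<rho> \<delta>) (x - y)"
proof -
  have eq: "(\<lambda>y. \<rho> \<delta> (x - y)) = (\<lambda>y. \<rho> \<delta> ((-1) *\<^sub>R y + x))" by simp
  have "smooth (\<lambda>y. \<rho> \<delta> (x - y))" unfolding smooth_def eq using Ck_affine[OF Ck_mollifier[OF d]] by blast
  moreover have "closure {y. \<rho> \<delta> (x - y) \<noteq> 0} \<subseteq> cball x \<delta>"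
    using mollifier_support[OF d] by (intro closure_minimal) (auto simp: dist_norm)
  ultimately show "test_function \<Omega> (\<lambda>y. \<rho> \<delta> (x - y))"
    unfolding test_function_def using sub
    by (meson bounded_cball bounded_subset closed_closure compact_eq_bounded_closed subset_trans)
  have "\<rho> \<delta> differentiable at ((-1) *\<^sub>R y + x)" using Ck_mollifier[OF d, of "Suc 0"] by simp
  from partial_deriv_affine(2)[OF this, of b] show "partial_deriv b (\<lambda>y. \<rho> \<delta> (x - y)) y = - partial_deriv b (\<rho> \<delta>) (x - y)"
    unfolding eq by simp
qed

text \<open>Here the definition of the weak gradient is used: if \<open>cball x \<delta>\<close> lies in \<open>\<Omega>\<close>, then
  \<open>\<lambda>y. \<rho> \<delta> (x - y)\<close> is a test function of \<open>\<Omega>\<close>.\<close>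

lemma partial_deriv_mollify:
  assumes \<Omega>: "open \<Omega>" "bounded \<Omega>" and u: "H1_pair \<Omega> u G" and d: "\<delta> > 0" and sub: "cball x \<delta> \<subseteq> \<Omega>" and b: "b \<in> Basis"
  shows "partial_deriv b (convolve (\<lambda>x. indicator \<Omega> x * u x) (\<rho> \<delta>)) x
    = convolve (\<lambda>x. indicator \<Omega> x * (G x \<bullet> b)) (\<rho> \<delta>) x"
proof -
  have "u \<in> L2_on \<Omega>" using u by (simp add: H1_pair_def)
  then have f: "integrable lborel (\<lambda>x. indicator \<Omega> x * u x)"
    using L2_on_set_integrable[OF _ \<Omega>, of u] by (simp add: set_integrable_def)
  have "partial_deriv b (convolve (\<lambda>x. indicator \<Omega> x * u x) (\<rho> \<delta>)) x
     = (LINT y:\<Omega>|lborel. u y * partial_deriv b (\<rho> \<delta>) (x - y))"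
    unfolding partial_deriv_convolve[OF f Ck_mollifier[OF d] bounded_support_mollifier[OF d] b]
    by (simp add: convolve_def set_lebesgue_integral_def mult.assoc)
  also have "\<dots> = - (LINT y:\<Omega>|lborel. u y * partial_deriv b (\<lambda>y. \<rho> \<delta> (x - y)) y)"
    using partial_deriv_mollifier[OF d sub] by (simp add: set_lebesgue_integral_def)
  also have "\<dots> = (LINT y:\<Omega>|lborel. (G y \<bullet> b) * \<rho> \<delta> (x - y))"
    using u b test_function_mollifier[OF d sub] unfolding H1_pair_def weak_gradient_def by simp
  also have "\<dots> = convolve (\<lambda>x. indicator \<Omega> x * (G x \<bullet> b)) (\<rho> \<delta>) x"
    by (simp add: convolve_def set_lebesgue_integral_def mult.assoc)
  finally show ?thesis .
qed

text \<open>Classical integration by parts for the mollified function, valid as soon as the mollification radius does not reach from the support of \<open>\<psi>\<close> to the boundary.\<close>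

lemma chain_rule_mollified:
  assumes \<Omega>: "open \<Omega>" "bounded \<Omega>" and u: "H1_pair \<Omega> u G" and d: "\<delta> > 0"
    and \<eta>: "\<And>t. (\<eta> has_real_derivative \<eta>' t) (at t)" "continuous_on UNIV \<eta>'"
    and \<psi>: "test_function \<Omega> \<psi>" and b: "b \<in> Basis"
    and sub: "\<And>x. \<psi> x \<noteq> 0 \<Longrightarrow> cball x \<delta> \<subseteq> \<Omega>"
  defines "z \<equiv> convolve (\<lambda>x. indicator \<Omega> x * u x) (\<rho> \<delta>)"
    and "h \<equiv> convolve (\<lambda>x. indicator \<Omega> x * (G x \<bullet> b)) (\<rho> \<delta>)"
  shows "(LINT x|lborel. \<eta> (z x) * partial_deriv b \<psi> x) = - (LINT x|lborel. \<eta>' (z x) * h x * \<psi> x)"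
proof -
  have "u \<in> L2_on \<Omega>" using u by (simp add: H1_pair_def)
  then have f: "integrable lborel (\<lambda>x. indicator \<Omega> x * u x)"
    using L2_on_set_integrable[OF _ \<Omega>, of u] by (simp add: set_integrable_def)
  have z1: "Ck (Suc 0) z" unfolding z_def
    by (rule Ck_convolve[OF f Ck_mollifier[OF d] bounded_support_mollifier[OF d]])
  have z: "z differentiable at x" "continuous_on UNIV z" "continuous_on UNIV (partial_deriv b z)" for x
    using z1 Ck_imp_continuous[OF z1] b by auto
  have \<psi>c: "continuous_on UNIV \<psi>" "continuous_on UNIV (partial_deriv b \<psi>)" "bounded {x. \<psi> x \<noteq> 0}"
    "bounded {x. partial_deriv b \<psi> x \<noteq> 0}"
    using test_function_continuous test_function_bounded_support \<psi> test_function_partial_deriv[OF \<psi> b] by blast+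
  have \<eta>c: "continuous_on UNIV \<eta>" using \<eta>(1) by (meson DERIV_isCont continuous_at_imp_continuous_on)
  have c: "continuous_on UNIV (\<lambda>x. \<eta> (z x))" "continuous_on UNIV (\<lambda>x. \<eta>' (z x))"
    using continuous_on_compose2[OF \<eta>c z(2)] continuous_on_compose2[OF \<eta>(2) z(2)] by auto
  have D: "((\<lambda>x. \<eta> (z x) * \<psi> x) has_derivative
    (\<lambda>k. \<eta> (z x) * frechet_derivative \<psi> (at x) k + (frechet_derivative z (at x) k * \<eta>' (z x)) * \<psi> x)) (at x)" for x
  proof -
    have dz: "(z has_derivative frechet_derivative z (at x)) (at x)" using z by (simp add: frechet_derivative_works)
    have d\<psi>: "(\<psi> has_derivative frechet_derivative \<psi> (at x)) (at x)"
      using test_function_differentiable[OF \<psi>] by (simp add: frechet_derivative_works)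
    have "((\<lambda>x. \<eta> (z x)) has_derivative (\<lambda>k. frechet_derivative z (at x) k * \<eta>' (z x))) (at x)"
      by (rule DERIV_compose_FDERIV[OF \<eta>(1) dz])
    from has_derivative_mult[OF this d\<psi>] show ?thesis .
  qed
  have pd: "partial_deriv b (\<lambda>x. \<eta> (z x) * \<psi> x) = (\<lambda>x. \<eta> (z x) * partial_deriv b \<psi> x + (partial_deriv b z x * \<eta>' (z x)) * \<psi> x)"
    using partial_deriv_eqI[OF D] by (auto simp: partial_deriv_def)
  have i1: "integrable lborel (\<lambda>x. \<eta> (z x) * partial_deriv b \<psi> x)"
    by (intro continuous_compact_support_integrable continuous_on_mult c \<psi>c bounded_subset[OF \<psi>c(4)]) auto
  have i2: "integrable lborel (\<lambda>x. (partial_deriv b z x * \<eta>' (z x)) * \<psi> x)"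
    by (intro continuous_compact_support_integrable continuous_on_mult c z \<psi>c bounded_subset[OF \<psi>c(3)]) auto
  have "(LINT x|lborel. partial_deriv b (\<lambda>x. \<eta> (z x) * \<psi> x) x) = 0"
  proof (rule integral_partial_deriv_eq_0)
    show "(\<lambda>x. \<eta> (z x) * \<psi> x) differentiable at x" for x using D by (rule differentiableI)
    show "continuous_on UNIV (partial_deriv b (\<lambda>x. \<eta> (z x) * \<psi> x))"
      unfolding pd by (intro continuous_on_add continuous_on_mult c z \<psi>c)
  qed (intro bounded_subset[OF \<psi>c(3)], auto)
  then have "(LINT x|lborel. \<eta> (z x) * partial_deriv b \<psi> x) = - (LINT x|lborel. (partial_deriv b z x * \<eta>' (z x)) * \<psi> x)"
    unfolding pd Bochner_Integration.integral_add[OF i1 i2] by simp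
  also have "(LINT x|lborel. (partial_deriv b z x * \<eta>' (z x)) * \<psi> x) = (LINT x|lborel. \<eta>' (z x) * h x * \<psi> x)"
  proof (intro Bochner_Integration.integral_cong refl)
    fix x
    show "(partial_deriv b z x * \<eta>' (z x)) * \<psi> x = \<eta>' (z x) * h x * \<psi> x"
      using partial_deriv_mollify[OF \<Omega> u d sub b, of x] by (cases "\<psi> x = 0") (auto simp: z_def h_def)
  qed
  finally show ?thesis .
qed

text \<open>Let the mollification radius tend to 0. Mollification converges in \<open>L\<^sup>1\<close> only, which is not enough for the
  product \<open>\<eta>' (z n) * h n\<close>; along a subsequence that converges almost everywhere, dominated
  convergence handles the factor \<open>\<eta>' (z n)\<close>, because \<open>\<eta>'\<close> is bounded and continuous.\<close>

lemma H1_pair_chain_rule: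
  fixes \<Omega> :: "'a set"
  assumes \<Omega>: "open \<Omega>" "bounded \<Omega>" and u: "H1_pair \<Omega> u G"
    and \<eta>: "\<And>t. (\<eta> has_real_derivative \<eta>' t) (at t)" "continuous_on UNIV \<eta>'" "\<And>t. \<bar>\<eta>' t\<bar> \<le> L"
    and \<eta>0: "\<eta> 0 = 0"
  shows "H1_pair \<Omega> (\<lambda>x. \<eta> (u x)) (\<lambda>x. \<eta>' (u x) *\<^sub>R G x)"
proof -
  have Lip: "\<bar>\<eta> s - \<eta> t\<bar> \<le> L * \<bar>s - t\<bar>" for s t
    using field_differentiable_bound[of UNIV \<eta> \<eta>' L s t] \<eta> by auto
  have L: "L \<ge> 0" using \<eta>(3)[of 0] by linarith
  have \<eta>c: "continuous_on UNIV \<eta>" using \<eta>(1) by (meson DERIV_isCont continuous_at_imp_continuous_on)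
  have [measurable]: "\<eta> \<in> borel_measurable borel" "\<eta>' \<in> borel_measurable borel"
    using \<eta>c \<eta>(2) by (auto intro: borel_measurable_continuous_onI)
  define f where "f x = indicator \<Omega> x * u x" for x
  have uL: "u \<in> L2_on \<Omega>" and GL: "G \<in> L2_on \<Omega>" using u by (auto simp: H1_pair_def)
  have fi: "integrable lborel f"
    using L2_on_set_integrable[OF uL \<Omega>] by (simp add: set_integrable_def f_def[abs_def])
  have [measurable]: "\<Omega> \<in> sets borel" "f \<in> borel_measurable borel" "(\<lambda>x. indicator \<Omega> x *\<^sub>R G x) \<in> borel_measurable borel"
    using \<Omega> fi GL by (auto simp: L2_on_iff)
  have 1: "(\<lambda>x. \<eta> (u x)) \<in> L2_on \<Omega>"
  proof (rule L2_on_dominated[OF uL, where C = L])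
    have "(\<lambda>x. indicator \<Omega> x *\<^sub>R \<eta> (u x)) = (\<lambda>x. \<eta> (f x))" using \<eta>0 by (auto simp: f_def indicator_def)
    then show "set_borel_measurable lborel \<Omega> (\<lambda>x. \<eta> (u x))" by (simp add: set_borel_measurable_def)
    show "norm (\<eta> (u x)) \<le> L * norm (u x)" for x using Lip[of "u x" 0] \<eta>0 by simp
  qed
  have 2: "(\<lambda>x. \<eta>' (u x) *\<^sub>R G x) \<in> L2_on \<Omega>"
  proof (rule L2_on_dominated[OF GL, where C = L])
    have "(\<lambda>x. indicator \<Omega> x *\<^sub>R \<eta>' (u x) *\<^sub>R G x) = (\<lambda>x. \<eta>' (f x) *\<^sub>R (indicator \<Omega> x *\<^sub>R G x))"
      by (auto simp: f_def indicator_def)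
    moreover have "(\<lambda>x. \<eta>' (f x) *\<^sub>R (indicator \<Omega> x *\<^sub>R G x)) \<in> borel_measurable borel" by measurable
    ultimately show "set_borel_measurable lborel \<Omega> (\<lambda>x. \<eta>' (u x) *\<^sub>R G x)"
      by (simp add: set_borel_measurable_def del: scaleR_scaleR)
    show "norm (\<eta>' (u x) *\<^sub>R G x) \<le> L * norm (G x)" for x using \<eta>(3)[of "u x"] by (simp add: mult_right_mono)
  qed
  have 3: "weak_gradient \<Omega> (\<lambda>x. \<eta> (u x)) (\<lambda>x. \<eta>' (u x) *\<^sub>R G x)"
    unfolding weak_gradient_def
  proof (intro allI impI ballI)
    fix \<psi> and b :: 'a assume \<psi>: "test_function \<Omega> \<psi>" and b: "b \<in> Basis"
    define g where "g x = indicator \<Omega> x * (G x \<bullet> b)" for x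
    have gi: "integrable lborel g"
      using L2_on_set_integrable[OF L2_on_component[OF GL] \<Omega>] by (simp add: set_integrable_def g_def[abs_def])
    note \<psi>' = test_function_partial_deriv[OF \<psi> b]
    obtain C where C: "\<And>x. \<bar>\<psi> x\<bar> \<le> C" "C \<ge> 0" using test_function_bounded[OF \<psi>] by blast
    obtain C' where C': "\<And>x. \<bar>partial_deriv b \<psi> x\<bar> \<le> C'" "C' \<ge> 0" using test_function_bounded[OF \<psi>'] by blast
    have [measurable]: "\<psi> \<in> borel_measurable borel" "partial_deriv b \<psi> \<in> borel_measurable borel" "g \<in> borel_measurable borel"
      using test_function_measurable \<psi> \<psi>' gi by auto
    define \<delta> where "\<delta> n = inverse (real (Suc n))" for n
    have \<delta>: "\<delta> n > 0" for n by (simp add: \<delta>_def)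
    have \<delta>0: "\<delta> \<longlonglongrightarrow> 0" unfolding \<delta>_def by (rule LIMSEQ_inverse_real_of_nat)
    define z where "z n = convolve f (\<rho> (\<delta> n))" for n
    define h where "h n = convolve g (\<rho> (\<delta> n))" for n
    have zi: "integrable lborel (z n)" and hi: "integrable lborel (h n)" for n
      using integrable_mollify[OF fi \<delta>] integrable_mollify[OF gi \<delta>] by (auto simp: z_def h_def)
    have [measurable]: "z n \<in> borel_measurable borel" "h n \<in> borel_measurable borel" for n using zi hi by auto
    have zL: "(\<lambda>n. LINT x|lborel. \<bar>z n x - f x\<bar>) \<longlonglongrightarrow> 0" and hL: "(\<lambda>n. LINT x|lborel. \<bar>h n x - g x\<bar>) \<longlonglongrightarrow> 0"
      using mollify_tendsto_L1[OF fi \<delta> \<delta>0] mollify_tendsto_L1[OF gi \<delta> \<delta>0] by (auto simp: z_def h_def)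
    obtain r :: "nat \<Rightarrow> nat" where r: "strict_mono r" "AE x in lborel. (\<lambda>n. z (r n) x - f x) \<longlonglongrightarrow> 0"
      using tendsto_L1_AE_subseq[of lborel "\<lambda>n x. z n x - f x"] zi fi zL by auto
    obtain e where e: "e > 0" "(\<Union>x\<in>closure {x. \<psi> x \<noteq> 0}. ball x e) \<subseteq> \<Omega>"
      using compact_subset_open_imp_ball_epsilon_subset[of "closure {x. \<psi> x \<noteq> 0}" \<Omega>] \<psi> \<Omega>
      by (auto simp: test_function_def)
    define A where "A n = (LINT x|lborel. \<eta> (z n x) * partial_deriv b \<psi> x)" for n
    define B1 where "B1 n = (LINT x|lborel. \<eta>' (z n x) * (h n x - g x) * \<psi> x)" for n
    define B2 where "B2 n = (LINT x|lborel. \<eta>' (z n x) * g x * \<psi> x)" for n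
    have b1: "\<bar>\<eta>' t * s * \<psi> x\<bar> \<le> L * C * \<bar>s\<bar>" for t s x
    proof -
      have "\<bar>\<eta>' t * s * \<psi> x\<bar> = (\<bar>\<eta>' t\<bar> * \<bar>\<psi> x\<bar>) * \<bar>s\<bar>" by (simp add: abs_mult)
      also have "\<dots> \<le> (L * C) * \<bar>s\<bar>" using \<eta>(3) C L by (intro mult_right_mono mult_mono) auto
      finally show ?thesis .
    qed
    have iB1: "integrable lborel (\<lambda>x. \<eta>' (z n x) * (h n x - g x) * \<psi> x)" for n
    proof (rule Bochner_Integration.integrable_bound)
      show "integrable lborel (\<lambda>x. L * C * \<bar>h n x - g x\<bar>)" using hi gi by auto
      show "AE x in lborel. norm (\<eta>' (z n x) * (h n x - g x) * \<psi> x) \<le> norm (L * C * \<bar>h n x - g x\<bar>)"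
        unfolding real_norm_def by (intro AE_I2 order_trans[OF b1 abs_ge_self])
    qed measurable
    have iB2: "integrable lborel (\<lambda>x. \<eta>' (z n x) * g x * \<psi> x)" for n
    proof (rule Bochner_Integration.integrable_bound)
      show "integrable lborel (\<lambda>x. L * C * \<bar>g x\<bar>)" using gi by auto
      show "AE x in lborel. norm (\<eta>' (z n x) * g x * \<psi> x) \<le> norm (L * C * \<bar>g x\<bar>)"
        unfolding real_norm_def by (intro AE_I2 order_trans[OF b1 abs_ge_self])
    qed measurable
    have eqAB: "\<forall>\<^sub>F n in sequentially. A n = - (B1 n + B2 n)"
    proof -
      have "\<forall>\<^sub>F n in sequentially. \<delta> n < e" using order_tendstoD(2)[OF \<delta>0 e(1)] .
      then show ?thesis
      proof eventually_elim
        case (elim n)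
        have "cball x (\<delta> n) \<subseteq> \<Omega>" if "\<psi> x \<noteq> 0" for x
        proof -
          have "x \<in> closure {x. \<psi> x \<noteq> 0}" using that closure_subset by fast
          then have "ball x e \<subseteq> \<Omega>" using e(2) by blast
          moreover have "cball x (\<delta> n) \<subseteq> ball x e" using elim by auto
          ultimately show ?thesis by blast
        qed
        from chain_rule_mollified[OF \<Omega> u \<delta> \<eta>(1,2) \<psi> b this]
        have "A n = - (LINT x|lborel. \<eta>' (z n x) * h n x * \<psi> x)"
          by (simp add: A_def z_def h_def f_def[abs_def] g_def[abs_def])
        also have "(LINT x|lborel. \<eta>' (z n x) * h n x * \<psi> x) = (LINT x|lborel. \<eta>' (z n x) * (h n x - g x) * \<psi> x + \<eta>' (z n x) * g x * \<psi> x)"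
          by (intro Bochner_Integration.integral_cong) (auto simp: algebra_simps)
        also have "\<dots> = B1 n + B2 n" unfolding B1_def B2_def
          by (rule Bochner_Integration.integral_add[OF iB1 iB2])
        finally show ?case .
      qed
    qed
    have bA: "\<bar>\<eta> s * partial_deriv b \<psi> x - \<eta> t * partial_deriv b \<psi> x\<bar> \<le> L * C' * \<bar>s - t\<bar>" for s t x
    proof -
      have "\<bar>\<eta> s * partial_deriv b \<psi> x - \<eta> t * partial_deriv b \<psi> x\<bar> = \<bar>\<eta> s - \<eta> t\<bar> * \<bar>partial_deriv b \<psi> x\<bar>"
        by (simp add: left_diff_distrib[symmetric] abs_mult)
      also have "\<dots> \<le> (L * \<bar>s - t\<bar>) * C'" using Lip C' L by (intro mult_mono) auto
      finally show ?thesis by (simp add: mult_ac)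
    qed
    have iA: "integrable lborel (\<lambda>x. \<eta> (w x) * partial_deriv b \<psi> x)" if w: "integrable lborel w" for w
    proof (rule Bochner_Integration.integrable_bound)
      show "integrable lborel (\<lambda>x. L * C' * \<bar>w x\<bar>)" using w by auto
      show "AE x in lborel. norm (\<eta> (w x) * partial_deriv b \<psi> x) \<le> norm (L * C' * \<bar>w x\<bar>)"
      proof (rule AE_I2)
        fix x
        show "norm (\<eta> (w x) * partial_deriv b \<psi> x) \<le> norm (L * C' * \<bar>w x\<bar>)"
          using bA[of "w x" x 0] \<eta>0 abs_ge_self[of "L * C' * \<bar>w x\<bar>"] by simp
      qed
    qed (use w in measurable)
    have "A \<longlonglongrightarrow> (LINT x|lborel. \<eta> (f x) * partial_deriv b \<psi> x)"
      unfolding A_def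
    proof (rule integral_tendsto_of_L1[OF iA[OF zi] iA[OF fi]])
      have "(\<lambda>n. L * C' * (LINT x|lborel. \<bar>z n x - f x\<bar>)) \<longlonglongrightarrow> L * C' * 0" by (intro tendsto_mult_left zL)
      then have lim0: "(\<lambda>n. L * C' * (LINT x|lborel. \<bar>z n x - f x\<bar>)) \<longlonglongrightarrow> 0" by simp
      show "(\<lambda>n. LINT x|lborel. \<bar>\<eta> (z n x) * partial_deriv b \<psi> x - \<eta> (f x) * partial_deriv b \<psi> x\<bar>) \<longlonglongrightarrow> 0"
      proof (rule Lim_null_comparison[OF always_eventually lim0], intro allI)
        fix n
        have "(LINT x|lborel. \<bar>\<eta> (z n x) * partial_deriv b \<psi> x - \<eta> (f x) * partial_deriv b \<psi> x\<bar>) \<le> (LINT x|lborel. L * C' * \<bar>z n x - f x\<bar>)"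
          by (rule integral_mono) (use iA[OF zi] iA[OF fi] zi fi bA in auto)
        then show "norm (LINT x|lborel. \<bar>\<eta> (z n x) * partial_deriv b \<psi> x - \<eta> (f x) * partial_deriv b \<psi> x\<bar>) \<le> L * C' * (LINT x|lborel. \<bar>z n x - f x\<bar>)"
          by (simp add: integral_nonneg_AE)
      qed
    qed
    then have "(A \<circ> r) \<longlonglongrightarrow> (LINT x|lborel. \<eta> (f x) * partial_deriv b \<psi> x)" by (rule LIMSEQ_subseq_LIMSEQ[OF _ r(1)])
    moreover have "B1 \<longlonglongrightarrow> 0"
    proof -
      have "(\<lambda>n. L * C * (LINT x|lborel. \<bar>h n x - g x\<bar>)) \<longlonglongrightarrow> L * C * 0" by (intro tendsto_mult_left hL)
      then have lim0: "(\<lambda>n. L * C * (LINT x|lborel. \<bar>h n x - g x\<bar>)) \<longlonglongrightarrow> 0" by simp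
      show ?thesis
      proof (rule Lim_null_comparison[OF always_eventually lim0], intro allI)
        fix n
        have "\<bar>B1 n\<bar> \<le> (LINT x|lborel. L * C * \<bar>h n x - g x\<bar>)"
          unfolding B1_def by (rule order_trans[OF integral_abs_bound], rule integral_mono) (use iB1 hi gi b1 in auto)
        then show "norm (B1 n) \<le> L * C * (LINT x|lborel. \<bar>h n x - g x\<bar>)" by simp
      qed
    qed
    then have "(B1 \<circ> r) \<longlonglongrightarrow> 0" by (rule LIMSEQ_subseq_LIMSEQ[OF _ r(1)])
    moreover have "(B2 \<circ> r) \<longlonglongrightarrow> (LINT x|lborel. \<eta>' (f x) * g x * \<psi> x)"
      unfolding B2_def comp_def
    proof (rule integral_dominated_convergence)
      show "integrable lborel (\<lambda>x. L * C * \<bar>g x\<bar>)" using gi by auto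
      show "AE x in lborel. (\<lambda>n. \<eta>' (z (r n) x) * g x * \<psi> x) \<longlonglongrightarrow> \<eta>' (f x) * g x * \<psi> x"
        using r(2)
      proof eventually_elim
        case (elim x)
        then have "(\<lambda>n. z (r n) x) \<longlonglongrightarrow> f x" by (simp add: LIM_zero_iff)
        then have "(\<lambda>n. \<eta>' (z (r n) x)) \<longlonglongrightarrow> \<eta>' (f x)"
          using \<eta>(2) by (intro isCont_tendsto_compose[of _ \<eta>']) (auto simp: continuous_on_eq_continuous_at)
        then show ?case by (intro tendsto_intros)
      qed
      show "AE x in lborel. norm (\<eta>' (z (r n) x) * g x * \<psi> x) \<le> L * C * \<bar>g x\<bar>" for n using b1 by auto
    qed measurable
    ultimately have "(LINT x|lborel. \<eta> (f x) * partial_deriv b \<psi> x) = - (0 + (LINT x|lborel. \<eta>' (f x) * g x * \<psi> x))"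
    proof -
      assume a: "(A \<circ> r) \<longlonglongrightarrow> (LINT x|lborel. \<eta> (f x) * partial_deriv b \<psi> x)" "(B1 \<circ> r) \<longlonglongrightarrow> 0"
        "(B2 \<circ> r) \<longlonglongrightarrow> (LINT x|lborel. \<eta>' (f x) * g x * \<psi> x)"
      have ev: "\<forall>\<^sub>F n in sequentially. (A \<circ> r) n = - ((B1 \<circ> r) n + (B2 \<circ> r) n)"
        using eventually_subseq[OF r(1) eqAB] by simp
      have "(\<lambda>n. - ((B1 \<circ> r) n + (B2 \<circ> r) n)) \<longlonglongrightarrow> - (0 + (LINT x|lborel. \<eta>' (f x) * g x * \<psi> x))"
        by (intro tendsto_minus tendsto_add a)
      then have "(A \<circ> r) \<longlonglongrightarrow> - (0 + (LINT x|lborel. \<eta>' (f x) * g x * \<psi> x))"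
        using tendsto_cong[OF ev] by blast
      then show ?thesis using a(1) LIMSEQ_unique by blast
    qed
    moreover have "(LINT x:\<Omega>|lborel. \<eta> (u x) * partial_deriv b \<psi> x) = (LINT x|lborel. \<eta> (f x) * partial_deriv b \<psi> x)"
      unfolding set_lebesgue_integral_def
      by (intro Bochner_Integration.integral_cong) (auto simp: f_def indicator_def test_function_outside[OF \<psi>'])
    moreover have "(LINT x:\<Omega>|lborel. ((\<eta>' (u x) *\<^sub>R G x) \<bullet> b) * \<psi> x) = (LINT x|lborel. \<eta>' (f x) * g x * \<psi> x)"
      unfolding set_lebesgue_integral_def
      by (intro Bochner_Integration.integral_cong) (auto simp: f_def g_def indicator_def)
    ultimately show "(LINT x:\<Omega>|lborel. \<eta> (u x) * partial_deriv b \<psi> x) = - (LINT x:\<Omega>|lborel. ((\<eta>' (u x) *\<^sub>R G x) \<bullet> b) * \<psi> x)"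
      by simp
  qed
  show ?thesis using 1 2 3 by (simp add: H1_pair_def)
qed

end

section \<open>Radial cutoffs on a convex domain\<close>

lemma continuous_L2_on:
  fixes f :: "'a::euclidean_space \<Rightarrow> 'b::euclidean_space"
  assumes \<Omega>: "open \<Omega>" "bounded \<Omega>" and f: "continuous_on UNIV f"
  shows "f \<in> L2_on \<Omega>"
proof -
  have "compact (f ` closure \<Omega>)"
    using \<Omega> f by (intro compact_continuous_image) (auto intro: continuous_on_subset)
  then obtain B where B: "\<And>x. x \<in> closure \<Omega> \<Longrightarrow> norm (f x) \<le> B"
    by (metis bounded_iff compact_imp_bounded imageI)
  have [measurable]: "f \<in> borel_measurable borel" using f by (rule borel_measurable_continuous_onI)
  show ?thesis
    by (rule L2_on_bounded[OF \<Omega>, where C = B]) (use B closure_subset \<Omega> in \<open>auto simp: set_borel_measurable_def\<close>)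
qed

context mollifiers
begin

text \<open>The set \<open>K\<close> is \<open>\<Omega>\<close> shrunk towards \<open>y\<close> by the factor \<open>1 / (1 + a)\<close>, and its distance to the
  complement of \<open>\<Omega>\<close> is at least \<open>2 * \<delta>\<close>. It is star-shaped about every point of
  \<open>cball y \<delta>\<close>, not only about \<open>y\<close>; this is why averaging its indicator over translations of
  size \<open>\<delta>\<close> preserves the monotonicity along rays from \<open>y\<close>.\<close>

lemma radial_cutoff:
  assumes \<Omega>: "open \<Omega>" "bounded \<Omega>" "convex \<Omega>" and ball: "ball y r \<subseteq> \<Omega>" and r: "r > 0"
    and a: "0 < a" "a \<le> 1"
  defines "\<delta> \<equiv> r * a / (1 + a) / 2"
  defines "K \<equiv> {x. y + (1 + a) *\<^sub>R (x - y) \<in> \<Omega>}"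
  defines "\<eta> \<equiv> convolve (indicator K) (\<rho> \<delta>)"
  shows "test_function \<Omega> \<eta>" "0 \<le> \<eta> x" "\<eta> x \<le> 1" "frechet_derivative \<eta> (at x) (x - y) \<le> 0"
    and "(\<And>z. norm z \<le> \<delta> \<Longrightarrow> x - z \<in> K) \<Longrightarrow> \<eta> x = 1"
proof -
  have \<delta>: "\<delta> > 0" using r a by (simp add: \<delta>_def)
  have cK: "continuous_on UNIV (\<lambda>x. y + (1 + a) *\<^sub>R (x - y))" by (intro continuous_intros)
  have K_eq: "K = (\<lambda>x. y + (1 + a) *\<^sub>R (x - y)) -` \<Omega>" by (auto simp: K_def)
  have "open K" unfolding K_eq by (rule open_vimage[OF \<Omega>(1) cK])
  then have [measurable]: "K \<in> sets borel" by simp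
  \<comment> \<open>\<open>x + z\<close> is a convex combination of a point of \<open>\<Omega>\<close> and a point of \<open>ball y r\<close>\<close>
  have sub: "x + z \<in> \<Omega>" if x: "x \<in> K" and z: "norm z < 2 * \<delta>" for x z
  proof -
    define X where "X = y + (1 + a) *\<^sub>R (x - y)"
    have X: "X \<in> \<Omega>" using x by (simp add: K_def X_def)
    define Y where "Y = y + ((1 + a) / a) *\<^sub>R z"
    have "norm (((1 + a) / a) *\<^sub>R z) < r" using z a by (simp add: \<delta>_def field_simps)
    then have Y: "Y \<in> \<Omega>" using ball by (auto simp: Y_def dist_norm subset_iff)
    define p q where "p = 1 / (1 + a)" and "q = a / (1 + a)"
    have pq: "p \<ge> 0" "q \<ge> 0" "p + q = 1" "p * (1 + a) = 1" "q * ((1 + a) / a) = 1"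
      using a by (auto simp: p_def q_def divide_simps)
    have "p *\<^sub>R X + q *\<^sub>R Y \<in> \<Omega>" by (rule convexD[OF \<Omega>(3) X Y pq(1-3)])
    moreover have "p *\<^sub>R X = p *\<^sub>R y + (p * (1 + a)) *\<^sub>R (x - y)"
      by (simp only: X_def scaleR_add_right scaleR_scaleR)
    moreover have "q *\<^sub>R Y = q *\<^sub>R y + (q * ((1 + a) / a)) *\<^sub>R z"
      by (simp only: Y_def scaleR_add_right scaleR_scaleR)
    moreover have "p *\<^sub>R y + q *\<^sub>R y = y"
      by (simp only: scaleR_add_left[symmetric] pq(3) scaleR_one)
    ultimately have "(p *\<^sub>R y + (x - y)) + (q *\<^sub>R y + z) \<in> \<Omega>" "p *\<^sub>R y + q *\<^sub>R y = y"
      using pq(4,5) by (simp_all only: scaleR_one)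
    moreover have "(p *\<^sub>R y + (x - y)) + (q *\<^sub>R y + z) = (p *\<^sub>R y + q *\<^sub>R y) + (x - y + z)"
      by (simp only: ac_simps)
    ultimately show ?thesis by simp
  qed
  have "K \<subseteq> \<Omega>" using sub[of _ 0] \<delta> by auto
  then have "bounded K" using \<Omega>(2) bounded_subset by blast
  then have iK: "integrable lborel (indicator K :: 'a \<Rightarrow> real)"
    by (intro integrable_real_indicator emeasure_bounded_finite) auto
  have \<eta>_eq: "\<eta> x = (LINT z|lborel. indicator K (x - z) * \<rho> \<delta> z)"
    and \<eta>_int: "integrable lborel (\<lambda>z. indicator K (x - z) * \<rho> \<delta> z)" for x
    using convolve_mollifier_eq[OF iK \<delta>] by (auto simp: \<eta>_def)
  show "0 \<le> \<eta> x" unfolding \<eta>_eq using mollifier_nonneg[OF \<delta>] by (intro integral_nonneg_AE) auto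
  have "\<eta> x \<le> (LINT z|lborel. \<rho> \<delta> z)" unfolding \<eta>_eq
    using mollifier_nonneg[OF \<delta>] by (intro integral_mono \<eta>_int integrable_mollifier[OF \<delta>]) (auto simp: indicator_def)
  then show "\<eta> x \<le> 1" using mollifier_integral[OF \<delta>] by simp
  have smooth: "smooth \<eta>" unfolding smooth_def \<eta>_def
    using Ck_convolve[OF iK Ck_mollifier[OF \<delta>] bounded_support_mollifier[OF \<delta>]] by blast
  have supp: "closure {x. \<eta> x \<noteq> 0} \<subseteq> \<Omega>"
  proof
    fix x assume "x \<in> closure {x. \<eta> x \<noteq> 0}"
    then obtain x' where x': "\<eta> x' \<noteq> 0" "dist x' x < \<delta>" using \<delta> by (auto simp: closure_approachable)
    have "\<exists>z. indicator K (x' - z) * \<rho> \<delta> z \<noteq> (0::real)"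
    proof (rule ccontr)
      assume "\<not> ?thesis"
      then have "(\<lambda>z. indicator K (x' - z) * \<rho> \<delta> z) = (\<lambda>z. 0::real)" by blast
      then have "\<eta> x' = 0" by (simp only: \<eta>_eq integral_zero)
      then show False using x' by simp
    qed
    then obtain z where z: "x' - z \<in> K" "\<rho> \<delta> z \<noteq> 0" by (auto simp: indicator_def split: if_splits)
    have "norm z \<le> \<delta>" using mollifier_support[OF \<delta> z(2)] .
    then have "norm (z + (x - x')) < 2 * \<delta>"
      using x'(2) norm_triangle_ineq[of z "x - x'"] by (simp add: dist_norm norm_minus_commute)
    from sub[OF z(1) this] show "x \<in> \<Omega>" by simp
  qed
  then show tf: "test_function \<Omega> \<eta>"
    unfolding test_function_def using smooth \<Omega>(2)
    by (auto simp: compact_eq_bounded_closed intro: bounded_subset)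
  show "\<eta> x = 1" if "\<And>z. norm z \<le> \<delta> \<Longrightarrow> x - z \<in> K"
  proof -
    have "indicator K (x - z) * \<rho> \<delta> z = \<rho> \<delta> z" for z
      using that[of z] mollifier_support[OF \<delta>, of z] by (cases "\<rho> \<delta> z = 0") auto
    then have "(\<lambda>z. indicator K (x - z) * \<rho> \<delta> z) = \<rho> \<delta>" by (intro ext)
    then show ?thesis unfolding \<eta>_eq using mollifier_integral[OF \<delta>] by simp
  qed
  show "frechet_derivative \<eta> (at x) (x - y) \<le> 0"
  proof (rule ccontr)
    assume "\<not> ?thesis"
    then have pos: "frechet_derivative \<eta> (at x) (x - y) > 0" by simp
    have "((\<lambda>t. \<eta> (x + t *\<^sub>R (x - y))) has_real_derivative frechet_derivative \<eta> (at x) (x - y)) (at 0)"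
      using has_real_derivative_along_line[of \<eta> x 0 "x - y"] test_function_differentiable[OF tf] by simp
    from DERIV_pos_inc_left[OF this pos] obtain d where d: "d > 0"
      "\<And>h. h > 0 \<Longrightarrow> h < d \<Longrightarrow> \<eta> (x + (0 - h) *\<^sub>R (x - y)) < \<eta> (x + 0 *\<^sub>R (x - y))" by blast
    define h where "h = min (d / 2) (1 / 2)"
    have h: "h > 0" "h < d" "h < 1" using d(1) by (auto simp: h_def min_def)
    \<comment> \<open>if \<open>x - z\<close> lies in the convex set \<open>K\<close>, so does the point between it and \<open>y - z\<close>\<close>
    have "\<eta> x \<le> \<eta> (x + (0 - h) *\<^sub>R (x - y))" unfolding \<eta>_eq
    proof (rule integral_mono[OF \<eta>_int \<eta>_int])
      fix z
      show "indicator K (x - z) * \<rho> \<delta> z \<le> indicator K (x + (0 - h) *\<^sub>R (x - y) - z) * \<rho> \<delta> z"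
      proof (cases "\<rho> \<delta> z \<noteq> 0 \<and> x - z \<in> K")
        case True
        have nz: "norm z \<le> \<delta>" using mollifier_support[OF \<delta>] True by blast
        have "norm ((1 + a) *\<^sub>R z) \<le> (1 + a) * \<delta>" using nz a by simp
        also have "\<dots> = r * a / 2" using \<open>a > 0\<close> by (simp add: \<delta>_def divide_simps)
        also have "\<dots> < r" using r a by (simp add: field_simps mult_left_le)
        finally have Y: "y - (1 + a) *\<^sub>R z \<in> \<Omega>" using ball by (auto simp: dist_norm)
        have X: "y + (1 + a) *\<^sub>R (x - z - y) \<in> \<Omega>" using True by (simp add: K_def)
        have "(1 - h) *\<^sub>R (y + (1 + a) *\<^sub>R (x - z - y)) + h *\<^sub>R (y - (1 + a) *\<^sub>R z) \<in> \<Omega>"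
          by (rule convexD[OF \<Omega>(3) X Y]) (use h in auto)
        also have "(1 - h) *\<^sub>R (y + (1 + a) *\<^sub>R (x - z - y)) + h *\<^sub>R (y - (1 + a) *\<^sub>R z)
          = y + (1 + a) *\<^sub>R ((x + (0 - h) *\<^sub>R (x - y) - z) - y)"
          by (simp add: algebra_simps)
        finally have "x + (0 - h) *\<^sub>R (x - y) - z \<in> K" by (simp add: K_def)
        then show ?thesis using True by simp
      next
        case False
        then show ?thesis using mollifier_nonneg[OF \<delta>, of z] by (auto simp: indicator_def)
      qed
    qed
    moreover have "\<eta> (x + (0 - h) *\<^sub>R (x - y)) < \<eta> x" using d(2)[OF h(1,2)] by simp
    ultimately show False by simp
  qed
qed

lemma radial_cutoffs:
  fixes \<Omega> :: "'a set"
  assumes \<Omega>: "open \<Omega>" "bounded \<Omega>" "convex \<Omega>" and y: "y \<in> \<Omega>"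
  obtains \<eta> :: "nat \<Rightarrow> 'a \<Rightarrow> real" where "\<And>n. test_function \<Omega> (\<eta> n)"
    "\<And>n x. 0 \<le> \<eta> n x" "\<And>n x. \<eta> n x \<le> 1" "\<And>n x. frechet_derivative (\<eta> n) (at x) (x - y) \<le> 0"
    "\<And>x. x \<in> \<Omega> \<Longrightarrow> (\<lambda>n. \<eta> n x) \<longlonglongrightarrow> 1"
proof -
  obtain r where r: "r > 0" "ball y r \<subseteq> \<Omega>" using \<Omega>(1) y openE by blast
  define a where "a n = inverse (real (Suc n))" for n
  have a: "0 < a n" "a n \<le> 1" for n by (auto simp: a_def field_simps)
  have a0: "a \<longlonglongrightarrow> 0" unfolding a_def by (rule LIMSEQ_inverse_real_of_nat)
  define \<delta> where "\<delta> n = r * a n / (1 + a n) / 2" for n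
  define K where "K n = {x. y + (1 + a n) *\<^sub>R (x - y) \<in> \<Omega>}" for n
  define \<eta> where "\<eta> n = convolve (indicator (K n)) (\<rho> (\<delta> n))" for n
  note cut = radial_cutoff[OF \<Omega> r(2,1) a, folded \<delta>_def K_def, folded \<eta>_def]
  have "(\<lambda>n. \<eta> n x) \<longlonglongrightarrow> 1" if x: "x \<in> \<Omega>" for x
  proof -
    obtain s where s: "s > 0" "ball x s \<subseteq> \<Omega>" using \<Omega>(1) x openE by blast
    have "(\<lambda>n. a n * norm (x - y) + 2 * \<delta> n) \<longlonglongrightarrow> 0 * norm (x - y) + 2 * (r * 0 / (1 + 0) / 2)"
      unfolding \<delta>_def by (intro tendsto_intros a0) auto
    then have "(\<lambda>n. a n * norm (x - y) + 2 * \<delta> n) \<longlonglongrightarrow> 0" by simp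
    from order_tendstoD(2)[OF this s(1)]
    have "\<forall>\<^sub>F n in sequentially. \<eta> n x = 1"
    proof eventually_elim
      case (elim n)
      show "\<eta> n x = 1"
      proof (rule cut(5))
        fix z :: 'a assume z: "norm z \<le> \<delta> n"
        have "(y + (1 + a n) *\<^sub>R (x - z - y)) - x = a n *\<^sub>R (x - y) - (1 + a n) *\<^sub>R z" by (simp add: algebra_simps)
        also have "norm \<dots> \<le> norm (a n *\<^sub>R (x - y)) + norm ((1 + a n) *\<^sub>R z)" by (rule norm_triangle_ineq4)
        also have "\<dots> = a n * norm (x - y) + (1 + a n) * norm z" using a[of n] by simp
        also have "\<dots> \<le> a n * norm (x - y) + 2 * \<delta> n" using a[of n] z by (intro add_left_mono mult_mono) auto
        also have "\<dots> < s" by (rule elim)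
        finally show "x - z \<in> K n" using s(2) by (auto simp: K_def dist_norm norm_minus_commute subset_iff)
      qed
    qed
    then show ?thesis by (rule tendsto_eventually)
  qed
  then show ?thesis using that[of \<eta>] cut(1-4) by blast
qed

text \<open>The divergence theorem for the field \<open>\<gamma> x *\<^sub>R (x - y)\<close>, weighted by \<open>v\<close>: the flux through the boundary of a domain that is
  star-shaped about \<open>y\<close> is nonnegative. With a cutoff \<open>\<eta> n\<close> in place of the indicator of \<open>\<Omega>\<close>, the flux becomes the
  integral of \<open>- v * \<gamma>\<close> times the radial derivative of \<open>\<eta> n\<close>, and the sign is visible.\<close>

lemma radial_divergence_nonneg:
  fixes \<Omega> :: "'a set"
  assumes \<Omega>: "open \<Omega>" "bounded \<Omega>" "convex \<Omega>" and y: "y \<in> \<Omega>"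
    and v: "H1_pair \<Omega> v H" "\<And>x. 0 \<le> v x"
    and \<gamma>: "smooth \<gamma>" "\<And>x. 0 \<le> \<gamma> x"
  shows "0 \<le> (LINT x:\<Omega>|lborel. \<gamma> x * ((x - y) \<bullet> H x)
           + (real DIM('a) * \<gamma> x + frechet_derivative \<gamma> (at x) (x - y)) * v x)"
proof -
  have vL: "v \<in> L2_on \<Omega>" and HL: "H \<in> L2_on \<Omega>" using v by (auto simp: H1_pair_def)
  have Ck\<gamma>: "Ck k \<gamma>" for k using \<gamma>(1) by (simp add: smooth_def)
  have \<gamma>d: "\<gamma> differentiable at x" for x using Ck\<gamma>[of "Suc 0"] by simp
  have c\<gamma>: "continuous_on UNIV \<gamma>" using Ck\<gamma> Ck_imp_continuous by blast
  obtain \<eta> where \<eta>: "\<And>n. test_function \<Omega> (\<eta> n)"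
    "\<And>n x. 0 \<le> \<eta> n x" "\<And>n x. \<eta> n x \<le> 1" "\<And>n x. frechet_derivative (\<eta> n) (at x) (x - y) \<le> 0"
    "\<And>x. x \<in> \<Omega> \<Longrightarrow> (\<lambda>n. \<eta> n x) \<longlonglongrightarrow> 1"
    using radial_cutoffs[OF \<Omega> y] by blast
  define D where "D x = frechet_derivative \<gamma> (at x) (x - y)" for x
  have cD: "continuous_on UNIV D"
  proof -
    have "continuous_on UNIV (\<lambda>x. \<Sum>b\<in>Basis. ((x - y) \<bullet> b) * partial_deriv b \<gamma> x)"
      using Ck\<gamma>[of "Suc 0"] by (intro continuous_intros) auto
    then show ?thesis by (simp add: D_def[abs_def] frechet_derivative_basis_expansion[OF \<gamma>d])
  qed
  define F where "F x = \<gamma> x * ((x - y) \<bullet> H x) + (real DIM('a) * \<gamma> x + D x) * v x" for x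
  have L1: "(\<lambda>x. \<gamma> x *\<^sub>R (x - y)) \<in> L2_on \<Omega>" "(\<lambda>x. real DIM('a) * \<gamma> x + D x) \<in> L2_on \<Omega>"
    by (intro continuous_L2_on \<Omega> continuous_intros c\<gamma> cD)+
  have Fi: "set_integrable lborel \<Omega> F"
    using set_integral_add(1)[OF L2_on_inner_integrable[OF L1(1) HL] L2_on_mult_integrable[OF L1(2) vL]]
    by (simp add: F_def[abs_def])
  have step: "0 \<le> (LINT x:\<Omega>|lborel. \<eta> n x * F x)" for n
  proof -
    define \<psi> where "\<psi> b x = \<eta> n x * (\<gamma> x * ((x - y) \<bullet> b))" for b x
    have ck: "Ck k (\<lambda>x. (x - y) \<bullet> b)" for k b
      using Ck_add[OF Ck_inner[of k b] Ck_const[of k "- (y \<bullet> b)"]] by (simp add: inner_diff_left)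
    have \<psi>: "test_function \<Omega> (\<psi> b)" for b
    proof -
      have "smooth (\<psi> b)" unfolding smooth_def \<psi>_def
        by (intro allI Ck_mult test_function_Ck[OF \<eta>(1)] Ck\<gamma> ck)
      moreover have "closure {x. \<psi> b x \<noteq> 0} \<subseteq> closure {x. \<eta> n x \<noteq> 0}"
        by (intro closure_mono) (auto simp: \<psi>_def)
      ultimately show ?thesis using \<eta>(1)[of n] unfolding test_function_def
        by (meson bounded_subset closed_closure compact_eq_bounded_closed subset_trans)
    qed
    have pd: "partial_deriv b (\<psi> b) x = \<eta> n x * (\<gamma> x + ((x - y) \<bullet> b) * partial_deriv b \<gamma> x)
        + \<gamma> x * (((x - y) \<bullet> b) * partial_deriv b (\<eta> n) x)" if b: "b \<in> Basis" for b x
    proof -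
      have lin: "((\<lambda>x. (x - y) \<bullet> b) has_derivative (\<lambda>h. h \<bullet> b)) (at x)" by (auto intro!: derivative_eq_intros)
      have ld: "(\<lambda>x. (x - y) \<bullet> b) differentiable at x" using lin by (rule differentiableI)
      have "partial_deriv b (\<lambda>x. \<gamma> x * ((x - y) \<bullet> b)) x = \<gamma> x * 1 + partial_deriv b \<gamma> x * ((x - y) \<bullet> b)"
        using partial_deriv_mult[OF \<gamma>d ld, of b] partial_deriv_eqI[OF lin, of b] b by simp
      moreover have "(\<lambda>x. \<gamma> x * ((x - y) \<bullet> b)) differentiable at x"
        using Ck_mult[OF Ck\<gamma>[of "Suc 0"] ck[of "Suc 0" b]] by simp
      ultimately have "partial_deriv b (\<lambda>x. \<eta> n x * (\<gamma> x * ((x - y) \<bullet> b))) x = \<eta> n x * (\<gamma> x + partial_deriv b \<gamma> x * ((x - y) \<bullet> b))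
         + partial_deriv b (\<eta> n) x * (\<gamma> x * ((x - y) \<bullet> b))"
        using partial_deriv_mult[where f = "\<eta> n" and g = "\<lambda>x. \<gamma> x * ((x - y) \<bullet> b)" and x = x and b = b,
            OF test_function_differentiable[OF \<eta>(1)[of n]]] by simp
      then show ?thesis by (simp add: \<psi>_def[abs_def] algebra_simps)
    qed
    have i1: "set_integrable lborel \<Omega> (\<lambda>x. v x * partial_deriv b (\<psi> b) x)"
      and i2: "set_integrable lborel \<Omega> (\<lambda>x. (H x \<bullet> b) * \<psi> b x)" if b: "b \<in> Basis" for b
      using L2_on_mult_integrable[OF vL test_function_L2[OF \<Omega>(1,2) test_function_partial_deriv[OF \<psi> b]]]
        L2_on_mult_integrable[OF L2_on_component[OF HL] test_function_L2[OF \<Omega>(1,2) \<psi>]] by auto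
    have w: "(LINT x:\<Omega>|lborel. v x * partial_deriv b (\<psi> b) x) = - (LINT x:\<Omega>|lborel. (H x \<bullet> b) * \<psi> b x)"
      if "b \<in> Basis" for b using v(1) \<psi> that by (auto simp: H1_pair_def weak_gradient_def)
    have S1: "(\<Sum>b\<in>Basis. v x * partial_deriv b (\<psi> b) x) = \<eta> n x * ((real DIM('a) * \<gamma> x + D x) * v x)
        + v x * \<gamma> x * frechet_derivative (\<eta> n) (at x) (x - y)" for x
    proof -
      have "(\<Sum>b\<in>Basis. v x * partial_deriv b (\<psi> b) x) = v x * (\<eta> n x * (\<Sum>b\<in>Basis. \<gamma> x + ((x - y) \<bullet> b) * partial_deriv b \<gamma> x)
        + \<gamma> x * (\<Sum>b\<in>Basis. ((x - y) \<bullet> b) * partial_deriv b (\<eta> n) x))"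
        by (simp add: pd sum_distrib_left[symmetric] sum.distrib)
      also have "(\<Sum>b\<in>Basis. ((x - y) \<bullet> b) * partial_deriv b (\<eta> n) x) = frechet_derivative (\<eta> n) (at x) (x - y)"
        by (rule frechet_derivative_basis_expansion[OF test_function_differentiable[OF \<eta>(1)], symmetric])
      also have "(\<Sum>b\<in>Basis. \<gamma> x + ((x - y) \<bullet> b) * partial_deriv b \<gamma> x) = real DIM('a) * \<gamma> x + D x"
        by (simp add: sum.distrib D_def frechet_derivative_basis_expansion[OF \<gamma>d])
      finally show ?thesis by (simp add: algebra_simps)
    qed
    have S2: "(\<Sum>b\<in>Basis. (H x \<bullet> b) * \<psi> b x) = \<eta> n x * (\<gamma> x * ((x - y) \<bullet> H x))" for x
    proof -
      have "(\<Sum>b\<in>Basis. (H x \<bullet> b) * \<psi> b x) = (\<eta> n x * \<gamma> x) * (\<Sum>b\<in>Basis. ((x - y) \<bullet> b) * (H x \<bullet> b))"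
        unfolding sum_distrib_left by (intro sum.cong refl) (simp add: \<psi>_def)
      then show ?thesis by (simp add: euclidean_inner[of "x - y" "H x"])
    qed
    have sum_int: "set_integrable lborel \<Omega> (\<lambda>x. \<Sum>b\<in>Basis. v x * partial_deriv b (\<psi> b) x)"
      "set_integrable lborel \<Omega> (\<lambda>x. \<Sum>b\<in>Basis. (H x \<bullet> b) * \<psi> b x)"
      using i1 i2 unfolding set_integrable_def scaleR_sum_right
      by (intro Bochner_Integration.integrable_sum; blast)+
    have "(LINT x:\<Omega>|lborel. (\<Sum>b\<in>Basis. v x * partial_deriv b (\<psi> b) x)) + (LINT x:\<Omega>|lborel. (\<Sum>b\<in>Basis. (H x \<bullet> b) * \<psi> b x))
      = (\<Sum>b\<in>Basis. (LINT x:\<Omega>|lborel. v x * partial_deriv b (\<psi> b) x)) + (\<Sum>b\<in>Basis. (LINT x:\<Omega>|lborel. (H x \<bullet> b) * \<psi> b x))"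
      using i1 i2 unfolding set_lebesgue_integral_def set_integrable_def scaleR_sum_right
      by (intro arg_cong2[where f = "(+)"] Bochner_Integration.integral_sum; blast)
    also have "\<dots> = 0" using w by (simp add: sum_negf)
    finally have "0 = (LINT x:\<Omega>|lborel. (\<Sum>b\<in>Basis. v x * partial_deriv b (\<psi> b) x) + (\<Sum>b\<in>Basis. (H x \<bullet> b) * \<psi> b x))"
      using set_integral_add(2)[OF sum_int] by simp
    also have "\<dots> = (LINT x:\<Omega>|lborel. \<eta> n x * F x + v x * \<gamma> x * frechet_derivative (\<eta> n) (at x) (x - y))"
      unfolding S1 S2 F_def by (simp add: algebra_simps)
    also have "\<dots> \<le> (LINT x:\<Omega>|lborel. \<eta> n x * F x)"
    proof (rule set_integral_mono)
      show "set_integrable lborel \<Omega> (\<lambda>x. \<eta> n x * F x + v x * \<gamma> x * frechet_derivative (\<eta> n) (at x) (x - y))"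
        using set_integral_add(1)[OF sum_int] unfolding S1 S2 F_def by (simp add: algebra_simps)
      have m: "\<eta> n \<in> borel_measurable borel" using test_function_measurable[OF \<eta>(1)] .
      have "integrable lborel (\<lambda>x. \<eta> n x * (indicator \<Omega> x *\<^sub>R F x))"
        by (rule Bochner_Integration.integrable_bound[OF Fi[unfolded set_integrable_def]])
          (use m Fi \<eta>(2,3) in \<open>auto simp: set_integrable_def abs_mult intro!: borel_measurable_times mult_left_le_one_le\<close>)
      then show "set_integrable lborel \<Omega> (\<lambda>x. \<eta> n x * F x)" by (simp add: set_integrable_def mult.left_commute)
      show "\<eta> n x * F x + v x * \<gamma> x * frechet_derivative (\<eta> n) (at x) (x - y) \<le> \<eta> n x * F x" for x
        using \<eta>(4)[of n x] v(2) \<gamma>(2) by (simp add: mult_nonneg_nonpos)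
    qed
    finally show ?thesis .
  qed
  have "(\<lambda>n. LINT x|lborel. \<eta> n x * (indicator \<Omega> x *\<^sub>R F x)) \<longlonglongrightarrow> (LINT x|lborel. indicator \<Omega> x *\<^sub>R F x)"
  proof (rule integral_dominated_convergence)
    show "integrable lborel (\<lambda>x. norm (indicator \<Omega> x *\<^sub>R F x))" using Fi unfolding set_integrable_def by (rule integrable_norm)
    show "AE x in lborel. (\<lambda>n. \<eta> n x * (indicator \<Omega> x *\<^sub>R F x)) \<longlonglongrightarrow> indicator \<Omega> x *\<^sub>R F x"
    proof (rule AE_I2)
      fix x
      show "(\<lambda>n. \<eta> n x * (indicator \<Omega> x *\<^sub>R F x)) \<longlonglongrightarrow> indicator \<Omega> x *\<^sub>R F x"
        using tendsto_mult_right[OF \<eta>(5), of x "F x"] by (cases "x \<in> \<Omega>") auto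
    qed
    show "AE x in lborel. norm (\<eta> n x * (indicator \<Omega> x *\<^sub>R F x)) \<le> norm (indicator \<Omega> x *\<^sub>R F x)" for n
      using \<eta>(2,3) by (auto simp: abs_mult intro!: mult_left_le_one_le)
    show "(\<lambda>x. \<eta> n x * (indicator \<Omega> x *\<^sub>R F x)) \<in> borel_measurable lborel" for n
      using test_function_measurable[OF \<eta>(1)[of n]] Fi by (intro borel_measurable_times) (auto simp: set_integrable_def)
  qed (use Fi in \<open>auto simp: set_integrable_def\<close>)
  then have "0 \<le> (LINT x|lborel. indicator \<Omega> x *\<^sub>R F x)"
    by (rule LIMSEQ_le_const) (use step in \<open>auto simp: set_lebesgue_integral_def mult.left_commute\<close>)
  then show ?thesis by (simp add: set_lebesgue_integral_def F_def D_def)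
qed

end

section \<open>Gaussians and the Fourier transform\<close>

lemma (in pair_sigma_finite) integrable_product_mult:
  fixes f g :: "_ \<Rightarrow> real"
  assumes f: "integrable M1 f" and g: "integrable M2 g"
  shows "integrable (M1 \<Otimes>\<^sub>M M2) (\<lambda>p. f (fst p) * g (snd p))"
proof (rule Fubini_integrable)
  have [measurable]: "f \<in> borel_measurable M1" "g \<in> borel_measurable M2" using f g by auto
  show "(\<lambda>p. f (fst p) * g (snd p)) \<in> borel_measurable (M1 \<Otimes>\<^sub>M M2)" by measurable
  show "integrable M1 (\<lambda>x. LINT y|M2. norm (f (fst (x, y)) * g (snd (x, y))))"
    using f by (simp add: abs_mult)
  show "AE x in M1. integrable M2 (\<lambda>y. f (fst (x, y)) * g (snd (x, y)))"
    using g by simp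
qed

definition heat_kernel :: "real \<Rightarrow> 'a::euclidean_space \<Rightarrow> real" where
  "heat_kernel t x = (4 * pi * t) powr (- real DIM('a) / 2) * exp (- (norm x)\<^sup>2 / (4 * t))"

text \<open>This is the characteristic function of the standard normal distribution after the substitution \<open>x = sqrt (2 * t) * \<xi>\<close>.\<close>

lemma gaussian_fourier_1d:
  assumes t: "t > 0"
  shows "integrable lborel (\<lambda>\<xi>::real. exp (- \<i> * of_real (\<xi> * y)) * of_real (exp (- t * \<xi>\<^sup>2)))"
    and "(LINT \<xi>|lborel. exp (- \<i> * of_real (\<xi> * y)) * of_real (exp (- t * \<xi>\<^sup>2)))
      = complex_of_real (sqrt (pi / t) * exp (- y\<^sup>2 / (4 * t)))"
proof -
  define c where "c = sqrt (2 * t)"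
  have c: "c > 0" "c\<^sup>2 = 2 * t" using t by (auto simp: c_def)
  define s where "s = - y / c"
  define f where "f x = std_normal_density x *\<^sub>R iexp (s * x)" for x
  have [measurable]: "f \<in> borel_measurable borel" unfolding f_def by measurable
  have fi: "integrable lborel f"
  proof (rule Bochner_Integration.integrable_bound)
    show "integrable lborel std_normal_density" by (rule integrable_normal_density) simp
    show "AE x in lborel. norm (f x) \<le> norm (std_normal_density x)" by (auto simp: f_def norm_mult)
  qed simp
  have fI: "(LINT x|lborel. f x) = exp (- (s\<^sup>2) / 2)"
  proof -
    have "(LINT x|lborel. f x) = char std_normal_distribution s"
      unfolding char_def f_def by (subst integral_density) (auto simp: normal_density_nonneg)
    then show ?thesis by (simp add: char_std_normal_distribution)
  qed
  have eq: "exp (- \<i> * of_real (\<xi> * y)) * of_real (exp (- t * \<xi>\<^sup>2)) = sqrt (2 * pi) *\<^sub>R f (0 + c *\<^sub>R \<xi>)" for \<xi>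
  proof -
    have "iexp (s * (c * \<xi>)) = exp (- \<i> * of_real (\<xi> * y))" using c by (simp add: s_def mult.commute)
    moreover have "std_normal_density (c * \<xi>) = exp (- t * \<xi>\<^sup>2) / sqrt (2 * pi)"
      using c by (simp add: std_normal_density_def power_mult_distrib)
    ultimately show ?thesis by (simp add: f_def scaleR_conv_of_real mult.commute)
  qed
  show "integrable lborel (\<lambda>\<xi>::real. exp (- \<i> * of_real (\<xi> * y)) * of_real (exp (- t * \<xi>\<^sup>2)))"
    unfolding eq using fi c by (intro integrable_scaleR_right) (subst lborel_integral_affine(2); simp)
  have "(LINT \<xi>|lborel. exp (- \<i> * of_real (\<xi> * y)) * of_real (exp (- t * \<xi>\<^sup>2))) = sqrt (2 * pi) *\<^sub>R ((1 / c) *\<^sub>R complex_of_real (exp (- (s\<^sup>2) / 2)))"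
    unfolding eq integral_scaleR_right using c by (subst lborel_integral_affine(1)) (simp_all add: fI exp_of_real)
  also have "\<dots> = complex_of_real ((sqrt (2 * pi) / c) * exp (- (s\<^sup>2) / 2))" by (simp add: scaleR_conv_of_real)
  also have "sqrt (2 * pi) / c = sqrt (pi / t)" using t by (simp add: c_def real_sqrt_divide[symmetric])
  also have "- (s\<^sup>2) / 2 = - y\<^sup>2 / (4 * t)" using c t by (simp add: s_def power_divide)
  finally show "(LINT \<xi>|lborel. exp (- \<i> * of_real (\<xi> * y)) * of_real (exp (- t * \<xi>\<^sup>2)))
      = complex_of_real (sqrt (pi / t) * exp (- y\<^sup>2 / (4 * t)))" .
qed

lemma lborel_integral_prod_Basis:
  fixes f :: "'a::euclidean_space \<Rightarrow> real \<Rightarrow> complex"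
  assumes f: "\<And>b. b \<in> Basis \<Longrightarrow> integrable lborel (f b)"
  shows "integrable lborel (\<lambda>x. \<Prod>b\<in>Basis. f b (x \<bullet> b))"
    and "(LINT x|lborel. (\<Prod>b\<in>Basis. f b (x \<bullet> b))) = (\<Prod>b\<in>Basis. LINT y|lborel. f b y)"
proof -
  interpret product_sigma_finite "\<lambda>b::'a. lborel :: real measure" by standard
  have [measurable]: "b \<in> Basis \<Longrightarrow> f b \<in> borel_measurable borel" for b using f by auto
  have eq: "(\<Prod>b\<in>Basis. f b ((\<Sum>b\<in>Basis. g b *\<^sub>R b) \<bullet> b)) = (\<Prod>b\<in>Basis. f b (g b))" for g
    by (intro prod.cong refl) simp
  have m: "(\<lambda>x::'a. \<Prod>b\<in>Basis. f b (x \<bullet> b)) \<in> borel_measurable borel" by measurable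
  have m2: "(\<lambda>g. \<Sum>b\<in>Basis. g b *\<^sub>R b) \<in> (\<Pi>\<^sub>M b\<in>(Basis::'a set). (lborel::real measure)) \<rightarrow>\<^sub>M borel" by measurable
  have L: "(lborel :: 'a measure) = distr (\<Pi>\<^sub>M b\<in>Basis. lborel) borel (\<lambda>g. \<Sum>b\<in>Basis. g b *\<^sub>R b)"
    unfolding lborel_eq_real by (rule lborel_def)
  show "integrable lborel (\<lambda>x. \<Prod>b\<in>Basis. f b (x \<bullet> b))"
    unfolding L by (subst integrable_distr_eq[OF m2 m]) (simp only: eq, rule product_integrable_prod[OF finite_Basis f])
  show "(LINT x|lborel. (\<Prod>b\<in>Basis. f b (x \<bullet> b))) = (\<Prod>b\<in>Basis. LINT y|lborel. f b y)"
    unfolding L by (subst integral_distr[OF m2 m]) (simp only: eq, rule product_integral_prod[OF finite_Basis f])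
qed

lemma gaussian_fourier:
  fixes x :: "'a::euclidean_space"
  assumes t: "t > 0"
  shows "integrable lborel (\<lambda>\<xi>::'a. exp (- \<i> * of_real (\<xi> \<bullet> x)) * of_real (exp (- t * (norm \<xi>)\<^sup>2)))"
    and "(LINT \<xi>|lborel. exp (- \<i> * of_real (\<xi> \<bullet> x)) * of_real (exp (- t * (norm \<xi>)\<^sup>2)))
      = complex_of_real ((2 * pi) ^ DIM('a) * heat_kernel t x)"
proof -
  have eq: "exp (- \<i> * of_real (\<xi> \<bullet> x)) * of_real (exp (- t * (norm \<xi>)\<^sup>2))
    = (\<Prod>b\<in>Basis. exp (- \<i> * of_real ((\<xi> \<bullet> b) * (x \<bullet> b))) * of_real (exp (- t * (\<xi> \<bullet> b)\<^sup>2)))" for \<xi> :: 'a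
  proof -
    have "- \<i> * of_real (\<xi> \<bullet> x) = (\<Sum>b\<in>Basis. - \<i> * of_real ((\<xi> \<bullet> b) * (x \<bullet> b)))"
      unfolding sum_distrib_left[symmetric] by (subst euclidean_inner) simp
    moreover have "(norm \<xi>)\<^sup>2 = (\<Sum>b\<in>Basis. (\<xi> \<bullet> b)\<^sup>2)"
      unfolding power2_norm_eq_inner by (subst euclidean_inner) (simp add: power2_eq_square)
    then have "- t * (norm \<xi>)\<^sup>2 = (\<Sum>b\<in>Basis. - t * (\<xi> \<bullet> b)\<^sup>2)" by (simp add: sum_distrib_left)
    ultimately show ?thesis by (simp only: exp_sum finite_Basis prod.distrib of_real_prod)
  qed
  note 1 = gaussian_fourier_1d[OF t]
  show "integrable lborel (\<lambda>\<xi>::'a. exp (- \<i> * of_real (\<xi> \<bullet> x)) * of_real (exp (- t * (norm \<xi>)\<^sup>2)))"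
    unfolding eq by (rule lborel_integral_prod_Basis(1)[where f = "\<lambda>b \<zeta>. exp (- \<i> * of_real (\<zeta> * (x \<bullet> b))) * of_real (exp (- t * \<zeta>\<^sup>2))"]) (rule 1)
  have "(LINT \<xi>|lborel. exp (- \<i> * of_real (\<xi> \<bullet> x)) * of_real (exp (- t * (norm \<xi>)\<^sup>2)))
    = (\<Prod>b\<in>(Basis::'a set). complex_of_real (sqrt (pi / t) * exp (- (x \<bullet> b)\<^sup>2 / (4 * t))))"
    unfolding eq by (subst lborel_integral_prod_Basis(2)[where f = "\<lambda>b \<zeta>. exp (- \<i> * of_real (\<zeta> * (x \<bullet> b))) * of_real (exp (- t * \<zeta>\<^sup>2))"])
      (rule 1, simp only: 1)
  also have "\<dots> = complex_of_real (sqrt (pi / t) ^ DIM('a) * exp (\<Sum>b\<in>(Basis::'a set). - (x \<bullet> b)\<^sup>2 / (4 * t)))"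
    by (simp only: of_real_prod[symmetric] prod.distrib exp_sum finite_Basis prod_constant)
  also have "(\<Sum>b\<in>(Basis::'a set). - (x \<bullet> b)\<^sup>2 / (4 * t)) = - (norm x)\<^sup>2 / (4 * t)"
    unfolding power2_norm_eq_inner by (subst euclidean_inner) (simp add: power2_eq_square sum_divide_distrib sum_negf)
  also have "sqrt (pi / t) ^ DIM('a) = (2 * pi) ^ DIM('a) * (4 * pi * t) powr (- real DIM('a) / 2)"
  proof -
    have p: "4 * pi * t > 0" using t by simp
    have "(4 * pi * t) powr (- real DIM('a) / 2) = (1 / sqrt (4 * pi * t)) ^ DIM('a)"
    proof -
      have "(4 * pi * t) powr (- real DIM('a) / 2) = ((4 * pi * t) powr (- (1 / 2))) powr real DIM('a)"
        by (simp add: powr_powr)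
      also have "(4 * pi * t) powr (- (1 / 2)) = 1 / sqrt (4 * pi * t)"
        unfolding powr_minus powr_half_sqrt[OF less_imp_le[OF p]] by (rule inverse_eq_divide)
      also have "(1 / sqrt (4 * pi * t)) powr real DIM('a) = (1 / sqrt (4 * pi * t)) ^ DIM('a)"
        using p by (intro powr_realpow) simp
      finally show ?thesis .
    qed
    moreover have "sqrt (pi / t) = 2 * pi * (1 / sqrt (4 * pi * t))"
    proof (rule power2_eq_imp_eq)
      have "(2 * pi * (1 / sqrt (4 * pi * t)))\<^sup>2 = 4 * pi\<^sup>2 * (1 / (4 * pi * t))"
        unfolding power_mult_distrib power_divide real_sqrt_pow2[OF less_imp_le[OF p]] by simp
      also have "\<dots> = pi / t" using t by (simp add: power2_eq_square)
      finally show "(sqrt (pi / t))\<^sup>2 = (2 * pi * (1 / sqrt (4 * pi * t)))\<^sup>2"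
        using t by simp
    qed (use t in auto)
    ultimately show ?thesis by (metis power_mult_distrib)
  qed
  finally show "(LINT \<xi>|lborel. exp (- \<i> * of_real (\<xi> \<bullet> x)) * of_real (exp (- t * (norm \<xi>)\<^sup>2)))
      = complex_of_real ((2 * pi) ^ DIM('a) * heat_kernel t x)" by (simp add: heat_kernel_def)
qed

lemma heat_kernel_pos: "t > 0 \<Longrightarrow> 0 < heat_kernel t x"
  by (simp add: heat_kernel_def)

lemma heat_kernel_measurable [measurable]: "heat_kernel t \<in> borel_measurable borel"
  unfolding heat_kernel_def by measurable

lemma heat_kernel_gaussian:
  fixes x :: "'a::euclidean_space"
  assumes t: "t > 0"
  shows "heat_kernel t x = (4 * pi * t) powr (- real DIM('a) / 2) * exp (- (1 / (4 * t)) * (norm x)\<^sup>2)"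
  by (simp add: heat_kernel_def)

lemma heat_kernel_integral:
  assumes t: "t > 0"
  shows "integrable lborel (heat_kernel t :: 'a::euclidean_space \<Rightarrow> real)"
    and "(LINT x|lborel. heat_kernel t (x::'a)) = 1"
proof -
  define r where "r = 1 / (4 * t)"
  have r: "r > 0" using t by (simp add: r_def)
  let ?e = "\<lambda>x::'a. complex_of_real (exp (- r * (norm x)\<^sup>2))"
  have i: "integrable lborel ?e" using gaussian_fourier(1)[OF r, of 0] by simp
  have ir: "integrable lborel (\<lambda>x::'a. exp (- r * (norm x)\<^sup>2))"
    using i complex_of_real_integrable_eq by blast
  then show "integrable lborel (heat_kernel t :: 'a \<Rightarrow> real)"
    by (simp add: heat_kernel_gaussian[OF t, abs_def] r_def)
  have "complex_of_real (LINT x|lborel. exp (- r * (norm (x::'a))\<^sup>2)) = complex_of_real ((2 * pi) ^ DIM('a) * heat_kernel r (0::'a))"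
    using gaussian_fourier(2)[OF r, of "0::'a"] by simp
  then have "(LINT x|lborel. exp (- r * (norm (x::'a))\<^sup>2)) = (2 * pi) ^ DIM('a) * heat_kernel r (0::'a)"
    using of_real_eq_iff by blast
  then have "(LINT x|lborel. heat_kernel t (x::'a)) = (4 * pi * t) powr (- real DIM('a) / 2) * ((2 * pi) ^ DIM('a) * (4 * pi * r) powr (- real DIM('a) / 2))"
    by (simp add: heat_kernel_gaussian[OF t] r_def[symmetric] heat_kernel_def[of r])
  also have "\<dots> = ((4 * pi * t) * (4 * pi * r)) powr (- real DIM('a) / 2) * (2 * pi) ^ DIM('a)"
  proof -
    have "((4 * pi * t) * (4 * pi * r)) powr a = (4 * pi * t) powr a * (4 * pi * r) powr a" for a
      by (rule powr_mult)
    then show ?thesis by (simp only: mult_ac)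
  qed
  also have "(4 * pi * t) * (4 * pi * r) = (2 * pi) powr 2" using t by (simp add: r_def power2_eq_square powr_numeral)
  also have "((2 * pi) powr 2) powr (- real DIM('a) / 2) = inverse ((2 * pi) ^ DIM('a))"
  proof -
    have "((2 * pi) powr 2) powr (- real DIM('a) / 2) = (2 * pi) powr (- real DIM('a))"
      unfolding powr_powr by (rule arg_cong[where f = "\<lambda>z. (2 * pi) powr z"]) simp
    also have "\<dots> = inverse ((2 * pi) ^ DIM('a))" by (subst powr_minus, subst powr_realpow) auto
    finally show ?thesis .
  qed
  also have "inverse ((2 * pi) ^ DIM('a)) * (2 * pi) ^ DIM('a) = 1"
    by (rule left_inverse) simp
  finally show "(LINT x|lborel. heat_kernel t (x::'a)) = 1" .
qed

text \<open>The bilinear form of the heat semigroup on the whole space.\<close>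

definition heat_form :: "real \<Rightarrow> ('a::euclidean_space \<Rightarrow> real) \<Rightarrow> ('a \<Rightarrow> real) \<Rightarrow> real" where
  "heat_form t u \<phi> = (LINT x|lborel. u x * convolve \<phi> (heat_kernel t) x)"

lemma heat_kernel_le: "t > 0 \<Longrightarrow> heat_kernel t (x::'a::euclidean_space) \<le> (4 * pi * t) powr (- real DIM('a) / 2)"
  by (simp add: heat_kernel_def)

lemma heat_form_integrable:
  fixes u \<phi> :: "'a::euclidean_space \<Rightarrow> real"
  assumes t: "t > 0" and u: "integrable lborel u" and \<phi>: "integrable lborel \<phi>"
  shows "integrable (lborel \<Otimes>\<^sub>M lborel) (\<lambda>p. heat_kernel t (fst p - snd p) * (u (fst p) * \<phi> (snd p)))"
proof (rule Bochner_Integration.integrable_bound)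
  have [measurable]: "u \<in> borel_measurable borel" "\<phi> \<in> borel_measurable borel" using u \<phi> by auto
  let ?C = "(4 * pi * t) powr (- real DIM('a) / 2)"
  show "integrable (lborel \<Otimes>\<^sub>M lborel) (\<lambda>p. ?C * (u (fst p) * \<phi> (snd p)))"
    by (intro integrable_mult_right lborel_pair.integrable_product_mult u \<phi>)
  show "(\<lambda>p. heat_kernel t (fst p - snd p) * (u (fst p) * \<phi> (snd p))) \<in> borel_measurable (lborel \<Otimes>\<^sub>M lborel)" by measurable
  show "AE p in lborel \<Otimes>\<^sub>M lborel. norm (heat_kernel t (fst p - snd p) * (u (fst p) * \<phi> (snd p))) \<le> norm (?C * (u (fst p) * \<phi> (snd p)))"
  proof (rule AE_I2)
    fix p :: "'a \<times> 'a"
    have "\<bar>heat_kernel t (fst p - snd p)\<bar> \<le> \<bar>?C\<bar>"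
      using heat_kernel_le[OF t, of "fst p - snd p"] heat_kernel_pos[OF t, of "fst p - snd p"] by linarith
    then show "norm (heat_kernel t (fst p - snd p) * (u (fst p) * \<phi> (snd p))) \<le> norm (?C * (u (fst p) * \<phi> (snd p)))"
      unfolding real_norm_def abs_mult[of _ "u (fst p) * \<phi> (snd p)"] by (rule mult_right_mono) simp
  qed
qed

lemma heat_form_pair:
  fixes u \<phi> :: "'a::euclidean_space \<Rightarrow> real"
  assumes t: "t > 0" and u: "integrable lborel u" and \<phi>: "integrable lborel \<phi>"
  shows "heat_form t u \<phi> = (LINT p|(lborel \<Otimes>\<^sub>M lborel). heat_kernel t (fst p - snd p) * (u (fst p) * \<phi> (snd p)))"
proof -
  have "(LINT x|lborel. LINT y|lborel. heat_kernel t (x - y) * (u x * \<phi> y)) = (LINT p|(lborel \<Otimes>\<^sub>M lborel). heat_kernel t (fst p - snd p) * (u (fst p) * \<phi> (snd p)))"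
    using lborel_pair.integral_fst'[OF heat_form_integrable[OF t u \<phi>]] by simp
  moreover have "(LINT y|lborel. heat_kernel t (x - y) * (u x * \<phi> y)) = u x * convolve \<phi> (heat_kernel t) x" for x
    unfolding convolve_def integral_mult_right_zero[symmetric] by (intro Bochner_Integration.integral_cong) auto
  ultimately show ?thesis by (simp add: heat_form_def)
qed

text \<open>Against a Gaussian weight the double Fourier integral converges absolutely, so Fubini's theorem applies and
  the frequency integral produces the heat kernel.\<close>

lemma gaussian_parseval:
  fixes u \<phi> :: "'a::euclidean_space \<Rightarrow> real"
  assumes t: "t > 0" and u: "integrable lborel u" and \<phi>: "integrable lborel \<phi>"
  shows "(LINT \<xi>|lborel. of_real (exp (- t * (norm \<xi>)\<^sup>2)) * (fourier (\<lambda>x. of_real (u x)) \<xi> * cnj (fourier (\<lambda>x. of_real (\<phi> x)) \<xi>)))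
    = complex_of_real (heat_form t u \<phi>)"
proof -
  have [measurable]: "u \<in> borel_measurable borel" "\<phi> \<in> borel_measurable borel" using u \<phi> by auto
  define c where "c = (2 * pi) powr (- real DIM('a) / 2)"
  have cc: "c * c * (2 * pi) ^ DIM('a) = 1"
  proof -
    have "c * c = (2 * pi) powr (- real DIM('a))" unfolding c_def powr_add[symmetric] by simp
    also have "\<dots> = inverse ((2 * pi) ^ DIM('a))" by (subst powr_minus, subst powr_realpow) auto
    finally have *: "c * c = inverse ((2 * pi) ^ DIM('a))" .
    have "(2 * pi) ^ DIM('a) \<noteq> 0" by simp
    then show ?thesis unfolding * by (rule left_inverse)
  qed
  define e where "e \<xi> x = exp (- \<i> * complex_of_real (\<xi> \<bullet> x))" for \<xi> x :: 'a
  have ne: "norm (e \<xi> x) = 1" for \<xi> x by (simp add: e_def)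
  have [measurable]: "(\<lambda>p. e (f p) (g p)) \<in> borel_measurable M" if "f \<in> borel_measurable M" "g \<in> borel_measurable M" for f g and M :: "'b measure"
    using that unfolding e_def by measurable
  have iu: "integrable lborel (\<lambda>x. e \<xi> x * of_real (h x))" if "integrable lborel h" for h \<xi>
    by (rule Bochner_Integration.integrable_bound[OF that]) (use that in \<open>auto simp: norm_mult ne\<close>)
  have prod: "fourier (\<lambda>x. of_real (u x)) \<xi> * cnj (fourier (\<lambda>x. of_real (\<phi> x)) \<xi>)
      = of_real (c * c) * (LINT p|(lborel \<Otimes>\<^sub>M lborel). e \<xi> (fst p - snd p) * of_real (u (fst p) * \<phi> (snd p)))" for \<xi>
  proof -
    let ?F = "\<lambda>p. e \<xi> (fst p - snd p) * of_real (u (fst p) * \<phi> (snd p))"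
    have iF: "integrable (lborel \<Otimes>\<^sub>M lborel) ?F"
      by (rule Bochner_Integration.integrable_bound[OF lborel_pair.integrable_product_mult[OF u \<phi>]])
        (auto simp: norm_mult ne)
    have "cnj (LINT x|lborel. e \<xi> x * of_real (\<phi> x)) = (LINT y|lborel. cnj (e \<xi> y) * of_real (\<phi> y))"
      unfolding Bochner_Integration.integral_cnj[symmetric] by simp
    then have "(LINT x|lborel. e \<xi> x * of_real (u x)) * cnj (LINT x|lborel. e \<xi> x * of_real (\<phi> x))
      = (LINT x|lborel. (LINT y|lborel. (e \<xi> x * of_real (u x)) * (cnj (e \<xi> y) * of_real (\<phi> y))))"
      by simp
    also have "\<dots> = (LINT x|lborel. (LINT y|lborel. ?F (x, y)))"
    proof -
      have "e \<xi> (x - y) = e \<xi> x * cnj (e \<xi> y)" for x y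
        unfolding e_def exp_cnj mult_exp_exp by (simp add: inner_diff_right algebra_simps)
      then show ?thesis by (intro Bochner_Integration.integral_cong refl) (simp add: mult_ac)
    qed
    also have "\<dots> = (LINT p|(lborel \<Otimes>\<^sub>M lborel). ?F p)" by (rule lborel_pair.integral_fst'[OF iF])
    finally show ?thesis unfolding fourier_def c_def[symmetric] e_def[symmetric] by simp
  qed
  let ?g = "\<lambda>\<xi>::'a. exp (- t * (norm \<xi>)\<^sup>2)"
  let ?U = "\<lambda>p::'a \<times> 'a. u (fst p) * \<phi> (snd p)"
  have ig: "integrable lborel ?g"
    using gaussian_fourier(1)[OF t, of "0::'a"] complex_of_real_integrable_eq[of lborel ?g] by simp
  have iU: "integrable lborel ?U"
    using lborel_pair.integrable_product_mult[OF u \<phi>] by (simp add: lborel_prod)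
  have fs: "(\<lambda>p::'a \<times> 'a. fst p) \<in> borel_measurable borel" "(\<lambda>p::'a \<times> 'a. snd p) \<in> borel_measurable borel"
    by (intro borel_measurable_continuous_onI continuous_intros)+
  have [measurable]: "(\<lambda>q::'a \<times> ('a \<times> 'a). fst (snd q)) \<in> borel_measurable (lborel \<Otimes>\<^sub>M lborel)"
    "(\<lambda>q::'a \<times> ('a \<times> 'a). snd (snd q)) \<in> borel_measurable (lborel \<Otimes>\<^sub>M lborel)"
    by (rule measurable_compose[OF measurable_snd], simp add: fs)+
  have iT: "integrable (lborel \<Otimes>\<^sub>M lborel) (\<lambda>q. of_real (?g (fst q)) * (e (fst q) (fst (snd q) - snd (snd q)) * of_real (?U (snd q))))"
    by (rule Bochner_Integration.integrable_bound[OF lborel_pair.integrable_product_mult[OF ig iU]])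
      (auto simp: norm_mult ne)
  have iT': "integrable (lborel \<Otimes>\<^sub>M lborel) (\<lambda>(\<xi>, p). of_real (?g \<xi>) * (e \<xi> (fst p - snd p) * of_real (?U p)))"
    using iT by (simp add: case_prod_unfold)
  have "(LINT \<xi>|lborel. of_real (?g \<xi>) * (fourier (\<lambda>x. of_real (u x)) \<xi> * cnj (fourier (\<lambda>x. of_real (\<phi> x)) \<xi>)))
      = (LINT \<xi>|lborel. of_real (c * c) * (LINT p|lborel. of_real (?g \<xi>) * (e \<xi> (fst p - snd p) * of_real (?U p))))"
    unfolding prod lborel_prod by (intro Bochner_Integration.integral_cong refl) simp
  also have "\<dots> = of_real (c * c) * (LINT \<xi>|lborel. LINT p|lborel. of_real (?g \<xi>) * (e \<xi> (fst p - snd p) * of_real (?U p)))"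
    by simp
  also have "(LINT \<xi>|lborel. LINT p|lborel. of_real (?g \<xi>) * (e \<xi> (fst p - snd p) * of_real (?U p)))
      = (LINT p|lborel. LINT \<xi>|lborel. of_real (?g \<xi>) * (e \<xi> (fst p - snd p) * of_real (?U p)))"
    using lborel_pair.integral_fst[OF iT'] lborel_pair.integral_snd[OF iT'] by simp
  also have "\<dots> = (LINT p|lborel. complex_of_real ((2 * pi) ^ DIM('a) * (heat_kernel t (fst p - snd p) * ?U p)))"
  proof (intro Bochner_Integration.integral_cong refl)
    fix p :: "'a \<times> 'a"
    have "(LINT \<xi>|lborel. of_real (?g \<xi>) * (e \<xi> (fst p - snd p) * of_real (?U p)))
      = (LINT \<xi>|lborel. (e \<xi> (fst p - snd p) * of_real (?g \<xi>)) * of_real (?U p))"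
      by (intro Bochner_Integration.integral_cong refl) (simp add: mult_ac)
    also have "\<dots> = (LINT \<xi>|lborel. e \<xi> (fst p - snd p) * of_real (?g \<xi>)) * of_real (?U p)"
      by simp
    also have "\<dots> = complex_of_real ((2 * pi) ^ DIM('a) * heat_kernel t (fst p - snd p)) * of_real (?U p)"
      unfolding e_def gaussian_fourier(2)[OF t] ..
    finally show "(LINT \<xi>|lborel. of_real (?g \<xi>) * (e \<xi> (fst p - snd p) * of_real (?U p))) = complex_of_real ((2 * pi) ^ DIM('a) * (heat_kernel t (fst p - snd p) * ?U p))"
      by simp
  qed
  also have "\<dots> = complex_of_real ((2 * pi) ^ DIM('a) * (LINT p|lborel. heat_kernel t (fst p - snd p) * ?U p))"
    by (simp only: integral_complex_of_real integral_mult_right_zero)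
  also have "(LINT p|lborel. heat_kernel t (fst p - snd p) * ?U p) = heat_form t u \<phi>"
    unfolding heat_form_pair[OF t u \<phi>] lborel_prod ..
  finally show ?thesis using cc by (simp only: of_real_mult[symmetric] mult.assoc[symmetric] mult_1)
qed

lemma fourier_measurable:
  fixes u :: "'a::euclidean_space \<Rightarrow> real"
  assumes u: "integrable lborel u"
  shows "fourier (\<lambda>x. of_real (u x)) \<in> borel_measurable borel"
proof -
  have [measurable]: "u \<in> borel_measurable borel" using u by auto
  show ?thesis unfolding fourier_def[abs_def] by measurable
qed

lemma fourier_bounded:
  fixes u :: "'a::euclidean_space \<Rightarrow> real"
  shows "cmod (fourier (\<lambda>x. of_real (u x)) \<xi>) \<le> (2 * pi) powr (- real DIM('a) / 2) * (LINT x|lborel. \<bar>u x\<bar>)"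
proof -
  have "cmod (LINT x|lborel. exp (- \<i> * of_real (\<xi> \<bullet> x)) * of_real (u x)) \<le> (LINT x|lborel. cmod (exp (- \<i> * of_real (\<xi> \<bullet> x)) * of_real (u x)))"
    by (rule integral_norm_bound)
  also have "\<dots> = (LINT x|lborel. \<bar>u x\<bar>)" by (simp add: norm_mult)
  finally show ?thesis by (simp add: fourier_def norm_mult mult_left_mono)
qed

text \<open>Young's inequality for the product \<open>f x * f y\<close>, and the heat kernel has mass one in either variable.\<close>

lemma heat_form_le:
  fixes f :: "'a::euclidean_space \<Rightarrow> real"
  assumes t: "t > 0" and f: "integrable lborel f" and f2: "integrable lborel (\<lambda>x. (f x)\<^sup>2)"
  shows "heat_form t f f \<le> (LINT x|lborel. (f x)\<^sup>2)"
proof -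
  have [measurable]: "f \<in> borel_measurable borel" using f by auto
  let ?h = "heat_kernel t :: 'a \<Rightarrow> real"
  have h0: "0 \<le> ?h x" for x using heat_kernel_pos[OF t] less_imp_le by blast
  have hi: "integrable lborel (\<lambda>y. ?h (x - y))" "(LINT y|lborel. ?h (x - y)) = 1" for x
    using lborel_integral_reflect[of ?h x] heat_kernel_integral[OF t, where ?'a = 'a] by auto
  have hi': "integrable lborel (\<lambda>x. ?h (x - y))" "(LINT x|lborel. ?h (x - y)) = 1" for y
    using lborel_integral_translate[of ?h "- y"] heat_kernel_integral[OF t, where ?'a = 'a] by auto
  have n1: "(\<integral>\<^sup>+y. ennreal (?h (x - y)) \<partial>lborel) = 1" and n2: "(\<integral>\<^sup>+y. ennreal (?h (y - x)) \<partial>lborel) = 1" for x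
    using hi[of x] hi'[of x] h0 by (simp_all add: nn_integral_eq_integral)
  let ?c = "\<integral>\<^sup>+x. ennreal ((f x)\<^sup>2 / 2) \<partial>lborel"
  have cI: "?c = ennreal ((LINT x|lborel. (f x)\<^sup>2) / 2)"
    using f2 by (subst nn_integral_eq_integral) auto
  have "ennreal (heat_form t f f) \<le> (\<integral>\<^sup>+p. ennreal \<bar>?h (fst p - snd p) * (f (fst p) * f (snd p))\<bar> \<partial>(lborel \<Otimes>\<^sub>M lborel))"
  proof -
    have "heat_form t f f \<le> (LINT p|(lborel \<Otimes>\<^sub>M lborel). \<bar>?h (fst p - snd p) * (f (fst p) * f (snd p))\<bar>)"
      unfolding heat_form_pair[OF t f f] using heat_form_integrable[OF t f f] by (intro integral_mono) auto
    then show ?thesis using heat_form_integrable[OF t f f]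
      by (subst nn_integral_eq_integral) (auto intro: ennreal_leI)
  qed
  also have "\<dots> \<le> (\<integral>\<^sup>+p. ennreal (?h (fst p - snd p)) * ennreal ((f (fst p))\<^sup>2 / 2) + ennreal (?h (fst p - snd p)) * ennreal ((f (snd p))\<^sup>2 / 2) \<partial>(lborel \<Otimes>\<^sub>M lborel))"
  proof (rule nn_integral_mono)
    fix p :: "'a \<times> 'a"
    have "\<bar>f (fst p) * f (snd p)\<bar> \<le> (f (fst p))\<^sup>2 / 2 + (f (snd p))\<^sup>2 / 2"
      using sum_squares_bound[of "\<bar>f (fst p)\<bar>" "\<bar>f (snd p)\<bar>"] by (simp add: abs_mult)
    then have "\<bar>?h (fst p - snd p) * (f (fst p) * f (snd p))\<bar> \<le> ?h (fst p - snd p) * ((f (fst p))\<^sup>2 / 2) + ?h (fst p - snd p) * ((f (snd p))\<^sup>2 / 2)"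
      unfolding abs_mult[of "?h (fst p - snd p)"] distrib_left[symmetric] abs_of_nonneg[OF h0]
      by (rule mult_left_mono[OF _ h0])
    then show "ennreal \<bar>?h (fst p - snd p) * (f (fst p) * f (snd p))\<bar> \<le> ennreal (?h (fst p - snd p)) * ennreal ((f (fst p))\<^sup>2 / 2) + ennreal (?h (fst p - snd p)) * ennreal ((f (snd p))\<^sup>2 / 2)"
      using h0[of "fst p - snd p"] by (simp add: ennreal_mult[symmetric] ennreal_plus[symmetric] ennreal_leI del: ennreal_plus)
  qed
  also have "\<dots> = (\<integral>\<^sup>+p. ennreal (?h (fst p - snd p)) * ennreal ((f (fst p))\<^sup>2 / 2) \<partial>(lborel \<Otimes>\<^sub>M lborel)) + (\<integral>\<^sup>+p. ennreal (?h (fst p - snd p)) * ennreal ((f (snd p))\<^sup>2 / 2) \<partial>(lborel \<Otimes>\<^sub>M lborel))"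
    by (rule nn_integral_add) measurable
  also have "(\<integral>\<^sup>+p. ennreal (?h (fst p - snd p)) * ennreal ((f (fst p))\<^sup>2 / 2) \<partial>(lborel \<Otimes>\<^sub>M lborel)) = ?c"
    by (subst lborel.nn_integral_fst[symmetric]) (simp_all add: nn_integral_multc n1)
  also have "(\<integral>\<^sup>+p. ennreal (?h (fst p - snd p)) * ennreal ((f (snd p))\<^sup>2 / 2) \<partial>(lborel \<Otimes>\<^sub>M lborel)) = ?c"
    by (subst lborel_pair.nn_integral_snd[symmetric]) (simp_all add: nn_integral_multc n2)
  also have "?c + ?c = ennreal (LINT x|lborel. (f x)\<^sup>2)"
    unfolding cI by (subst ennreal_plus[symmetric]) auto
  finally show ?thesis by (simp add: ennreal_le_iff)
qed

text \<open>The half of Plancherel's theorem that is needed: remove the Gaussian weight in \<open>gaussian_parseval\<close> by Fatou's lemma.\<close>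

lemma fourier_square_integrable:
  fixes f :: "'a::euclidean_space \<Rightarrow> real"
  assumes f: "integrable lborel f" and f2: "integrable lborel (\<lambda>x. (f x)\<^sup>2)"
  shows "integrable lborel (\<lambda>\<xi>. (cmod (fourier (\<lambda>x. of_real (f x)) \<xi>))\<^sup>2)"
proof -
  let ?F = "fourier (\<lambda>x. complex_of_real (f x))"
  have [measurable]: "?F \<in> borel_measurable borel" by (rule fourier_measurable[OF f])
  define C where "C = (2 * pi) powr (- real DIM('a) / 2) * (LINT x|lborel. \<bar>f x\<bar>)"
  have C: "(cmod (?F \<xi>))\<^sup>2 \<le> C\<^sup>2" for \<xi> unfolding C_def by (intro power_mono fourier_bounded) simp
  have bound: "(\<integral>\<^sup>+\<xi>. ennreal (exp (- t * (norm \<xi>)\<^sup>2) * (cmod (?F \<xi>))\<^sup>2) \<partial>lborel) \<le> ennreal (LINT x|lborel. (f x)\<^sup>2)"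
    if t: "t > 0" for t
  proof -
    have ig: "integrable lborel (\<lambda>\<xi>::'a. exp (- t * (norm \<xi>)\<^sup>2))"
      using gaussian_fourier(1)[OF t, of "0::'a"] complex_of_real_integrable_eq[of lborel "\<lambda>\<xi>::'a. exp (- t * (norm \<xi>)\<^sup>2)"] by simp
    have i: "integrable lborel (\<lambda>\<xi>. exp (- t * (norm \<xi>)\<^sup>2) * (cmod (?F \<xi>))\<^sup>2)"
    proof (rule Bochner_Integration.integrable_bound)
      show "integrable lborel (\<lambda>\<xi>::'a. C\<^sup>2 * exp (- t * (norm \<xi>)\<^sup>2))" using ig by simp
      show "AE \<xi> in lborel. norm (exp (- t * (norm \<xi>)\<^sup>2) * (cmod (?F \<xi>))\<^sup>2) \<le> norm (C\<^sup>2 * exp (- t * (norm \<xi>)\<^sup>2))"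
        using C by (auto simp: abs_mult mult.commute intro!: mult_right_mono)
    qed measurable
    have "complex_of_real (LINT \<xi>|lborel. exp (- t * (norm \<xi>)\<^sup>2) * (cmod (?F \<xi>))\<^sup>2)
      = (LINT \<xi>|lborel. of_real (exp (- t * (norm \<xi>)\<^sup>2)) * (?F \<xi> * cnj (?F \<xi>)))"
      by (subst integral_complex_of_real[symmetric]) (simp only: of_real_mult complex_norm_square)
    also have "\<dots> = complex_of_real (heat_form t f f)" by (rule gaussian_parseval[OF t f f])
    finally have "(LINT \<xi>|lborel. exp (- t * (norm \<xi>)\<^sup>2) * (cmod (?F \<xi>))\<^sup>2) = heat_form t f f"
      using of_real_eq_iff by blast
    then show ?thesis using heat_form_le[OF t f f2] i by (simp add: nn_integral_eq_integral ennreal_leI)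
  qed
  define t where "t n = inverse (real (Suc n))" for n
  have t: "t n > 0" for n by (simp add: t_def)
  have t0: "t \<longlonglongrightarrow> 0" unfolding t_def by (rule LIMSEQ_inverse_real_of_nat)
  have "(\<integral>\<^sup>+\<xi>. ennreal ((cmod (?F \<xi>))\<^sup>2) \<partial>lborel) = (\<integral>\<^sup>+\<xi>. liminf (\<lambda>n. ennreal (exp (- t n * (norm \<xi>)\<^sup>2) * (cmod (?F \<xi>))\<^sup>2)) \<partial>lborel)"
  proof (intro nn_integral_cong)
    fix \<xi> :: 'a
    have "(\<lambda>n. exp (- t n * (norm \<xi>)\<^sup>2) * (cmod (?F \<xi>))\<^sup>2) \<longlonglongrightarrow> exp (- 0 * (norm \<xi>)\<^sup>2) * (cmod (?F \<xi>))\<^sup>2"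
      by (intro tendsto_intros t0)
    then have "(\<lambda>n. ennreal (exp (- t n * (norm \<xi>)\<^sup>2) * (cmod (?F \<xi>))\<^sup>2)) \<longlonglongrightarrow> ennreal ((cmod (?F \<xi>))\<^sup>2)"
      by (intro tendsto_ennrealI) simp
    from lim_imp_Liminf[OF sequentially_bot this]
    show "ennreal ((cmod (?F \<xi>))\<^sup>2) = liminf (\<lambda>n. ennreal (exp (- t n * (norm \<xi>)\<^sup>2) * (cmod (?F \<xi>))\<^sup>2))"
      by (rule sym)
  qed
  also have "\<dots> \<le> liminf (\<lambda>n. (\<integral>\<^sup>+\<xi>. ennreal (exp (- t n * (norm \<xi>)\<^sup>2) * (cmod (?F \<xi>))\<^sup>2) \<partial>lborel))"
    by (rule nn_integral_liminf) measurable
  also have "\<dots> \<le> ennreal (LINT x|lborel. (f x)\<^sup>2)"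
    using bound[OF t] by (intro order_trans[OF Liminf_le_Limsup] Limsup_bounded) auto
  finally show ?thesis by (intro integrableI_bounded) (auto simp: less_top[symmetric] top_unique)
qed

lemma fourier_integral_of_real:
  fixes f :: "'a::euclidean_space \<Rightarrow> real"
  assumes f: "integrable lborel f"
  shows "(LINT x|lborel. exp (- \<i> * of_real (\<xi> \<bullet> x)) * of_real (f x))
    = Complex (LINT x|lborel. cos (\<xi> \<bullet> x) * f x) (- (LINT x|lborel. sin (\<xi> \<bullet> x) * f x))"
proof -
  have [measurable]: "f \<in> borel_measurable borel" using f by auto
  have i: "integrable lborel (\<lambda>x. exp (- \<i> * of_real (\<xi> \<bullet> x)) * complex_of_real (f x))"
    by (rule Bochner_Integration.integrable_bound[OF f]) (auto simp: norm_mult)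
  have e: "exp (- (\<i> * of_real s)) = Complex (cos s) (- sin s)" for s
    using cis_conv_exp[of "- s"] by (simp add: complex_eq_iff)
  show ?thesis
  proof (rule complex_eqI)
    show "Re (LINT x|lborel. exp (- \<i> * of_real (\<xi> \<bullet> x)) * complex_of_real (f x)) = Re (Complex (LINT x|lborel. cos (\<xi> \<bullet> x) * f x) (- (LINT x|lborel. sin (\<xi> \<bullet> x) * f x)))"
      by (subst integral_Re[OF i, symmetric]) (simp add: e)
    show "Im (LINT x|lborel. exp (- \<i> * of_real (\<xi> \<bullet> x)) * complex_of_real (f x)) = Im (Complex (LINT x|lborel. cos (\<xi> \<bullet> x) * f x) (- (LINT x|lborel. sin (\<xi> \<bullet> x) * f x)))"
      by (subst integral_Im[OF i, symmetric]) (simp add: e)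
  qed
qed

lemma integral_by_parts_test_function:
  assumes \<phi>: "test_function \<Omega> \<phi>" and b: "b \<in> Basis"
    and g: "\<And>x. (g has_derivative g' x) (at x)" "continuous_on UNIV (\<lambda>x. g' x b)"
  shows "(LINT x|lborel. g x * partial_deriv b \<phi> x) = - (LINT x|lborel. g' x b * \<phi> x)"
proof -
  have gd: "g differentiable at x" for x using g(1) differentiableI by blast
  have gc: "continuous_on UNIV g" using g(1) has_derivative_continuous continuous_at_imp_continuous_on by blast
  note \<phi>' = test_function_partial_deriv[OF \<phi> b]
  have pd: "partial_deriv b (\<lambda>x. g x * \<phi> x) = (\<lambda>x. g x * partial_deriv b \<phi> x + g' x b * \<phi> x)"
    by (rule ext) (simp add: partial_deriv_mult[OF gd test_function_differentiable[OF \<phi>]] partial_deriv_eqI[OF g(1)])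
  have i1: "integrable lborel (\<lambda>x. g x * partial_deriv b \<phi> x)"
    by (intro continuous_compact_support_integrable continuous_on_mult gc test_function_continuous[OF \<phi>']
        bounded_subset[OF test_function_bounded_support[OF \<phi>']]) auto
  have i2: "integrable lborel (\<lambda>x. g' x b * \<phi> x)"
    by (intro continuous_compact_support_integrable continuous_on_mult g(2) test_function_continuous[OF \<phi>]
        bounded_subset[OF test_function_bounded_support[OF \<phi>]]) auto
  have "(LINT x|lborel. partial_deriv b (\<lambda>x. g x * \<phi> x) x) = 0"
  proof (rule integral_partial_deriv_eq_0)
    show "(\<lambda>x. g x * \<phi> x) differentiable at x" for x
      using gd test_function_differentiable[OF \<phi>] by simp
    show "continuous_on UNIV (partial_deriv b (\<lambda>x. g x * \<phi> x))" unfolding pd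
      by (intro continuous_on_add continuous_on_mult gc g(2) test_function_continuous[OF \<phi>] test_function_continuous[OF \<phi>'])
  qed (intro bounded_subset[OF test_function_bounded_support[OF \<phi>]], auto)
  then show ?thesis unfolding pd Bochner_Integration.integral_add[OF i1 i2] by simp
qed

lemma fourier_partial_deriv:
  assumes \<phi>: "test_function \<Omega> \<phi>" and b: "b \<in> Basis"
  shows "fourier (\<lambda>x. of_real (partial_deriv b \<phi> x)) \<xi> = \<i> * of_real (\<xi> \<bullet> b) * fourier (\<lambda>x. of_real (\<phi> x)) \<xi>"
proof -
  note \<phi>' = test_function_partial_deriv[OF \<phi> b]
  have c: "(LINT x|lborel. cos (\<xi> \<bullet> x) * partial_deriv b \<phi> x) = (\<xi> \<bullet> b) * (LINT x|lborel. sin (\<xi> \<bullet> x) * \<phi> x)"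
  proof -
    have "(LINT x|lborel. cos (\<xi> \<bullet> x) * partial_deriv b \<phi> x) = - (LINT x|lborel. (- ((\<xi> \<bullet> b) * sin (\<xi> \<bullet> x))) * \<phi> x)"
      by (rule integral_by_parts_test_function[OF \<phi> b, where g' = "\<lambda>x h. - ((\<xi> \<bullet> h) * sin (\<xi> \<bullet> x))"])
        (auto intro!: derivative_eq_intros continuous_intros)
    then show ?thesis by (simp add: mult.assoc)
  qed
  have s: "(LINT x|lborel. sin (\<xi> \<bullet> x) * partial_deriv b \<phi> x) = - (\<xi> \<bullet> b) * (LINT x|lborel. cos (\<xi> \<bullet> x) * \<phi> x)"
  proof -
    have "(LINT x|lborel. sin (\<xi> \<bullet> x) * partial_deriv b \<phi> x) = - (LINT x|lborel. ((\<xi> \<bullet> b) * cos (\<xi> \<bullet> x)) * \<phi> x)"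
      by (rule integral_by_parts_test_function[OF \<phi> b, where g' = "\<lambda>x h. (\<xi> \<bullet> h) * cos (\<xi> \<bullet> x)"])
        (auto intro!: derivative_eq_intros continuous_intros)
    then show ?thesis by (simp add: mult.assoc)
  qed
  show ?thesis
    unfolding fourier_def fourier_integral_of_real[OF test_function_integrable[OF \<phi>']]
      fourier_integral_of_real[OF test_function_integrable[OF \<phi>]] c s
    by (simp add: complex_eq_iff)
qed

definition laplacian :: "('a::euclidean_space \<Rightarrow> real) \<Rightarrow> 'a \<Rightarrow> real" where
  "laplacian f x = (\<Sum>b\<in>Basis. partial_deriv b (partial_deriv b f) x)"

lemma continuous_laplacian:
  assumes "test_function \<Omega> \<phi>" shows "continuous_on UNIV (laplacian \<phi>)"
  unfolding laplacian_def[abs_def]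
  by (intro continuous_on_sum test_function_continuous[of \<Omega>] test_function_partial_deriv assms)

lemma bounded_support_laplacian:
  assumes \<phi>: "test_function \<Omega> \<phi>" shows "bounded {x. laplacian \<phi> x \<noteq> 0}"
proof (rule bounded_subset)
  show "bounded (\<Union>b\<in>Basis. {x. partial_deriv b (partial_deriv b \<phi>) x \<noteq> 0})"
    using test_function_bounded_support[OF test_function_partial_deriv[OF test_function_partial_deriv[OF \<phi>]]]
    by (intro bounded_UN finite_Basis) blast
  show "{x. laplacian \<phi> x \<noteq> 0} \<subseteq> (\<Union>b\<in>Basis. {x. partial_deriv b (partial_deriv b \<phi>) x \<noteq> 0})"
    unfolding laplacian_def by (auto dest: sum.not_neutral_contains_not_neutral)
qed

lemma fourier_laplacian:
  assumes \<phi>: "test_function \<Omega> \<phi>"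
  shows "fourier (\<lambda>x. of_real (laplacian \<phi> x)) \<xi> = - of_real ((norm \<xi>)\<^sup>2) * fourier (\<lambda>x. of_real (\<phi> x)) \<xi>"
proof -
  have "fourier (\<lambda>x. of_real (laplacian \<phi> x)) \<xi> = (\<Sum>b\<in>Basis. fourier (\<lambda>x. of_real (partial_deriv b (partial_deriv b \<phi>) x)) \<xi>)"
  proof -
    have i: "integrable lborel (\<lambda>x. exp (- \<i> * of_real (\<xi> \<bullet> x)) * complex_of_real (partial_deriv b (partial_deriv b \<phi>) x))" if b: "b \<in> Basis" for b
    proof -
      have f: "integrable lborel (partial_deriv b (partial_deriv b \<phi>))"
        by (intro test_function_integrable[of \<Omega>] test_function_partial_deriv \<phi> b)
      then have [measurable]: "partial_deriv b (partial_deriv b \<phi>) \<in> borel_measurable borel" by auto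
      show ?thesis by (rule Bochner_Integration.integrable_bound[OF f]) (auto simp: norm_mult)
    qed
    have "(LINT x|lborel. exp (- \<i> * of_real (\<xi> \<bullet> x)) * complex_of_real (laplacian \<phi> x))
      = (LINT x|lborel. (\<Sum>b\<in>Basis. exp (- \<i> * of_real (\<xi> \<bullet> x)) * complex_of_real (partial_deriv b (partial_deriv b \<phi>) x)))"
      by (simp only: laplacian_def of_real_sum sum_distrib_left)
    also have "\<dots> = (\<Sum>b\<in>Basis. LINT x|lborel. exp (- \<i> * of_real (\<xi> \<bullet> x)) * complex_of_real (partial_deriv b (partial_deriv b \<phi>) x))"
      by (rule Bochner_Integration.integral_sum) (rule i)
    finally show ?thesis by (simp only: fourier_def sum_distrib_left)
  qed
  also have "\<dots> = (\<Sum>b\<in>Basis. - of_real ((\<xi> \<bullet> b)\<^sup>2) * fourier (\<lambda>x. of_real (\<phi> x)) \<xi>)"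
  proof (intro sum.cong refl)
    fix b :: 'a assume b: "b \<in> Basis"
    show "fourier (\<lambda>x. of_real (partial_deriv b (partial_deriv b \<phi>) x)) \<xi> = - of_real ((\<xi> \<bullet> b)\<^sup>2) * fourier (\<lambda>x. of_real (\<phi> x)) \<xi>"
    proof -
      have "\<i> * a * (\<i> * a * F) = (\<i> * \<i>) * (a * a) * F" for a F :: complex by (simp only: mult_ac)
      then show ?thesis
        unfolding fourier_partial_deriv[OF test_function_partial_deriv[OF \<phi> b] b] fourier_partial_deriv[OF \<phi> b]
        by (simp add: power2_eq_square)
    qed
  qed
  also have "\<dots> = - of_real (\<Sum>b\<in>Basis. (\<xi> \<bullet> b)\<^sup>2) * fourier (\<lambda>x. of_real (\<phi> x)) \<xi>"
    by (simp add: sum_distrib_right sum_negf)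
  also have "(\<Sum>b\<in>Basis. (\<xi> \<bullet> b)\<^sup>2) = (norm \<xi>)\<^sup>2"
    unfolding power2_norm_eq_inner by (subst euclidean_inner) (simp add: power2_eq_square)
  finally show ?thesis .
qed

text \<open>Both \<open>\<phi>\<close> and its Laplacian have square-integrable Fourier transforms, so one may estimate in
  \<open>L\<^sup>2\<close> and avoid pointwise decay of the Fourier transform, which would depend on the dimension.\<close>

lemma fourier_product_moment_integrable:
  fixes u \<phi> :: "'a::euclidean_space \<Rightarrow> real"
  assumes u: "integrable lborel u" "integrable lborel (\<lambda>x. (u x)\<^sup>2)" and \<phi>: "test_function \<Omega> \<phi>"
  shows "integrable lborel (\<lambda>\<xi>. (1 + (norm \<xi>)\<^sup>2) * cmod (fourier (\<lambda>x. of_real (u x)) \<xi> * cnj (fourier (\<lambda>x. of_real (\<phi> x)) \<xi>)))"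
proof -
  let ?u = "fourier (\<lambda>x. complex_of_real (u x))" and ?p = "fourier (\<lambda>x. complex_of_real (\<phi> x))"
    and ?l = "fourier (\<lambda>x. complex_of_real (laplacian \<phi> x))"
  have l: "integrable lborel (laplacian \<phi>)" "integrable lborel (\<lambda>x. (laplacian \<phi> x)\<^sup>2)"
    using continuous_laplacian[OF \<phi>] bounded_support_laplacian[OF \<phi>]
    by (auto intro!: continuous_compact_support_integrable continuous_intros)
  have p: "integrable lborel \<phi>" "integrable lborel (\<lambda>x. (\<phi> x)\<^sup>2)"
    using test_function_continuous[OF \<phi>] test_function_bounded_support[OF \<phi>]
    by (auto intro!: continuous_compact_support_integrable continuous_intros)
  have [measurable]: "?u \<in> borel_measurable borel" "?p \<in> borel_measurable borel"
    by (intro fourier_measurable u p)+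
  have [measurable]: "cnj \<in> borel_measurable borel"
    by (intro borel_measurable_continuous_onI continuous_intros)
  have "integrable lborel (\<lambda>\<xi>. 2 * (cmod (?u \<xi>))\<^sup>2 + ((cmod (?p \<xi>))\<^sup>2 + (cmod (?l \<xi>))\<^sup>2))"
    by (intro Bochner_Integration.integrable_add integrable_mult_right fourier_square_integrable u l p)
  then show ?thesis
  proof (rule Bochner_Integration.integrable_bound)
    show "AE \<xi> in lborel. norm ((1 + (norm \<xi>)\<^sup>2) * cmod (?u \<xi> * cnj (?p \<xi>))) \<le> norm (2 * (cmod (?u \<xi>))\<^sup>2 + ((cmod (?p \<xi>))\<^sup>2 + (cmod (?l \<xi>))\<^sup>2))"
    proof (rule AE_I2)
      fix \<xi> :: 'a
      have l: "cmod (?l \<xi>) = (norm \<xi>)\<^sup>2 * cmod (?p \<xi>)" unfolding fourier_laplacian[OF \<phi>] by (simp add: norm_mult norm_power)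
      have "(1 + (norm \<xi>)\<^sup>2) * cmod (?u \<xi> * cnj (?p \<xi>)) = cmod (?u \<xi>) * cmod (?p \<xi>) + cmod (?u \<xi>) * cmod (?l \<xi>)"
        unfolding l by (simp add: norm_mult algebra_simps)
      also have "\<dots> \<le> ((cmod (?u \<xi>))\<^sup>2 + (cmod (?p \<xi>))\<^sup>2) + ((cmod (?u \<xi>))\<^sup>2 + (cmod (?l \<xi>))\<^sup>2)"
        using sum_squares_bound[of "cmod (?u \<xi>)" "cmod (?p \<xi>)"] sum_squares_bound[of "cmod (?u \<xi>)" "cmod (?l \<xi>)"]
          mult_nonneg_nonneg[OF norm_ge_zero norm_ge_zero, of "?u \<xi>" "?p \<xi>"] mult_nonneg_nonneg[OF norm_ge_zero norm_ge_zero, of "?u \<xi>" "?l \<xi>"]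
        by linarith
      finally show "norm ((1 + (norm \<xi>)\<^sup>2) * cmod (?u \<xi> * cnj (?p \<xi>))) \<le> norm (2 * (cmod (?u \<xi>))\<^sup>2 + ((cmod (?p \<xi>))\<^sup>2 + (cmod (?l \<xi>))\<^sup>2))"
        by simp
    qed
  qed measurable
qed

section \<open>Heat smoothing\<close>

lemma heat_kernel_scaling:
  assumes t: "t > 0" shows "sqrt t ^ DIM('a) * heat_kernel t (sqrt t *\<^sub>R (z::'a::euclidean_space)) = heat_kernel 1 z"
proof -
  have a: "sqrt t ^ DIM('a) = t powr (real DIM('a) / 2)"
  proof -
    have "sqrt t ^ DIM('a) = (t powr (1/2)) powr real DIM('a)"
      using t by (subst powr_realpow) (auto simp: powr_half_sqrt)
    then show ?thesis by (simp add: powr_powr)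
  qed
  have b: "(4 * pi * t) powr (- real DIM('a) / 2) = (4 * pi) powr (- real DIM('a) / 2) * t powr (- real DIM('a) / 2)"
    by (rule powr_mult)
  have c: "t powr (real DIM('a) / 2) * t powr (- real DIM('a) / 2) = 1"
    unfolding powr_add[symmetric] using t by simp
  have d: "exp (- (norm (sqrt t *\<^sub>R z))\<^sup>2 / (4 * t)) = exp (- (norm z)\<^sup>2 / (4 * 1))"
  proof -
    have "(norm (sqrt t *\<^sub>R z))\<^sup>2 = t * (norm z)\<^sup>2" using t by (simp add: power_mult_distrib)
    then show ?thesis using t by simp
  qed
  have "sqrt t ^ DIM('a) * heat_kernel t (sqrt t *\<^sub>R z)
     = (t powr (real DIM('a) / 2) * t powr (- real DIM('a) / 2)) * ((4 * pi) powr (- real DIM('a) / 2) * exp (- (norm z)\<^sup>2 / (4 * 1)))"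
    unfolding heat_kernel_def a b d by (simp only: mult_ac)
  also have "\<dots> = heat_kernel 1 z"
    unfolding c by (simp add: heat_kernel_def)
  finally show ?thesis .
qed

text \<open>In the scaled variable the time appears in \<open>\<phi>\<close> only, where continuity can be used.\<close>

lemma convolve_heat_kernel_rescaled:
  fixes \<phi> :: "'a::euclidean_space \<Rightarrow> real"
  assumes t: "t > 0" and [measurable]: "\<phi> \<in> borel_measurable borel"
  shows "convolve \<phi> (heat_kernel t) x = (LINT z|lborel. \<phi> (x - sqrt t *\<^sub>R z) * heat_kernel 1 z)"
proof -
  let ?f = "\<lambda>z. \<phi> (x - z) * heat_kernel t z"
  have "convolve \<phi> (heat_kernel t) x = (LINT z|lborel. ?f z)"
    using lborel_integral_reflect(1)[of "\<lambda>y. \<phi> y * heat_kernel t (x - y)" x] by (simp add: convolve_def)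
  also have "\<dots> = sqrt t ^ DIM('a) * (LINT z|lborel. ?f (0 + sqrt t *\<^sub>R z))"
    using t by (subst lborel_integral_affine(1)) auto
  also have "\<dots> = (LINT z|lborel. sqrt t ^ DIM('a) * ?f (0 + sqrt t *\<^sub>R z))" by simp
  also have "\<dots> = (LINT z|lborel. \<phi> (x - sqrt t *\<^sub>R z) * heat_kernel 1 z)"
    unfolding heat_kernel_scaling[OF t, symmetric] by (intro Bochner_Integration.integral_cong refl) simp
  finally show ?thesis .
qed

lemma convolve_heat_kernel_bound:
  fixes \<phi> :: "'a::euclidean_space \<Rightarrow> real"
  assumes t: "t > 0" and [measurable]: "\<phi> \<in> borel_measurable borel" and C: "\<And>x. \<bar>\<phi> x\<bar> \<le> C"
  shows "\<bar>convolve \<phi> (heat_kernel t) x\<bar> \<le> C"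
proof -
  note h = heat_kernel_integral[of 1, where ?'a = 'a] heat_kernel_pos[of 1, where ?'a = 'a]
  have i: "integrable lborel (\<lambda>z. \<phi> (x - sqrt t *\<^sub>R z) * heat_kernel 1 z)"
  proof (rule Bochner_Integration.integrable_bound)
    show "integrable lborel (\<lambda>z::'a. C * heat_kernel 1 z)" using h by simp
    show "AE z in lborel. norm (\<phi> (x - sqrt t *\<^sub>R z) * heat_kernel 1 z) \<le> norm (C * heat_kernel 1 z)"
    proof (rule AE_I2)
      fix z :: 'a
      have "0 \<le> C" using C[of x] by linarith
      then show "norm (\<phi> (x - sqrt t *\<^sub>R z) * heat_kernel 1 z) \<le> norm (C * heat_kernel 1 z)"
        using C[of "x - sqrt t *\<^sub>R z"] by (simp add: abs_mult mult_right_mono)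
    qed
  qed measurable
  have i2: "integrable lborel (\<lambda>z. \<bar>\<phi> (x - sqrt t *\<^sub>R z)\<bar> * heat_kernel 1 z)"
    using integrable_abs[OF i] h by (simp add: abs_mult less_imp_le)
  have "\<bar>convolve \<phi> (heat_kernel t) x\<bar> \<le> (LINT z|lborel. C * heat_kernel 1 (z::'a))"
    unfolding convolve_heat_kernel_rescaled[OF t assms(2)]
    by (rule order_trans[OF integral_abs_bound], rule integral_mono)
      (use i2 h C in \<open>auto simp: abs_mult less_imp_le intro!: mult_right_mono\<close>)
  also have "\<dots> = C" using h by simp
  finally show ?thesis .
qed

lemma convolve_heat_kernel_tendsto:
  fixes \<phi> :: "'a::euclidean_space \<Rightarrow> real"
  assumes t: "\<And>n. t n > 0" "t \<longlonglongrightarrow> 0" and \<phi>: "continuous_on UNIV \<phi>" and C: "\<And>x. \<bar>\<phi> x\<bar> \<le> C"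
  shows "(\<lambda>n. convolve \<phi> (heat_kernel (t n)) x) \<longlonglongrightarrow> \<phi> x"
proof -
  have [measurable]: "\<phi> \<in> borel_measurable borel" using \<phi> by (rule borel_measurable_continuous_onI)
  note h = heat_kernel_integral[of 1, where ?'a = 'a] heat_kernel_pos[of 1, where ?'a = 'a]
  have "(\<lambda>n. LINT z|lborel. \<phi> (x - sqrt (t n) *\<^sub>R z) * heat_kernel 1 z) \<longlonglongrightarrow> (LINT z|lborel. \<phi> x * heat_kernel 1 (z::'a))"
  proof (rule integral_dominated_convergence)
    show "integrable lborel (\<lambda>z::'a. C * heat_kernel 1 z)" using h by simp
    show "AE z in lborel. norm (\<phi> (x - sqrt (t n) *\<^sub>R z) * heat_kernel 1 z) \<le> C * heat_kernel 1 z" for n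
      using C h by (intro AE_I2) (auto simp: abs_mult less_imp_le intro!: mult_right_mono)
    show "AE z in lborel. (\<lambda>n. \<phi> (x - sqrt (t n) *\<^sub>R z) * heat_kernel 1 z) \<longlonglongrightarrow> \<phi> x * heat_kernel 1 z"
    proof (rule AE_I2)
      fix z :: 'a
      have "(\<lambda>n. x - sqrt (t n) *\<^sub>R z) \<longlonglongrightarrow> x - sqrt 0 *\<^sub>R z" by (intro tendsto_intros t)
      then have "(\<lambda>n. \<phi> (x - sqrt (t n) *\<^sub>R z)) \<longlonglongrightarrow> \<phi> x"
        using \<phi> by (intro isCont_tendsto_compose[of _ \<phi>]) (auto simp: continuous_on_eq_continuous_at)
      then show "(\<lambda>n. \<phi> (x - sqrt (t n) *\<^sub>R z) * heat_kernel 1 z) \<longlonglongrightarrow> \<phi> x * heat_kernel 1 z"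
        by (intro tendsto_intros)
    qed
  qed measurable
  then show ?thesis using h by (simp add: convolve_heat_kernel_rescaled[OF t(1)])
qed

lemma convolve_heat_kernel_measurable:
  assumes [measurable]: "\<phi> \<in> borel_measurable borel"
  shows "convolve \<phi> (heat_kernel t) \<in> borel_measurable borel"
  unfolding convolve_def[abs_def] by measurable

lemma heat_form_tendsto:
  fixes u \<phi> :: "'a::euclidean_space \<Rightarrow> real"
  assumes t: "\<And>n. t n > 0" "t \<longlonglongrightarrow> 0" and u: "integrable lborel u" and \<phi>: "continuous_on UNIV \<phi>" and C: "\<And>x. \<bar>\<phi> x\<bar> \<le> C"
  shows "(\<lambda>n. heat_form (t n) u \<phi>) \<longlonglongrightarrow> (LINT x|lborel. u x * \<phi> x)"
  unfolding heat_form_def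
proof (rule integral_dominated_convergence)
  have m: "\<phi> \<in> borel_measurable borel" using \<phi> by (rule borel_measurable_continuous_onI)
  have mu: "u \<in> borel_measurable borel" using u by auto
  show "integrable lborel (\<lambda>x. C * \<bar>u x\<bar>)" using u by simp
  show "AE x in lborel. norm (u x * convolve \<phi> (heat_kernel (t n)) x) \<le> C * \<bar>u x\<bar>" for n
    using convolve_heat_kernel_bound[OF t(1) m C] by (intro AE_I2) (simp add: abs_mult mult.commute[of C] mult_left_mono)
  show "AE x in lborel. (\<lambda>n. u x * convolve \<phi> (heat_kernel (t n)) x) \<longlonglongrightarrow> u x * \<phi> x"
    by (intro AE_I2 tendsto_intros convolve_heat_kernel_tendsto[OF t \<phi> C])
  show "(\<lambda>x. u x * \<phi> x) \<in> borel_measurable lborel" using m mu by simp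
  show "(\<lambda>x. u x * convolve \<phi> (heat_kernel (t n)) x) \<in> borel_measurable lborel" for n
    using convolve_heat_kernel_measurable[OF m] mu by simp
qed

section \<open>Comparison of the heat kernel with the Neumann problem\<close>

text \<open>The gradient in space and the derivative in time. Since the kernel solves the heat equation, the latter is
  also its Laplacian.\<close>

definition heat_kernel_grad :: "real \<Rightarrow> 'a::euclidean_space \<Rightarrow> 'a" where
  "heat_kernel_grad t z = - (heat_kernel t z / (2 * t)) *\<^sub>R z"

definition heat_kernel_deriv :: "real \<Rightarrow> 'a::euclidean_space \<Rightarrow> real" where
  "heat_kernel_deriv t z = ((norm z)\<^sup>2 / (4 * t\<^sup>2) - real DIM('a) / (2 * t)) * heat_kernel t z"

lemma heat_kernel_has_derivative:
  assumes t: "t > 0"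
  shows "((\<lambda>x. heat_kernel t (x - y)) has_derivative (\<lambda>h. heat_kernel_grad t (x - y) \<bullet> h)) (at x)"
proof -
  have n: "((\<lambda>x. (norm (x - y))\<^sup>2) has_derivative (\<lambda>h. 2 * ((x - y) \<bullet> h))) (at x)"
    unfolding power2_norm_eq_inner by (auto intro!: derivative_eq_intros simp: inner_commute)
  let ?A = "(4 * pi * t) powr (- real DIM('a) / 2)" and ?B = "- (1 / (4 * t))"
  have "((\<lambda>x. ?A * exp (?B * (norm (x - y))\<^sup>2)) has_derivative
      (\<lambda>h. ?A * ((?B * (2 * ((x - y) \<bullet> h))) * exp (?B * (norm (x - y))\<^sup>2)))) (at x)"
    by (rule has_derivative_mult_right[OF has_derivative_exp[OF has_derivative_mult_right[OF n, of ?B]], THEN has_derivative_eq_rhs])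
      (simp add: mult_ac)
  moreover have "(\<lambda>x. heat_kernel t (x - y)) = (\<lambda>x. ?A * exp (?B * (norm (x - y))\<^sup>2))"
    by (simp add: heat_kernel_def)
  moreover have "?A * ((?B * (2 * ((x - y) \<bullet> h))) * exp (?B * (norm (x - y))\<^sup>2)) = heat_kernel_grad t (x - y) \<bullet> h" for h
    by (simp add: heat_kernel_grad_def heat_kernel_def)
  ultimately show ?thesis by simp
qed

lemma smooth_heat_kernel:
  "smooth (\<lambda>x. c * heat_kernel t (x - (y::'a::euclidean_space)))"
proof -
  have ck: "Ck k (\<lambda>x. (x - y) \<bullet> b)" for k b
    using Ck_add[OF Ck_inner[of k b] Ck_const[of k "- (y \<bullet> b)"]] by (simp add: inner_diff_left)
  have eq: "(\<lambda>x. c * heat_kernel t (x - y)) = (\<lambda>x. (c * (4 * pi * t) powr (- real DIM('a) / 2)) *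
      exp ((- 1 / (4 * t)) * (\<Sum>b\<in>Basis. ((x - y) \<bullet> b) * ((x - y) \<bullet> b))))"
    unfolding heat_kernel_def power2_norm_eq_inner euclidean_inner[of "_ - y" "_ - y", symmetric] by (simp add: mult.assoc)
  show ?thesis unfolding smooth_def eq by (intro allI Ck_mult Ck_const Ck_exp Ck_sum ck)
qed

lemma heat_kernel_has_real_derivative_time:
  assumes t: "t > 0"
  shows "((\<lambda>t. heat_kernel t (z::'a::euclidean_space)) has_real_derivative heat_kernel_deriv t z) (at t)"
proof -
  define r where "r = - real DIM('a) / 2"
  define a where "a = (norm z)\<^sup>2"
  define g where "g t = exp (r * ln (4 * pi * t) - a / (4 * t))" for t
  have g: "heat_kernel t z = g t" if "t > 0" for t
  proof -
    have "(4 * pi * t) powr r = exp (r * ln (4 * pi * t))" using that by (simp add: powr_def)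
    moreover have "g t = exp (r * ln (4 * pi * t)) * exp (- a / (4 * t))"
      unfolding g_def exp_add[symmetric] by simp
    ultimately show ?thesis by (simp add: heat_kernel_def r_def a_def)
  qed
  have d1: "((\<lambda>t. ln (4 * pi * t)) has_real_derivative 1 / t) (at t)"
    using t by (auto intro!: derivative_eq_intros)
  have "((\<lambda>t. a / (4 * t)) has_real_derivative (0 * (4 * t) - a * 4) / ((4 * t) * (4 * t))) (at t)"
    using t by (auto intro!: derivative_eq_intros)
  also have "(0 * (4 * t) - a * 4) / ((4 * t) * (4 * t)) = - (a / (4 * t\<^sup>2))"
    using t by (simp add: power2_eq_square divide_simps)
  finally have d2: "((\<lambda>t. a / (4 * t)) has_real_derivative - (a / (4 * t\<^sup>2))) (at t)" .
  have "(g has_real_derivative g t * (r * (1 / t) - (- (a / (4 * t\<^sup>2))))) (at t)"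
    unfolding g_def[abs_def] by (intro DERIV_fun_exp DERIV_diff DERIV_cmult d1 d2)
  then have "(g has_real_derivative g t * (r * (1 / t) + a / (4 * t\<^sup>2))) (at t)" by simp
  moreover have "g t * (r * (1 / t) + a / (4 * t\<^sup>2)) = heat_kernel_deriv t z"
    using g[OF t] by (simp add: heat_kernel_deriv_def r_def a_def mult.commute)
  ultimately have "(g has_real_derivative heat_kernel_deriv t z) (at t)" by simp
  then show ?thesis
    by (rule has_field_derivative_transform_within_open[of _ _ _ "{0<..}"]) (use t g in auto)
qed

text \<open>Apply \<open>radial_divergence_nonneg\<close> to minus the gradient of the heat kernel: its coefficient along \<open>x - y\<close> is
  \<open>heat_kernel t (x - y) / (2 * t)\<close>, which is nonnegative, and its divergence is minus the Laplacian of the kernel,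
  that is, minus the time derivative.\<close>

lemma (in mollifiers) heat_kernel_subsolution:
  fixes \<Omega> :: "'a set"
  assumes \<Omega>: "open \<Omega>" "bounded \<Omega>" "convex \<Omega>" and y: "y \<in> \<Omega>" and t: "t > 0"
    and v: "H1_pair \<Omega> v H" "\<And>x. 0 \<le> v x"
  shows "(LINT x:\<Omega>|lborel. heat_kernel_grad t (x - y) \<bullet> H x + heat_kernel_deriv t (x - y) * v x) \<le> 0"
proof -
  define \<gamma> where "\<gamma> x = (1 / (2 * t)) * heat_kernel t (x - y)" for x
  have s: "smooth \<gamma>" unfolding \<gamma>_def[abs_def] by (rule smooth_heat_kernel)
  have p: "0 \<le> \<gamma> x" for x using heat_kernel_pos[OF t, of "x - y"] t by (simp add: \<gamma>_def)
  have "(\<gamma> has_derivative (\<lambda>h. (1 / (2 * t)) * (heat_kernel_grad t (x - y) \<bullet> h))) (at x)" for x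
    unfolding \<gamma>_def[abs_def] by (intro has_derivative_mult_right heat_kernel_has_derivative t)
  then have D: "frechet_derivative \<gamma> (at x) = (\<lambda>h. (1 / (2 * t)) * (heat_kernel_grad t (x - y) \<bullet> h))" for x
    using frechet_derivative_at by metis
  have eq: "\<gamma> x * ((x - y) \<bullet> H x) + (real DIM('a) * \<gamma> x + frechet_derivative \<gamma> (at x) (x - y)) * v x
    = - (heat_kernel_grad t (x - y) \<bullet> H x + heat_kernel_deriv t (x - y) * v x)" for x
  proof -
    have "real DIM('a) * \<gamma> x + frechet_derivative \<gamma> (at x) (x - y) = - heat_kernel_deriv t (x - y)"
    proof -
      have "heat_kernel_grad t (x - y) \<bullet> (x - y) = - (heat_kernel t (x - y) / (2 * t)) * (norm (x - y))\<^sup>2"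
        by (simp add: heat_kernel_grad_def power2_norm_eq_inner)
      moreover have "n * (1 / (2 * t) * h) + 1 / (2 * t) * (- (h / (2 * t)) * N) = - ((N / (4 * t\<^sup>2) - n / (2 * t)) * h)"
        for n h N :: real using t by (simp add: field_simps power2_eq_square)
      ultimately show ?thesis unfolding D \<gamma>_def heat_kernel_deriv_def by simp
    qed
    moreover have "\<gamma> x * ((x - y) \<bullet> H x) = - (heat_kernel_grad t (x - y) \<bullet> H x)"
      by (simp add: \<gamma>_def heat_kernel_grad_def)
    ultimately show ?thesis by simp
  qed
  have "0 \<le> (LINT x:\<Omega>|lborel. - (heat_kernel_grad t (x - y) \<bullet> H x + heat_kernel_deriv t (x - y) * v x))"
    using radial_divergence_nonneg[OF \<Omega> y v s p] unfolding eq .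
  then show ?thesis
    unfolding set_lebesgue_integral_def scaleR_minus_right Bochner_Integration.integral_minus by linarith
qed

lemma weak_gradient_classical:
  assumes f: "\<And>x. (f has_derivative (\<lambda>h. G x \<bullet> h)) (at x)" and G: "continuous_on UNIV G"
  shows "weak_gradient \<Omega> f G"
  unfolding weak_gradient_def
proof (intro allI impI ballI)
  fix \<phi> and b :: 'a assume \<phi>: "test_function \<Omega> \<phi>" and b: "b \<in> Basis"
  have "(LINT x|lborel. f x * partial_deriv b \<phi> x) = - (LINT x|lborel. (G x \<bullet> b) * \<phi> x)"
    by (rule integral_by_parts_test_function[OF \<phi> b f]) (intro continuous_intros G)
  moreover have "(LINT x:\<Omega>|lborel. f x * partial_deriv b \<phi> x) = (LINT x|lborel. f x * partial_deriv b \<phi> x)"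
    unfolding set_lebesgue_integral_def using test_function_outside[OF test_function_partial_deriv[OF \<phi> b]]
    by (intro Bochner_Integration.integral_cong) (auto simp: indicator_def)
  moreover have "(LINT x:\<Omega>|lborel. (G x \<bullet> b) * \<phi> x) = (LINT x|lborel. (G x \<bullet> b) * \<phi> x)"
    unfolding set_lebesgue_integral_def using test_function_outside[OF \<phi>]
    by (intro Bochner_Integration.integral_cong) (auto simp: indicator_def)
  ultimately show "(LINT x:\<Omega>|lborel. f x * partial_deriv b \<phi> x) = - (LINT x:\<Omega>|lborel. (G x \<bullet> b) * \<phi> x)"
    by simp
qed

text \<open>All superpositions of heat kernels below are integrals against a density \<open>q\<close> on parameters; the kernel need
  only be bounded where the density and the test factor are nonzero, which keeps times near 0 out.\<close>

lemma fubini_bounded_kernel: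
  fixes q :: "'p \<Rightarrow> real" and h :: "'a::euclidean_space \<Rightarrow> real"
  assumes M: "sigma_finite_measure M" and q: "integrable M q" and h: "integrable lborel h"
    and k[measurable]: "(\<lambda>z. k (fst z) (snd z)) \<in> borel_measurable (M \<Otimes>\<^sub>M lborel)"
    and C: "\<And>p x. q p \<noteq> 0 \<Longrightarrow> h x \<noteq> 0 \<Longrightarrow> \<bar>k p x\<bar> \<le> C"
  shows "(LINT x|lborel. (LINT p|M. q p * k p x) * h x) = (LINT p|M. q p * (LINT x|lborel. k p x * h x))"
    and "integrable lborel (\<lambda>x. (LINT p|M. q p * k p x) * h x)"
    and "integrable M (\<lambda>p. q p * (LINT x|lborel. k p x * h x))"
proof -
  interpret P: pair_sigma_finite M "lborel :: 'a measure"
    using M by (simp add: pair_sigma_finite_def sigma_finite_lborel)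
  have [measurable]: "q \<in> borel_measurable M" "h \<in> borel_measurable borel" using q h by auto
  have i: "integrable (M \<Otimes>\<^sub>M lborel) (\<lambda>(p, x). q p * k p x * h x)"
  proof (rule Bochner_Integration.integrable_bound)
    show "integrable (M \<Otimes>\<^sub>M lborel) (\<lambda>z. C * (q (fst z) * h (snd z)))"
      by (intro integrable_mult_right P.integrable_product_mult q h)
    have "(\<lambda>z. q (fst z) * k (fst z) (snd z) * h (snd z)) \<in> borel_measurable (M \<Otimes>\<^sub>M lborel)" by measurable
    then show "(\<lambda>(p, x). q p * k p x * h x) \<in> borel_measurable (M \<Otimes>\<^sub>M lborel)"
      by (simp add: case_prod_unfold)
    show "AE z in M \<Otimes>\<^sub>M lborel. norm (case z of (p, x) \<Rightarrow> q p * k p x * h x) \<le> norm (C * (q (fst z) * h (snd z)))"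
    proof (rule AE_I2, clarsimp simp: abs_mult)
      fix p x
      show "\<bar>q p\<bar> * \<bar>k p x\<bar> * \<bar>h x\<bar> \<le> \<bar>C\<bar> * (\<bar>q p\<bar> * \<bar>h x\<bar>)"
      proof (cases "q p = 0 \<or> h x = 0")
        case False
        then have "\<bar>k p x\<bar> \<le> \<bar>C\<bar>" using C[of p x] by linarith
        then have "\<bar>k p x\<bar> * (\<bar>q p\<bar> * \<bar>h x\<bar>) \<le> \<bar>C\<bar> * (\<bar>q p\<bar> * \<bar>h x\<bar>)" by (intro mult_right_mono) auto
        then show ?thesis by (simp add: mult_ac)
      qed auto
    qed
  qed
  have e1: "(LINT p|M. q p * k p x) * h x = (LINT p|M. q p * k p x * h x)" for x by simp
  have e2: "q p * (LINT x|lborel. k p x * h x) = (LINT x|lborel. q p * k p x * h x)" for p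
    unfolding integral_mult_right_zero[symmetric] by (simp only: mult.assoc)
  show "(LINT x|lborel. (LINT p|M. q p * k p x) * h x) = (LINT p|M. q p * (LINT x|lborel. k p x * h x))"
    unfolding e1 e2 using P.integral_fst[OF i] P.integral_snd[OF i] by simp
  show "integrable lborel (\<lambda>x. (LINT p|M. q p * k p x) * h x)"
    unfolding e1 using P.integrable_snd[OF i] .
  show "integrable M (\<lambda>p. q p * (LINT x|lborel. k p x * h x))"
    unfolding e2 using P.integrable_fst[OF i] .
qed

lemma heat_kernel_joint_measurable [measurable]:
  fixes g :: "'b \<Rightarrow> 'a::euclidean_space"
  assumes [measurable]: "f \<in> borel_measurable M" "g \<in> borel_measurable M"
  shows "(\<lambda>p. heat_kernel (f p) (g p)) \<in> borel_measurable M"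
    and "(\<lambda>p. heat_kernel_deriv (f p) (g p)) \<in> borel_measurable M"
    and "(\<lambda>p. heat_kernel_grad (f p) (g p) \<bullet> b) \<in> borel_measurable M"
  unfolding heat_kernel_deriv_def heat_kernel_grad_def heat_kernel_def by measurable

lemma heat_kernel_bounds:
  fixes z :: "'a::euclidean_space"
  assumes e: "0 < \<epsilon>" "\<epsilon> \<le> t"
  shows "\<bar>heat_kernel t z\<bar> \<le> (4 * pi * \<epsilon>) powr (- real DIM('a) / 2)"
    and "norm z \<le> D \<Longrightarrow> b \<in> Basis \<Longrightarrow> \<bar>heat_kernel_grad t z \<bullet> b\<bar> \<le> (4 * pi * \<epsilon>) powr (- real DIM('a) / 2) * D / (2 * \<epsilon>)"
    and "norm z \<le> D \<Longrightarrow> \<bar>heat_kernel_deriv t z\<bar> \<le> (D\<^sup>2 / (4 * \<epsilon>\<^sup>2) + real DIM('a) / (2 * \<epsilon>)) * (4 * pi * \<epsilon>) powr (- real DIM('a) / 2)"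
proof -
  let ?C = "(4 * pi * \<epsilon>) powr (- real DIM('a) / 2)"
  have t: "t > 0" using e by simp
  have "heat_kernel t z \<le> (4 * pi * t) powr (- real DIM('a) / 2)" by (rule heat_kernel_le[OF t])
  also have "\<dots> \<le> ?C" by (rule powr_mono2') (use e in auto)
  finally show h: "\<bar>heat_kernel t z\<bar> \<le> ?C" using heat_kernel_pos[OF t, of z] by simp
  show "\<bar>heat_kernel_grad t z \<bullet> b\<bar> \<le> ?C * D / (2 * \<epsilon>)" if D: "norm z \<le> D" and b: "b \<in> Basis"
  proof -
    have "\<bar>heat_kernel_grad t z \<bullet> b\<bar> = \<bar>heat_kernel t z\<bar> * \<bar>z \<bullet> b\<bar> / (2 * t)"
      using t by (simp add: heat_kernel_grad_def abs_mult)
    also have "\<dots> \<le> ?C * D / (2 * \<epsilon>)"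
      using h D Basis_le_norm[OF b, of z] e by (intro frac_le mult_mono) auto
    finally show ?thesis .
  qed
  show "\<bar>heat_kernel_deriv t z\<bar> \<le> (D\<^sup>2 / (4 * \<epsilon>\<^sup>2) + real DIM('a) / (2 * \<epsilon>)) * ?C" if D: "norm z \<le> D"
  proof -
    have "\<bar>(norm z)\<^sup>2 / (4 * t\<^sup>2) - real DIM('a) / (2 * t)\<bar> \<le> (norm z)\<^sup>2 / (4 * t\<^sup>2) + real DIM('a) / (2 * t)"
      using t by (intro abs_triangle_ineq4[THEN order_trans]) simp
    also have "\<dots> \<le> D\<^sup>2 / (4 * \<epsilon>\<^sup>2) + real DIM('a) / (2 * \<epsilon>)"
      using D e by (intro add_mono frac_le power_mono mult_left_mono) auto
    finally show ?thesis unfolding heat_kernel_deriv_def abs_mult using h e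
      by (intro mult_mono) auto
  qed
qed

section \<open>The free resolvent with a truncated heat integral\<close>

text \<open>
  The free resolvent at \<open>\<kappa>\<close> applied to \<open>\<phi>\<close> is the integral of \<open>exp (- \<kappa> * t)\<close> times the heat evolution of \<open>\<phi>\<close> over all
  times. Restricting \<open>t\<close> to \<open>{\<epsilon>..T}\<close> removes the singularity of the kernel: all kernels that occur are smooth
  and bounded. A parameter is a pair of a time and a pole.
\<close>

locale heat_resolvent =
  fixes \<Omega> :: "'a::euclidean_space set" and \<phi> :: "'a \<Rightarrow> real" and \<kappa> \<epsilon> T :: real
  assumes domain: "open \<Omega>" "bounded \<Omega>"
    and test: "test_function \<Omega> \<phi>"
    and params: "0 < \<epsilon>" "\<epsilon> \<le> T"
begin

definition weight :: "real \<times> 'a \<Rightarrow> real" where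
  "weight p = (indicator {\<epsilon>..T} (fst p) * exp (- \<kappa> * fst p)) * \<phi> (snd p)"

abbreviation param_measure :: "(real \<times> 'a) measure" where
  "param_measure \<equiv> lborel \<Otimes>\<^sub>M lborel"

definition resolvent :: "'a \<Rightarrow> real" where
  "resolvent x = (LINT p|param_measure. weight p * heat_kernel (fst p) (x - snd p))"

definition resolvent_grad :: "'a \<Rightarrow> 'a" where
  "resolvent_grad x = (\<Sum>b\<in>Basis. (LINT p|param_measure. weight p * (heat_kernel_grad (fst p) (x - snd p) \<bullet> b)) *\<^sub>R b)"

lemma sigma_finite_param: "sigma_finite_measure param_measure"
  unfolding lborel_prod by (rule sigma_finite_lborel)

lemma time_weight_integrable: "integrable lborel (\<lambda>t. indicator {\<epsilon>..T} t * exp (- \<kappa> * t))"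
proof -
  have "continuous_on {\<epsilon>..T} (\<lambda>t. exp (- \<kappa> * t))" by (intro continuous_intros)
  from borel_integrable_compact[OF compact_Icc this] show ?thesis by simp
qed

lemma \<phi>_measurable [measurable]: "\<phi> \<in> borel_measurable borel"
  by (rule test_function_measurable[OF test])

lemma weight_integrable: "integrable param_measure weight"
  unfolding weight_def[abs_def]
  by (rule lborel_pair.integrable_product_mult[OF time_weight_integrable test_function_integrable[OF test]])

lemma weight_nonzero: "weight p \<noteq> 0 \<Longrightarrow> \<epsilon> \<le> fst p \<and> snd p \<in> \<Omega>"
  using test_function_outside[OF test, of "snd p"] by (auto simp: weight_def indicator_def split: if_splits)

lemma diameter: obtains D where "\<And>x y. x \<in> \<Omega> \<Longrightarrow> y \<in> \<Omega> \<Longrightarrow> norm (x - y) \<le> D"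
  using diameter_bounded_bound[OF domain(2)] by (metis dist_norm)

lemma
  assumes h: "integrable lborel h"
  shows resolvent_fubini: "(LINT x|lborel. resolvent x * h x) = (LINT p|param_measure. weight p * (LINT x|lborel. heat_kernel (fst p) (x - snd p) * h x))"
    and resolvent_fubini_integrable: "integrable param_measure (\<lambda>p. weight p * (LINT x|lborel. heat_kernel (fst p) (x - snd p) * h x))"
proof -
  have m: "(\<lambda>z. heat_kernel (fst (fst z)) (snd z - snd (fst z))) \<in> borel_measurable (param_measure \<Otimes>\<^sub>M lborel)" by measurable
  have C: "\<bar>heat_kernel (fst p) (x - snd p)\<bar> \<le> (4 * pi * \<epsilon>) powr (- real DIM('a) / 2)" if "weight p \<noteq> 0" for p x
    using heat_kernel_bounds(1)[OF params(1)] weight_nonzero[OF that] by blast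
  note f = fubini_bounded_kernel[OF sigma_finite_param weight_integrable h, of "\<lambda>p x. heat_kernel (fst p) (x - snd p)", OF m C]
  show "(LINT x|lborel. resolvent x * h x) = (LINT p|param_measure. weight p * (LINT x|lborel. heat_kernel (fst p) (x - snd p) * h x))"
    unfolding resolvent_def by (rule f(1))
  show "integrable param_measure (\<lambda>p. weight p * (LINT x|lborel. heat_kernel (fst p) (x - snd p) * h x))"
    by (rule f(3))
qed

lemma
  assumes h: "integrable lborel h" "\<And>x. h x \<noteq> 0 \<Longrightarrow> x \<in> \<Omega>" and b: "b \<in> Basis"
  shows grad_fubini: "(LINT x|lborel. (resolvent_grad x \<bullet> b) * h x) = (LINT p|param_measure. weight p * (LINT x|lborel. (heat_kernel_grad (fst p) (x - snd p) \<bullet> b) * h x))"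
    and grad_fubini_integrable: "integrable lborel (\<lambda>x. (resolvent_grad x \<bullet> b) * h x)"
    and grad_fubini_integrable': "integrable param_measure (\<lambda>p. weight p * (LINT x|lborel. (heat_kernel_grad (fst p) (x - snd p) \<bullet> b) * h x))"
proof -
  obtain D where D: "\<And>x y. x \<in> \<Omega> \<Longrightarrow> y \<in> \<Omega> \<Longrightarrow> norm (x - y) \<le> D" using diameter by blast
  have m: "(\<lambda>z. heat_kernel_grad (fst (fst z)) (snd z - snd (fst z)) \<bullet> b) \<in> borel_measurable (param_measure \<Otimes>\<^sub>M lborel)" by measurable
  have C: "\<bar>heat_kernel_grad (fst p) (x - snd p) \<bullet> b\<bar> \<le> (4 * pi * \<epsilon>) powr (- real DIM('a) / 2) * D / (2 * \<epsilon>)"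
    if "weight p \<noteq> 0" "h x \<noteq> 0" for p x
    using heat_kernel_bounds(2)[OF params(1) _ _ b] D h(2)[OF that(2)] weight_nonzero[OF that(1)] by blast
  note f = fubini_bounded_kernel[OF sigma_finite_param weight_integrable h(1), of "\<lambda>p x. heat_kernel_grad (fst p) (x - snd p) \<bullet> b", OF m C]
  have g: "resolvent_grad x \<bullet> b = (LINT p|param_measure. weight p * (heat_kernel_grad (fst p) (x - snd p) \<bullet> b))" for x
    using b by (simp add: resolvent_grad_def inner_sum_left inner_Basis if_distrib[of "\<lambda>c. _ * c"] cong: if_cong)
  show "(LINT x|lborel. (resolvent_grad x \<bullet> b) * h x) = (LINT p|param_measure. weight p * (LINT x|lborel. (heat_kernel_grad (fst p) (x - snd p) \<bullet> b) * h x))"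
    unfolding g by (rule f(1))
  show "integrable lborel (\<lambda>x. (resolvent_grad x \<bullet> b) * h x)" unfolding g by (rule f(2))
  show "integrable param_measure (\<lambda>p. weight p * (LINT x|lborel. (heat_kernel_grad (fst p) (x - snd p) \<bullet> b) * h x))" by (rule f(3))
qed

lemma
  assumes h: "integrable lborel h" "\<And>x. h x \<noteq> 0 \<Longrightarrow> x \<in> \<Omega>"
  shows deriv_fubini: "(LINT x|lborel. (LINT p|param_measure. weight p * heat_kernel_deriv (fst p) (x - snd p)) * h x) = (LINT p|param_measure. weight p * (LINT x|lborel. heat_kernel_deriv (fst p) (x - snd p) * h x))"
    and deriv_fubini_integrable: "integrable lborel (\<lambda>x. (LINT p|param_measure. weight p * heat_kernel_deriv (fst p) (x - snd p)) * h x)"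
    and deriv_fubini_integrable': "integrable param_measure (\<lambda>p. weight p * (LINT x|lborel. heat_kernel_deriv (fst p) (x - snd p) * h x))"
proof -
  obtain D where D: "\<And>x y. x \<in> \<Omega> \<Longrightarrow> y \<in> \<Omega> \<Longrightarrow> norm (x - y) \<le> D" using diameter by blast
  have m: "(\<lambda>z. heat_kernel_deriv (fst (fst z)) (snd z - snd (fst z))) \<in> borel_measurable (param_measure \<Otimes>\<^sub>M lborel)" by measurable
  have C: "\<bar>heat_kernel_deriv (fst p) (x - snd p)\<bar> \<le> (D\<^sup>2 / (4 * \<epsilon>\<^sup>2) + real DIM('a) / (2 * \<epsilon>)) * (4 * pi * \<epsilon>) powr (- real DIM('a) / 2)"
    if "weight p \<noteq> 0" "h x \<noteq> 0" for p x
    using heat_kernel_bounds(3)[OF params(1)] D h(2)[OF that(2)] weight_nonzero[OF that(1)] by blast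
  note f = fubini_bounded_kernel[OF sigma_finite_param weight_integrable h(1), of "\<lambda>p x. heat_kernel_deriv (fst p) (x - snd p)", OF m C]
  show "(LINT x|lborel. (LINT p|param_measure. weight p * heat_kernel_deriv (fst p) (x - snd p)) * h x) = (LINT p|param_measure. weight p * (LINT x|lborel. heat_kernel_deriv (fst p) (x - snd p) * h x))"
    by (rule f(1))
  show "integrable lborel (\<lambda>x. (LINT p|param_measure. weight p * heat_kernel_deriv (fst p) (x - snd p)) * h x)" by (rule f(2))
  show "integrable param_measure (\<lambda>p. weight p * (LINT x|lborel. heat_kernel_deriv (fst p) (x - snd p) * h x))" by (rule f(3))
qed

lemma weighted_bounded:
  assumes m: "(\<lambda>p. k p) \<in> borel_measurable param_measure" and C: "\<And>p. weight p \<noteq> 0 \<Longrightarrow> \<bar>k p\<bar> \<le> C"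
  shows "integrable param_measure (\<lambda>p. weight p * k p)"
    and "\<bar>LINT p|param_measure. weight p * k p\<bar> \<le> \<bar>C\<bar> * (LINT p|param_measure. \<bar>weight p\<bar>)"
proof -
  have b: "\<bar>weight p * k p\<bar> \<le> \<bar>C\<bar> * \<bar>weight p\<bar>" for p
    using C[of p] by (cases "weight p = 0") (auto simp: abs_mult mult.commute intro!: mult_right_mono)
  have wm: "weight \<in> borel_measurable param_measure" using weight_integrable by auto
  show i: "integrable param_measure (\<lambda>p. weight p * k p)"
  proof (rule Bochner_Integration.integrable_bound)
    show "integrable param_measure (\<lambda>p. \<bar>C\<bar> * \<bar>weight p\<bar>)" using weight_integrable by auto
    show "AE p in param_measure. norm (weight p * k p) \<le> norm (\<bar>C\<bar> * \<bar>weight p\<bar>)"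
      using b by (intro AE_I2) simp
  qed (use wm m in measurable)
  have "\<bar>LINT p|param_measure. weight p * k p\<bar> \<le> (LINT p|param_measure. \<bar>C\<bar> * \<bar>weight p\<bar>)"
    by (rule order_trans[OF integral_abs_bound], rule integral_mono)
      (use i weight_integrable b in auto)
  then show "\<bar>LINT p|param_measure. weight p * k p\<bar> \<le> \<bar>C\<bar> * (LINT p|param_measure. \<bar>weight p\<bar>)" by simp
qed

lemma resolvent_measurable: "resolvent \<in> borel_measurable borel"
  unfolding resolvent_def[abs_def] weight_def by measurable

lemma resolvent_L2: "resolvent \<in> L2_on \<Omega>"
proof (rule L2_on_bounded[OF domain])
  show "set_borel_measurable lborel \<Omega> resolvent"
    using resolvent_measurable domain by (auto simp: set_borel_measurable_def)
  fix x
  have "(\<lambda>p. heat_kernel (fst p) (x - snd p)) \<in> borel_measurable param_measure" by measurable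
  then have "\<bar>resolvent x\<bar> \<le> \<bar>(4 * pi * \<epsilon>) powr (- real DIM('a) / 2)\<bar> * (LINT p|param_measure. \<bar>weight p\<bar>)"
    unfolding resolvent_def
    by (rule weighted_bounded(2)) (use heat_kernel_bounds(1)[OF params(1)] weight_nonzero in blast)
  then show "norm (resolvent x) \<le> \<bar>(4 * pi * \<epsilon>) powr (- real DIM('a) / 2)\<bar> * (LINT p|param_measure. \<bar>weight p\<bar>)"
    by simp
qed

lemma resolvent_grad_L2: "resolvent_grad \<in> L2_on \<Omega>"
  unfolding resolvent_grad_def[abs_def]
proof (rule L2_on_sum)
  fix b :: 'a assume b: "b \<in> Basis"
  obtain D where D: "\<And>x y. x \<in> \<Omega> \<Longrightarrow> y \<in> \<Omega> \<Longrightarrow> norm (x - y) \<le> D" using diameter by blast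
  let ?I = "\<lambda>x. LINT p|param_measure. weight p * (heat_kernel_grad (fst p) (x - snd p) \<bullet> b)"
  let ?C = "(4 * pi * \<epsilon>) powr (- real DIM('a) / 2) * D / (2 * \<epsilon>)"
  have m: "?I \<in> borel_measurable borel" unfolding weight_def by measurable
  show "(\<lambda>x. ?I x *\<^sub>R b) \<in> L2_on \<Omega>"
  proof (rule L2_on_bounded[OF domain])
    show "set_borel_measurable lborel \<Omega> (\<lambda>x. ?I x *\<^sub>R b)"
      using m domain by (auto simp: set_borel_measurable_def intro!: borel_measurable_scaleR)
    fix x assume x: "x \<in> \<Omega>"
    have "(\<lambda>p. heat_kernel_grad (fst p) (x - snd p) \<bullet> b) \<in> borel_measurable param_measure" by measurable
    then have "\<bar>?I x\<bar> \<le> \<bar>?C\<bar> * (LINT p|param_measure. \<bar>weight p\<bar>)"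
    proof (rule weighted_bounded(2))
      fix p assume "weight p \<noteq> 0"
      then show "\<bar>heat_kernel_grad (fst p) (x - snd p) \<bullet> b\<bar> \<le> ?C"
        using heat_kernel_bounds(2)[OF params(1) _ _ b] D x weight_nonzero by blast
    qed
    then show "norm (?I x *\<^sub>R b) \<le> \<bar>?C\<bar> * (LINT p|param_measure. \<bar>weight p\<bar>)" using b by simp
  qed
qed

lemma resolvent_H1: "H1_pair \<Omega> resolvent resolvent_grad"
proof -
  have "weak_gradient \<Omega> resolvent resolvent_grad"
    unfolding weak_gradient_def
  proof (intro allI impI ballI)
    fix \<theta> and b :: 'a assume \<theta>: "test_function \<Omega> \<theta>" and b: "b \<in> Basis"
    note \<theta>' = test_function_partial_deriv[OF \<theta> b]
    have "(LINT x:\<Omega>|lborel. resolvent x * partial_deriv b \<theta> x) = (LINT x|lborel. resolvent x * partial_deriv b \<theta> x)"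
      unfolding set_lebesgue_integral_def using test_function_outside[OF \<theta>']
      by (intro Bochner_Integration.integral_cong) (auto simp: indicator_def)
    also have "\<dots> = (LINT p|param_measure. weight p * (LINT x|lborel. heat_kernel (fst p) (x - snd p) * partial_deriv b \<theta> x))"
      by (rule resolvent_fubini[OF test_function_integrable[OF \<theta>']])
    also have "\<dots> = (LINT p|param_measure. - (weight p * (LINT x|lborel. (heat_kernel_grad (fst p) (x - snd p) \<bullet> b) * \<theta> x)))"
    proof (intro Bochner_Integration.integral_cong refl)
      fix p
      show "weight p * (LINT x|lborel. heat_kernel (fst p) (x - snd p) * partial_deriv b \<theta> x)
         = - (weight p * (LINT x|lborel. (heat_kernel_grad (fst p) (x - snd p) \<bullet> b) * \<theta> x))"
      proof (cases "weight p = 0")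
        case False
        then have t: "fst p > 0" using weight_nonzero[OF False] params by simp
        have c: "continuous_on UNIV (\<lambda>x. heat_kernel_grad (fst p) (x - snd p) \<bullet> b)"
          unfolding heat_kernel_grad_def heat_kernel_def using t by (intro continuous_intros) auto
        show ?thesis
          using integral_by_parts_test_function[OF \<theta> b heat_kernel_has_derivative[OF t] c] by simp
      qed simp
    qed
    also have "\<dots> = - (LINT p|param_measure. weight p * (LINT x|lborel. (heat_kernel_grad (fst p) (x - snd p) \<bullet> b) * \<theta> x))"
      by (rule Bochner_Integration.integral_minus)
    also have "(LINT p|param_measure. weight p * (LINT x|lborel. (heat_kernel_grad (fst p) (x - snd p) \<bullet> b) * \<theta> x))
      = (LINT x|lborel. (resolvent_grad x \<bullet> b) * \<theta> x)"
      by (rule grad_fubini[symmetric]) (use test_function_integrable[OF \<theta>] test_function_outside[OF \<theta>] b in auto)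
    also have "\<dots> = (LINT x:\<Omega>|lborel. (resolvent_grad x \<bullet> b) * \<theta> x)"
      unfolding set_lebesgue_integral_def using test_function_outside[OF \<theta>]
      by (intro Bochner_Integration.integral_cong) (auto simp: indicator_def)
    finally show "(LINT x:\<Omega>|lborel. resolvent x * partial_deriv b \<theta> x) = - (LINT x:\<Omega>|lborel. (resolvent_grad x \<bullet> b) * \<theta> x)" .
  qed
  then show ?thesis using resolvent_L2 resolvent_grad_L2 by (simp add: H1_pair_def)
qed

text \<open>The time derivative is integrated by the fundamental theorem of calculus. The two end point terms are what
  distinguishes the truncated heat integral from the true resolvent.\<close>

lemma weighted_time_derivative:
  assumes x: "x \<in> \<Omega>"
  shows "(LINT p|param_measure. weight p * heat_kernel_deriv (fst p) (x - snd p))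
    = exp (- \<kappa> * T) * convolve \<phi> (heat_kernel T) x - exp (- \<kappa> * \<epsilon>) * convolve \<phi> (heat_kernel \<epsilon>) x + \<kappa> * resolvent x"
proof -
  obtain D where D: "\<And>x y. x \<in> \<Omega> \<Longrightarrow> y \<in> \<Omega> \<Longrightarrow> norm (x - y) \<le> D" using diameter by blast
  have i1: "integrable param_measure (\<lambda>p. weight p * heat_kernel_deriv (fst p) (x - snd p))"
  proof (rule weighted_bounded(1))
    fix p assume "weight p \<noteq> 0"
    then show "\<bar>heat_kernel_deriv (fst p) (x - snd p)\<bar> \<le> (D\<^sup>2 / (4 * \<epsilon>\<^sup>2) + real DIM('a) / (2 * \<epsilon>)) * (4 * pi * \<epsilon>) powr (- real DIM('a) / 2)"
      using heat_kernel_bounds(3)[OF params(1)] D x weight_nonzero by blast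
  qed measurable
  have i2: "integrable param_measure (\<lambda>p. weight p * heat_kernel (fst p) (x - snd p))"
  proof (rule weighted_bounded(1))
    fix p assume "weight p \<noteq> 0"
    then show "\<bar>heat_kernel (fst p) (x - snd p)\<bar> \<le> (4 * pi * \<epsilon>) powr (- real DIM('a) / 2)"
      using heat_kernel_bounds(1)[OF params(1)] weight_nonzero by blast
  qed measurable
  have i3: "integrable param_measure (\<lambda>(t, y). weight (t, y) * heat_kernel_deriv t (x - y) - \<kappa> * (weight (t, y) * heat_kernel t (x - y)))"
    using Bochner_Integration.integrable_diff[OF i1 integrable_mult_right[OF i2, of \<kappa>]] by (simp add: case_prod_unfold)
  have ftc: "(LINT t|lborel. (exp (- \<kappa> * t) * heat_kernel_deriv t z - \<kappa> * exp (- \<kappa> * t) * heat_kernel t z) * indicator {\<epsilon>..T} t)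
      = exp (- \<kappa> * T) * heat_kernel T z - exp (- \<kappa> * \<epsilon>) * heat_kernel \<epsilon> z" for z :: 'a
  proof (rule integral_FTC_Icc_real[OF params(2)])
    fix t assume t: "\<epsilon> \<le> t" "t \<le> T"
    then have t0: "t > 0" using params by simp
    have e: "((\<lambda>t. exp (- \<kappa> * t)) has_real_derivative - \<kappa> * exp (- \<kappa> * t)) (at t)"
      by (auto intro!: derivative_eq_intros)
    show "((\<lambda>t. exp (- \<kappa> * t) * heat_kernel t z) has_real_derivative
      exp (- \<kappa> * t) * heat_kernel_deriv t z - \<kappa> * exp (- \<kappa> * t) * heat_kernel t z) (at t)"
      by (rule DERIV_cong[OF DERIV_mult[OF e heat_kernel_has_real_derivative_time[OF t0]]]) (simp add: algebra_simps)
    have hc: "isCont (\<lambda>t. heat_kernel t z) t" by (rule DERIV_isCont[OF heat_kernel_has_real_derivative_time[OF t0]])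
    then show "isCont (\<lambda>t. exp (- \<kappa> * t) * heat_kernel_deriv t z - \<kappa> * exp (- \<kappa> * t) * heat_kernel t z) t"
      unfolding heat_kernel_deriv_def using t0 by (intro continuous_intros) auto
  qed
  have conv: "integrable lborel (\<lambda>y. \<phi> y * heat_kernel t (x - y))" if "t > 0" for t
  proof (rule Bochner_Integration.integrable_bound)
    show "integrable lborel (\<lambda>y. (4 * pi * t) powr (- real DIM('a) / 2) * \<phi> y)" using test_function_integrable[OF test] by simp
    show "AE y in lborel. norm (\<phi> y * heat_kernel t (x - y)) \<le> norm ((4 * pi * t) powr (- real DIM('a) / 2) * \<phi> y)"
    proof (rule AE_I2)
      fix y
      have "\<bar>\<phi> y\<bar> * \<bar>heat_kernel t (x - y)\<bar> \<le> \<bar>\<phi> y\<bar> * (4 * pi * t) powr (- real DIM('a) / 2)"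
        by (rule mult_left_mono[OF heat_kernel_bounds(1)[OF that order_refl]]) simp
      then show "norm (\<phi> y * heat_kernel t (x - y)) \<le> norm ((4 * pi * t) powr (- real DIM('a) / 2) * \<phi> y)"
        by (simp add: abs_mult mult.commute[of _ "\<bar>\<phi> y\<bar>"])
    qed
  qed measurable
  have "(LINT p|param_measure. weight p * heat_kernel_deriv (fst p) (x - snd p)) - \<kappa> * resolvent x
      = (LINT p|param_measure. weight p * heat_kernel_deriv (fst p) (x - snd p) - \<kappa> * (weight p * heat_kernel (fst p) (x - snd p)))"
    unfolding resolvent_def by (subst Bochner_Integration.integral_diff[OF i1 integrable_mult_right[OF i2]]) simp
  also have "\<dots> = (LINT y|lborel. LINT t|lborel. weight (t, y) * heat_kernel_deriv t (x - y) - \<kappa> * (weight (t, y) * heat_kernel t (x - y)))"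
    using lborel_pair.integral_snd[OF i3] by (simp add: case_prod_unfold)
  also have "\<dots> = (LINT y|lborel. \<phi> y * (exp (- \<kappa> * T) * heat_kernel T (x - y) - exp (- \<kappa> * \<epsilon>) * heat_kernel \<epsilon> (x - y)))"
  proof (intro Bochner_Integration.integral_cong refl)
    fix y :: 'a
    have "(LINT t|lborel. weight (t, y) * heat_kernel_deriv t (x - y) - \<kappa> * (weight (t, y) * heat_kernel t (x - y)))
      = (LINT t|lborel. \<phi> y * ((exp (- \<kappa> * t) * heat_kernel_deriv t (x - y) - \<kappa> * exp (- \<kappa> * t) * heat_kernel t (x - y)) * indicator {\<epsilon>..T} t))"
      by (intro Bochner_Integration.integral_cong refl) (simp add: weight_def algebra_simps)
    then show "(LINT t|lborel. weight (t, y) * heat_kernel_deriv t (x - y) - \<kappa> * (weight (t, y) * heat_kernel t (x - y)))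
      = \<phi> y * (exp (- \<kappa> * T) * heat_kernel T (x - y) - exp (- \<kappa> * \<epsilon>) * heat_kernel \<epsilon> (x - y))"
      by (simp only: integral_mult_right_zero ftc)
  qed
  also have "\<dots> = (LINT y|lborel. exp (- \<kappa> * T) * (\<phi> y * heat_kernel T (x - y)) - exp (- \<kappa> * \<epsilon>) * (\<phi> y * heat_kernel \<epsilon> (x - y)))"
    by (intro Bochner_Integration.integral_cong refl) (simp add: right_diff_distrib mult.left_commute)
  also have "\<dots> = exp (- \<kappa> * T) * convolve \<phi> (heat_kernel T) x - exp (- \<kappa> * \<epsilon>) * convolve \<phi> (heat_kernel \<epsilon>) x"
    unfolding convolve_def using params
    by (subst Bochner_Integration.integral_diff) (auto intro!: integrable_mult_right conv)
  finally show ?thesis by simp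
qed

lemma resolvent_heat_form:
  assumes u: "integrable lborel u"
  shows "(LINT x|lborel. resolvent x * u x) = (LINT t|lborel. indicator {\<epsilon>..T} t * exp (- \<kappa> * t) * heat_form t u \<phi>)"
proof -
  have "(LINT x|lborel. resolvent x * u x) = (LINT p|param_measure. weight p * (LINT x|lborel. heat_kernel (fst p) (x - snd p) * u x))"
    by (rule resolvent_fubini[OF u])
  also have "\<dots> = (LINT t|lborel. LINT y|lborel. weight (t, y) * (LINT x|lborel. heat_kernel t (x - y) * u x))"
    using lborel_pair.integral_fst'[OF resolvent_fubini_integrable[OF u]] by simp
  also have "\<dots> = (LINT t|lborel. indicator {\<epsilon>..T} t * exp (- \<kappa> * t) * heat_form t u \<phi>)"
  proof (intro Bochner_Integration.integral_cong refl)
    fix t :: real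
    show "(LINT y|lborel. weight (t, y) * (LINT x|lborel. heat_kernel t (x - y) * u x)) = indicator {\<epsilon>..T} t * exp (- \<kappa> * t) * heat_form t u \<phi>"
    proof (cases "t \<in> {\<epsilon>..T}")
      case True
      then have t: "t > 0" using params by simp
      have i: "integrable (lborel \<Otimes>\<^sub>M lborel) (\<lambda>(x, y). heat_kernel t (x - y) * (u x * \<phi> y))"
        using heat_form_integrable[OF t u test_function_integrable[OF test]] by (simp add: case_prod_unfold)
      have "heat_form t u \<phi> = (LINT y|lborel. LINT x|lborel. heat_kernel t (x - y) * (u x * \<phi> y))"
        unfolding heat_form_pair[OF t u test_function_integrable[OF test]]
        using lborel_pair.integral_snd[OF i] by (simp add: case_prod_unfold)
      also have "\<dots> = (LINT y|lborel. \<phi> y * (LINT x|lborel. heat_kernel t (x - y) * u x))"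
        unfolding integral_mult_right_zero[symmetric] by (simp only: mult_ac)
      finally show ?thesis using True
        by (simp add: weight_def mult.assoc)
    qed (simp add: weight_def)
  qed
  finally show ?thesis .
qed

end

context heat_resolvent
begin

lemma convolve_heat_L2:
  assumes t: "t > 0" shows "convolve \<phi> (heat_kernel t) \<in> L2_on \<Omega>"
proof -
  obtain B where B: "\<And>x. \<bar>\<phi> x\<bar> \<le> B" using test_function_bounded[OF test] by blast
  show ?thesis
    by (rule L2_on_bounded[OF domain, where C = B])
      (use convolve_heat_kernel_bound[OF t \<phi>_measurable B] convolve_heat_kernel_measurable[OF \<phi>_measurable] domain
        in \<open>auto simp: set_borel_measurable_def\<close>)
qed

text \<open>Average \<open>heat_kernel_subsolution\<close> over the pole and the time. Of the two end point terms from
  \<open>weighted_time_derivative\<close>, the one at \<open>T\<close> has the favourable sign and is dropped; the one at \<open>\<epsilon>\<close> is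
  the right-hand side, and approximates \<open>\<phi>\<close>.\<close>

lemma resolvent_subsolution:
  assumes \<rho>: "mollifiers (\<rho> :: real \<Rightarrow> 'a \<Rightarrow> real)" and convex: "convex \<Omega>" and \<phi>: "\<And>x. 0 \<le> \<phi> x"
    and v: "H1_pair \<Omega> v H" "\<And>x. 0 \<le> v x"
  shows "(LINT x:\<Omega>|lborel. resolvent_grad x \<bullet> H x) + \<kappa> * L2_inner \<Omega> resolvent v
    \<le> L2_inner \<Omega> (\<lambda>x. exp (- \<kappa> * \<epsilon>) * convolve \<phi> (heat_kernel \<epsilon>) x) v"
proof -
  have vL: "v \<in> L2_on \<Omega>" and HL: "H \<in> L2_on \<Omega>" using v by (auto simp: H1_pair_def)
  define h where "h x = indicator \<Omega> x * v x" for x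
  define g where "g b x = indicator \<Omega> x * (H x \<bullet> b)" for b x
  have hi: "integrable lborel h" using L2_on_set_integrable[OF vL domain] by (simp add: set_integrable_def h_def[abs_def])
  have gi: "integrable lborel (g b)" for b
    using L2_on_set_integrable[OF L2_on_component[OF HL] domain] by (simp add: set_integrable_def g_def[abs_def])
  have h0: "h x \<noteq> 0 \<Longrightarrow> x \<in> \<Omega>" and g0: "g b x \<noteq> 0 \<Longrightarrow> x \<in> \<Omega>" for x b by (auto simp: h_def g_def indicator_def split: if_splits)
  let ?D = "\<lambda>x. LINT p|param_measure. weight p * heat_kernel_deriv (fst p) (x - snd p)"
  let ?G = "\<lambda>b p. LINT x|lborel. (heat_kernel_grad (fst p) (x - snd p) \<bullet> b) * g b x"
  let ?K = "\<lambda>p. LINT x|lborel. heat_kernel_deriv (fst p) (x - snd p) * h x"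
  have A: "(LINT x:\<Omega>|lborel. resolvent_grad x \<bullet> H x) = (\<Sum>b\<in>Basis. LINT p|param_measure. weight p * ?G b p)"
  proof -
    have "(LINT x:\<Omega>|lborel. resolvent_grad x \<bullet> H x) = (LINT x|lborel. (\<Sum>b\<in>Basis. (resolvent_grad x \<bullet> b) * g b x))"
      unfolding set_lebesgue_integral_def
      by (intro Bochner_Integration.integral_cong refl)
        (simp add: g_def euclidean_inner[of "resolvent_grad _" "H _"] sum_distrib_left mult_ac)
    also have "\<dots> = (\<Sum>b\<in>Basis. LINT x|lborel. (resolvent_grad x \<bullet> b) * g b x)"
      by (rule Bochner_Integration.integral_sum) (rule grad_fubini_integrable[OF gi g0])
    also have "\<dots> = (\<Sum>b\<in>Basis. LINT p|param_measure. weight p * ?G b p)"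
      by (intro sum.cong refl grad_fubini[OF gi g0])
    finally show ?thesis .
  qed
  have B: "(LINT x|lborel. ?D x * h x) = (LINT p|param_measure. weight p * ?K p)"
    by (rule deriv_fubini[OF hi h0])
  have neg: "(\<Sum>b\<in>Basis. ?G b p) + ?K p \<le> 0" if p: "weight p \<noteq> 0" for p
  proof -
    have t: "fst p > 0" and y: "snd p \<in> \<Omega>" using weight_nonzero[OF p] params by auto
    have cg: "continuous_on UNIV (\<lambda>x. heat_kernel_grad (fst p) (x - snd p))"
      and cd: "continuous_on UNIV (\<lambda>x. heat_kernel_deriv (fst p) (x - snd p))"
      unfolding heat_kernel_grad_def heat_kernel_deriv_def heat_kernel_def using t by (intro continuous_intros; simp)+
    note gL = continuous_L2_on[OF domain cg] and dL = continuous_L2_on[OF domain cd]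
    have i1: "integrable lborel (\<lambda>x. (heat_kernel_grad (fst p) (x - snd p) \<bullet> b) * g b x)" for b
      using L2_on_mult_integrable[OF L2_on_component[OF gL, of b] L2_on_component[OF HL, of b]]
      by (simp add: set_integrable_def g_def mult_ac)
    have i2: "integrable lborel (\<lambda>x. heat_kernel_deriv (fst p) (x - snd p) * h x)"
      using L2_on_mult_integrable[OF dL vL] by (simp add: set_integrable_def h_def mult_ac)
    have "(\<Sum>b\<in>Basis. ?G b p) + ?K p = (LINT x|lborel. (\<Sum>b\<in>Basis. (heat_kernel_grad (fst p) (x - snd p) \<bullet> b) * g b x) + heat_kernel_deriv (fst p) (x - snd p) * h x)"
      by (subst Bochner_Integration.integral_add[OF Bochner_Integration.integrable_sum[OF i1] i2],
          subst Bochner_Integration.integral_sum[OF i1]) simp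
    also have "\<dots> = (LINT x:\<Omega>|lborel. heat_kernel_grad (fst p) (x - snd p) \<bullet> H x + heat_kernel_deriv (fst p) (x - snd p) * v x)"
      unfolding set_lebesgue_integral_def
      by (intro Bochner_Integration.integral_cong refl)
        (simp add: g_def h_def euclidean_inner[of "heat_kernel_grad _ _" "H _"] sum_distrib_left distrib_left mult_ac)
    also have "\<dots> \<le> 0"
      by (rule mollifiers.heat_kernel_subsolution[OF \<rho> domain convex y t v])
    finally show ?thesis .
  qed
  have w0: "0 \<le> weight p" for p using \<phi> by (simp add: weight_def)
  have total: "(LINT x:\<Omega>|lborel. resolvent_grad x \<bullet> H x) + (LINT x|lborel. ?D x * h x) \<le> 0"
  proof -
    have "(LINT x:\<Omega>|lborel. resolvent_grad x \<bullet> H x) + (LINT x|lborel. ?D x * h x)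
      = (LINT p|param_measure. (\<Sum>b\<in>Basis. weight p * ?G b p) + weight p * ?K p)"
    proof -
      have S: "integrable param_measure (\<lambda>p. \<Sum>b\<in>Basis. weight p * ?G b p)"
        by (rule Bochner_Integration.integrable_sum) (rule grad_fubini_integrable'[OF gi g0])
      have "(LINT p|param_measure. (\<Sum>b\<in>Basis. weight p * ?G b p)) = (\<Sum>b\<in>Basis. (LINT p|param_measure. weight p * ?G b p))"
        by (rule Bochner_Integration.integral_sum) (rule grad_fubini_integrable'[OF gi g0])
      moreover have "(LINT p|param_measure. (\<Sum>b\<in>Basis. weight p * ?G b p) + weight p * ?K p)
        = (LINT p|param_measure. (\<Sum>b\<in>Basis. weight p * ?G b p)) + (LINT p|param_measure. weight p * ?K p)"
        by (rule Bochner_Integration.integral_add[OF S]) (rule deriv_fubini_integrable'[OF hi h0])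
      ultimately show ?thesis unfolding A B by linarith
    qed
    also have "\<dots> \<le> 0"
    proof (rule integral_nonpos)
      fix p
      have "weight p * ((\<Sum>b\<in>Basis. ?G b p) + ?K p) \<le> 0"
        using neg[of p] w0[of p] by (cases "weight p = 0") (auto intro: mult_nonneg_nonpos)
      then show "(\<Sum>b\<in>Basis. weight p * ?G b p) + weight p * ?K p \<le> 0" by (simp add: distrib_left sum_distrib_left)
    qed
    finally show ?thesis .
  qed
  have T: "T > 0" using params by simp
  note cL = convolve_heat_L2[OF T] and cL' = convolve_heat_L2[OF params(1)]
  have "(LINT x|lborel. ?D x * h x)
    = L2_inner \<Omega> (\<lambda>x. (exp (- \<kappa> * T) * convolve \<phi> (heat_kernel T) x - exp (- \<kappa> * \<epsilon>) * convolve \<phi> (heat_kernel \<epsilon>) x) + \<kappa> * resolvent x) v"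
    unfolding L2_inner_def set_lebesgue_integral_def
  proof (intro Bochner_Integration.integral_cong refl)
    fix x
    show "?D x * h x = indicator \<Omega> x *\<^sub>R ((exp (- \<kappa> * T) * convolve \<phi> (heat_kernel T) x - exp (- \<kappa> * \<epsilon>) * convolve \<phi> (heat_kernel \<epsilon>) x + \<kappa> * resolvent x) * v x)"
      using weighted_time_derivative[of x] by (cases "x \<in> \<Omega>") (auto simp: h_def)
  qed
  also have "\<dots> = exp (- \<kappa> * T) * L2_inner \<Omega> (convolve \<phi> (heat_kernel T)) v
      - L2_inner \<Omega> (\<lambda>x. exp (- \<kappa> * \<epsilon>) * convolve \<phi> (heat_kernel \<epsilon>) x) v + \<kappa> * L2_inner \<Omega> resolvent v"
    using L2_on_scaleR[OF cL, of "exp (- \<kappa> * T)"] L2_on_scaleR[OF cL', of "exp (- \<kappa> * \<epsilon>)"] L2_on_scaleR[OF resolvent_L2, of \<kappa>] vL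
    by (subst L2_inner_add_left, auto intro: L2_on_diff, subst L2_inner_diff_left) (auto simp: L2_inner_mult_left)
  finally have eq: "(LINT x|lborel. ?D x * h x) = \<dots>" .
  have "0 \<le> L2_inner \<Omega> (convolve \<phi> (heat_kernel T)) v"
    unfolding L2_inner_def set_lebesgue_integral_def
  proof (intro integral_nonneg_AE AE_I2)
    fix x
    have "0 \<le> convolve \<phi> (heat_kernel T) x"
      unfolding convolve_def using \<phi> heat_kernel_pos[OF T, THEN less_imp_le]
      by (intro integral_nonneg_AE AE_I2 mult_nonneg_nonneg) auto
    then show "0 \<le> indicator \<Omega> x *\<^sub>R (convolve \<phi> (heat_kernel T) x * v x)" using v(2)[of x] by simp
  qed
  then have "0 \<le> exp (- \<kappa> * T) * L2_inner \<Omega> (convolve \<phi> (heat_kernel T)) v" by simp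
  then show ?thesis using total unfolding eq by linarith
qed

end

section \<open>A weak maximum principle\<close>

text \<open>A continuously differentiable replacement for \<open>\<lambda>s. min s 0\<close>: the chain rule for weak gradients is available
  for it, and it still grows linearly at \<open>- \<infinity>\<close>, so that it controls the negative part.\<close>

definition soft_neg :: "real \<Rightarrow> real" where
  "soft_neg s = (if s < 0 then - s\<^sup>2 / (1 - s) else 0)"

definition soft_neg' :: "real \<Rightarrow> real" where
  "soft_neg' s = 1 - 1 / (1 + max 0 (- s))\<^sup>2"

lemma soft_neg_le: "\<bar>soft_neg s\<bar> \<le> \<bar>s\<bar> * min 1 \<bar>s\<bar>"
proof (cases "s < 0")
  case True
  then have "s\<^sup>2 / (1 - s) \<le> s\<^sup>2 / 1" "s\<^sup>2 / (1 - s) \<le> - s"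
    by (intro divide_left_mono, auto) (simp add: field_simps power2_eq_square)
  then show ?thesis using True by (simp add: soft_neg_def min_def power2_eq_square)
qed (simp add: soft_neg_def)

lemma soft_neg_has_derivative: "(soft_neg has_real_derivative soft_neg' s) (at s)"
proof -
  consider "s < 0" | "s > 0" | "s = 0" by linarith
  then show ?thesis
  proof cases
    case 1
    have "((\<lambda>s. - s\<^sup>2 / (1 - s)) has_real_derivative - ((2 * s * (1 - s) + s\<^sup>2) / ((1 - s) * (1 - s)))) (at s)"
      using 1 by (auto intro!: derivative_eq_intros)
    also have "- ((2 * s * (1 - s) + s\<^sup>2) / ((1 - s) * (1 - s))) = soft_neg' s"
    proof -
      have "- (2 * s * (1 - s) + s\<^sup>2) = (1 - s) * (1 - s) - 1" by (simp add: algebra_simps power2_eq_square)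
      then have "- ((2 * s * (1 - s) + s\<^sup>2) / ((1 - s) * (1 - s))) = ((1 - s) * (1 - s) - 1) / ((1 - s) * (1 - s))"
        by (simp only: minus_divide_left)
      also have "\<dots> = 1 - 1 / ((1 - s) * (1 - s))" using 1 by (simp only: diff_divide_distrib) simp
      finally show ?thesis using 1 by (simp add: soft_neg'_def power2_eq_square)
    qed
    finally show ?thesis
      by (rule has_field_derivative_transform_within_open[of _ _ _ "{..<0}"]) (use 1 in \<open>auto simp: soft_neg_def\<close>)
  next
    case 2
    have "((\<lambda>s. 0) has_real_derivative soft_neg' s) (at s)" using 2 by (simp add: soft_neg'_def)
    then show ?thesis
      by (rule has_field_derivative_transform_within_open[of _ _ _ "{0<..}"]) (use 2 in \<open>auto simp: soft_neg_def\<close>)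
  next
    case 3
    have "((\<lambda>h. soft_neg h / h) \<longlongrightarrow> 0) (at 0)"
    proof (rule Lim_null_comparison)
      have "\<bar>soft_neg h / h\<bar> \<le> \<bar>h\<bar>" for h
      proof (cases "h = 0")
        case False
        have "\<bar>soft_neg h\<bar> \<le> \<bar>h\<bar> * \<bar>h\<bar>"
          using soft_neg_le[of h] by (rule order_trans) (intro mult_left_mono, auto)
        then show ?thesis using False by (simp add: abs_divide divide_le_eq)
      qed simp
      then show "\<forall>\<^sub>F h in at 0. norm (soft_neg h / h) \<le> \<bar>h\<bar>" by simp
      show "((\<lambda>h::real. \<bar>h\<bar>) \<longlongrightarrow> 0) (at 0)" by (auto intro!: tendsto_eq_intros)
    qed
    then show ?thesis using 3 by (simp add: DERIV_def soft_neg'_def soft_neg_def[of 0])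
  qed
qed

lemma soft_neg'_bounds: "0 \<le> soft_neg' s" "soft_neg' s \<le> 1"
proof -
  have "1 \<le> (1 + max 0 (- s))\<^sup>2" by (rule one_le_power) simp
  then have "1 / (1 + max 0 (- s))\<^sup>2 \<le> 1" by (simp add: divide_le_eq)
  then show "0 \<le> soft_neg' s" by (simp add: soft_neg'_def)
  show "soft_neg' s \<le> 1" by (simp add: soft_neg'_def)
qed

lemma continuous_soft_neg': "continuous_on UNIV soft_neg'"
  unfolding soft_neg'_def[abs_def]
proof (intro continuous_intros ballI)
  fix s :: real
  have "1 + max 0 (- s) > 0" by (simp add: add_pos_nonneg)
  then show "(1 + max 0 (- s))\<^sup>2 \<noteq> 0" by simp
qed

lemma soft_neg_nonpos: "soft_neg s \<le> 0"
  by (simp add: soft_neg_def)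

text \<open>The negative part enters the energy estimate as \<open>s * soft_neg s\<close>; this bound lets Cauchy--Schwarz absorb the right-hand side.\<close>

lemma soft_neg_square_le: "(soft_neg s)\<^sup>2 \<le> s * soft_neg s"
proof (cases "s < 0")
  case True
  have "(soft_neg s)\<^sup>2 = - soft_neg s * (s\<^sup>2 / (1 - s))" using True by (simp add: soft_neg_def power2_eq_square)
  also have "\<dots> \<le> - soft_neg s * (- s)"
    using True soft_neg_nonpos[of s] by (intro mult_left_mono) (auto simp: field_simps power2_eq_square)
  finally show ?thesis by (simp add: mult.commute)
qed (simp add: soft_neg_def)

text \<open>If \<open>- s \<le> \<delta>\<close>, the first term suffices. Otherwise \<open>s * soft_neg s\<close> is at least \<open>\<delta> / (1 + \<delta>) * s\<^sup>2\<close>, and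
  Young's inequality for \<open>u * (- s)\<close> with weight \<open>\<delta>\<close> yields the stated constant.\<close>

lemma neg_part_young:
  assumes d: "\<delta> > 0" and u: "u \<ge> 0"
  shows "u * (- s) \<le> \<delta> * u + \<delta> * u\<^sup>2 + (1 + \<delta>) / (4 * \<delta>\<^sup>2) * (s * soft_neg s)"
proof (cases "- s \<le> \<delta>")
  case True
  have "0 \<le> s * soft_neg s" using soft_neg_square_le[of s] zero_le_power2[of "soft_neg s"] by linarith
  then have "0 \<le> (1 + \<delta>) / (4 * \<delta>\<^sup>2) * (s * soft_neg s)" using d by (intro mult_nonneg_nonneg[of "_ / _"]) auto
  moreover have "u * (- s) \<le> \<delta> * u" using mult_left_mono[OF True u] by (simp add: mult.commute)
  moreover have "0 \<le> \<delta> * u\<^sup>2" using d by simp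
  ultimately show ?thesis by linarith
next
  case False
  define m where "m = - s"
  have m: "m > \<delta>" using False by (simp add: m_def)
  have e: "s * soft_neg s = m\<^sup>2 * (m / (1 + m))" using m d by (simp add: soft_neg_def m_def power2_eq_square)
  have "\<delta> / (1 + \<delta>) \<le> m / (1 + m)" using m d by (simp add: field_simps)
  then have "m\<^sup>2 * (\<delta> / (1 + \<delta>)) \<le> s * soft_neg s" unfolding e by (intro mult_left_mono) auto
  then have "(1 + \<delta>) / (4 * \<delta>\<^sup>2) * (m\<^sup>2 * (\<delta> / (1 + \<delta>))) \<le> (1 + \<delta>) / (4 * \<delta>\<^sup>2) * (s * soft_neg s)"
    using d by (intro mult_left_mono) auto
  moreover have "(1 + \<delta>) / (4 * \<delta>\<^sup>2) * (m\<^sup>2 * (\<delta> / (1 + \<delta>))) = m\<^sup>2 / (4 * \<delta>)"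
  proof -
    have "1 + \<delta> > 0" using d by simp
    then show ?thesis using d by (simp add: divide_simps power2_eq_square)
  qed
  moreover have "u * m \<le> \<delta> * u\<^sup>2 + m\<^sup>2 / (4 * \<delta>)"
  proof -
    have "0 \<le> (2 * \<delta> * u - m)\<^sup>2 / (4 * \<delta>)" using d by simp
    also have "\<dots> = \<delta> * u\<^sup>2 + m\<^sup>2 / (4 * \<delta>) - u * m" using d by (simp add: power2_diff field_simps power2_eq_square)
    finally show ?thesis by simp
  qed
  moreover have "0 \<le> \<delta> * u" using d u by simp
  ultimately show ?thesis by (simp add: m_def)
qed

lemma soft_neg_L2:
  fixes d :: "'a::euclidean_space \<Rightarrow> real"
  assumes d: "d \<in> L2_on \<Omega>"
  shows "(\<lambda>x. soft_neg (d x)) \<in> L2_on \<Omega>"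
proof (rule L2_on_dominated[OF d, where C = 1])
  have c: "continuous_on UNIV soft_neg"
    using soft_neg_has_derivative by (meson DERIV_isCont continuous_at_imp_continuous_on)
  have [measurable]: "soft_neg \<in> borel_measurable borel" using c by (rule borel_measurable_continuous_onI)
  have [measurable]: "(\<lambda>x. indicator \<Omega> x *\<^sub>R d x) \<in> borel_measurable lborel" using d by (simp add: L2_on_iff)
  have "(\<lambda>x. indicator \<Omega> x *\<^sub>R soft_neg (d x)) = (\<lambda>x. soft_neg (indicator \<Omega> x *\<^sub>R d x))"
    by (auto simp: indicator_def soft_neg_def)
  moreover have "(\<lambda>x. soft_neg (indicator \<Omega> x *\<^sub>R d x)) \<in> borel_measurable lborel" by measurable
  ultimately show "set_borel_measurable lborel \<Omega> (\<lambda>x. soft_neg (d x))" by (simp add: set_borel_measurable_def)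
  show "norm (soft_neg (d x)) \<le> 1 * norm (d x)" for x
    using soft_neg_le[of "d x"] mult_left_le[of "min 1 \<bar>d x\<bar>" "\<bar>d x\<bar>"] by simp
qed

text \<open>Test the difference of the two relations with the nonnegative function \<open>- soft_neg (d x)\<close>. The gradient term
  has a sign because \<open>soft_neg\<close> is nondecreasing, so \<open>\<kappa>\<close> times the weighted negative part of \<open>d\<close> is bounded by
  the pairing of \<open>f - g\<close> with \<open>soft_neg (d x)\<close>, and Cauchy--Schwarz gives the claim. For \<open>f = g\<close> it says that \<open>d\<close> is nonnegative.\<close>

lemma (in mollifiers) weak_maximum_principle:
  fixes \<Omega> :: "'a set"
  assumes \<Omega>: "open \<Omega>" "bounded \<Omega>" and k: "\<kappa> > 0"
    and z: "H1_pair \<Omega> z Z" and w: "H1_pair \<Omega> w W" and fL: "f \<in> L2_on \<Omega>" and gL: "g \<in> L2_on \<Omega>"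
    and zeq: "\<And>v H. H1_pair \<Omega> v H \<Longrightarrow> (LINT x:\<Omega>|lborel. Z x \<bullet> H x) + \<kappa> * L2_inner \<Omega> z v = L2_inner \<Omega> f v"
    and wle: "\<And>v H. H1_pair \<Omega> v H \<Longrightarrow> (\<And>x. 0 \<le> v x) \<Longrightarrow>
       (LINT x:\<Omega>|lborel. W x \<bullet> H x) + \<kappa> * L2_inner \<Omega> w v \<le> L2_inner \<Omega> g v"
  defines "d \<equiv> \<lambda>x. z x - w x"
  shows "\<kappa>\<^sup>2 * L2_inner \<Omega> d (\<lambda>x. soft_neg (d x)) \<le> L2_inner \<Omega> (\<lambda>x. f x - g x) (\<lambda>x. f x - g x)"
proof -
  have zL: "z \<in> L2_on \<Omega>" "Z \<in> L2_on \<Omega>" and wL: "w \<in> L2_on \<Omega>" "W \<in> L2_on \<Omega>" using z w by (auto simp: H1_pair_def)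
  define D where "D x = Z x - W x" for x
  have dD: "H1_pair \<Omega> d D" unfolding d_def D_def[abs_def] by (rule H1_pair_diff[OF \<Omega> z w])
  have dL: "d \<in> L2_on \<Omega>" "D \<in> L2_on \<Omega>" using dD by (auto simp: H1_pair_def)
  have chain: "H1_pair \<Omega> (\<lambda>x. soft_neg (d x)) (\<lambda>x. soft_neg' (d x) *\<^sub>R D x)"
    by (rule H1_pair_chain_rule[OF \<Omega> dD soft_neg_has_derivative continuous_soft_neg', of 1])
      (use soft_neg'_bounds in \<open>auto simp: soft_neg_def abs_le_iff intro: order_trans[of _ 0]\<close>)
  let ?n = "\<lambda>x. soft_neg (d x)"
  have nL: "?n \<in> L2_on \<Omega>" by (rule soft_neg_L2[OF dL(1)])
  define v where "v x = - 1 * soft_neg (d x)" for x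
  define H where "H x = (- 1) *\<^sub>R (soft_neg' (d x) *\<^sub>R D x)" for x
  have v: "H1_pair \<Omega> v H" unfolding v_def[abs_def] H_def[abs_def] by (rule H1_pair_scaleR[OF chain])
  have v0: "0 \<le> v x" for x using soft_neg_nonpos[of "d x"] by (simp add: v_def)
  have HL: "H \<in> L2_on \<Omega>" using v by (simp add: H1_pair_def)
  have inner_v: "L2_inner \<Omega> q v = - L2_inner \<Omega> q ?n" for q
    unfolding v_def L2_inner_commute[of \<Omega> q] L2_inner_mult_left by simp
  define B where "B = L2_inner \<Omega> d ?n"
  define F where "F = L2_inner \<Omega> (\<lambda>x. f x - g x) (\<lambda>x. f x - g x)"
  have "(LINT x:\<Omega>|lborel. D x \<bullet> H x) \<le> 0"
    unfolding set_lebesgue_integral_def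
    by (rule integral_nonpos) (auto simp: H_def soft_neg'_bounds indicator_def)
  moreover have "(LINT x:\<Omega>|lborel. D x \<bullet> H x) = (LINT x:\<Omega>|lborel. Z x \<bullet> H x) - (LINT x:\<Omega>|lborel. W x \<bullet> H x)"
    using L2_on_inner_integrable[OF zL(2) HL] L2_on_inner_integrable[OF wL(2) HL] by (simp add: D_def inner_diff_left)
  moreover note zeq[OF v] wle[OF v v0]
  moreover have "L2_inner \<Omega> z v - L2_inner \<Omega> w v = - B"
    using L2_inner_diff_left[OF zL(1) wL(1) nL] by (simp add: inner_v B_def d_def)
  then have "\<kappa> * L2_inner \<Omega> z v - \<kappa> * L2_inner \<Omega> w v = - \<kappa> * B" by (simp add: right_diff_distrib[symmetric])
  moreover have "L2_inner \<Omega> f v - L2_inner \<Omega> g v = - L2_inner \<Omega> (\<lambda>x. f x - g x) ?n"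
    using L2_inner_diff_left[OF fL gL nL] by (simp add: inner_v)
  ultimately have le: "\<kappa> * B \<le> L2_inner \<Omega> (\<lambda>x. f x - g x) ?n" by linarith
  have nB: "L2_inner \<Omega> ?n ?n \<le> B"
    unfolding B_def L2_inner_def
    by (rule set_integral_mono[OF L2_on_mult_integrable[OF nL nL] L2_on_mult_integrable[OF dL(1) nL]])
      (use soft_neg_square_le in \<open>auto simp: power2_eq_square\<close>)
  have B0: "0 \<le> B" using nB L2_inner_self_nonneg order_trans by blast
  have "(\<kappa> * B)\<^sup>2 \<le> (L2_inner \<Omega> (\<lambda>x. f x - g x) ?n)\<^sup>2" using le B0 k by (intro power_mono) auto
  also have "\<dots> \<le> F * L2_inner \<Omega> ?n ?n" unfolding F_def by (rule L2_on_Cauchy_Schwarz[OF L2_on_diff[OF fL gL] nL])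
  also have "\<dots> \<le> F * B" using nB by (intro mult_left_mono) (auto simp: F_def L2_inner_self_nonneg)
  finally have "\<kappa>\<^sup>2 * B * B \<le> F * B" by (simp add: power2_eq_square mult_ac)
  then have "B = 0 \<or> \<kappa>\<^sup>2 * B \<le> F" using B0 by (cases "B = 0") (auto simp: mult_le_cancel_right)
  moreover have "0 \<le> F" by (simp add: F_def L2_inner_self_nonneg)
  ultimately have "\<kappa>\<^sup>2 * B \<le> F" by auto
  then show ?thesis by (simp add: B_def F_def)
qed

text \<open>The functions \<open>d n\<close> need not converge; it is enough that their negative parts vanish in the limit in the
  weighted sense supplied by \<open>weak_maximum_principle\<close>.\<close>

lemma limit_nonneg_of_small_neg_part:
  fixes u :: "'a::euclidean_space \<Rightarrow> real"
  assumes \<Omega>: "open \<Omega>" "bounded \<Omega>" and u: "u \<in> L2_on \<Omega>" "AE x in lborel. 0 \<le> u x"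
    and d: "\<And>n. d n \<in> L2_on \<Omega>" and small: "(\<lambda>n. L2_inner \<Omega> (d n) (\<lambda>x. soft_neg (d n x))) \<longlonglongrightarrow> 0"
    and lim: "(\<lambda>n. L2_inner \<Omega> u (d n)) \<longlonglongrightarrow> l"
  shows "0 \<le> l"
proof -
  have c1: "(\<lambda>x. 1::real) \<in> L2_on \<Omega>" by (rule continuous_L2_on[OF \<Omega>]) simp
  let ?P = "\<lambda>n. L2_inner \<Omega> (d n) (\<lambda>x. soft_neg (d n x))"
  define K where "K = L2_inner \<Omega> u (\<lambda>x. 1) + L2_inner \<Omega> u u"
  have bound: "- l \<le> \<delta> * K" if \<delta>: "\<delta> > 0" for \<delta>
  proof -
    define C where "C = (1 + \<delta>) / (4 * \<delta>\<^sup>2)"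
    have "- L2_inner \<Omega> u (d n) \<le> \<delta> * K + C * ?P n" for n
    proof -
      note nL = soft_neg_L2[OF d[of n]]
      note i = L2_on_mult_integrable[OF u(1) d[of n]] L2_on_mult_integrable[OF u(1) c1] L2_on_mult_integrable[OF u(1) u(1)]
        L2_on_mult_integrable[OF d[of n] nL]
      have "- L2_inner \<Omega> u (d n) = (LINT x:\<Omega>|lborel. u x * (- d n x))" by (simp add: L2_inner_def set_lebesgue_integral_def)
      also have "\<dots> \<le> (LINT x:\<Omega>|lborel. \<delta> * (u x * 1) + \<delta> * (u x * u x) + C * (d n x * soft_neg (d n x)))"
      proof (rule set_integral_mono_AE)
        show "set_integrable lborel \<Omega> (\<lambda>x. u x * (- d n x))" using i(1) by (simp add: set_integrable_def)
        show "set_integrable lborel \<Omega> (\<lambda>x. \<delta> * (u x * 1) + \<delta> * (u x * u x) + C * (d n x * soft_neg (d n x)))"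
          using i by (intro set_integral_add set_integrable_mult_right) auto
        show "AE x\<in>\<Omega> in lborel. u x * (- d n x) \<le> \<delta> * (u x * 1) + \<delta> * (u x * u x) + C * (d n x * soft_neg (d n x))"
          using u(2)
        proof eventually_elim
          case (elim x)
          then show ?case using neg_part_young[OF \<delta> elim, of "d n x"] by (simp add: C_def power2_eq_square)
        qed
      qed
      also have "\<dots> = \<delta> * K + C * ?P n"
        using i by (simp add: K_def L2_inner_def distrib_left)
      finally show ?thesis .
    qed
    moreover have "(\<lambda>n. \<delta> * K + C * ?P n) \<longlonglongrightarrow> \<delta> * K + C * 0" by (intro tendsto_intros small)
    moreover have "(\<lambda>n. - L2_inner \<Omega> u (d n)) \<longlonglongrightarrow> - l" by (intro tendsto_intros lim)
    ultimately have "- l \<le> \<delta> * K + C * 0" by (intro LIMSEQ_le[of "\<lambda>n. - L2_inner \<Omega> u (d n)" _ "\<lambda>n. \<delta> * K + C * ?P n"]) auto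
    then show ?thesis by simp
  qed
  have "((\<lambda>\<delta>. \<delta> * K) \<longlongrightarrow> 0 * K) (at_right 0)" by (intro tendsto_intros)
  then have "- l \<le> 0 * K"
    by (rule tendsto_lowerbound) (use bound in \<open>auto simp: eventually_at_right_less eventually_at_filter intro!: always_eventually\<close>)
  then show ?thesis by simp
qed

section \<open>Fractional powers as integrals of resolvents\<close>

text \<open>The value is \<open>pi / sin (pi * s)\<close>.\<close>

definition subordination_const :: "real \<Rightarrow> real" where
  "subordination_const s = (LINT r|lborel. indicator {0<..} r * (r powr (s - 1) / (r + 1)))"

lemma subordination_integrable:
  fixes s :: real
  assumes s: "0 < s" "s < 1"
  shows "integrable lborel (\<lambda>r. indicator {0<..} r * (r powr (s - 1) / (r + 1)))"
proof -
  \<comment> \<open>near 0 the integrand is that of the Beta function with second argument 1\<close>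
  have "set_integrable lborel {0..1} (\<lambda>t. t powr (s - 1) * (1 - t) powr (1 - 1))"
    using Gamma_Function.integrable_Beta[of s 1] s by simp
  then have i1: "integrable lborel (\<lambda>t. indicator {0..1} t * (t powr (s - 1) * (1 - t) powr (1 - 1)))"
    by (simp add: set_integrable_def)
  have i2: "integrable lborel (\<lambda>t. t powr (s - 2) * indicator {1..} t)"
  proof (rule integrableI_bounded)
    have "(\<integral>\<^sup>+t. ennreal (norm (t powr (s - 2) * indicator {1..} t)) \<partial>lborel) = (\<integral>\<^sup>+t. ennreal (t powr (s - 2)) * indicator {1..} t \<partial>lborel)"
      by (intro nn_integral_cong) (auto simp: indicator_def)
    also have "\<dots> = ennreal (0 - 1 powr (s - 1) / (s - 1))"
    proof (rule nn_integral_FTC_atLeast[where F = "\<lambda>t. t powr (s - 1) / (s - 1)"])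
      show "((\<lambda>t. t powr (s - 1) / (s - 1)) has_real_derivative t powr (s - 2)) (at t)" if "1 \<le> t" for t
      proof -
        have "((\<lambda>t. t powr (s - 1) / (s - 1)) has_real_derivative (s - 1) * t powr (s - 1 - 1) / (s - 1)) (at t)"
          using that by (intro DERIV_cdivide has_real_derivative_powr) simp
        then show ?thesis using s by simp
      qed
      have "((\<lambda>t. t powr (s - 1)) \<longlongrightarrow> 0) at_top"
        using s by (intro tendsto_neg_powr filterlim_ident) auto
      from tendsto_divide[OF this tendsto_const[of "s - 1"]] show "((\<lambda>t. t powr (s - 1) / (s - 1)) \<longlongrightarrow> 0) at_top"
        using s by simp
    qed auto
    finally show "(\<integral>\<^sup>+t. ennreal (norm (t powr (s - 2) * indicator {1..} t)) \<partial>lborel) < \<infinity>" by simp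
  qed measurable
  \<comment> \<open>at \<open>r = 1\<close> the Beta integrand is \<open>0 powr 0 = 0\<close>\<close>
  have ae: "AE r::real in lborel. r \<noteq> 1" by (rule AE_lborel_singleton)
  show ?thesis
  proof (rule Bochner_Integration.integrable_bound[OF Bochner_Integration.integrable_add[OF i1 i2]])
    show "AE r in lborel. norm (indicator {0<..} r * (r powr (s - 1) / (r + 1)))
      \<le> norm (indicator {0..1} r * (r powr (s - 1) * (1 - r) powr (1 - 1)) + r powr (s - 2) * indicator {1..} r)"
      using ae
    proof eventually_elim
      case (elim r)
      consider "r \<le> 0" | "0 < r" "r < 1" | "1 < r" using elim by linarith
      then show ?case
      proof cases
        case 2
        have "r powr (s - 1) / (r + 1) \<le> r powr (s - 1) / 1" using 2 by (intro divide_left_mono) auto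
        then show ?thesis using 2 by simp
      next
        case 3
        have "r powr (s - 1) / (r + 1) \<le> r powr (s - 1) / r" using 3 by (intro divide_left_mono) auto
        also have "\<dots> = r powr (s - 2)" using 3 powr_diff[of r "s - 1" 1] by simp
        finally show ?thesis using 3 by simp
      qed auto
    qed
  qed measurable
qed

lemma subordination_const_pos:
  assumes s: "0 < s" "s < 1"
  shows "0 < subordination_const s"
proof -
  have nn: "0 \<le> subordination_const s" unfolding subordination_const_def
    by (intro integral_nonneg_AE AE_I2) (auto simp: indicator_def)
  have "subordination_const s \<noteq> 0"
  proof
    assume "subordination_const s = 0"
    then have "AE r in lborel. indicator {0<..} r * (r powr (s - 1) / (r + 1)) = 0"
      unfolding subordination_const_def
      by (subst (asm) integral_nonneg_eq_0_iff_AE[OF subordination_integrable[OF s]]) (auto simp: indicator_def)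
    then have "AE r::real in lborel. r \<notin> {0<..<1}"
    proof eventually_elim
      case (elim r)
      then show ?case by (auto simp: indicator_def)
    qed
    then have "{0<..<1::real} \<in> null_sets lborel"
      by (subst (asm) AE_iff_null_sets[symmetric]) auto
    then show False by (auto simp: null_sets_def)
  qed
  then show ?thesis using nn by simp
qed

text \<open>Substitute \<open>a * r\<close> for \<open>r\<close>.\<close>

lemma subordination_scaled:
  assumes s: "0 < s" "s < 1" and a: "0 \<le> a"
  shows "integrable lborel (\<lambda>r. indicator {0<..} r * (r powr (s - 1) * (a / (r + a))))"
    and "(LINT r|lborel. indicator {0<..} r * (r powr (s - 1) * (a / (r + a)))) = a powr s * subordination_const s"
proof -
  let ?f = "\<lambda>r::real. indicator {0<..} r * (r powr (s - 1) * (a / (r + a)))"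
  have "integrable lborel ?f \<and> (LINT r|lborel. ?f r) = a powr s * subordination_const s"
  proof (cases "a = 0")
    case False
    then have a: "a > 0" using a by simp
    have m: "?f \<in> borel_measurable borel" by measurable
    have eq: "?f (0 + a *\<^sub>R r) = a powr (s - 1) * (indicator {0<..} r * (r powr (s - 1) / (r + 1)))" for r
    proof (cases "r > 0")
      case True
      have "a / (a * r + a) = 1 / (r + 1)"
      proof -
        have "a * r + a = a * (r + 1)" by (simp add: algebra_simps)
        then show ?thesis using a by simp
      qed
      then show ?thesis using True a by (simp add: powr_mult)
    qed (use a in \<open>auto simp: indicator_def zero_less_mult_iff\<close>)
    have i: "integrable lborel (\<lambda>r. ?f (0 + a *\<^sub>R r))" unfolding eq by (rule integrable_mult_right[OF subordination_integrable[OF s]])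
    then have "integrable lborel ?f" using lborel_integral_affine(2)[OF m, of a 0] a by simp
    moreover have "(LINT r|lborel. ?f (0 + a *\<^sub>R r)) = a powr (s - 1) * subordination_const s"
      unfolding eq subordination_const_def by (rule integral_mult_right_zero)
    then have "(LINT r|lborel. ?f r) = a * (a powr (s - 1) * subordination_const s)"
      using lborel_integral_affine(1)[OF m, of a 0] a by (simp add: field_simps)
    moreover have "a * a powr (s - 1) = a powr s" using a by (simp add: powr_diff)
    ultimately show ?thesis by (simp add: mult.assoc[symmetric])
  qed simp
  then show "integrable lborel ?f" "(LINT r|lborel. ?f r) = a powr s * subordination_const s" by auto
qed

text \<open>The same statement serves the Fourier side, where \<open>M\<close> is Lebesgue measure and \<open>a \<xi> = (norm \<xi>)\<^sup>2\<close>, and the Neumann side,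
  where \<open>M\<close> is the counting measure and \<open>a\<close> lists the eigenvalues.\<close>

lemma power_subordination:
  fixes a m :: "'p \<Rightarrow> real"
  assumes M: "sigma_finite_measure M" and s: "0 < s" "s < 1"
    and a: "a \<in> borel_measurable M" "\<And>p. 0 \<le> a p" and m: "m \<in> borel_measurable M"
    and i: "integrable M (\<lambda>p. a p powr s * m p)"
  shows "integrable lborel (\<lambda>r. indicator {0<..} r * r powr (s - 1) * (LINT p|M. a p / (r + a p) * m p))"
    and "(LINT r|lborel. indicator {0<..} r * r powr (s - 1) * (LINT p|M. a p / (r + a p) * m p))
      = subordination_const s * (LINT p|M. a p powr s * m p)"
proof -
  interpret P: pair_sigma_finite M "lborel :: real measure"
    using M by (simp add: pair_sigma_finite_def sigma_finite_lborel)
  note [measurable] = a(1) m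
  let ?k = "\<lambda>p r::real. indicator {0<..} r * (r powr (s - 1) * (a p / (r + a p)))"
  have "(\<lambda>z. ?k (fst z) (snd z) * m (fst z)) \<in> borel_measurable (M \<Otimes>\<^sub>M lborel)" by measurable
  then have meas: "(\<lambda>(p, r). ?k p r * m p) \<in> borel_measurable (M \<Otimes>\<^sub>M lborel)"
    by (simp add: case_prod_unfold)
  have k0: "0 \<le> ?k p r" for p r using a(2)[of p] by (auto simp: indicator_def)
  have int: "integrable (M \<Otimes>\<^sub>M lborel) (\<lambda>(p, r). ?k p r * m p)"
  proof (rule P.Fubini_integrable[OF meas])
    have "integrable M (\<lambda>p. subordination_const s * \<bar>a p powr s * m p\<bar>)" using i by simp
    moreover have "(LINT r|lborel. norm (case (p, r) of (p, r) \<Rightarrow> ?k p r * m p)) = subordination_const s * \<bar>a p powr s * m p\<bar>" for p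
    proof -
      have "(LINT r|lborel. norm (case (p, r) of (p, r) \<Rightarrow> ?k p r * m p)) = (LINT r|lborel. ?k p r * \<bar>m p\<bar>)"
        by (intro Bochner_Integration.integral_cong refl)
          (simp only: prod.case real_norm_def abs_mult[of "?k p _"] abs_of_nonneg[OF k0])
      also have "\<dots> = (a p powr s * subordination_const s) * \<bar>m p\<bar>"
        unfolding integral_mult_left_zero subordination_scaled(2)[OF s a(2)] ..
      finally show ?thesis by (simp add: abs_mult)
    qed
    ultimately show "integrable M (\<lambda>p. LINT r|lborel. norm (case (p, r) of (p, r) \<Rightarrow> ?k p r * m p))" by simp
    show "AE p in M. integrable lborel (\<lambda>r. case (p, r) of (p, r) \<Rightarrow> ?k p r * m p)"
      by (intro AE_I2) (simp only: prod.case, rule integrable_mult_left[OF subordination_scaled(1)[OF s a(2)]])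
  qed
  have e: "(LINT p|M. ?k p r * m p) = indicator {0<..} r * r powr (s - 1) * (LINT p|M. a p / (r + a p) * m p)" for r
    unfolding integral_mult_right_zero[symmetric] by (simp only: mult_ac)
  show "integrable lborel (\<lambda>r. indicator {0<..} r * r powr (s - 1) * (LINT p|M. a p / (r + a p) * m p))"
    using P.integrable_snd[OF int] unfolding e .
  have "(LINT r|lborel. LINT p|M. ?k p r * m p) = (LINT p|M. LINT r|lborel. ?k p r * m p)"
    using P.integral_fst[OF int] P.integral_snd[OF int] by simp
  also have "\<dots> = (LINT p|M. subordination_const s * (a p powr s * m p))"
    unfolding integral_mult_left_zero subordination_scaled(2)[OF s a(2)]
    by (intro Bochner_Integration.integral_cong refl) simp
  finally show "(LINT r|lborel. indicator {0<..} r * r powr (s - 1) * (LINT p|M. a p / (r + a p) * m p))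
      = subordination_const s * (LINT p|M. a p powr s * m p)" unfolding e by simp
qed

section \<open>The spectral side\<close>

text \<open>A test function lies in the domain of the Neumann Laplacian: test the eigenvalue equation with \<open>\<phi>\<close> and move the
  remaining derivative from the eigenfunction to \<open>\<phi>\<close>.\<close>

lemma neumann_coefficient:
  fixes \<Omega> :: "'a::euclidean_space set"
  assumes \<Omega>: "open \<Omega>" "bounded \<Omega>" and \<psi>: "neumann_eigenfunction \<Omega> m \<psi>" and \<phi>: "test_function \<Omega> \<phi>"
  shows "m * L2_inner \<Omega> \<psi> \<phi> = - L2_inner \<Omega> \<psi> (laplacian \<phi>)"
proof -
  obtain G where G: "H1_pair \<Omega> \<psi> G" "\<And>v H. H1_pair \<Omega> v H \<Longrightarrow> (LINT x:\<Omega>|lborel. G x \<bullet> H x) = m * L2_inner \<Omega> \<psi> v"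
    using \<psi> unfolding neumann_eigenfunction_def by blast
  have L2: "\<psi> \<in> L2_on \<Omega>" "G \<in> L2_on \<Omega>" using G(1) by (auto simp: H1_pair_def)
  define D where "D x = (\<Sum>b\<in>Basis. partial_deriv b \<phi> x *\<^sub>R b)" for x
  have cD: "continuous_on UNIV D" unfolding D_def
    by (intro continuous_intros test_function_continuous[of \<Omega>] test_function_partial_deriv \<phi>)
  have "(\<phi> has_derivative (\<lambda>h. D x \<bullet> h)) (at x)" for x
  proof -
    have "frechet_derivative \<phi> (at x) = (\<lambda>h. D x \<bullet> h)"
    proof
      fix h
      show "frechet_derivative \<phi> (at x) h = D x \<bullet> h"
        unfolding frechet_derivative_basis_expansion[OF test_function_differentiable[OF \<phi>]] D_def inner_sum_left inner_scaleR_left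
        by (intro sum.cong refl) (subst inner_commute, rule mult.commute)
    qed
    then show ?thesis using test_function_differentiable[OF \<phi>] frechet_derivative_works by metis
  qed
  then have "H1_pair \<Omega> \<phi> D"
    using weak_gradient_classical[OF _ cD] continuous_L2_on[OF \<Omega> cD] test_function_L2[OF \<Omega> \<phi>] by (simp add: H1_pair_def)
  from G(2)[OF this] have "m * L2_inner \<Omega> \<psi> \<phi> = (LINT x:\<Omega>|lborel. G x \<bullet> D x)" by simp
  also have "\<dots> = (LINT x|lborel. (\<Sum>b\<in>Basis. indicator \<Omega> x *\<^sub>R ((G x \<bullet> b) * partial_deriv b \<phi> x)))"
    unfolding set_lebesgue_integral_def
    by (intro Bochner_Integration.integral_cong refl) (simp add: D_def inner_sum_right sum_distrib_left mult_ac)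
  also have "\<dots> = (\<Sum>b\<in>Basis. LINT x:\<Omega>|lborel. (G x \<bullet> b) * partial_deriv b \<phi> x)"
    unfolding set_lebesgue_integral_def
  proof (rule Bochner_Integration.integral_sum)
    fix b :: 'a assume b: "b \<in> Basis"
    show "integrable lborel (\<lambda>x. indicator \<Omega> x *\<^sub>R ((G x \<bullet> b) * partial_deriv b \<phi> x))"
      using L2_on_mult_integrable[OF L2_on_component[OF L2(2)] test_function_L2[OF \<Omega> test_function_partial_deriv[OF \<phi> b]], of b]
      by (simp add: set_integrable_def)
  qed
  also have "\<dots> = (\<Sum>b\<in>Basis. - L2_inner \<Omega> \<psi> (partial_deriv b (partial_deriv b \<phi>)))"
  proof (intro sum.cong refl)
    fix b :: 'a assume b: "b \<in> Basis"
    show "(LINT x:\<Omega>|lborel. (G x \<bullet> b) * partial_deriv b \<phi> x) = - L2_inner \<Omega> \<psi> (partial_deriv b (partial_deriv b \<phi>))"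
      using G(1) test_function_partial_deriv[OF \<phi> b] b unfolding H1_pair_def weak_gradient_def L2_inner_def by simp
  qed
  also have "\<dots> = - L2_inner \<Omega> \<psi> (laplacian \<phi>)"
  proof -
    have "L2_inner \<Omega> (\<lambda>x. \<Sum>b\<in>Basis. partial_deriv b (partial_deriv b \<phi>) x) \<psi> = (\<Sum>b\<in>Basis. L2_inner \<Omega> (partial_deriv b (partial_deriv b \<phi>)) \<psi>)"
      by (rule L2_inner_sum_left[OF L2(1)]) (intro test_function_L2[OF \<Omega>] test_function_partial_deriv \<phi>)
    then show ?thesis by (simp add: laplacian_def[abs_def] L2_inner_commute[of \<Omega> \<psi>] sum_negf)
  qed
  finally show ?thesis .
qed

lemma parseval_sums:
  assumes B: "L2_orthonormal_basis \<Omega> \<psi>" and u: "u \<in> L2_on \<Omega>" and f: "f \<in> L2_on \<Omega>"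
  shows "(\<lambda>j. L2_inner \<Omega> u (\<psi> j) * L2_inner \<Omega> f (\<psi> j)) sums L2_inner \<Omega> u f"
proof -
  have \<psi>: "\<psi> j \<in> L2_on \<Omega>" for j using B by (simp add: L2_orthonormal_basis_def)
  define F where "F n x = (\<Sum>j<n. L2_inner \<Omega> f (\<psi> j) * \<psi> j x)" for n x
  have FL: "F n \<in> L2_on \<Omega>" for n
    unfolding F_def[abs_def] using L2_on_scaleR[OF \<psi>] by (intro L2_on_sum) simp
  have "(\<lambda>n. LINT x:\<Omega>|lborel. (f x - F n x)\<^sup>2) \<longlonglongrightarrow> 0"
    using B f unfolding L2_orthonormal_basis_def F_def by blast
  then have e: "(\<lambda>n. L2_inner \<Omega> (\<lambda>x. f x - F n x) (\<lambda>x. f x - F n x)) \<longlonglongrightarrow> 0"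
    by (simp add: L2_inner_def power2_eq_square)
  have s: "(\<lambda>n. (L2_inner \<Omega> u f - L2_inner \<Omega> u (F n))\<^sup>2) \<longlonglongrightarrow> 0"
  proof (rule Lim_null_comparison[OF always_eventually])
    show "(\<lambda>n. L2_inner \<Omega> u u * L2_inner \<Omega> (\<lambda>x. f x - F n x) (\<lambda>x. f x - F n x)) \<longlonglongrightarrow> 0"
      using tendsto_mult_left[OF e, of "L2_inner \<Omega> u u"] by simp
    show "\<forall>n. norm ((L2_inner \<Omega> u f - L2_inner \<Omega> u (F n))\<^sup>2) \<le> L2_inner \<Omega> u u * L2_inner \<Omega> (\<lambda>x. f x - F n x) (\<lambda>x. f x - F n x)"
    proof
      fix n
      have "L2_inner \<Omega> u f - L2_inner \<Omega> u (F n) = L2_inner \<Omega> u (\<lambda>x. f x - F n x)"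
        using L2_inner_diff_left[OF f FL u] by (simp add: L2_inner_commute)
      then show "norm ((L2_inner \<Omega> u f - L2_inner \<Omega> u (F n))\<^sup>2) \<le> L2_inner \<Omega> u u * L2_inner \<Omega> (\<lambda>x. f x - F n x) (\<lambda>x. f x - F n x)"
        using L2_on_Cauchy_Schwarz[OF u L2_on_diff[OF f FL]] by simp
    qed
  qed
  have "(\<lambda>n. L2_inner \<Omega> u f - L2_inner \<Omega> u (F n)) \<longlonglongrightarrow> 0"
    using tendsto_real_sqrt[OF s] by (simp add: tendsto_rabs_zero_iff)
  then have "(\<lambda>n. L2_inner \<Omega> u f - (L2_inner \<Omega> u f - L2_inner \<Omega> u (F n))) \<longlonglongrightarrow> L2_inner \<Omega> u f - 0"
    by (intro tendsto_intros)
  moreover have "L2_inner \<Omega> u (F n) = (\<Sum>j<n. L2_inner \<Omega> u (\<psi> j) * L2_inner \<Omega> f (\<psi> j))" for n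
  proof -
    have "L2_inner \<Omega> (F n) u = (\<Sum>j<n. L2_inner \<Omega> (\<lambda>x. L2_inner \<Omega> f (\<psi> j) * \<psi> j x) u)"
      unfolding F_def by (rule L2_inner_sum_left[OF u]) (use L2_on_scaleR[OF \<psi>] in simp)
    also have "\<dots> = (\<Sum>j<n. L2_inner \<Omega> u (\<psi> j) * L2_inner \<Omega> f (\<psi> j))"
      unfolding L2_inner_mult_left by (intro sum.cong refl) (subst L2_inner_commute[of \<Omega> u], rule mult.commute)
    finally show ?thesis by (subst L2_inner_commute)
  qed
  ultimately show ?thesis by (simp add: sums_def)
qed

text \<open>By \<open>neumann_coefficient\<close>, the eigenvalue turns the coefficients of \<open>\<phi>\<close> into those of its Laplacian, so both factors are square-summable.\<close>

lemma summable_coefficients: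
  fixes \<Omega> :: "'a::euclidean_space set"
  assumes \<Omega>: "open \<Omega>" "bounded \<Omega>" and E: "neumann_eigensystem \<Omega> \<mu> \<psi>" and u: "u \<in> L2_on \<Omega>" and \<phi>: "test_function \<Omega> \<phi>"
  shows "summable (\<lambda>j. (1 + \<bar>\<mu> j\<bar>) * \<bar>L2_inner \<Omega> u (\<psi> j) * L2_inner \<Omega> \<phi> (\<psi> j)\<bar>)"
proof -
  have B: "L2_orthonormal_basis \<Omega> \<psi>" and eig: "neumann_eigenfunction \<Omega> (\<mu> j) (\<psi> j)" for j
    using E by (auto simp: neumann_eigensystem_def)
  note \<phi>L = test_function_L2[OF \<Omega> \<phi>] and lL = continuous_L2_on[OF \<Omega> continuous_laplacian[OF \<phi>]]
  let ?u = "\<lambda>j. L2_inner \<Omega> u (\<psi> j)" and ?p = "\<lambda>j. L2_inner \<Omega> \<phi> (\<psi> j)" and ?l = "\<lambda>j. L2_inner \<Omega> (laplacian \<phi>) (\<psi> j)"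
  have "summable (\<lambda>j. (?u j * ?u j + ?p j * ?p j) + (?u j * ?u j + ?l j * ?l j))"
    by (intro summable_add sums_summable[OF parseval_sums[OF B]] u \<phi>L lL)
  then show ?thesis
  proof (rule summable_comparison_test'[where N = 0])
    fix j :: nat
    have l: "\<mu> j * ?p j = - ?l j"
      using neumann_coefficient[OF \<Omega> eig \<phi>, of j] by (simp add: L2_inner_commute)
    have young: "\<bar>a * b\<bar> \<le> a * a + b * b" for a b :: real
    proof -
      have "2 * \<bar>a * b\<bar> \<le> a * a + b * b"
        using sum_squares_bound[of "\<bar>a\<bar>" "\<bar>b\<bar>"] by (simp add: power2_eq_square abs_mult)
      then show ?thesis using abs_ge_zero[of "a * b"] by linarith
    qed
    have "(1 + \<bar>\<mu> j\<bar>) * \<bar>?u j * ?p j\<bar> = \<bar>?u j * ?p j\<bar> + \<bar>?u j * (\<mu> j * ?p j)\<bar>"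
      by (simp add: abs_mult algebra_simps)
    also have "\<dots> = \<bar>?u j * ?p j\<bar> + \<bar>?u j * ?l j\<bar>" unfolding l by simp
    also have "\<dots> \<le> (?u j * ?u j + ?p j * ?p j) + (?u j * ?u j + ?l j * ?l j)"
      by (intro add_mono young)
    finally show "norm ((1 + \<bar>\<mu> j\<bar>) * \<bar>?u j * ?p j\<bar>) \<le> (?u j * ?u j + ?p j * ?p j) + (?u j * ?u j + ?l j * ?l j)"
      by simp
  qed
qed

section \<open>The Fourier side\<close>

text \<open>The joint spectral measure of \<open>u\<close> and \<open>\<phi>\<close> for the free Laplacian has this density; the imaginary part
  integrates to 0 against even functions.\<close>

definition spectral_density :: "('a::euclidean_space \<Rightarrow> real) \<Rightarrow> ('a \<Rightarrow> real) \<Rightarrow> 'a \<Rightarrow> real" where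
  "spectral_density u \<phi> \<xi> = Re (fourier (\<lambda>x. of_real (u x)) \<xi> * cnj (fourier (\<lambda>x. of_real (\<phi> x)) \<xi>))"

lemma fourier_product_measurable:
  fixes u \<phi> :: "'a::euclidean_space \<Rightarrow> real"
  assumes "integrable lborel u" "integrable lborel \<phi>"
  shows "(\<lambda>\<xi>. fourier (\<lambda>x. of_real (u x)) \<xi> * cnj (fourier (\<lambda>x. of_real (\<phi> x)) \<xi>)) \<in> borel_measurable borel"
proof -
  note [measurable] = fourier_measurable[OF assms(1)] fourier_measurable[OF assms(2)]
  have [measurable]: "cnj \<in> borel_measurable borel"
    by (intro borel_measurable_continuous_onI continuous_intros)
  show ?thesis by measurable
qed

lemma
  fixes u \<phi> :: "'a::euclidean_space \<Rightarrow> real"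
  assumes u: "integrable lborel u" "integrable lborel (\<lambda>x. (u x)\<^sup>2)" and \<phi>: "test_function \<Omega> \<phi>"
  shows spectral_density_measurable: "spectral_density u \<phi> \<in> borel_measurable borel"
    and spectral_density_moment_integrable: "integrable lborel (\<lambda>\<xi>. (1 + (norm \<xi>)\<^sup>2) * spectral_density u \<phi> \<xi>)"
    and spectral_density_integrable: "integrable lborel (spectral_density u \<phi>)"
    and fourier_product_integrable: "integrable lborel (\<lambda>\<xi>. fourier (\<lambda>x. of_real (u x)) \<xi> * cnj (fourier (\<lambda>x. of_real (\<phi> x)) \<xi>))"
proof -
  let ?m = "\<lambda>\<xi>. fourier (\<lambda>x. of_real (u x)) \<xi> * cnj (fourier (\<lambda>x. of_real (\<phi> x)) \<xi>)"
  note i = fourier_product_moment_integrable[OF u \<phi>]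
  have mm: "?m \<in> borel_measurable borel"
    by (rule fourier_product_measurable[OF u(1) test_function_integrable[OF \<phi>]])
  show m: "spectral_density u \<phi> \<in> borel_measurable borel"
  proof -
    have "Re \<in> borel_measurable borel" by (intro borel_measurable_continuous_onI continuous_intros)
    from measurable_compose[OF mm this] show ?thesis by (simp add: spectral_density_def[abs_def])
  qed
  have le: "\<bar>spectral_density u \<phi> \<xi>\<bar> \<le> cmod (?m \<xi>)" for \<xi>
    unfolding spectral_density_def by (rule abs_Re_le_cmod)
  have one: "1 \<le> 1 + (norm \<xi>)\<^sup>2" for \<xi> :: 'a by simp
  show "integrable lborel (\<lambda>\<xi>. (1 + (norm \<xi>)\<^sup>2) * spectral_density u \<phi> \<xi>)"
  proof (rule Bochner_Integration.integrable_bound[OF i])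
    show "AE \<xi> in lborel. norm ((1 + (norm \<xi>)\<^sup>2) * spectral_density u \<phi> \<xi>) \<le> norm ((1 + (norm \<xi>)\<^sup>2) * cmod (?m \<xi>))"
    proof (rule AE_I2)
      fix \<xi> :: 'a
      have "\<bar>1 + (norm \<xi>)\<^sup>2\<bar> * \<bar>spectral_density u \<phi> \<xi>\<bar> \<le> \<bar>1 + (norm \<xi>)\<^sup>2\<bar> * \<bar>cmod (?m \<xi>)\<bar>"
        using le[of \<xi>] by (intro mult_left_mono) auto
      then show "norm ((1 + (norm \<xi>)\<^sup>2) * spectral_density u \<phi> \<xi>) \<le> norm ((1 + (norm \<xi>)\<^sup>2) * cmod (?m \<xi>))"
        by (simp only: real_norm_def abs_mult)
    qed
  qed (use m in measurable)
  show "integrable lborel ?m"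
  proof (rule Bochner_Integration.integrable_bound[OF i])
    show "AE \<xi> in lborel. norm (?m \<xi>) \<le> norm ((1 + (norm \<xi>)\<^sup>2) * cmod (?m \<xi>))"
    proof (rule AE_I2)
      fix \<xi> :: 'a
      have "1 * cmod (?m \<xi>) \<le> (1 + (norm \<xi>)\<^sup>2) * cmod (?m \<xi>)" using one by (rule mult_right_mono) simp
      then show "norm (?m \<xi>) \<le> norm ((1 + (norm \<xi>)\<^sup>2) * cmod (?m \<xi>))" by (simp only: mult_1 real_norm_def)
    qed
  qed (use mm in simp)
  then show "integrable lborel (spectral_density u \<phi>)"
    unfolding spectral_density_def[abs_def] by (rule integrable_Re)
qed

lemma heat_form_spectral:
  fixes u \<phi> :: "'a::euclidean_space \<Rightarrow> real"
  assumes u: "integrable lborel u" "integrable lborel (\<lambda>x. (u x)\<^sup>2)" and \<phi>: "test_function \<Omega> \<phi>" and t: "t > 0"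
  shows "heat_form t u \<phi> = (LINT \<xi>|lborel. exp (- t * (norm \<xi>)\<^sup>2) * spectral_density u \<phi> \<xi>)"
proof -
  let ?m = "\<lambda>\<xi>. fourier (\<lambda>x. of_real (u x)) \<xi> * cnj (fourier (\<lambda>x. of_real (\<phi> x)) \<xi>)"
  have i: "integrable lborel (\<lambda>\<xi>. of_real (exp (- t * (norm \<xi>)\<^sup>2)) * ?m \<xi>)"
  proof (rule Bochner_Integration.integrable_bound[OF fourier_product_integrable[OF u \<phi>]])
    have mm: "?m \<in> borel_measurable borel"
      by (rule fourier_product_measurable[OF u(1) test_function_integrable[OF \<phi>]])
    show "(\<lambda>\<xi>. of_real (exp (- t * (norm \<xi>)\<^sup>2)) * ?m \<xi>) \<in> borel_measurable lborel"
      using borel_measurable_times[OF _ mm] by simp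
    show "AE \<xi> in lborel. norm (of_real (exp (- t * (norm \<xi>)\<^sup>2)) * ?m \<xi>) \<le> norm (?m \<xi>)"
      unfolding norm_mult using t by (intro AE_I2 mult_left_le_one_le) auto
  qed
  have rm: "Re (of_real a * z) = a * Re z" for a z by simp
  have "heat_form t u \<phi> = Re (LINT \<xi>|lborel. of_real (exp (- t * (norm \<xi>)\<^sup>2)) * ?m \<xi>)"
    unfolding gaussian_parseval[OF t u(1) test_function_integrable[OF \<phi>]] by simp
  also have "\<dots> = (LINT \<xi>|lborel. Re (of_real (exp (- t * (norm \<xi>)\<^sup>2)) * ?m \<xi>))"
    by (rule integral_Re[OF i, symmetric])
  finally show ?thesis by (simp only: spectral_density_def rm)
qed

text \<open>Remove the Gaussian weight: on one side by dominated convergence, on the other because heat smoothing tends to the identity.\<close>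

lemma spectral_density_integral:
  fixes u \<phi> :: "'a::euclidean_space \<Rightarrow> real"
  assumes u: "integrable lborel u" "integrable lborel (\<lambda>x. (u x)\<^sup>2)" and \<phi>: "test_function \<Omega> \<phi>"
  shows "(LINT \<xi>|lborel. spectral_density u \<phi> \<xi>) = (LINT x|lborel. u x * \<phi> x)"
proof -
  obtain C where C: "\<And>x. \<bar>\<phi> x\<bar> \<le> C" using test_function_bounded[OF \<phi>] by blast
  define t where "t n = inverse (real (Suc n))" for n
  have t: "t n > 0" for n by (simp add: t_def)
  have t0: "t \<longlonglongrightarrow> 0" unfolding t_def by (rule LIMSEQ_inverse_real_of_nat)
  note m[measurable] = spectral_density_measurable[OF u \<phi>]
  have "(\<lambda>n. LINT \<xi>|lborel. exp (- t n * (norm \<xi>)\<^sup>2) * spectral_density u \<phi> \<xi>) \<longlonglongrightarrow> (LINT \<xi>|lborel. spectral_density u \<phi> \<xi>)"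
  proof (rule integral_dominated_convergence)
    show "integrable lborel (\<lambda>\<xi>. \<bar>spectral_density u \<phi> \<xi>\<bar>)" using spectral_density_integrable[OF u \<phi>] by simp
    show "AE \<xi> in lborel. (\<lambda>n. exp (- t n * (norm \<xi>)\<^sup>2) * spectral_density u \<phi> \<xi>) \<longlonglongrightarrow> spectral_density u \<phi> \<xi>"
    proof (rule AE_I2)
      fix \<xi> :: 'a
      have "(\<lambda>n. exp (- t n * (norm \<xi>)\<^sup>2) * spectral_density u \<phi> \<xi>) \<longlonglongrightarrow> exp (- 0 * (norm \<xi>)\<^sup>2) * spectral_density u \<phi> \<xi>"
        by (intro tendsto_intros t0)
      then show "(\<lambda>n. exp (- t n * (norm \<xi>)\<^sup>2) * spectral_density u \<phi> \<xi>) \<longlonglongrightarrow> spectral_density u \<phi> \<xi>" by simp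
    qed
    show "AE \<xi> in lborel. norm (exp (- t n * (norm \<xi>)\<^sup>2) * spectral_density u \<phi> \<xi>) \<le> \<bar>spectral_density u \<phi> \<xi>\<bar>" for n
      unfolding real_norm_def abs_mult using t[of n] by (intro AE_I2 mult_left_le_one_le) auto
  qed measurable
  then have "(\<lambda>n. heat_form (t n) u \<phi>) \<longlonglongrightarrow> (LINT \<xi>|lborel. spectral_density u \<phi> \<xi>)"
    by (simp add: heat_form_spectral[OF u \<phi> t])
  moreover have "(\<lambda>n. heat_form (t n) u \<phi>) \<longlonglongrightarrow> (LINT x|lborel. u x * \<phi> x)"
    by (rule heat_form_tendsto[OF t t0 u(1) test_function_continuous[OF \<phi>] C])
  ultimately show ?thesis by (rule LIMSEQ_unique)
qed

text \<open>On the Fourier side the heat integral over \<open>{\<epsilon>..T}\<close> multiplies by \<open>(exp (- c * \<epsilon>) - exp (- c * T)) / c\<close> with \<open>c = \<kappa> + (norm \<xi>)\<^sup>2\<close>, which tends to \<open>1 / c\<close>.\<close>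

lemma truncated_laplace_tendsto:
  fixes u \<phi> :: "'a::euclidean_space \<Rightarrow> real"
  assumes u: "integrable lborel u" "integrable lborel (\<lambda>x. (u x)\<^sup>2)" and \<phi>: "test_function \<Omega> \<phi>" and k: "\<kappa> > 0"
  shows "(\<lambda>n. LINT t|lborel. indicator {inverse (real (Suc n))..real (Suc n)} t * exp (- \<kappa> * t) * heat_form t u \<phi>)
    \<longlonglongrightarrow> (LINT \<xi>|lborel. spectral_density u \<phi> \<xi> / (\<kappa> + (norm \<xi>)\<^sup>2))"
proof -
  define \<epsilon> where "\<epsilon> n = inverse (real (Suc n))" for n
  define T where "T n = real (Suc n)" for n
  have \<epsilon>0: "\<epsilon> \<longlonglongrightarrow> 0" unfolding \<epsilon>_def by (rule LIMSEQ_inverse_real_of_nat)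
  have eT: "0 < \<epsilon> n" "\<epsilon> n \<le> T n" for n by (auto simp: \<epsilon>_def T_def field_simps)
  note m[measurable] = spectral_density_measurable[OF u \<phi>]
  note mi = spectral_density_integrable[OF u \<phi>]
  define c where "c \<xi> = \<kappa> + (norm \<xi>)\<^sup>2" for \<xi> :: 'a
  have c: "\<kappa> \<le> c \<xi>" "0 < c \<xi>" for \<xi> using k by (auto simp: c_def add_pos_nonneg)
  define q where "q n t = indicator {\<epsilon> n..T n} t * exp (- \<kappa> * t)" for n t
  have qi: "integrable lborel (q n)" for n
  proof -
    have "continuous_on {\<epsilon> n..T n} (\<lambda>t. exp (- \<kappa> * t))" by (intro continuous_intros)
    from borel_integrable_compact[OF compact_Icc this] show ?thesis by (simp add: q_def[abs_def])
  qed
  have inner: "(LINT t|lborel. q n t * exp (- t * (norm \<xi>)\<^sup>2)) = (exp (- c \<xi> * \<epsilon> n) - exp (- c \<xi> * T n)) / c \<xi>" for n and \<xi> :: 'a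
  proof -
    have "(LINT t|lborel. q n t * exp (- t * (norm \<xi>)\<^sup>2)) = (LINT t|lborel. exp (- c \<xi> * t) * indicator {\<epsilon> n..T n} t)"
      by (intro Bochner_Integration.integral_cong refl) (simp add: q_def c_def mult_exp_exp algebra_simps)
    also have "\<dots> = (- exp (- c \<xi> * T n) / c \<xi>) - (- exp (- c \<xi> * \<epsilon> n) / c \<xi>)"
    proof (rule integral_FTC_Icc_real[OF eT(2)])
      fix t
      show "((\<lambda>t. - exp (- c \<xi> * t) / c \<xi>) has_real_derivative exp (- c \<xi> * t)) (at t)"
        using c(2)[of \<xi>] by (auto intro!: derivative_eq_intros)
      show "isCont (\<lambda>t. exp (- c \<xi> * t)) t" by (intro continuous_intros)
    qed
    finally show ?thesis by (simp add: diff_divide_distrib)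
  qed
  have km: "(\<lambda>z. exp (- fst z * (norm (snd z))\<^sup>2)) \<in> borel_measurable (lborel \<Otimes>\<^sub>M (lborel :: 'a measure))" by measurable
  have kb: "\<bar>exp (- t * (norm \<xi>)\<^sup>2)\<bar> \<le> 1" if "q n t \<noteq> 0" for n t and \<xi> :: 'a
    using that eT(1)[of n] by (auto simp: q_def indicator_def split: if_splits)
  have eq: "(LINT t|lborel. q n t * heat_form t u \<phi>) = (LINT \<xi>|lborel. (exp (- c \<xi> * \<epsilon> n) - exp (- c \<xi> * T n)) / c \<xi> * spectral_density u \<phi> \<xi>)" for n
  proof -
    have "(LINT t|lborel. q n t * heat_form t u \<phi>) = (LINT t|lborel. q n t * (LINT \<xi>|lborel. exp (- t * (norm \<xi>)\<^sup>2) * spectral_density u \<phi> \<xi>))"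
    proof (intro Bochner_Integration.integral_cong refl)
      fix t
      show "q n t * heat_form t u \<phi> = q n t * (LINT \<xi>|lborel. exp (- t * (norm \<xi>)\<^sup>2) * spectral_density u \<phi> \<xi>)"
        using heat_form_spectral[OF u \<phi>, of t] eT(1)[of n] by (cases "t \<in> {\<epsilon> n..T n}") (auto simp: q_def)
    qed
    also have "\<dots> = (LINT \<xi>|lborel. (LINT t|lborel. q n t * exp (- t * (norm \<xi>)\<^sup>2)) * spectral_density u \<phi> \<xi>)"
      by (rule fubini_bounded_kernel(1)[OF sigma_finite_lborel qi mi km kb, symmetric])
    finally show ?thesis unfolding inner .
  qed
  have "(\<lambda>n. LINT \<xi>|lborel. (exp (- c \<xi> * \<epsilon> n) - exp (- c \<xi> * T n)) / c \<xi> * spectral_density u \<phi> \<xi>)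
    \<longlonglongrightarrow> (LINT \<xi>|lborel. spectral_density u \<phi> \<xi> / c \<xi>)"
  proof (rule integral_dominated_convergence)
    show "integrable lborel (\<lambda>\<xi>. (1 / \<kappa>) * \<bar>spectral_density u \<phi> \<xi>\<bar>)" using mi by simp
    show "AE \<xi> in lborel. (\<lambda>n. (exp (- c \<xi> * \<epsilon> n) - exp (- c \<xi> * T n)) / c \<xi> * spectral_density u \<phi> \<xi>) \<longlonglongrightarrow> spectral_density u \<phi> \<xi> / c \<xi>"
    proof (rule AE_I2)
      fix \<xi> :: 'a
      have "exp (- c \<xi> * T n) = exp (- c \<xi>) ^ Suc n" for n
        unfolding T_def by (subst exp_of_nat_mult[symmetric]) (simp add: mult.commute)
      moreover have "(\<lambda>n. exp (- c \<xi>) ^ Suc n) \<longlonglongrightarrow> 0"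
        using c(2)[of \<xi>] by (intro LIMSEQ_Suc LIMSEQ_power_zero) simp
      ultimately have T0: "(\<lambda>n. exp (- c \<xi> * T n)) \<longlonglongrightarrow> 0" by presburger
      have "(\<lambda>n. (exp (- c \<xi> * \<epsilon> n) - exp (- c \<xi> * T n)) / c \<xi> * spectral_density u \<phi> \<xi>) \<longlonglongrightarrow> (exp (- c \<xi> * 0) - 0) / c \<xi> * spectral_density u \<phi> \<xi>"
        using c(2)[of \<xi>] by (intro tendsto_intros \<epsilon>0 T0) auto
      then show "(\<lambda>n. (exp (- c \<xi> * \<epsilon> n) - exp (- c \<xi> * T n)) / c \<xi> * spectral_density u \<phi> \<xi>) \<longlonglongrightarrow> spectral_density u \<phi> \<xi> / c \<xi>" by simp
    qed
    show "AE \<xi> in lborel. norm ((exp (- c \<xi> * \<epsilon> n) - exp (- c \<xi> * T n)) / c \<xi> * spectral_density u \<phi> \<xi>) \<le> (1 / \<kappa>) * \<bar>spectral_density u \<phi> \<xi>\<bar>" for n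
    proof (rule AE_I2)
      fix \<xi> :: 'a
      have "exp (- c \<xi> * T n) \<le> exp (- c \<xi> * \<epsilon> n)" "exp (- c \<xi> * \<epsilon> n) \<le> 1"
        using c(2)[of \<xi>] eT[of n] by auto
      then have "\<bar>exp (- c \<xi> * \<epsilon> n) - exp (- c \<xi> * T n)\<bar> \<le> 1" using exp_gt_zero[of "- c \<xi> * T n"] by linarith
      then have "\<bar>(exp (- c \<xi> * \<epsilon> n) - exp (- c \<xi> * T n)) / c \<xi>\<bar> \<le> 1 / \<kappa>"
        using c[of \<xi>] k unfolding abs_divide by (intro frac_le) auto
      then show "norm ((exp (- c \<xi> * \<epsilon> n) - exp (- c \<xi> * T n)) / c \<xi> * spectral_density u \<phi> \<xi>) \<le> (1 / \<kappa>) * \<bar>spectral_density u \<phi> \<xi>\<bar>"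
        unfolding real_norm_def abs_mult by (rule mult_right_mono) simp
    qed
    show "(\<lambda>\<xi>. (exp (- c \<xi> * \<epsilon> n) - exp (- c \<xi> * T n)) / c \<xi> * spectral_density u \<phi> \<xi>) \<in> borel_measurable lborel" for n
      unfolding c_def by measurable
    show "(\<lambda>\<xi>. spectral_density u \<phi> \<xi> / c \<xi>) \<in> borel_measurable lborel" unfolding c_def by measurable
  qed
  then show ?thesis unfolding eq[symmetric] by (simp add: q_def \<epsilon>_def T_def c_def)
qed

section \<open>Comparison of the resolvents\<close>

text \<open>Compare the \<open>n\<close>-th partial sum \<open>z n\<close> of the Neumann resolvent with the free resolvent \<open>w n\<close> truncated to the times
  from \<open>1 / (n + 1)\<close> to \<open>n + 1\<close>. Their right-hand sides \<open>f n\<close> and \<open>g n\<close> both tend to \<open>\<phi>\<close> in \<open>L\<^sup>2\<close>, so the negative part of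
  \<open>z n - w n\<close> vanishes in the limit.\<close>

lemma (in mollifiers) resolvent_comparison:
  fixes \<Omega> :: "'a set" and u \<phi> :: "'a \<Rightarrow> real"
  assumes \<Omega>: "open \<Omega>" "bounded \<Omega>" "convex \<Omega>" and E: "neumann_eigensystem \<Omega> \<mu> \<psi>"
    and u: "integrable lborel u" "integrable lborel (\<lambda>x. (u x)\<^sup>2)" "AE x in lborel. 0 \<le> u x" "\<And>x. x \<notin> \<Omega> \<Longrightarrow> u x = 0"
    and \<phi>: "test_function \<Omega> \<phi>" "\<And>x. 0 \<le> \<phi> x" and k: "\<kappa> > 0"
  shows "(LINT \<xi>|lborel. spectral_density u \<phi> \<xi> / (\<kappa> + (norm \<xi>)\<^sup>2))
    \<le> (\<Sum>j. L2_inner \<Omega> u (\<psi> j) * L2_inner \<Omega> \<phi> (\<psi> j) / (\<kappa> + \<mu> j))"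
proof -
  have B: "L2_orthonormal_basis \<Omega> \<psi>" and eig: "neumann_eigenfunction \<Omega> (\<mu> j) (\<psi> j)"
    and \<mu>: "mono \<mu>" "\<mu> 0 = 0" for j
    using E by (auto simp: neumann_eigensystem_def)
  have \<mu>0: "0 \<le> \<mu> j" for j using monoD[OF \<mu>(1), of 0 j] \<mu>(2) by simp
  have \<psi>: "\<psi> j \<in> L2_on \<Omega>" for j using B by (simp add: L2_orthonormal_basis_def)
  have uL: "u \<in> L2_on \<Omega>"
  proof -
    have e: "indicator \<Omega> x *\<^sub>R u x = u x" "indicator \<Omega> x * (norm (u x))\<^sup>2 = (u x)\<^sup>2" for x
      using u(4)[of x] by (cases "x \<in> \<Omega>"; simp)+
    show ?thesis unfolding L2_on_iff e using u by auto
  qed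
  note \<phi>L = test_function_L2[OF \<Omega>(1,2) \<phi>(1)]
  obtain G where G: "\<And>j. H1_pair \<Omega> (\<psi> j) (G j)" "\<And>j v H. H1_pair \<Omega> v H \<Longrightarrow> (LINT x:\<Omega>|lborel. G j x \<bullet> H x) = \<mu> j * L2_inner \<Omega> (\<psi> j) v"
    using eig unfolding neumann_eigenfunction_def by metis
  have GL: "G j \<in> L2_on \<Omega>" for j using G(1) by (simp add: H1_pair_def)
  let ?p = "\<lambda>j. L2_inner \<Omega> \<phi> (\<psi> j)" and ?u = "\<lambda>j. L2_inner \<Omega> u (\<psi> j)"
  define \<epsilon> where "\<epsilon> n = inverse (real (Suc n))" for n
  define T where "T n = real (Suc n)" for n
  have \<epsilon>0: "\<epsilon> \<longlonglongrightarrow> 0" unfolding \<epsilon>_def by (rule LIMSEQ_inverse_real_of_nat)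
  have eT: "0 < \<epsilon> n" "\<epsilon> n \<le> T n" for n by (auto simp: \<epsilon>_def T_def field_simps)
  have loc: "heat_resolvent \<Omega> \<phi> (\<epsilon> n) (T n)" for n
    using \<Omega> \<phi>(1) eT by (simp add: heat_resolvent_def)
  define w where "w n = heat_resolvent.resolvent \<phi> \<kappa> (\<epsilon> n) (T n)" for n
  define W where "W n = heat_resolvent.resolvent_grad \<phi> \<kappa> (\<epsilon> n) (T n)" for n
  have wW: "H1_pair \<Omega> (w n) (W n)" for n unfolding w_def W_def by (rule heat_resolvent.resolvent_H1[OF loc])
  have wL: "w n \<in> L2_on \<Omega>" for n using wW by (simp add: H1_pair_def)
  define z where "z n x = (\<Sum>j<n. (?p j / (\<kappa> + \<mu> j)) * \<psi> j x)" for n x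
  define Z where "Z n x = (\<Sum>j<n. (?p j / (\<kappa> + \<mu> j)) *\<^sub>R G j x)" for n x
  have zZ: "H1_pair \<Omega> (z n) (Z n)" for n
    unfolding z_def[abs_def] Z_def[abs_def] by (intro H1_pair_sum[OF \<Omega>(1,2)] H1_pair_scaleR G)
  have zL: "z n \<in> L2_on \<Omega>" for n using zZ by (simp add: H1_pair_def)
  define f where "f n x = (\<Sum>j<n. ?p j * \<psi> j x)" for n x
  have fL: "f n \<in> L2_on \<Omega>" for n
    unfolding f_def[abs_def] using L2_on_scaleR[OF \<psi>] by (intro L2_on_sum) simp
  define g where "g n x = exp (- \<kappa> * \<epsilon> n) * convolve \<phi> (heat_kernel (\<epsilon> n)) x" for n x
  have gL: "g n \<in> L2_on \<Omega>" for n
    using L2_on_scaleR[OF heat_resolvent.convolve_heat_L2[OF loc eT(1)], of "exp (- \<kappa> * \<epsilon> n)"] by (simp add: g_def[abs_def])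
  define d where "d n x = z n x - w n x" for n x
  have dL: "d n \<in> L2_on \<Omega>" for n unfolding d_def[abs_def] by (rule L2_on_diff[OF zL wL])
  have zeq: "(LINT x:\<Omega>|lborel. Z n x \<bullet> H x) + \<kappa> * L2_inner \<Omega> (z n) v = L2_inner \<Omega> (f n) v" if v: "H1_pair \<Omega> v H" for n v H
  proof -
    have vL: "v \<in> L2_on \<Omega>" "H \<in> L2_on \<Omega>" using v by (auto simp: H1_pair_def)
    have s: "L2_inner \<Omega> (\<lambda>x. \<Sum>j<n. c j * \<psi> j x) v = (\<Sum>j<n. c j * L2_inner \<Omega> (\<psi> j) v)" for c
      using L2_inner_sum_left[OF vL(1), of "{..<n}" "\<lambda>j x. c j * \<psi> j x"] L2_on_scaleR[OF \<psi>]
      by (simp add: L2_inner_mult_left)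
    have "(LINT x:\<Omega>|lborel. Z n x \<bullet> H x) = (LINT x|lborel. (\<Sum>j<n. (?p j / (\<kappa> + \<mu> j)) * (indicator \<Omega> x *\<^sub>R (G j x \<bullet> H x))))"
      unfolding set_lebesgue_integral_def
      by (intro Bochner_Integration.integral_cong refl) (simp add: Z_def inner_sum_left sum_distrib_left mult_ac)
    also have "\<dots> = (\<Sum>j<n. LINT x|lborel. (?p j / (\<kappa> + \<mu> j)) * (indicator \<Omega> x *\<^sub>R (G j x \<bullet> H x)))"
      by (rule Bochner_Integration.integral_sum, rule integrable_mult_right)
        (use L2_on_inner_integrable[OF GL vL(2)] in \<open>simp add: set_integrable_def\<close>)
    also have "\<dots> = (\<Sum>j<n. (?p j / (\<kappa> + \<mu> j)) * (\<mu> j * L2_inner \<Omega> (\<psi> j) v))"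
      unfolding integral_mult_right_zero set_lebesgue_integral_def[symmetric] by (intro sum.cong refl) (simp add: G(2)[OF v])
    finally have "(LINT x:\<Omega>|lborel. Z n x \<bullet> H x) + \<kappa> * L2_inner \<Omega> (z n) v
      = (\<Sum>j<n. (?p j / (\<kappa> + \<mu> j)) * (\<mu> j * L2_inner \<Omega> (\<psi> j) v)) + \<kappa> * (\<Sum>j<n. (?p j / (\<kappa> + \<mu> j)) * L2_inner \<Omega> (\<psi> j) v)"
      unfolding z_def s by simp
    also have "\<dots> = (\<Sum>j<n. ?p j * L2_inner \<Omega> (\<psi> j) v)"
      unfolding sum_distrib_left sum.distrib[symmetric]
    proof (intro sum.cong refl)
      fix j
      have "\<kappa> + \<mu> j \<noteq> 0" using k \<mu>0[of j] by linarith
      then have "(a / (\<kappa> + \<mu> j)) * (\<mu> j * b) + \<kappa> * ((a / (\<kappa> + \<mu> j)) * b) = a * b" for a b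
      proof -
        define q where "q = a / (\<kappa> + \<mu> j)"
        have "q * (\<mu> j * b) + \<kappa> * (q * b) = (q * (\<kappa> + \<mu> j)) * b" by (simp add: algebra_simps)
        also have "q * (\<kappa> + \<mu> j) = a" using \<open>\<kappa> + \<mu> j \<noteq> 0\<close> by (simp add: q_def)
        finally show ?thesis by (simp add: q_def)
      qed
      then show "(?p j / (\<kappa> + \<mu> j)) * (\<mu> j * L2_inner \<Omega> (\<psi> j) v) + \<kappa> * ((?p j / (\<kappa> + \<mu> j)) * L2_inner \<Omega> (\<psi> j) v) = ?p j * L2_inner \<Omega> (\<psi> j) v" .
    qed
    finally show ?thesis unfolding f_def s .
  qed
  have wle: "(LINT x:\<Omega>|lborel. W n x \<bullet> H x) + \<kappa> * L2_inner \<Omega> (w n) v \<le> L2_inner \<Omega> (g n) v"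
    if "H1_pair \<Omega> v H" "\<And>x. 0 \<le> v x" for n v H
    unfolding W_def w_def g_def
    by (rule heat_resolvent.resolvent_subsolution[OF loc mollifiers_axioms \<Omega>(3) \<phi>(2) that])
  let ?P = "\<lambda>n. L2_inner \<Omega> (d n) (\<lambda>x. soft_neg (d n x))"
  let ?F = "\<lambda>n. L2_inner \<Omega> (\<lambda>x. f n x - g n x) (\<lambda>x. f n x - g n x)"
  have max: "\<kappa>\<^sup>2 * ?P n \<le> ?F n" for n
    unfolding d_def by (rule weak_maximum_principle[OF \<Omega>(1,2) k zZ wW fL gL zeq wle])
  have F0: "?F \<longlonglongrightarrow> 0"
  proof -
    have f0: "(\<lambda>n. L2_inner \<Omega> (\<lambda>x. \<phi> x - f n x) (\<lambda>x. \<phi> x - f n x)) \<longlonglongrightarrow> 0"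
      using B \<phi>L unfolding L2_orthonormal_basis_def f_def L2_inner_def by (simp add: power2_eq_square)
    obtain C where C: "\<And>x. \<bar>\<phi> x\<bar> \<le> C" using test_function_bounded[OF \<phi>(1)] by blast
    note m = test_function_measurable[OF \<phi>(1)]
    have gC: "\<bar>g n x\<bar> \<le> C" for n x
    proof -
      have "exp (- \<kappa> * \<epsilon> n) \<le> 1" using k eT(1)[of n] by simp
      then have "\<bar>g n x\<bar> \<le> 1 * \<bar>convolve \<phi> (heat_kernel (\<epsilon> n)) x\<bar>"
        unfolding g_def abs_mult by (intro mult_right_mono) auto
      then show ?thesis using convolve_heat_kernel_bound[OF eT(1) m C, of n x] by linarith
    qed
    have "(\<lambda>n. LINT x|lborel. indicator \<Omega> x *\<^sub>R ((\<phi> x - g n x) * (\<phi> x - g n x))) \<longlonglongrightarrow> integral\<^sup>L (lborel :: 'a measure) (\<lambda>_. 0::real)"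
    proof (rule integral_dominated_convergence)
      have "integrable lborel (\<lambda>x. (2 * C)\<^sup>2 * (indicator \<Omega> x :: real))"
        using emeasure_bounded_finite[OF \<Omega>(2)] \<Omega>(1) by (intro integrable_mult_right integrable_real_indicator) auto
      then show "integrable lborel (\<lambda>x. (2 * C)\<^sup>2 * (indicator \<Omega> x :: real))" .
      show "AE x in lborel. norm (indicator \<Omega> x *\<^sub>R ((\<phi> x - g n x) * (\<phi> x - g n x))) \<le> (2 * C)\<^sup>2 * indicator \<Omega> x" for n
      proof (rule AE_I2)
        fix x
        have "\<bar>\<phi> x - g n x\<bar> \<le> 2 * C" using C[of x] gC[of n x] by linarith
        then have "(\<phi> x - g n x)\<^sup>2 \<le> (2 * C)\<^sup>2" using abs_le_square_iff[of "\<phi> x - g n x" "2 * C"] by simp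
        then show "norm (indicator \<Omega> x *\<^sub>R ((\<phi> x - g n x) * (\<phi> x - g n x))) \<le> (2 * C)\<^sup>2 * indicator \<Omega> x"
          by (auto simp: indicator_def power2_eq_square)
      qed
      show "AE x in lborel. (\<lambda>n. indicator \<Omega> x *\<^sub>R ((\<phi> x - g n x) * (\<phi> x - g n x))) \<longlonglongrightarrow> 0"
      proof (rule AE_I2)
        fix x
        have "(\<lambda>n. g n x) \<longlonglongrightarrow> exp (- \<kappa> * 0) * \<phi> x"
          unfolding g_def by (intro tendsto_intros \<epsilon>0 convolve_heat_kernel_tendsto[OF eT(1) \<epsilon>0 test_function_continuous[OF \<phi>(1)] C])
        then have "(\<lambda>n. indicator \<Omega> x *\<^sub>R ((\<phi> x - g n x) * (\<phi> x - g n x))) \<longlonglongrightarrow> indicator \<Omega> x *\<^sub>R ((\<phi> x - exp (- \<kappa> * 0) * \<phi> x) * (\<phi> x - exp (- \<kappa> * 0) * \<phi> x))"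
          by (intro tendsto_intros)
        then show "(\<lambda>n. indicator \<Omega> x *\<^sub>R ((\<phi> x - g n x) * (\<phi> x - g n x))) \<longlonglongrightarrow> 0" by simp
      qed
      show "(\<lambda>x. indicator \<Omega> x *\<^sub>R ((\<phi> x - g n x) * (\<phi> x - g n x))) \<in> borel_measurable lborel" for n
        using convolve_heat_kernel_measurable[OF m] m \<Omega>(1) unfolding g_def by simp
    qed simp
    then have g0: "(\<lambda>n. L2_inner \<Omega> (\<lambda>x. \<phi> x - g n x) (\<lambda>x. \<phi> x - g n x)) \<longlonglongrightarrow> 0"
      by (simp add: L2_inner_def set_lebesgue_integral_def)
    have le: "?F n \<le> 2 * L2_inner \<Omega> (\<lambda>x. \<phi> x - f n x) (\<lambda>x. \<phi> x - f n x) + 2 * L2_inner \<Omega> (\<lambda>x. \<phi> x - g n x) (\<lambda>x. \<phi> x - g n x)" for n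
    proof -
      note i1 = L2_on_mult_integrable[OF L2_on_diff[OF fL gL] L2_on_diff[OF fL gL], of n n]
        and i2 = L2_on_mult_integrable[OF L2_on_diff[OF \<phi>L fL] L2_on_diff[OF \<phi>L fL], of n n]
        and i3 = L2_on_mult_integrable[OF L2_on_diff[OF \<phi>L gL] L2_on_diff[OF \<phi>L gL], of n n]
      have "?F n \<le> (LINT x:\<Omega>|lborel. 2 * ((\<phi> x - f n x) * (\<phi> x - f n x)) + 2 * ((\<phi> x - g n x) * (\<phi> x - g n x)))"
        unfolding L2_inner_def
      proof (rule set_integral_mono[OF i1])
        show "set_integrable lborel \<Omega> (\<lambda>x. 2 * ((\<phi> x - f n x) * (\<phi> x - f n x)) + 2 * ((\<phi> x - g n x) * (\<phi> x - g n x)))"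
          using i2 i3 by (intro set_integral_add set_integrable_mult_right) auto
        have "(a - b) * (a - b) \<le> 2 * ((c - a) * (c - a)) + 2 * ((c - b) * (c - b))" for a b c :: real
          using zero_le_square[of "(c - a) + (c - b)"] by (simp add: algebra_simps)
        then show "(f n x - g n x) * (f n x - g n x) \<le> 2 * ((\<phi> x - f n x) * (\<phi> x - f n x)) + 2 * ((\<phi> x - g n x) * (\<phi> x - g n x))" for x .
      qed
      then show ?thesis using i2 i3 by (simp add: L2_inner_def)
    qed
    have "(\<lambda>n. 2 * L2_inner \<Omega> (\<lambda>x. \<phi> x - f n x) (\<lambda>x. \<phi> x - f n x) + 2 * L2_inner \<Omega> (\<lambda>x. \<phi> x - g n x) (\<lambda>x. \<phi> x - g n x)) \<longlonglongrightarrow> 2 * 0 + 2 * 0"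
      by (intro tendsto_intros f0 g0)
    then have lim: "(\<lambda>n. 2 * L2_inner \<Omega> (\<lambda>x. \<phi> x - f n x) (\<lambda>x. \<phi> x - f n x) + 2 * L2_inner \<Omega> (\<lambda>x. \<phi> x - g n x) (\<lambda>x. \<phi> x - g n x)) \<longlonglongrightarrow> 0"
      by simp
    show ?thesis
      by (rule Lim_null_comparison[OF always_eventually lim]) (use le in \<open>simp add: L2_inner_self_nonneg\<close>)
  qed
  have small: "?P \<longlonglongrightarrow> 0"
  proof (rule Lim_null_comparison[OF always_eventually])
    show "(\<lambda>n. ?F n / \<kappa>\<^sup>2) \<longlonglongrightarrow> 0" using tendsto_divide[OF F0 tendsto_const[of "\<kappa>\<^sup>2"]] k by simp
    show "\<forall>n. norm (?P n) \<le> ?F n / \<kappa>\<^sup>2"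
    proof
      fix n
      have "0 \<le> ?P n" unfolding L2_inner_def set_lebesgue_integral_def
      proof (intro integral_nonneg_AE AE_I2)
        fix x
        have "0 \<le> d n x * soft_neg (d n x)" using soft_neg_square_le[of "d n x"] zero_le_power2[of "soft_neg (d n x)"] by linarith
        then show "0 \<le> indicator \<Omega> x *\<^sub>R (d n x * soft_neg (d n x))" by simp
      qed
      then show "norm (?P n) \<le> ?F n / \<kappa>\<^sup>2" using max[of n] k by (simp add: field_simps)
    qed
  qed
  let ?I = "LINT \<xi>|lborel. spectral_density u \<phi> \<xi> / (\<kappa> + (norm \<xi>)\<^sup>2)"
  have lim_w: "(\<lambda>n. L2_inner \<Omega> u (w n)) \<longlonglongrightarrow> ?I"
  proof -
    have "L2_inner \<Omega> u (w n) = (LINT t|lborel. indicator {\<epsilon> n..T n} t * exp (- \<kappa> * t) * heat_form t u \<phi>)" for n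
    proof -
      have "L2_inner \<Omega> u (w n) = (LINT x|lborel. w n x * u x)"
        unfolding L2_inner_def set_lebesgue_integral_def using u(4)
        by (intro Bochner_Integration.integral_cong refl) (auto simp: indicator_def)
      then show ?thesis unfolding w_def using heat_resolvent.resolvent_heat_form[OF loc u(1), of \<kappa> n] by simp
    qed
    then show ?thesis using truncated_laplace_tendsto[OF u(1,2) \<phi>(1) k] by (simp add: \<epsilon>_def T_def)
  qed
  have summ: "summable (\<lambda>j. ?u j * ?p j / (\<kappa> + \<mu> j))"
  proof (rule summable_comparison_test'[where N = 0])
    show "summable (\<lambda>j. (1 / \<kappa>) * ((1 + \<bar>\<mu> j\<bar>) * \<bar>?u j * ?p j\<bar>))"
      by (intro summable_mult summable_coefficients[OF \<Omega>(1,2) E uL \<phi>(1)])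
    fix j :: nat
    have "\<bar>?u j * ?p j\<bar> / (\<kappa> + \<mu> j) \<le> \<bar>?u j * ?p j\<bar> / \<kappa>" using k \<mu>0[of j] by (intro divide_left_mono) (auto intro!: mult_pos_pos add_pos_nonneg)
    also have "\<dots> = (1 / \<kappa>) * (1 * \<bar>?u j * ?p j\<bar>)" by simp
    also have "\<dots> \<le> (1 / \<kappa>) * ((1 + \<bar>\<mu> j\<bar>) * \<bar>?u j * ?p j\<bar>)"
      using k by (intro mult_left_mono mult_right_mono) auto
    finally show "norm (?u j * ?p j / (\<kappa> + \<mu> j)) \<le> (1 / \<kappa>) * ((1 + \<bar>\<mu> j\<bar>) * \<bar>?u j * ?p j\<bar>)"
      using k \<mu>0[of j] by (simp add: abs_mult)
  qed
  have lim_z: "(\<lambda>n. L2_inner \<Omega> u (z n)) \<longlonglongrightarrow> (\<Sum>j. ?u j * ?p j / (\<kappa> + \<mu> j))"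
  proof -
    have "L2_inner \<Omega> u (z n) = (\<Sum>j<n. ?u j * ?p j / (\<kappa> + \<mu> j))" for n
    proof -
      have "L2_inner \<Omega> (z n) u = (\<Sum>j<n. L2_inner \<Omega> (\<lambda>x. (?p j / (\<kappa> + \<mu> j)) * \<psi> j x) u)"
        unfolding z_def by (rule L2_inner_sum_left[OF uL]) (rule L2_on_scaleR[OF \<psi>, unfolded real_scaleR_def])
      also have "\<dots> = (\<Sum>j<n. ?u j * ?p j / (\<kappa> + \<mu> j))"
        unfolding L2_inner_mult_left by (intro sum.cong refl) (simp add: L2_inner_commute[of \<Omega> "\<psi> _" u])
      finally show ?thesis by (subst L2_inner_commute)
    qed
    then show ?thesis using summable_LIMSEQ[OF summ] by simp
  qed
  have "(\<lambda>n. L2_inner \<Omega> u (d n)) \<longlonglongrightarrow> (\<Sum>j. ?u j * ?p j / (\<kappa> + \<mu> j)) - ?I"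
  proof -
    have "L2_inner \<Omega> u (d n) = L2_inner \<Omega> u (z n) - L2_inner \<Omega> u (w n)" for n
      using L2_inner_diff_left[OF zL wL uL] by (simp add: d_def[abs_def] L2_inner_commute[of \<Omega> u])
    then show ?thesis using tendsto_diff[OF lim_z lim_w] by simp
  qed
  from limit_nonneg_of_small_neg_part[OF \<Omega>(1,2) uL u(3) dL small this] show ?thesis by simp
qed

section \<open>Conclusion\<close>

lemma integral_pos_of_continuous:
  fixes f :: "'a::euclidean_space \<Rightarrow> real"
  assumes c: "continuous_on UNIV f" and i: "integrable lborel f" and nn: "\<And>x. 0 \<le> f x" and x0: "f x0 \<noteq> 0"
  shows "0 < (LINT x|lborel. f x)"
proof -
  have "(LINT x|lborel. f x) \<noteq> 0"
  proof
    assume "(LINT x|lborel. f x) = 0"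
    then have ae: "AE x in lborel. f x = 0"
      using integral_nonneg_eq_0_iff_AE[OF i] nn by auto
    have op: "open {x. f x \<noteq> 0}"
      using open_Collect_neq[OF c continuous_on_const[of UNIV 0]] by simp
    have "{x. f x \<noteq> 0} \<in> null_sets lborel"
      using ae op by (subst AE_iff_null_sets) auto
    then have "negligible {x. f x \<noteq> 0}"
      by (simp add: negligible_iff_null_sets null_sets_completionI)
    then show False using open_not_negligible[OF op] x0 by blast
  qed
  moreover have "0 \<le> (LINT x|lborel. f x)" using nn by (intro integral_nonneg_AE) auto
  ultimately show ?thesis by simp
qed

text \<open>Any nonnegative test function that does not vanish identically can be rescaled; in the theorem, the test function at hand is used.\<close>

lemma mollifiers_of_bump:
  fixes \<phi> :: "'a::euclidean_space \<Rightarrow> real"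
  assumes \<phi>: "test_function \<Omega> \<phi>" "\<And>x. 0 \<le> \<phi> x" "\<phi> x0 \<noteq> 0"
  obtains \<rho> :: "real \<Rightarrow> 'a \<Rightarrow> real" where "mollifiers \<rho>"
proof -
  define c where "c = (LINT x|lborel. \<phi> x)"
  have c: "c > 0" unfolding c_def
    by (rule integral_pos_of_continuous[OF test_function_continuous[OF \<phi>(1)] test_function_integrable[OF \<phi>(1)] \<phi>(2,3)])
  obtain R where R: "R > 0" "\<And>x. \<phi> x \<noteq> 0 \<Longrightarrow> norm x \<le> R"
    using test_function_bounded_support[OF \<phi>(1)] unfolding bounded_pos by auto
  define \<rho> where "\<rho> \<delta> x = ((R / \<delta>) ^ DIM('a) / c) * \<phi> ((R / \<delta>) *\<^sub>R x + 0)" for \<delta> x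
  have "mollifiers \<rho>"
  proof
    fix \<delta> :: real and x :: 'a assume d: "\<delta> > 0"
    show "smooth (\<rho> \<delta>)" unfolding smooth_def \<rho>_def[abs_def]
      by (intro allI Ck_mult Ck_const Ck_affine test_function_Ck[OF \<phi>(1)])
    show "0 \<le> \<rho> \<delta> x" using \<phi>(2) R c d by (simp add: \<rho>_def)
    show "norm x \<le> \<delta>" if "\<rho> \<delta> x \<noteq> 0"
    proof -
      have "norm ((R / \<delta>) *\<^sub>R x) \<le> R" using that R(2)[of "(R / \<delta>) *\<^sub>R x"] by (auto simp: \<rho>_def)
      then show ?thesis using R(1) d by (simp add: field_simps)
    qed
    have "(LINT x|lborel. \<phi> (0 + (R / \<delta>) *\<^sub>R x)) = (1 / \<bar>R / \<delta>\<bar> ^ DIM('a)) *\<^sub>R c"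
      unfolding c_def using R(1) d by (intro lborel_integral_affine(1) test_function_measurable[OF \<phi>(1)]) simp
    then show "(LINT x|lborel. \<rho> \<delta> x) = 1"
      using R(1) d c by (simp add: \<rho>_def)
  qed
  then show ?thesis using that by blast
qed

lemma AE_imp_ex_small_positive:
  fixes e :: real
  assumes ae: "AE r in lborel. 0 < r \<longrightarrow> P r" and e: "e > 0"
  shows "\<exists>r. 0 < r \<and> r < e \<and> P r"
proof (rule ccontr)
  assume n: "\<not> ?thesis"
  have "AE r in lborel. r \<notin> {0<..<e}" using ae by eventually_elim (use n in auto)
  then have "{0<..<e} \<in> null_sets lborel" by (subst (asm) AE_iff_null_sets[symmetric]) auto
  then show False using e by (auto simp: null_sets_def)
qed

lemma powr_le_one_plus: "0 \<le> a \<Longrightarrow> 0 < s \<Longrightarrow> s < 1 \<Longrightarrow> (a::real) powr s \<le> 1 + a"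
proof (cases "a \<le> 1")
  case True
  assume "0 \<le> a" "0 < s"
  then show ?thesis using True powr_le1[of s a] by simp
next
  case False
  assume "0 \<le> a" "0 < s" "s < 1"
  then show ?thesis using False powr_mono[of s 1 a] by simp
qed

text \<open>By \<open>power_subordination\<close> the difference of the two sides is an integral over \<open>r\<close> of resolvent differences,
  nonnegative by the comparison of the resolvents. For strictness suppose that the integral is 0: then the
  pairings of \<open>u\<close> with the two resolvents of \<open>\<phi>\<close> agree for almost every \<open>r\<close>, in particular for arbitrarily small \<open>r\<close>, where the constant Neumann mode
  survives as \<open>r\<close> tends to 0 while the free resolvent, having no mass at frequency 0, does not.\<close>

lemma (in mollifiers) frac_laplacian_comparison:
  fixes \<Omega> :: "'a set" and u \<phi> :: "'a \<Rightarrow> real"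
  assumes \<Omega>: "open \<Omega>" "bounded \<Omega>" "convex \<Omega>" and s: "0 < s" "s < 1" and E: "neumann_eigensystem \<Omega> \<mu> \<psi>"
    and u: "integrable lborel u" "integrable lborel (\<lambda>x. (u x)\<^sup>2)" "AE x in lborel. 0 \<le> u x" "\<And>x. x \<notin> \<Omega> \<Longrightarrow> u x = 0"
      "\<not> (AE x in lborel. u x = 0)"
    and \<phi>: "test_function \<Omega> \<phi>" "\<And>x. 0 \<le> \<phi> x" "\<phi> x0 \<noteq> 0"
  shows "frac_laplacian_NSp s \<Omega> \<mu> \<psi> u \<phi> < frac_laplacian_DR s u \<phi>"
proof -
  have B: "L2_orthonormal_basis \<Omega> \<psi>" and \<mu>: "mono \<mu>" "\<mu> 0 = 0" "0 < \<mu> 1" and const: "\<exists>c. AE x in lborel. x \<in> \<Omega> \<longrightarrow> \<psi> 0 x = c"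
    using E by (auto simp: neumann_eigensystem_def)
  have \<mu>0: "0 \<le> \<mu> j" for j using monoD[OF \<mu>(1), of 0 j] \<mu>(2) by simp
  have \<mu>1: "0 < \<mu> j" if "j \<noteq> 0" for j using monoD[OF \<mu>(1), of 1 j] \<mu>(3) that by simp
  have e: "indicator \<Omega> x *\<^sub>R u x = u x" "indicator \<Omega> x * (norm (u x))\<^sup>2 = (u x)\<^sup>2" for x
    using u(4)[of x] by (cases "x \<in> \<Omega>"; simp)+
  have uL: "u \<in> L2_on \<Omega>" unfolding L2_on_iff e using u by auto
  note \<phi>L = test_function_L2[OF \<Omega>(1,2) \<phi>(1)]
  define m where "m = spectral_density u \<phi>"
  define n where "n j = L2_inner \<Omega> u (\<psi> j) * L2_inner \<Omega> \<phi> (\<psi> j)" for j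
  define a where "a \<xi> = (norm \<xi>)\<^sup>2" for \<xi> :: 'a
  have a0: "0 \<le> a \<xi>" for \<xi> by (simp add: a_def)
  have a_meas[measurable]: "a \<in> borel_measurable borel" unfolding a_def[abs_def] by measurable
  have m_meas[measurable]: "m \<in> borel_measurable borel" unfolding m_def by (rule spectral_density_measurable[OF u(1,2) \<phi>(1)])
  have mi: "integrable lborel m" unfolding m_def by (rule spectral_density_integrable[OF u(1,2) \<phi>(1)])
  have mai: "integrable lborel (\<lambda>\<xi>. (1 + a \<xi>) * m \<xi>)"
    unfolding m_def a_def by (rule spectral_density_moment_integrable[OF u(1,2) \<phi>(1)])
  have msi: "integrable lborel (\<lambda>\<xi>. a \<xi> powr s * m \<xi>)"
  proof (rule Bochner_Integration.integrable_bound[OF mai])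
    show "AE \<xi> in lborel. norm (a \<xi> powr s * m \<xi>) \<le> norm ((1 + a \<xi>) * m \<xi>)"
      unfolding real_norm_def abs_mult using powr_le_one_plus[OF a0 s] a0 by (intro AE_I2 mult_right_mono) auto
  qed measurable
  define inner where "inner = (LINT x|lborel. u x * \<phi> x)"
  have inner_L2: "L2_inner \<Omega> u \<phi> = inner"
    unfolding inner_def L2_inner_def set_lebesgue_integral_def using u(4)
    by (intro Bochner_Integration.integral_cong refl) (auto simp: indicator_def)
  have m_int: "(LINT \<xi>|lborel. m \<xi>) = inner"
    unfolding m_def inner_def by (rule spectral_density_integral[OF u(1,2) \<phi>(1)])
  have n_sums: "n sums inner"
    using parseval_sums[OF B uL \<phi>L] unfolding inner_L2 n_def[abs_def] .
  have nai: "summable (\<lambda>j. (1 + \<mu> j) * \<bar>n j\<bar>)"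
    using summable_coefficients[OF \<Omega>(1,2) E uL \<phi>(1)] \<mu>0 by (simp add: n_def)
  have n_abs: "summable (\<lambda>j. \<bar>n j\<bar>)"
    by (rule summable_comparison_test'[OF nai, where N = 0]) (use \<mu>0 in \<open>simp add: distrib_right\<close>)
  have nsi: "summable (\<lambda>j. norm (\<mu> j powr s * n j))"
    by (rule summable_comparison_test'[OF nai, where N = 0])
      (use powr_le_one_plus[OF \<mu>0 s] in \<open>simp add: abs_mult mult_right_mono\<close>)

  \<comment> \<open>the pairings of \<open>u\<close> with the free and the Neumann resolvent of \<open>\<phi>\<close>\<close>
  define Ed where "Ed r = (LINT \<xi>|lborel. m \<xi> / (r + a \<xi>))" for r
  define Es where "Es r = (\<Sum>j. n j / (r + \<mu> j))" for r
  define K where "K = subordination_const s"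
  have K: "K > 0" unfolding K_def by (rule subordination_const_pos[OF s])
  have Ed_int: "integrable lborel (\<lambda>\<xi>. m \<xi> / (r + a \<xi>))" if r: "r > 0" for r
  proof (rule Bochner_Integration.integrable_bound)
    show "integrable lborel (\<lambda>\<xi>. (1 / r) * m \<xi>)" using mi by simp
    show "AE \<xi> in lborel. norm (m \<xi> / (r + a \<xi>)) \<le> norm ((1 / r) * m \<xi>)"
    proof (rule AE_I2)
      fix \<xi> :: 'a
      have "\<bar>m \<xi>\<bar> / (r + a \<xi>) \<le> \<bar>m \<xi>\<bar> / r" using r a0[of \<xi>] by (intro divide_left_mono mult_pos_pos add_pos_nonneg) auto
      then show "norm (m \<xi> / (r + a \<xi>)) \<le> norm ((1 / r) * m \<xi>)" using r a0[of \<xi>] by (simp add: abs_mult)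
    qed
  qed measurable
  have Es_sum: "summable (\<lambda>j. n j / (r + \<mu> j))" if r: "r > 0" for r
  proof (rule summable_comparison_test'[OF summable_mult[OF n_abs, of "1 / r"], where N = 0])
    fix j :: nat
    have "\<bar>n j\<bar> / (r + \<mu> j) \<le> \<bar>n j\<bar> / r" using r \<mu>0[of j] by (intro divide_left_mono mult_pos_pos add_pos_nonneg) auto
    then show "norm (n j / (r + \<mu> j)) \<le> 1 / r * \<bar>n j\<bar>" using r \<mu>0[of j] by simp
  qed
  have split: "b / (r + b) * y = y - r * (y / (r + b))" if "r > 0" "0 \<le> b" for r b y :: real
  proof -
    have "r + b \<noteq> 0" using that by linarith
    then show ?thesis by (simp add: field_simps)
  qed
  have D_eq: "(LINT \<xi>|lborel. a \<xi> / (r + a \<xi>) * m \<xi>) = inner - r * Ed r" if r: "r > 0" for r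
  proof -
    have "(LINT \<xi>|lborel. a \<xi> / (r + a \<xi>) * m \<xi>) = (LINT \<xi>|lborel. m \<xi> - r * (m \<xi> / (r + a \<xi>)))"
      by (intro Bochner_Integration.integral_cong refl split r a0)
    also have "\<dots> = inner - r * Ed r"
      unfolding Ed_def m_int[symmetric]
      by (subst Bochner_Integration.integral_diff[OF mi integrable_mult_right[OF Ed_int[OF r]]])
        (simp only: integral_mult_right_zero)
    finally show ?thesis .
  qed
  have S_eq: "(LINT j|count_space UNIV. \<mu> j / (r + \<mu> j) * n j) = inner - r * Es r" if r: "r > 0" for r
  proof -
    have "(\<lambda>j. n j - r * (n j / (r + \<mu> j))) sums (inner - r * Es r)"
      unfolding Es_def by (intro sums_diff n_sums sums_mult summable_sums Es_sum r)
    then have sums: "(\<lambda>j. \<mu> j / (r + \<mu> j) * n j) sums (inner - r * Es r)"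
      using split[OF r \<mu>0] by simp
    have "summable (\<lambda>j. norm (\<mu> j / (r + \<mu> j) * n j))"
    proof (rule summable_comparison_test'[OF n_abs, where N = 0])
      fix j :: nat
      have "\<bar>\<mu> j / (r + \<mu> j)\<bar> \<le> 1" using r \<mu>0[of j] by simp
      then show "norm (norm (\<mu> j / (r + \<mu> j) * n j)) \<le> \<bar>n j\<bar>"
        unfolding real_norm_def abs_idempotent abs_mult by (intro mult_left_le_one_le) auto
    qed
    then show ?thesis
      using sums by (simp add: integral_count_space_nat integrable_count_space_nat_iff sums_iff)
  qed
  note PD = power_subordination[OF sigma_finite_lborel s, of a m, OF _ a0 _ msi]
  have PD1: "integrable lborel (\<lambda>r. indicator {0<..} r * r powr (s - 1) * (LINT \<xi>|lborel. a \<xi> / (r + a \<xi>) * m \<xi>))"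
    and PD2: "(LINT r|lborel. indicator {0<..} r * r powr (s - 1) * (LINT \<xi>|lborel. a \<xi> / (r + a \<xi>) * m \<xi>)) = K * (LINT \<xi>|lborel. a \<xi> powr s * m \<xi>)"
    using PD by (simp_all add: K_def)
  have sfc: "sigma_finite_measure (count_space (UNIV :: nat set))"
    by (rule sigma_finite_measure_count_space)
  have nsi': "integrable (count_space UNIV) (\<lambda>j. \<mu> j powr s * n j)"
    using nsi by (simp add: integrable_count_space_nat_iff)
  note PS = power_subordination[OF sfc s, of \<mu> n, OF _ \<mu>0 _ nsi']
  have PS1: "integrable lborel (\<lambda>r. indicator {0<..} r * r powr (s - 1) * (LINT j|count_space UNIV. \<mu> j / (r + \<mu> j) * n j))"
    and PS2: "(LINT r|lborel. indicator {0<..} r * r powr (s - 1) * (LINT j|count_space UNIV. \<mu> j / (r + \<mu> j) * n j)) = K * (LINT j|count_space UNIV. \<mu> j powr s * n j)"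
    using PS by (simp_all add: K_def)
  have DR: "frac_laplacian_DR s u \<phi> = (LINT \<xi>|lborel. a \<xi> powr s * m \<xi>)"
  proof -
    let ?M = "\<lambda>\<xi>. fourier (\<lambda>x. of_real (u x)) \<xi> * cnj (fourier (\<lambda>x. of_real (\<phi> x)) \<xi>)"
    have pw: "norm \<xi> powr (2 * s) = a \<xi> powr s" for \<xi> :: 'a
    proof (cases "\<xi> = 0")
      case False
      then have "a \<xi> = norm \<xi> powr 2" by (simp add: a_def powr_numeral)
      then show ?thesis by (simp only: powr_powr)
    qed (simp add: a_def)
    have mm: "?M \<in> borel_measurable borel"
      by (rule fourier_product_measurable[OF u(1) test_function_integrable[OF \<phi>(1)]])
    have i: "integrable lborel (\<lambda>\<xi>. of_real (a \<xi> powr s) * ?M \<xi>)"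
    proof (rule Bochner_Integration.integrable_bound[OF fourier_product_moment_integrable[OF u(1,2) \<phi>(1)]])
      show "(\<lambda>\<xi>. of_real (a \<xi> powr s) * ?M \<xi>) \<in> borel_measurable lborel"
        using borel_measurable_times[OF _ mm, of "\<lambda>\<xi>. of_real (a \<xi> powr s)"] by simp
      show "AE \<xi> in lborel. norm (of_real (a \<xi> powr s) * ?M \<xi>) \<le> norm ((1 + (norm \<xi>)\<^sup>2) * cmod (?M \<xi>))"
      proof (rule AE_I2)
        fix \<xi> :: 'a
        have "\<bar>a \<xi> powr s\<bar> * cmod (?M \<xi>) \<le> (1 + a \<xi>) * cmod (?M \<xi>)"
          using powr_le_one_plus[OF a0 s] by (intro mult_right_mono) auto
        also have "\<dots> \<le> norm ((1 + (norm \<xi>)\<^sup>2) * cmod (?M \<xi>))" unfolding a_def by (metis abs_ge_self real_norm_def)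
        finally show "norm (of_real (a \<xi> powr s) * ?M \<xi>) \<le> norm ((1 + (norm \<xi>)\<^sup>2) * cmod (?M \<xi>))"
          by (simp only: norm_mult norm_of_real)
      qed
    qed
    have rm: "Re (of_real c * y) = c * Re y" for c y by simp
    have "frac_laplacian_DR s u \<phi> = Re (LINT \<xi>|lborel. of_real (a \<xi> powr s) * ?M \<xi>)"
      unfolding frac_laplacian_DR_def pw mult.assoc ..
    also have "\<dots> = (LINT \<xi>|lborel. Re (of_real (a \<xi> powr s) * ?M \<xi>))"
      by (rule integral_Re[OF i, symmetric])
    finally show ?thesis by (simp only: m_def spectral_density_def rm)
  qed
  have NS: "frac_laplacian_NSp s \<Omega> \<mu> \<psi> u \<phi> = (LINT j|count_space UNIV. \<mu> j powr s * n j)"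
    by (subst integral_count_space_nat[OF nsi'])
      (simp add: frac_laplacian_NSp_def n_def L2_inner_commute[of \<Omega> "\<psi> _" \<phi>] mult.assoc)

  \<comment> \<open>by \<open>a / (r + a) = 1 - r / (r + a)\<close>, the inner product of \<open>u\<close> and \<open>\<phi>\<close> cancels in the difference\<close>
  define gap where "gap r = indicator {0<..} r * r powr (s - 1) * (r * (Es r - Ed r))" for r
  have gap_eq: "gap r = indicator {0<..} r * r powr (s - 1) * (LINT \<xi>|lborel. a \<xi> / (r + a \<xi>) * m \<xi>)
      - indicator {0<..} r * r powr (s - 1) * (LINT j|count_space UNIV. \<mu> j / (r + \<mu> j) * n j)" for r
  proof (cases "r > 0")
    case True
    show ?thesis unfolding gap_def D_eq[OF True] S_eq[OF True] by (simp add: algebra_simps)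
  qed (simp add: gap_def)
  have gap_int: "integrable lborel gap" unfolding gap_eq[abs_def] by (rule Bochner_Integration.integrable_diff[OF PD1 PS1])
  have total: "K * (frac_laplacian_DR s u \<phi> - frac_laplacian_NSp s \<Omega> \<mu> \<psi> u \<phi>) = (LINT r|lborel. gap r)"
    unfolding gap_eq Bochner_Integration.integral_diff[OF PD1 PS1] PD2 PS2 DR NS by (rule right_diff_distrib)
  have le: "Ed r \<le> Es r" if r: "r > 0" for r
    using resolvent_comparison[OF \<Omega> E u(1-4) \<phi>(1,2) r] by (simp add: Ed_def Es_def m_def n_def a_def)
  have gap0: "0 \<le> gap r" for r using le[of r] by (auto simp: gap_def indicator_def)
  have nonneg: "0 \<le> (LINT r|lborel. gap r)" using gap0 by (intro integral_nonneg_AE) auto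

  \<comment> \<open>the constant mode is the only one that survives in \<open>r * Es r\<close> as \<open>r\<close> tends to 0\<close>
  have n0: "n 0 > 0"
  proof -
    obtain c where c: "AE x in lborel. x \<in> \<Omega> \<longrightarrow> \<psi> 0 x = c" using const by blast
    have mean: "L2_inner \<Omega> v (\<psi> 0) = c * (LINT x|lborel. v x)" if v: "\<And>x. x \<notin> \<Omega> \<Longrightarrow> v x = 0" "integrable lborel v" "v \<in> L2_on \<Omega>" for v
    proof -
      have \<psi>0: "\<psi> 0 \<in> L2_on \<Omega>" using B by (simp add: L2_orthonormal_basis_def)
      have "L2_inner \<Omega> v (\<psi> 0) = (LINT x|lborel. c * v x)"
        unfolding L2_inner_def set_lebesgue_integral_def
      proof (rule integral_cong_AE)
        show "(\<lambda>x. indicator \<Omega> x *\<^sub>R (v x * \<psi> 0 x)) \<in> borel_measurable lborel"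
          using L2_on_mult_integrable[OF v(3) \<psi>0] by (auto simp: set_integrable_def)
        show "(\<lambda>x. c * v x) \<in> borel_measurable lborel" using v(2) by auto
        show "AE x in lborel. indicator \<Omega> x *\<^sub>R (v x * \<psi> 0 x) = c * v x"
          using c by eventually_elim (use v(1) in \<open>auto simp: indicator_def\<close>)
      qed
      then show ?thesis by simp
    qed
    have c0: "c \<noteq> 0"
    proof
      assume "c = 0"
      have "\<not> (AE x in lborel. x \<in> \<Omega> \<longrightarrow> \<psi> 0 x = 0)"
        using E by (auto simp: neumann_eigensystem_def neumann_eigenfunction_def)
      then show False using c \<open>c = 0\<close> by simp
    qed
    have iu: "0 < (LINT x|lborel. u x)"
    proof -
      have "(LINT x|lborel. u x) \<noteq> 0" using integral_nonneg_eq_0_iff_AE[OF u(1,3)] u(5) by simp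
      moreover have "0 \<le> (LINT x|lborel. u x)" using u(3) by (rule integral_nonneg_AE)
      ultimately show ?thesis by simp
    qed
    have ip: "0 < (LINT x|lborel. \<phi> x)"
      by (rule integral_pos_of_continuous[OF test_function_continuous[OF \<phi>(1)] test_function_integrable[OF \<phi>(1)] \<phi>(2,3)])
    have "n 0 = (c * c) * ((LINT x|lborel. u x) * (LINT x|lborel. \<phi> x))"
      unfolding n_def using mean[OF u(4,1) uL] mean[OF test_function_outside[OF \<phi>(1)] test_function_integrable[OF \<phi>(1)] \<phi>L] by simp
    moreover have "0 < c * c" using c0 by (auto simp: zero_less_mult_iff linorder_neq_iff)
    ultimately show ?thesis using iu ip by simp
  qed
  have "(LINT r|lborel. gap r) \<noteq> 0"
  proof
    assume "(LINT r|lborel. gap r) = 0"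
    then have "AE r in lborel. gap r = 0" using integral_nonneg_eq_0_iff_AE[OF gap_int] gap0 by auto
    then have ae: "AE r in lborel. 0 < r \<longrightarrow> Es r = Ed r"
      by eventually_elim (auto simp: gap_def)
    \<comment> \<open>equality for almost every \<open>r\<close> provides a sequence tending to 0 along which equality holds\<close>
    have "\<exists>r. 0 < r \<and> r < inverse (real (Suc k)) \<and> Es r = Ed r" for k
      by (rule AE_imp_ex_small_positive[OF ae]) simp
    then obtain r where r: "\<And>k. 0 < r k" "\<And>k. r k < inverse (real (Suc k))" "\<And>k. Es (r k) = Ed (r k)" by metis
    have r0: "r \<longlonglongrightarrow> 0"
      by (rule tendsto_sandwich[OF _ _ tendsto_const LIMSEQ_inverse_real_of_nat])
        (use r in \<open>auto intro!: always_eventually less_imp_le\<close>)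
    have frac: "(\<lambda>k. r k / (r k + b)) \<longlonglongrightarrow> 0" if "b > 0" for b
    proof -
      have "(\<lambda>k. r k / (r k + b)) \<longlonglongrightarrow> 0 / (0 + b)" using that by (intro tendsto_intros r0) auto
      then show ?thesis by simp
    qed
    have frac1: "\<bar>r k / (r k + b)\<bar> \<le> 1" if "0 \<le> b" for k b using r(1)[of k] that by simp
    have "(\<lambda>k. LINT \<xi>|lborel. r k / (r k + a \<xi>) * m \<xi>) \<longlonglongrightarrow> integral\<^sup>L (lborel :: 'a measure) (\<lambda>_. 0::real)"
    proof (rule integral_dominated_convergence)
      show "integrable lborel (\<lambda>\<xi>. \<bar>m \<xi>\<bar>)" using mi by simp
      show "AE \<xi> in lborel. norm (r k / (r k + a \<xi>) * m \<xi>) \<le> \<bar>m \<xi>\<bar>" for k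
        unfolding real_norm_def abs_mult using frac1[OF a0] by (intro AE_I2 mult_left_le_one_le) auto
      have "AE \<xi>::'a in lborel. \<xi> \<noteq> 0" by (rule AE_lborel_singleton)
      then show "AE \<xi> in lborel. (\<lambda>k. r k / (r k + a \<xi>) * m \<xi>) \<longlonglongrightarrow> 0"
      proof eventually_elim
        case (elim \<xi>)
        then have "a \<xi> > 0" by (simp add: a_def)
        from tendsto_mult_right[OF frac[OF this], of "m \<xi>"] show ?case by simp
      qed
    qed measurable
    moreover have "(LINT \<xi>|lborel. r k / (r k + a \<xi>) * m \<xi>) = r k * Ed (r k)" for k
      unfolding Ed_def integral_mult_right_zero[symmetric] by (intro Bochner_Integration.integral_cong refl) simp
    ultimately have lim_d: "(\<lambda>k. r k * Ed (r k)) \<longlonglongrightarrow> 0" by simp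
    have "(\<lambda>k. LINT j|count_space UNIV. r k / (r k + \<mu> j) * n j) \<longlonglongrightarrow> (LINT j|count_space (UNIV :: nat set). (if j = 0 then n 0 else 0))"
    proof (rule integral_dominated_convergence)
      show "integrable (count_space UNIV) (\<lambda>j. \<bar>n j\<bar>)" using n_abs by (simp add: integrable_count_space_nat_iff)
      show "AE j in count_space UNIV. norm (r k / (r k + \<mu> j) * n j) \<le> \<bar>n j\<bar>" for k
        unfolding real_norm_def abs_mult using frac1[OF \<mu>0] by (intro AE_I2 mult_left_le_one_le) auto
      show "AE j in count_space UNIV. (\<lambda>k. r k / (r k + \<mu> j) * n j) \<longlonglongrightarrow> (if j = 0 then n 0 else 0)"
      proof (rule AE_I2)
        fix j :: nat
        show "(\<lambda>k. r k / (r k + \<mu> j) * n j) \<longlonglongrightarrow> (if j = 0 then n 0 else 0)"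
        proof (cases "j = 0")
          case True
          have "r k \<noteq> 0" for k using r(1)[of k] by simp
          then show ?thesis using True \<mu>(2) by simp
        next
          case False
          from tendsto_mult_right[OF frac[OF \<mu>1[OF this]], of "n j"] show ?thesis using False by simp
        qed
      qed
    qed simp_all
    moreover have "(LINT j|count_space UNIV. r k / (r k + \<mu> j) * n j) = r k * Es (r k)" for k
    proof -
      have "summable (\<lambda>j. norm (r k / (r k + \<mu> j) * n j))"
      proof (rule summable_comparison_test'[OF n_abs, where N = 0])
        fix j :: nat
        show "norm (norm (r k / (r k + \<mu> j) * n j)) \<le> \<bar>n j\<bar>"
          unfolding real_norm_def abs_idempotent abs_mult using frac1[OF \<mu>0] by (intro mult_left_le_one_le) auto
      qed
      then have "(LINT j|count_space UNIV. r k / (r k + \<mu> j) * n j) = (\<Sum>j. r k / (r k + \<mu> j) * n j)"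
        by (intro integral_count_space_nat) (simp add: integrable_count_space_nat_iff)
      also have "\<dots> = (\<Sum>j. r k * (n j / (r k + \<mu> j)))" by simp
      also have "\<dots> = r k * Es (r k)" unfolding Es_def by (rule suminf_mult[OF Es_sum[OF r(1)]])
      finally show ?thesis .
    qed
    moreover have "(LINT j|count_space (UNIV :: nat set). (if j = 0 then n 0 else 0)) = n 0"
    proof -
      have "integrable (count_space UNIV) (\<lambda>j::nat. if j = 0 then n 0 else 0)"
        by (simp add: integrable_count_space_nat_iff summable_single if_distrib cong: if_cong)
      moreover have "(\<lambda>j::nat. if j = 0 then n 0 else 0) sums n 0"
        using sums_single[of 0 "\<lambda>_. n 0"] by simp
      ultimately show ?thesis by (simp add: integral_count_space_nat sums_iff)
    qed
    ultimately have "(\<lambda>k. r k * Es (r k)) \<longlonglongrightarrow> n 0" by simp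
    then have "n 0 = 0" using lim_d LIMSEQ_unique unfolding r(3) by blast
    then show False using n0 by simp
  qed
  then have "0 < K * (frac_laplacian_DR s u \<phi> - frac_laplacian_NSp s \<Omega> \<mu> \<psi> u \<phi>)"
    using total nonneg by simp
  then show ?thesis using K by (simp add: zero_less_mult_iff)
qed

theorem theorem4:
  fixes \<Omega> :: "'a::euclidean_space set"
    and s :: real
    and u :: "'a \<Rightarrow> real"
    and \<mu> :: "nat \<Rightarrow> real"
    and \<psi> :: "nat \<Rightarrow> 'a \<Rightarrow> real"
  assumes "bounded \<Omega>"
    and "lipschitz_domain \<Omega>"
    and "convex \<Omega>"
    and "0 < s" and "s < 1"
    and "neumann_eigensystem \<Omega> \<mu> \<psi>"
    and "u \<in> sobolev_tilde s \<Omega>"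
    and "AE x in lborel. 0 \<le> u x"
    and "\<not> (AE x in lborel. u x = 0)"
  shows "distr_greater \<Omega> (frac_laplacian_DR s u) (frac_laplacian_NSp s \<Omega> \<mu> \<psi> u)"
  unfolding distr_greater_def
proof (intro allI impI)
  fix \<phi> assume \<phi>: "test_function \<Omega> \<phi>" "\<forall>x. 0 \<le> \<phi> x" "\<exists>x. \<phi> x \<noteq> 0"
  then obtain x0 where x0: "\<phi> x0 \<noteq> 0" by blast
  obtain \<rho> :: "real \<Rightarrow> 'a \<Rightarrow> real" where "mollifiers \<rho>" using mollifiers_of_bump[OF \<phi>(1) _ x0] \<phi>(2) by blast
  then interpret mollifiers \<rho> .
  have op: "open \<Omega>" using assms(2) by (simp add: lipschitz_domain_def)
  then have [measurable]: "\<Omega> \<in> sets borel" by simp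
  have u2: "u \<in> L2_on UNIV" and supp: "AE x in lborel. x \<notin> closure \<Omega> \<longrightarrow> u x = 0"
    using assms(7) by (auto simp: sobolev_tilde_def sobolev_slobodetskii_def)
  have um[measurable]: "u \<in> borel_measurable borel" and ui: "integrable lborel (\<lambda>x. (u x)\<^sup>2)"
    using u2 by (auto simp: L2_on_iff)
  \<comment> \<open>the boundary of a convex set is a null set, so \<open>u\<close> may be replaced by its restriction to \<open>\<Omega>\<close>\<close>
  have out: "AE x in lborel. x \<notin> \<Omega> \<longrightarrow> u x = 0"
  proof -
    have "frontier \<Omega> \<in> null_sets lborel"
      using negligible_convex_frontier[OF assms(3)] by (simp add: negligible_iff_null_sets null_sets_completion_iff)
    then have "AE x in lborel. x \<notin> frontier \<Omega>" by (rule AE_not_in)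
    with supp show ?thesis
      by eventually_elim (use op in \<open>auto simp: frontier_def interior_open\<close>)
  qed
  define v where "v x = indicator \<Omega> x * u x" for x
  have vu: "AE x in lborel. v x = u x" using out by eventually_elim (auto simp: v_def indicator_def)
  have [measurable]: "v \<in> borel_measurable borel" unfolding v_def by measurable
  have vu2: "AE x in lborel. (v x)\<^sup>2 = (u x)\<^sup>2" using vu by eventually_elim simp
  have v2: "integrable lborel (\<lambda>x. (v x)\<^sup>2)" using integrable_cong_AE[OF _ _ vu2] ui by simp
  have vL: "v \<in> L2_on \<Omega>"
  proof -
    have "indicator \<Omega> x *\<^sub>R v x = v x" "indicator \<Omega> x * (norm (v x))\<^sup>2 = (v x)\<^sup>2" for x
      by (auto simp: v_def indicator_def)
    then show ?thesis using v2 by (simp only: L2_on_iff) simp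
  qed
  have vi: "integrable lborel v"
  proof -
    have "indicator \<Omega> x *\<^sub>R v x = v x" for x by (auto simp: v_def indicator_def)
    then show ?thesis using L2_on_set_integrable[OF vL op assms(1)] by (simp only: set_integrable_def)
  qed
  have v0: "AE x in lborel. 0 \<le> v x" using vu assms(8) by eventually_elim simp
  have vn: "\<not> (AE x in lborel. v x = 0)"
  proof
    assume "AE x in lborel. v x = 0"
    with vu have "AE x in lborel. u x = 0" by eventually_elim simp
    then show False using assms(9) by simp
  qed
  have vout: "v x = 0" if "x \<notin> \<Omega>" for x using that by (simp add: v_def)
  have "frac_laplacian_NSp s \<Omega> \<mu> \<psi> v \<phi> < frac_laplacian_DR s v \<phi>"
    by (rule frac_laplacian_comparison[OF op assms(1,3,4,5,6) vi v2 v0 vout vn \<phi>(1) _ x0]) (use \<phi>(2) in auto)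
  moreover have "L2_inner \<Omega> v f = L2_inner \<Omega> u f" for f
    unfolding L2_inner_def set_lebesgue_integral_def
    by (intro Bochner_Integration.integral_cong refl) (auto simp: v_def indicator_def)
  then have "frac_laplacian_NSp s \<Omega> \<mu> \<psi> v \<phi> = frac_laplacian_NSp s \<Omega> \<mu> \<psi> u \<phi>"
    by (simp add: frac_laplacian_NSp_def)
  moreover have "fourier (\<lambda>x. complex_of_real (v x)) \<xi> = fourier (\<lambda>x. complex_of_real (u x)) \<xi>" for \<xi>
  proof -
    have "AE x in lborel. exp (- \<i> * of_real (\<xi> \<bullet> x)) * complex_of_real (v x) = exp (- \<i> * of_real (\<xi> \<bullet> x)) * complex_of_real (u x)"
      using vu by eventually_elim simp
    then have "(LINT x|lborel. exp (- \<i> * of_real (\<xi> \<bullet> x)) * complex_of_real (v x)) = (LINT x|lborel. exp (- \<i> * of_real (\<xi> \<bullet> x)) * complex_of_real (u x))"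
      by (intro integral_cong_AE) measurable
    then show ?thesis by (simp only: fourier_def)
  qed
  then have "frac_laplacian_DR s v \<phi> = frac_laplacian_DR s u \<phi>" by (simp add: frac_laplacian_DR_def)
  ultimately show "frac_laplacian_DR s u \<phi> - frac_laplacian_NSp s \<Omega> \<mu> \<psi> u \<phi> > 0" by simp
qed

end
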